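(* $\mathcal{A}=\mathcal{A}^\mu[\zeta^3I]\cong\mathcal{A}^\mu[t]/(t^2-\zeta^6I)$, where $(t^2-\zeta^6I)$ denotes the ideal generated by this quadratic. Therefore the inclusion $\mathcal{A}^\mu\subset\mathcal{A}$ is dual to a double cover $\delta:X\to Y$, ramified at $P_0$ and $P_\infty$ only, where $Y$ is the smooth completion of $\mathrm{Spec}(\mathcal{A}^\mu)$. The involution $\mu$ is the swapping of sheets for this cover. It follows that $X$ has even genus $g=2p$, where $p$ is the genus of $Y$.
   Context: Let $\varphi:T^2\to\mathbb{CP}^2$ be a minimal Lagrangian torus (a minimal immersion on which the Fubini-Study form vanishes). On the universal cover $\mathbb{R}^2$ let $f$ be a horizontal lift to $S^5\subset\mathbb{C}^3$ for the Hopf fibration, let $z$ be a global conformal coordinate with $\langle f_{zzz},f\rangle=1$, and choose the constant phase of $f$ so that $F=(f,f_z/|f_z|,-f_{\bar z}/|f_{\bar z}|)$ is $SU_3$-valued (columns). Let $\alpha=F^{-1}dF=\alpha_{\mathfrak{k}}+\alpha_{\mathfrak{p}}$ be the splitting into diagonal and off-diagonal parts, $\alpha_{\mathfrak{p}}=\alpha_{\mathfrak{p}}^{1,0}+\alpha_{\mathfrak{p}}^{0,1}$ the type decomposition, and $$\alpha_\zeta=\zeta\alpha_{\mathfrak{p}}^{1,0}+\alpha_{\mathfrak{k}}+\zeta^{-1}\alpha_{\mathfrak{p}}^{0,1}.$$ Let $\epsilon=e^{2\pi i/3}$, $S=\mathrm{diag}(1,\epsilon,\epsilon^2)$, and $T$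 the permutation matrix fixing $e_1$ and swapping $e_2,e_3$. $\mathcal{A}$ is the algebra (known to be commutative) of complexified polynomial Killing fields: maps $\xi_\zeta$ on $\mathbb{R}^2$ with values in Laurent polynomials in $\zeta$ with coefficients in $\mathfrak{gl}_3(\mathbb{C})$, of degree bounded over $\mathbb{R}^2$, with $S\xi_\zeta S^{-1}=\xi_{\epsilon\zeta}$ and $d\xi_\zeta=[\xi_\zeta,\alpha_\zeta]$. It contains $\zeta^{\pm3}I$, $I$ the identity matrix. It has the algebra involution $\mu_*(\xi_\zeta)=T\xi_{-\zeta}^tT$, and $\mathcal{A}^\mu=\{\xi_\zeta\in\mathcal{A}:\mu_*(\xi_\zeta)=\xi_\zeta\}$; $\mathcal{A}^\mu[\zeta^3I]$ is the subalgebra of $\mathcal{A}$ generated by $\mathcal{A}^\mu$ and $\zeta^3I$. The spectral curve $X$ is the completion of the affine curve $\mathrm{Spec}(\mathcal{A})$ by smooth points at infinity ("smooth completion"). It is known that the subalgebra generated by $\zeta^{\pm3}I$ is dual to a degree three cover $\lambda:X\to\mathbb{C}\cup\{\infty\}$ ($\lambda=\zeta^3$) with a single zero $P_0$ and a single pole $P_\infty$, these being the points added to $\mathrm{Spec}(\mathcal{A})$. $\mu$ is the involution of $X$ induced by $\mu_*$; it covers $\lambda\mapsto-\lambda$. Genus means arithmetic genus if a curve is singular. *)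

theory Defs
  imports "HOL-Analysis.Analysis" "HOL-Algebra.UnivPoly"
    "HOL-Algebra.QuotRing" "HOL-Algebra.Generated_Rings"
begin

section \<open>Minimal Lagrangian surfaces in the complex projective plane\<close>

definition dir_deriv :: "complex \<Rightarrow> (complex \<Rightarrow> 'b::real_normed_vector) \<Rightarrow> complex \<Rightarrow> 'b"
  where "dir_deriv v f p = frechet_derivative f (at p) v"

abbreviation d_x :: "(complex \<Rightarrow> 'b::real_normed_vector) \<Rightarrow> complex \<Rightarrow> 'b"
  where "d_x \<equiv> dir_deriv 1"

abbreviation d_y :: "(complex \<Rightarrow> 'b::real_normed_vector) \<Rightarrow> complex \<Rightarrow> 'b"
  where "d_y \<equiv> dir_deriv \<i>"

primrec cont_diff :: "nat \<Rightarrow> (complex \<Rightarrow> 'b::real_normed_vector) \<Rightarrow> bool" where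
  "cont_diff 0 f \<longleftrightarrow> continuous_on UNIV f"
| "cont_diff (Suc k) f \<longleftrightarrow>
     f differentiable_on UNIV \<and> cont_diff k (d_x f) \<and> cont_diff k (d_y f)"

definition smooth_map :: "(complex \<Rightarrow> 'b::real_normed_vector) \<Rightarrow> bool"
  where "smooth_map f \<longleftrightarrow> (\<forall>k. cont_diff k f)"

definition d_z :: "(complex \<Rightarrow> complex^3) \<Rightarrow> complex \<Rightarrow> complex^3"
  where "d_z f p = (1/2) *s (d_x f p - \<i> *s d_y f p)"

definition d_zbar :: "(complex \<Rightarrow> complex^3) \<Rightarrow> complex \<Rightarrow> complex^3"
  where "d_zbar f p = (1/2) *s (d_x f p + \<i> *s d_y f p)"

definition herm :: "complex^3 \<Rightarrow> complex^3 \<Rightarrow> complex"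
  where "herm u v = (\<Sum>i\<in>UNIV. u $ i * cnj (v $ i))"

text \<open>Points of the projective plane are complex lines in \<open>\<complex>\<^sup>3\<close>.\<close>

definition cline :: "complex^3 \<Rightarrow> (complex^3) set"
  where "cline v = {c *s v | c. True}"

text \<open>A map from the torus \<open>\<complex>/(\<int>\<omega>\<^sub>1 + \<int>\<omega>\<^sub>2)\<close>, regarded as a doubly
  periodic map on the universal cover.\<close>

definition doubly_periodic :: "complex \<Rightarrow> complex \<Rightarrow> (complex \<Rightarrow> 'b) \<Rightarrow> bool"
  where "doubly_periodic \<omega>1 \<omega>2 \<phi> \<longleftrightarrow> Im (\<omega>1 * cnj \<omega>2) \<noteq> 0
     \<and> (\<forall>p. \<phi> (p + \<omega>1) = \<phi> p) \<and> (\<forall>p. \<phi> (p + \<omega>2) = \<phi> p)"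

definition horizontal_lift :: "(complex \<Rightarrow> (complex^3) set) \<Rightarrow> (complex \<Rightarrow> complex^3) \<Rightarrow> bool"
  where "horizontal_lift \<phi> f \<longleftrightarrow> smooth_map f
     \<and> (\<forall>p. norm (f p) = 1 \<and> \<phi> p = cline (f p))
     \<and> (\<forall>p v. herm (dir_deriv v f p) (f p) = 0)"

text \<open>For a horizontal lift \<open>f\<close> of \<open>\<phi>\<close>, the vectors \<open>dir_deriv v f p\<close> are the
  horizontal lifts of \<open>d\<phi>(v)\<close>, on which the Fubini-Study metric and form are the real and the
  imaginary part of \<^const>\<open>herm\<close> (up to normalisation). The Hopf fibration is a Riemannian
  submersion, so the Levi-Civita derivative of \<open>d\<phi>(w)\<close> along \<open>v\<close> lifts to the horizontal
  part of \<open>dir_deriv v (dir_deriv w f) p\<close>.\<close>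

definition immersive :: "(complex \<Rightarrow> complex^3) \<Rightarrow> bool"
  where "immersive f \<longleftrightarrow> (\<forall>p v. v \<noteq> 0 \<longrightarrow> dir_deriv v f p \<noteq> 0)"

definition lagrangian :: "(complex \<Rightarrow> complex^3) \<Rightarrow> bool"
  where "lagrangian f \<longleftrightarrow> (\<forall>p v w. Im (herm (dir_deriv v f p) (dir_deriv w f p)) = 0)"

definition conformal :: "(complex \<Rightarrow> complex^3) \<Rightarrow> bool"
  where "conformal f \<longleftrightarrow>
    (\<forall>p. norm (d_x f p) = norm (d_y f p) \<and> Re (herm (d_x f p) (d_y f p)) = 0)"

definition horizontal_part :: "complex^3 \<Rightarrow> complex^3 \<Rightarrow> complex^3"
  where "horizontal_part u w = w - herm w u *s u"

text \<open>The mean curvature vector is the normal part of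
  \<open>(G \<nabla>\<^sub>x \<phi>\<^sub>x - 2 F \<nabla>\<^sub>x \<phi>\<^sub>y + E \<nabla>\<^sub>y \<phi>\<^sub>y) / (2 (E G - F\<^sup>2))\<close>, where \<open>E, F, G\<close>
  are the coefficients of the induced metric; it vanishes iff the numerator is tangent.\<close>

definition minimal :: "(complex \<Rightarrow> complex^3) \<Rightarrow> bool"
  where "minimal f \<longleftrightarrow> (\<forall>p.
    let E = Re (herm (d_x f p) (d_x f p));
        F = Re (herm (d_x f p) (d_y f p));
        G = Re (herm (d_y f p) (d_y f p))
    in horizontal_part (f p)
         (G *\<^sub>R d_x (d_x f) p - (2 * F) *\<^sub>R d_x (d_y f) p + E *\<^sub>R d_y (d_y f) p)
       \<in> span {d_x f p, d_y f p})"

definition minimal_lagrangian_torus ::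
    "complex \<Rightarrow> complex \<Rightarrow> (complex \<Rightarrow> (complex^3) set) \<Rightarrow> (complex \<Rightarrow> complex^3) \<Rightarrow> bool"
  where "minimal_lagrangian_torus \<omega>1 \<omega>2 \<phi> f \<longleftrightarrow>
     doubly_periodic \<omega>1 \<omega>2 \<phi> \<and> horizontal_lift \<phi> f \<and>
     immersive f \<and> lagrangian f \<and> minimal f"

section \<open>The frame and the loop of connection forms\<close>

type_synonym mat3 = "complex^3^3"

definition smat :: "complex \<Rightarrow> mat3 \<Rightarrow> mat3"
  where "smat c M = map_matrix ((*) c) M"

definition diag_part :: "mat3 \<Rightarrow> mat3"
  where "diag_part M = (\<chi> i j. if i = j then M $ i $ j else 0)"

definition offdiag_part :: "mat3 \<Rightarrow> mat3"
  where "offdiag_part M = (\<chi> i j. if i = j then 0 else M $ i $ j)"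

definition commutator :: "mat3 \<Rightarrow> mat3 \<Rightarrow> mat3"
  where "commutator M N = M ** N - N ** M"

definition in_SU3 :: "mat3 \<Rightarrow> bool"
  where "in_SU3 M \<longleftrightarrow> M ** map_matrix cnj (transpose M) = mat 1 \<and> det M = 1"

text \<open>The transpose is needed because \<^const>\<open>vector\<close> lists rows.\<close>

definition frame :: "(complex \<Rightarrow> complex^3) \<Rightarrow> complex \<Rightarrow> mat3"
  where "frame f p = transpose (vector
     [f p,
      (1 / norm (d_z f p)) *\<^sub>R d_z f p,
      - ((1 / norm (d_zbar f p)) *\<^sub>R d_zbar f p)])"

text \<open>A matrix valued 1-form at a point is a real linear map from \<open>\<complex>\<close> to matrices.\<close>

definition type10 :: "(complex \<Rightarrow> mat3) \<Rightarrow> complex \<Rightarrow> mat3"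
  where "type10 \<beta> v = smat (1/2) (\<beta> v - smat \<i> (\<beta> (\<i> * v)))"

definition type01 :: "(complex \<Rightarrow> mat3) \<Rightarrow> complex \<Rightarrow> mat3"
  where "type01 \<beta> v = smat (1/2) (\<beta> v + smat \<i> (\<beta> (\<i> * v)))"

definition conn :: "(complex \<Rightarrow> complex^3) \<Rightarrow> complex \<Rightarrow> complex \<Rightarrow> mat3"
  where "conn f p v = matrix_inv (frame f p) ** dir_deriv v (frame f) p"

definition conn_loop :: "(complex \<Rightarrow> complex^3) \<Rightarrow> complex \<Rightarrow> complex \<Rightarrow> complex \<Rightarrow> mat3"
  where "conn_loop f \<zeta> p v =
     smat \<zeta> (type10 (\<lambda>w. offdiag_part (conn f p w)) v)
     + diag_part (conn f p v)
     + smat (inverse \<zeta>) (type01 (\<lambda>w. offdiag_part (conn f p w)) v)"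

section \<open>Complexified polynomial Killing fields\<close>

definition eps :: complex where "eps = cis (2 * pi / 3)"

definition S_mat :: mat3
  where "S_mat = vector [vector [1, 0, 0], vector [0, eps, 0], vector [0, 0, eps\<^sup>2]]"

definition T_mat :: mat3
  where "T_mat = vector [vector [1, 0, 0], vector [0, 0, 1], vector [0, 1, 0]]"

text \<open>The matrix \<open>\<xi>\<^sub>\<zeta>(p)\<close> is written \<open>\<xi> \<zeta> p\<close>. Only the values at \<open>\<zeta> \<noteq> 0\<close> matter; the value
  at \<open>\<zeta> = 0\<close> is fixed to be \<open>0\<close>, so that Laurent polynomials and functions correspond
  bijectively and the ring operations are pointwise.\<close>

type_synonym loop_field = "complex \<Rightarrow> complex \<Rightarrow> mat3"

definition laurent_field :: "loop_field \<Rightarrow> bool"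
  where "laurent_field \<xi> \<longleftrightarrow> \<xi> 0 = (\<lambda>p. 0) \<and>
     (\<exists>(N::int) c. \<forall>\<zeta> p. \<zeta> \<noteq> 0 \<longrightarrow> \<xi> \<zeta> p = (\<Sum>k = -N..N. smat (\<zeta> powi k) (c k p)))"

definition killing_fields :: "(complex \<Rightarrow> complex^3) \<Rightarrow> loop_field set"
  where "killing_fields f = {\<xi>. laurent_field \<xi> \<and>
     (\<forall>\<zeta> p. S_mat ** \<xi> \<zeta> p ** matrix_inv S_mat = \<xi> (eps * \<zeta>) p) \<and>
     (\<forall>\<zeta> p. \<zeta> \<noteq> 0 \<longrightarrow>
        (\<xi> \<zeta> has_derivative (\<lambda>v. commutator (\<xi> \<zeta> p) (conn_loop f \<zeta> p v))) (at p))}"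

definition scalar_field :: "(complex \<Rightarrow> complex) \<Rightarrow> loop_field"
  where "scalar_field c = (\<lambda>\<zeta> p. if \<zeta> = 0 then 0 else mat (c \<zeta>))"

definition zeta_pow :: "int \<Rightarrow> loop_field"
  where "zeta_pow n = scalar_field (\<lambda>\<zeta>. \<zeta> powi n)"

definition killing_algebra :: "(complex \<Rightarrow> complex^3) \<Rightarrow> loop_field ring"
  where "killing_algebra f =
     \<lparr>carrier = killing_fields f,
      mult = (\<lambda>\<xi> \<eta> \<zeta> p. \<xi> \<zeta> p ** \<eta> \<zeta> p),
      one = scalar_field (\<lambda>\<zeta>. 1),
      zero = (\<lambda>\<zeta> p. 0),
      add = (\<lambda>\<xi> \<eta> \<zeta> p. \<xi> \<zeta> p + \<eta> \<zeta> p)\<rparr>"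

definition constants :: "loop_field set"
  where "constants = {scalar_field (\<lambda>\<zeta>. c) | c. True}"

definition subalgebra_generated :: "(complex \<Rightarrow> complex^3) \<Rightarrow> loop_field set \<Rightarrow> loop_field set"
  where "subalgebra_generated f H = generate_ring (killing_algebra f) (constants \<union> H)"

definition mu_star :: "loop_field \<Rightarrow> loop_field"
  where "mu_star \<xi> = (\<lambda>\<zeta> p. T_mat ** transpose (\<xi> (- \<zeta>) p) ** T_mat)"

definition mu_invariants :: "(complex \<Rightarrow> complex^3) \<Rightarrow> loop_field set"
  where "mu_invariants f = {\<xi> \<in> killing_fields f. mu_star \<xi> = \<xi>}"

definition mu_algebra :: "(complex \<Rightarrow> complex^3) \<Rightarrow> loop_field ring"
  where "mu_algebra f = (killing_algebra f)\<lparr>carrier := mu_invariants f\<rparr>"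

section \<open>The field of fractions of a domain\<close>

definition fraction :: "('a, 'm) ring_scheme \<Rightarrow> 'a \<Rightarrow> 'a \<Rightarrow> ('a \<times> 'a) set"
  where "fraction R a b = {(c, d). c \<in> carrier R \<and> d \<in> carrier R - {\<zero>\<^bsub>R\<^esub>} \<and>
     a \<otimes>\<^bsub>R\<^esub> d = c \<otimes>\<^bsub>R\<^esub> b}"

definition fraction_field :: "('a, 'm) ring_scheme \<Rightarrow> ('a \<times> 'a) set ring"
  where "fraction_field R =
     \<lparr>carrier = {fraction R a b | a b. a \<in> carrier R \<and> b \<in> carrier R - {\<zero>\<^bsub>R\<^esub>}},
      mult = (\<lambda>X Y. \<Union>(a, b) \<in> X. \<Union>(c, d) \<in> Y. fraction R (a \<otimes>\<^bsub>R\<^esub> c) (b \<otimes>\<^bsub>R\<^esub> d)),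
      one = fraction R \<one>\<^bsub>R\<^esub> \<one>\<^bsub>R\<^esub>,
      zero = fraction R \<zero>\<^bsub>R\<^esub> \<one>\<^bsub>R\<^esub>,
      add = (\<lambda>X Y. \<Union>(a, b) \<in> X. \<Union>(c, d) \<in> Y.
               fraction R (a \<otimes>\<^bsub>R\<^esub> d \<oplus>\<^bsub>R\<^esub> c \<otimes>\<^bsub>R\<^esub> b) (b \<otimes>\<^bsub>R\<^esub> d))\<rparr>"

definition to_fraction :: "('a, 'm) ring_scheme \<Rightarrow> 'a \<Rightarrow> ('a \<times> 'a) set"
  where "to_fraction R a = fraction R a \<one>\<^bsub>R\<^esub>"

definition fraction_map ::
    "('a, 'm) ring_scheme \<Rightarrow> ('a \<Rightarrow> 'a) \<Rightarrow> ('a \<times> 'a) set \<Rightarrow> ('a \<times> 'a) set"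
  where "fraction_map R h X = (\<Union>(a, b) \<in> X. fraction R (h a) (h b))"

section \<open>Integral algebraic curves as sets of local rings of closed points\<close>

text \<open>An integral curve is represented by the set of the local rings of its closed points, as
  subrings of a field (Chevalley's description of integral schemes). Throughout, \<open>K\<close> is a
  field, \<open>k\<close> an algebraically closed subfield of characteristic \<open>0\<close>, and \<open>B\<close> a subring of
  \<open>K\<close> containing \<open>k\<close>. The curve with coordinate ring \<open>B\<close> has function field
  \<open>quotients K B\<close>, which may be smaller than \<open>K\<close>.\<close>

definition quotients :: "('a, 'm) ring_scheme \<Rightarrow> 'a set \<Rightarrow> 'a set"
  where "quotients K B = {a \<otimes>\<^bsub>K\<^esub> inv\<^bsub>K\<^esub> b | a b. a \<in> B \<and> b \<in> B - {\<zero>\<^bsub>K\<^esub>}}"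

definition local_ring_at :: "('a, 'm) ring_scheme \<Rightarrow> 'a set \<Rightarrow> 'a set \<Rightarrow> 'a set"
  where "local_ring_at K B M = {a \<otimes>\<^bsub>K\<^esub> inv\<^bsub>K\<^esub> s | a s. a \<in> B \<and> s \<in> B - M}"

definition Spec :: "('a, 'm) ring_scheme \<Rightarrow> 'a set \<Rightarrow> 'a set set"
  where "Spec K B = {local_ring_at K B M | M. maximalideal M (K\<lparr>carrier := B\<rparr>)}"

definition discrete_valuation_ring ::
    "('a, 'm) ring_scheme \<Rightarrow> 'a set \<Rightarrow> 'a set \<Rightarrow> 'a set \<Rightarrow> bool"
  where "discrete_valuation_ring K k L V \<longleftrightarrow> k \<subseteq> V \<and>
     (\<exists>v :: 'a \<Rightarrow> int.
        v ` (L - {\<zero>\<^bsub>K\<^esub>}) = UNIV \<and>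
        (\<forall>a \<in> L - {\<zero>\<^bsub>K\<^esub>}. \<forall>b \<in> L - {\<zero>\<^bsub>K\<^esub>}.
           v (a \<otimes>\<^bsub>K\<^esub> b) = v a + v b \<and>
           (a \<oplus>\<^bsub>K\<^esub> b \<noteq> \<zero>\<^bsub>K\<^esub> \<longrightarrow> min (v a) (v b) \<le> v (a \<oplus>\<^bsub>K\<^esub> b))) \<and>
        V = {a \<in> L. a = \<zero>\<^bsub>K\<^esub> \<or> 0 \<le> v a})"

text \<open>A discrete valuation ring of the function field has a centre on the affine curve iff it
  contains \<open>B\<close>, so the smooth points to be added are those that do not contain \<open>B\<close>.\<close>

definition points_at_infinity :: "('a, 'm) ring_scheme \<Rightarrow> 'a set \<Rightarrow> 'a set \<Rightarrow> 'a set set"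
  where "points_at_infinity K k B =
     {V. discrete_valuation_ring K k (quotients K B) V \<and> \<not> B \<subseteq> V}"

definition smooth_completion :: "('a, 'm) ring_scheme \<Rightarrow> 'a set \<Rightarrow> 'a set \<Rightarrow> 'a set set"
  where "smooth_completion K k B = Spec K B \<union> points_at_infinity K k B"

text \<open>The maximal ideal of a local subring \<open>x\<close> of \<open>K\<close>: its non-units.\<close>

definition max_ideal :: "('a, 'm) ring_scheme \<Rightarrow> 'a set \<Rightarrow> 'a set"
  where "max_ideal K x = {a \<in> x. a = \<zero>\<^bsub>K\<^esub> \<or> inv\<^bsub>K\<^esub> a \<notin> x}"

definition dominates :: "('a, 'm) ring_scheme \<Rightarrow> 'a set \<Rightarrow> 'a set \<Rightarrow> bool"
  where "dominates K x y \<longleftrightarrow> y \<subseteq> x \<and> max_ideal K y = max_ideal K x \<inter> y"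

text \<open>The map of completed curves dual to an inclusion \<open>B' \<subseteq> B\<close>: the image of a point is the
  point whose local ring is dominated.\<close>

definition dual_map ::
    "('a, 'm) ring_scheme \<Rightarrow> 'a set \<Rightarrow> 'a set \<Rightarrow> 'a set \<Rightarrow> 'a set"
  where "dual_map K k B' x = (THE y. y \<in> smooth_completion K k B' \<and> dominates K x y)"

text \<open>The stalk at \<open>y\<close> of the direct image of the structure sheaf: the functions that are
  regular at all points above \<open>y\<close>.\<close>

definition direct_image_stalk ::
    "('a, 'm) ring_scheme \<Rightarrow> 'a set \<Rightarrow> 'a set \<Rightarrow> 'a set \<Rightarrow> 'a set \<Rightarrow> 'a set"
  where "direct_image_stalk K k B B' y =
     {a \<in> quotients K B. \<forall>x \<in> smooth_completion K k B. dual_map K k B' x = y \<longrightarrow> a \<in> x}"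

definition free_of_rank :: "('a, 'm) ring_scheme \<Rightarrow> nat \<Rightarrow> 'a set \<Rightarrow> 'a set \<Rightarrow> bool"
  where "free_of_rank K n y E \<longleftrightarrow> (\<exists>e. (\<forall>i<n. e i \<in> E) \<and>
     bij_betw (\<lambda>c. \<Oplus>\<^bsub>K\<^esub> i \<in> {..<n}. c i \<otimes>\<^bsub>K\<^esub> e i) ({..<n} \<rightarrow>\<^sub>E y) E)"

text \<open>A cover of degree \<open>n\<close> is a finite, locally free morphism of rank \<open>n\<close>.\<close>

definition dual_to_cover ::
    "('a, 'm) ring_scheme \<Rightarrow> 'a set \<Rightarrow> nat \<Rightarrow> 'a set \<Rightarrow> 'a set \<Rightarrow> bool"
  where "dual_to_cover K k n B B' \<longleftrightarrow>
     (\<forall>x \<in> smooth_completion K k B. \<exists>!y. y \<in> smooth_completion K k B' \<and> dominates K x y) \<and>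
     (\<forall>y \<in> smooth_completion K k B'. free_of_rank K n y (direct_image_stalk K k B B' y))"

text \<open>Residue fields are all equal to \<open>k\<close>, so a locally free cover is unramified at \<open>x\<close> iff the
  maximal ideal of the image point generates that of \<open>x\<close>.\<close>

definition ramified_at ::
    "('a, 'm) ring_scheme \<Rightarrow> 'a set \<Rightarrow> 'a set \<Rightarrow> 'a set \<Rightarrow> bool"
  where "ramified_at K k B' x \<longleftrightarrow>
     Idl\<^bsub>K\<lparr>carrier := x\<rparr>\<^esub> (max_ideal K (dual_map K k B' x)) \<noteq> max_ideal K x"

text \<open>The arithmetic genus is the dimension of \<open>H\<^sup>1(X, \<O>\<^sub>X)\<close>. By the flasque resolution of
  \<open>\<O>\<^sub>X\<close> by the constant sheaf of rational functions and its quotient, this space is the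
  quotient of the repartitions by the sum of the rational functions (embedded diagonally) and
  the everywhere regular repartitions. Its dimension is computed as the supremum of the sizes of
  finite families that are linearly independent modulo that sum.\<close>

definition repartitions :: "('a, 'm) ring_scheme \<Rightarrow> 'a set \<Rightarrow> 'a set \<Rightarrow> ('a set \<Rightarrow> 'a) set"
  where "repartitions K k B =
     {r \<in> smooth_completion K k B \<rightarrow> quotients K B.
        finite {x \<in> smooth_completion K k B. r x \<notin> x}}"

definition independent_in_H1 ::
    "('a, 'm) ring_scheme \<Rightarrow> 'a set \<Rightarrow> 'a set \<Rightarrow> nat \<Rightarrow> (nat \<Rightarrow> 'a set \<Rightarrow> 'a) \<Rightarrow> bool"
  where "independent_in_H1 K k B n r \<longleftrightarrow>
     (\<forall>c. (\<forall>i<n. c i \<in> k) \<longrightarrow>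
        (\<exists>a \<in> quotients K B. \<forall>x \<in> smooth_completion K k B.
           (\<Oplus>\<^bsub>K\<^esub> i \<in> {..<n}. c i \<otimes>\<^bsub>K\<^esub> r i x) \<ominus>\<^bsub>K\<^esub> a \<in> x) \<longrightarrow>
        (\<forall>i<n. c i = \<zero>\<^bsub>K\<^esub>))"

definition arithmetic_genus :: "('a, 'm) ring_scheme \<Rightarrow> 'a set \<Rightarrow> 'a set \<Rightarrow> enat"
  where "arithmetic_genus K k B =
     Sup {enat n | n. \<exists>r. (\<forall>i<n. r i \<in> repartitions K k B) \<and> independent_in_H1 K k B n r}"

section \<open>The spectral curve\<close>

text \<open>All curves below are formed inside the field of fractions of the Killing field algebra.\<close>

type_synonym frac = "(loop_field \<times> loop_field) set"

abbreviation frac_ring :: "(complex \<Rightarrow> complex^3) \<Rightarrow> frac ring"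
  where "frac_ring f \<equiv> fraction_field (killing_algebra f)"

definition in_frac :: "(complex \<Rightarrow> complex^3) \<Rightarrow> loop_field set \<Rightarrow> frac set"
  where "in_frac f B = to_fraction (killing_algebra f) ` B"

definition curve_of :: "(complex \<Rightarrow> complex^3) \<Rightarrow> loop_field set \<Rightarrow> frac set set"
  where "curve_of f B = smooth_completion (frac_ring f) (in_frac f constants) (in_frac f B)"

definition added_points :: "(complex \<Rightarrow> complex^3) \<Rightarrow> loop_field set \<Rightarrow> frac set set"
  where "added_points f B = points_at_infinity (frac_ring f) (in_frac f constants) (in_frac f B)"

definition genus_of :: "(complex \<Rightarrow> complex^3) \<Rightarrow> loop_field set \<Rightarrow> enat"
  where "genus_of f B = arithmetic_genus (frac_ring f) (in_frac f constants) (in_frac f B)"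

definition inclusion_dual_to_cover ::
    "(complex \<Rightarrow> complex^3) \<Rightarrow> nat \<Rightarrow> loop_field set \<Rightarrow> loop_field set \<Rightarrow> bool"
  where "inclusion_dual_to_cover f n B' B \<longleftrightarrow> B' \<subseteq> B \<and>
     dual_to_cover (frac_ring f) (in_frac f constants) n (in_frac f B) (in_frac f B')"

definition zeros :: "(complex \<Rightarrow> complex^3) \<Rightarrow> loop_field \<Rightarrow> frac set set"
  where "zeros f \<xi> = {x \<in> curve_of f (killing_fields f).
     to_fraction (killing_algebra f) \<xi> \<in> max_ideal (frac_ring f) x}"

text \<open>Poles of \<open>\<lambda> = \<zeta>\<^sup>3\<close> are the zeros of \<open>\<lambda>\<^sup>-\<^sup>1\<close>. The subalgebra generated by \<open>\<zeta>\<^sup>\<plusminus>\<^sup>3 I\<close> is the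
  ring of Laurent polynomials in \<open>\<lambda>\<close>, whose completed curve is the projective line.\<close>

definition lambda_cover :: "(complex \<Rightarrow> complex^3) \<Rightarrow> frac set \<Rightarrow> frac set \<Rightarrow> bool"
  where "lambda_cover f P0 Pinf \<longleftrightarrow>
     inclusion_dual_to_cover f 3
       (subalgebra_generated f {zeta_pow 3, zeta_pow (-3)}) (killing_fields f) \<and>
     zeros f (zeta_pow 3) = {P0} \<and>
     zeros f (zeta_pow (-3)) = {Pinf} \<and>
     added_points f (killing_fields f) = {P0, Pinf}"

definition delta_map :: "(complex \<Rightarrow> complex^3) \<Rightarrow> frac set \<Rightarrow> frac set"
  where "delta_map f = dual_map (frac_ring f) (in_frac f constants) (in_frac f (mu_invariants f))"

definition delta_ramified_at :: "(complex \<Rightarrow> complex^3) \<Rightarrow> frac set \<Rightarrow> bool"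
  where "delta_ramified_at f =
     ramified_at (frac_ring f) (in_frac f constants) (in_frac f (mu_invariants f))"

text \<open>The map of points induced contravariantly by the automorphism \<^const>\<open>mu_star\<close>.\<close>

definition mu_map :: "(complex \<Rightarrow> complex^3) \<Rightarrow> frac set \<Rightarrow> frac set"
  where "mu_map f x =
     {a \<in> carrier (frac_ring f). fraction_map (killing_algebra f) mu_star a \<in> x}"

section \<open>The quadratic extension of the invariant algebra\<close>

abbreviation mu_poly where "mu_poly f \<equiv> UP (mu_algebra f)"

definition quadratic_ideal ::
    "(complex \<Rightarrow> complex^3) \<Rightarrow> (nat \<Rightarrow> loop_field) set"
  where "quadratic_ideal f = Idl\<^bsub>mu_poly f\<^esub>
     {up_ring.monom (mu_poly f) \<one>\<^bsub>mu_algebra f\<^esub> 2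
        \<ominus>\<^bsub>mu_poly f\<^esub> up_ring.monom (mu_poly f) (zeta_pow 6) 0}"

definition quadratic_class ::
    "(complex \<Rightarrow> complex^3) \<Rightarrow> loop_field \<Rightarrow> nat \<Rightarrow> (nat \<Rightarrow> loop_field) set"
  where "quadratic_class f \<xi> n =
     quadratic_ideal f +>\<^bsub>mu_poly f\<^esub> up_ring.monom (mu_poly f) \<xi> n"

end

theory Submission
 imports Defs "HOL-Computational_Algebra.Fundamental_Theorem_Algebra"
begin

text \<open>
  Fix a minimal Lagrangian torus and put \<open>\<lambda> = \<zeta>\<^sup>3\<close>. The algebraic half of the theorem is a computation
  with parity. Averaging over the involution writes every Killing field uniquely as \<open>b + c \<zeta>\<^sup>3\<close> with
  invariant \<open>b\<close> and \<open>c\<close>, because \<open>\<zeta>\<^sup>3 I\<close> is an anti-invariant unit whose square is invariant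
  (\<open>invariant_decomposition\<close>); so the algebra arises from its invariants by adjoining a square root of
  \<open>\<zeta>\<^sup>6\<close> (\<open>adjoin_square_root\<close>).

  The geometric half rests on the behaviour of a Killing field \<open>\<xi>\<close> for \<open>\<zeta> \<rightarrow> 0\<close> and \<open>\<zeta> \<rightarrow> \<infinity>\<close>. In the
  moving frame the part of the connection form of type \<open>(1,0)\<close> is a cyclic matrix with cube \<open>1\<close>
  (\<open>conn_loop_form\<close>; minimality, the Lagrangian condition and the cubic normalisation enter here).
  Comparing the extreme powers of \<open>\<zeta>\<close> in \<open>d\<xi> = [\<xi>, \<alpha>\<^sub>\<zeta>]\<close> shows that the leading coefficient of \<open>\<xi>\<close>
  commutes with this cyclic matrix, so that by the grading it is a multiple of one of its powers
  (\<open>lead_structure\<close>). Leading coefficients therefore never multiply to zero, two of equal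
  degree are proportional, and the transformation \<open>T (\<cdot>)\<^sup>t T\<close> fixes them. Hence the algebra is a domain,
  the orders of vanishing at \<open>\<zeta> = 0\<close> and \<open>\<zeta> = \<infinity>\<close> are valuations with residue field \<open>\<complex>\<close>, and \<open>\<mu>\<close> acts
  on the leading term of degree \<open>n\<close> by \<open>(-1)\<^sup>n\<close>. If all the orders at one end were divisible by \<open>3\<close>, then \<open>\<lambda>\<close> or
  its inverse would be a local parameter at its only zero, which is impossible on a cover of degree three
  (\<open>unit_not_uniformizer\<close>); so both valuations are onto the integers.

  What remains is about a ring \<open>A\<close> with two such valuations \<open>v\<close>, \<open>w\<close> that satisfy \<open>v + w \<le> 0\<close> and with a
  unit \<open>l\<close> for which \<open>v l > 0\<close>. Reducing elements first at one place and then at the other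
  shows that quotients of \<open>A\<close> by nonzero principal ideals are finite dimensional (\<open>one_dim\<close>). Consequences are
  that \<open>Spec A\<close> has residue fields \<open>\<complex>\<close> and no first cohomology, that it is completed by exactly the two
  valuation rings (\<open>points_at_infinity_eq\<close>), and that the arithmetic genus is the number of gaps, the
  pole orders at the second point that no function with poles only there attains
  (\<open>genus_eq_card_gaps\<close>). An automorphism \<open>\<sigma>\<close> of order two that acts on leading terms by the parity of
  the valuation and maps \<open>l\<close> to \<open>-l\<close> makes \<open>A\<close> free of rank two over its invariants. It moves every
  maximal ideal, as it changes the sign of the unit \<open>l\<close>, so that the double cover is ramified over the
  two added points only.

  For the genus, even gaps \<open>2 m\<close> of \<open>A\<close> correspond to the gaps \<open>m\<close> of the invariants. For an odd
  gap one divides anti-invariant functions by \<open>l\<close> and counts gaps of a line bundle of degree zero on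
  the quotient curve; they are as numerous as the gaps of the trivial bundle
  (\<open>card_gaps_twisted\<close>). Hence \<open>g = 2 p\<close>.
\<close>

section \<open>Affine rings inside a field\<close>

locale field_over_complex = field K for K (structure) +
 fixes cst :: "complex => 'a"
 assumes cst_closed [simp, intro]: "cst c \<in> carrier K"
  and cst_add: "cst (c + d) = cst c \<oplus> cst d"
  and cst_mult: "cst (c * d) = cst c \<otimes> cst d"
  and cst_one [simp]: "cst 1 = \<one>"
begin

lemma cst_zero [simp]: "cst 0 = \<zero>"
proof -
 have "cst 0 \<oplus> cst 0 = cst 0" using cst_add[of 0 0] by simp
 thus ?thesis using cst_closed add.r_cancel_one by blast
qed

lemma cst_uminus: "cst (- c) = \<ominus> cst c"
proof -
 have "cst (- c) \<oplus> cst c = \<zero>" using cst_add[of "-c" c] by simp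
 thus ?thesis using cst_closed minus_equality by metis
qed

lemma cst_eq_zero [simp]: "cst c = \<zero> \<longleftrightarrow> c = 0"
proof
 assume c: "cst c = \<zero>"
 show "c = 0"
 proof (rule ccontr)
  assume "c ~= 0"
  hence "cst c \<otimes> cst (inverse c) = \<one>" by (simp flip: cst_mult)
  thus False using c by simp
 qed
qed simp

lemma nonzero_Units: "a \<in> carrier K ==> a ~= \<zero> ==> a \<in> Units K" by (simp add: field_Units)

lemma inv_closed [simp, intro]: "a \<in> carrier K ==> a ~= \<zero> ==> inv a \<in> carrier K" using nonzero_Units Units_inv_closed by blast

lemma inv_nonzero [simp]: "a \<in> carrier K ==> a ~= \<zero> ==> inv a ~= \<zero>" using Units_inv_Units field_Units nonzero_Units by auto

lemma inv_r [simp]: "a \<in> carrier K ==> a ~= \<zero> ==> a \<otimes> inv a = \<one>" using nonzero_Units Units_r_inv by blast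

lemma inv_l [simp]: "a \<in> carrier K ==> a ~= \<zero> ==> inv a \<otimes> a = \<one>" using nonzero_Units Units_l_inv by blast

lemma inv_inv' [simp]: "a \<in> carrier K ==> a ~= \<zero> ==> inv (inv a) = a" using nonzero_Units Units_inv_inv by blast

lemma mult_eq_zero [simp]:
 "a \<in> carrier K ==> b \<in> carrier K ==> a \<otimes> b = \<zero> \<longleftrightarrow> a = \<zero> \<or> b = \<zero>" using integral_iff by blast

lemma eq_divide: "[|a \<in> carrier K; b \<in> carrier K; c \<in> carrier K; b ~= \<zero>|] ==>
  c = a \<otimes> inv b \<longleftrightarrow> c \<otimes> b = a" by (metis inv_closed inv_l inv_r m_assoc r_one)

lemma divide_mult: "[|a \<in> carrier K; b \<in> carrier K; c \<in> carrier K; d \<in> carrier K; b ~= \<zero>; d ~= \<zero>|]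
  ==> (a \<otimes> inv b) \<otimes> (c \<otimes> inv d) = (a \<otimes> c) \<otimes> inv (b \<otimes> d)"
proof -
 assume *: "a \<in> carrier K" "b \<in> carrier K" "c \<in> carrier K" "d \<in> carrier K" "b ~= \<zero>" "d ~= \<zero>"
 have "(a \<otimes> inv b) \<otimes> (c \<otimes> inv d) \<otimes> (b \<otimes> d) = a \<otimes> (inv b \<otimes> b) \<otimes> c \<otimes> (inv d \<otimes> d)" using * by (simp add: m_ac del: inv_l inv_r)
 thus ?thesis using * by (subst eq_divide) auto
qed

lemma divide_add: "[|a \<in> carrier K; b \<in> carrier K; c \<in> carrier K; d \<in> carrier K; b ~= \<zero>; d ~= \<zero>|]
  ==> a \<otimes> inv b \<oplus> c \<otimes> inv d = (a \<otimes> d \<oplus> c \<otimes> b) \<otimes> inv (b \<otimes> d)"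
proof -
 assume *: "a \<in> carrier K" "b \<in> carrier K" "c \<in> carrier K" "d \<in> carrier K" "b ~= \<zero>" "d ~= \<zero>"
 have "(a \<otimes> inv b \<oplus> c \<otimes> inv d) \<otimes> (b \<otimes> d)
   = a \<otimes> (inv b \<otimes> b) \<otimes> d \<oplus> c \<otimes> (inv d \<otimes> d) \<otimes> b" using * inv_closed[of b] inv_closed[of d] by algebra
 thus ?thesis using * by (subst eq_divide) auto
qed

lemma inv_divide: "[|a \<in> carrier K; b \<in> carrier K; a ~= \<zero>; b ~= \<zero>|] ==> inv (a \<otimes> inv b) = b \<otimes> inv a"
proof -
 assume *: "a \<in> carrier K" "b \<in> carrier K" "a ~= \<zero>" "b ~= \<zero>"
 have "(b \<otimes> inv a) \<otimes> (a \<otimes> inv b) = b \<otimes> (inv a \<otimes> a) \<otimes> inv b" using * by (simp add: m_ac del: inv_l inv_r)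
 hence "(b \<otimes> inv a) \<otimes> (a \<otimes> inv b) = \<one>" using * by simp
 thus ?thesis using * inv_unique' comm_inv_char  by (metis inv_closed m_closed m_comm)
qed

end

locale affine_ring = field_over_complex K cst for K (structure) and cst +
 fixes B :: "'a set"
 assumes B_subring: "subring B K" and cst_B [simp, intro]: "cst c \<in> B"
begin

abbreviation L :: "'a set" where "L \<equiv> quotients K B"

lemma B_sub: "B \<subseteq> carrier K"
 and B_zero [simp, intro]: "\<zero> \<in> B" and B_one [simp, intro]: "\<one> \<in> B"
 and B_uminus [intro]: "a \<in> B ==> \<ominus> a \<in> B"
 and B_add [intro]: "a \<in> B ==> b \<in> B ==> a \<oplus> b \<in> B"
 and B_mult [intro]: "a \<in> B ==> b \<in> B ==> a \<otimes> b \<in> B"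
proof -
 note * = subringE[OF B_subring]
 show "B \<subseteq> carrier K" by (rule *(1))
 show "\<zero> \<in> B" by (rule *(2))
 show "\<one> \<in> B" by (rule *(3))
 show "a \<in> B ==> \<ominus> a \<in> B" by (rule *(5))
 show "a \<in> B ==> b \<in> B ==> a \<oplus> b \<in> B" by (rule *(7))
 show "a \<in> B ==> b \<in> B ==> a \<otimes> b \<in> B" by (rule *(6))
qed

lemma B_carr [intro, simp]: "a \<in> B ==> a \<in> carrier K" using B_sub by blast

lemma B_minus [intro]: "a \<in> B ==> b \<in> B ==> a \<ominus> b \<in> B" by (simp add: a_minus_def B_add B_uminus)

lemma B_pow [intro]: "a \<in> B ==> a [^] (n::nat) \<in> B" by (induct n) (auto intro: B_mult)

lemma L_I: "a \<in> B ==> b \<in> B ==> b ~= \<zero> ==> a \<otimes> inv b \<in> L" unfolding quotients_def by blast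

lemma L_E: assumes "x \<in> L"
 obtains a b where "a \<in> B" "b \<in> B" "b ~= \<zero>" "x = a \<otimes> inv b" using assms unfolding quotients_def by blast

lemma L_carr [simp, intro]: "x \<in> L ==> x \<in> carrier K" by (metis B_carr L_E inv_closed m_closed)

lemma B_L [simp, intro]: "a \<in> B ==> a \<in> L" using L_I[of a \<one>] by (simp add: B_carr)

lemma L_mult [intro]: "x \<in> L ==> y \<in> L ==> x \<otimes> y \<in> L"
proof -
 assume "x \<in> L" "y \<in> L"
 then obtain a b c d where "a \<in> B" "b \<in> B" "b ~= \<zero>" "x = a \<otimes> inv b"
  "c \<in> B" "d \<in> B" "d ~= \<zero>" "y = c \<otimes> inv d" using L_E by metis
 thus ?thesis using divide_mult[of a b c d] by (simp add: L_I B_mult)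
qed

lemma L_add [intro]: "x \<in> L ==> y \<in> L ==> x \<oplus> y \<in> L"
proof -
 assume "x \<in> L" "y \<in> L"
 then obtain a b c d where "a \<in> B" "b \<in> B" "b ~= \<zero>" "x = a \<otimes> inv b"
  "c \<in> B" "d \<in> B" "d ~= \<zero>" "y = c \<otimes> inv d" using L_E by metis
 thus ?thesis using divide_add[of a b c d] by (simp add: L_I B_mult B_add)
qed

lemma L_uminus [intro]: "x \<in> L ==> \<ominus> x \<in> L" by (metis B_L B_one B_uminus L_carr L_mult l_minus l_one one_closed)

lemma L_minus [intro]: "x \<in> L ==> y \<in> L ==> x \<ominus> y \<in> L" by (simp add: a_minus_def L_add L_uminus)

lemma L_inv [intro]: "x \<in> L ==> x ~= \<zero> ==> inv x \<in> L"
proof -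
 assume "x \<in> L" "x ~= \<zero>"
 then obtain a b where ab: "a \<in> B" "b \<in> B" "b ~= \<zero>" "x = a \<otimes> inv b" using L_E by metis
 hence "a ~= \<zero>" using \<open>x ~= \<zero>\<close> by auto
 thus ?thesis using ab by (simp add: inv_divide L_I)
qed

definition ideal_of_B :: "'a set => bool" where
 "ideal_of_B J \<longleftrightarrow> J \<subseteq> B \<and> \<zero> \<in> J \<and> (\<forall>a\<in>J. \<forall>b\<in>J. a \<oplus> b \<in> J) \<and> (\<forall>a\<in>J. \<forall>b\<in>B. a \<otimes> b \<in> J)"

lemma ideal_of_B_D:
 assumes "ideal_of_B J"
 shows "a \<in> J ==> a \<in> B" "\<zero> \<in> J" "a \<in> J ==> b \<in> J ==> a \<oplus> b \<in> J"
  "a \<in> J ==> b \<in> B ==> a \<otimes> b \<in> J" "a \<in> J ==> b \<in> B ==> b \<otimes> a \<in> J"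
  "a \<in> J ==> \<ominus> a \<in> J" "a \<in> J ==> b \<in> J ==> a \<ominus> b \<in> J"
proof -
 show 1: "a \<in> B" if "a \<in> J" for a using that assms unfolding ideal_of_B_def by blast
 show "\<zero> \<in> J" using assms unfolding ideal_of_B_def by blast
 show 2: "a \<oplus> b \<in> J" if "a \<in> J" "b \<in> J" for a b using that assms unfolding ideal_of_B_def by blast
 show 3: "a \<otimes> b \<in> J" if "a \<in> J" "b \<in> B" for a b using that assms unfolding ideal_of_B_def by blast
 show "a \<in> J ==> b \<in> B ==> b \<otimes> a \<in> J" using 1 3[of a b] by (simp add: m_comm)
 show 4: "\<ominus> a \<in> J" if "a \<in> J" for a using 3[OF that, of "\<ominus> \<one>"] 1[OF that] by (simp add: r_minus B_uminus)
 show "a \<in> J ==> b \<in> J ==> a \<ominus> b \<in> J" using 2 4 by (simp add: a_minus_def)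
qed

lemma restricted_cring: "cring (K\<lparr>carrier := B\<rparr>)" using subcring_iff[OF B_sub] subcringI'[OF B_subring] by simp

lemma ideal_iff: "ideal J (K\<lparr>carrier := B\<rparr>) \<longleftrightarrow> ideal_of_B J"
proof
 note S = restricted_cring
 note Sr = cring.axioms(1)[OF S]
 note Sa = ring.is_abelian_group[OF Sr]
 show "ideal J (K\<lparr>carrier := B\<rparr>)" if "ideal_of_B J"
 proof (rule idealI)
  show "ring (K\<lparr>carrier := B\<rparr>)" by (rule Sr)
  show "subgroup J (add_monoid (K\<lparr>carrier := B\<rparr>))"
  proof (rule group.subgroupI[OF abelian_group.a_group[OF Sa]])
   show "J \<subseteq> carrier (add_monoid (K\<lparr>carrier := B\<rparr>))" "J ~= {}" using ideal_of_B_D[OF that] by auto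
   fix a assume a: "a \<in> J"
   have "\<ominus>\<^bsub>K\<lparr>carrier := B\<rparr>\<^esub> a = \<ominus> a" using abelian_group.minus_equality[OF Sa, of "\<ominus> a" a] ideal_of_B_D(1)[OF that a] B_uminus
    by (auto simp: l_neg)
   thus "inv\<^bsub>add_monoid (K\<lparr>carrier := B\<rparr>)\<^esub> a \<in> J" using ideal_of_B_D[OF that] a by (simp add: a_inv_def)
  next
   fix a b assume "a \<in> J" "b \<in> J"
   thus "a \<otimes>\<^bsub>add_monoid (K\<lparr>carrier := B\<rparr>)\<^esub> b \<in> J" using ideal_of_B_D[OF that] by simp
  qed
 qed (use ideal_of_B_D[OF that] in auto)
next
 assume "ideal J (K\<lparr>carrier := B\<rparr>)"
 hence J: "ideal J (K\<lparr>carrier := B\<rparr>)" .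
 note Ja = ideal.axioms(1)[OF J]
 show "ideal_of_B J" unfolding ideal_of_B_def using additive_subgroup.a_subset[OF Ja] additive_subgroup.zero_closed[OF Ja]
   additive_subgroup.a_closed[OF Ja] ideal.I_r_closed[OF J] by auto
qed

text \<open>Maximality in the form of an inverse modulo \<open>M\<close>: this elementwise version, unlike the one by comparison
 of ideals, can be applied directly in computations.\<close>
definition max_id :: "'a set => bool" where
 "max_id M \<longleftrightarrow> ideal_of_B M \<and> \<one> \<notin> M \<and> (\<forall>b\<in>B - M. \<exists>c\<in>B. \<one> \<ominus> b \<otimes> c \<in> M)"

lemma ideal_of_B_extend:
 assumes "ideal_of_B M" "b \<in> B"
 shows "ideal_of_B {x \<oplus> b \<otimes> c | x c. x \<in> M \<and> c \<in> B}" (is "ideal_of_B ?J")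
  and "M \<subseteq> {x \<oplus> b \<otimes> c | x c. x \<in> M \<and> c \<in> B}" and "b \<in> {x \<oplus> b \<otimes> c | x c. x \<in> M \<and> c \<in> B}"
proof -
 note M = ideal_of_B_D[OF assms(1)]
 show "M \<subseteq> ?J"
 proof
  fix x assume "x \<in> M"
  hence "x = x \<oplus> b \<otimes> \<zero>" using M(1) assms(2) by simp
  thus "x \<in> ?J" using \<open>x \<in> M\<close> by blast
 qed
 have "b = \<zero> \<oplus> b \<otimes> \<one>" using assms(2) by simp
 thus "b \<in> ?J" using M(2) by blast
 show "ideal_of_B ?J" unfolding ideal_of_B_def
 proof (intro conjI ballI)
  show "?J \<subseteq> B" using M(1) assms(2) by auto
  have "\<zero> = \<zero> \<oplus> b \<otimes> \<zero>" using assms(2) by simp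
  thus "\<zero> \<in> ?J" using M(2) by blast
 next
  fix u v assume "u \<in> ?J" "v \<in> ?J"
  then obtain x c y d where *: "u = x \<oplus> b \<otimes> c" "v = y \<oplus> b \<otimes> d" "x \<in> M" "c \<in> B" "y \<in> M" "d \<in> B" by blast
  have "u \<oplus> v = (x \<oplus> y) \<oplus> b \<otimes> (c \<oplus> d)" unfolding *(1,2) using M(1)[OF *(3)] M(1)[OF *(5)] *(4,6) assms(2) B_carr by algebra
  moreover have "x \<oplus> y \<in> M" "c \<oplus> d \<in> B" using * M(3) by auto
  ultimately show "u \<oplus> v \<in> ?J" by blast
 next
  fix u v assume "u \<in> ?J" "v \<in> B"
  then obtain x c where *: "u = x \<oplus> b \<otimes> c" "x \<in> M" "c \<in> B" by blast
  have "u \<otimes> v = x \<otimes> v \<oplus> b \<otimes> (c \<otimes> v)" unfolding *(1) using M(1)[OF *(2)] *(3) assms(2) B_carr \<open>v \<in> B\<close> by algebra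
  moreover have "x \<otimes> v \<in> M" "c \<otimes> v \<in> B" using * M(4) \<open>v \<in> B\<close> by auto
  ultimately show "u \<otimes> v \<in> ?J" by blast
 qed
qed

lemma maximalideal_iff: "maximalideal M (K\<lparr>carrier := B\<rparr>) \<longleftrightarrow> max_id M"
proof
 assume "maximalideal M (K\<lparr>carrier := B\<rparr>)"
 hence m: "maximalideal M (K\<lparr>carrier := B\<rparr>)" .
 have mi: "ideal M (K\<lparr>carrier := B\<rparr>)" by (rule maximalideal.axioms(1)[OF m])
 have M: "ideal_of_B M" using mi ideal_iff by blast
 note MD = ideal_of_B_D[OF M]
 have one: "\<one> \<notin> M" using maximalideal.I_notcarr[OF m] ideal.one_imp_carrier[OF mi] by auto
 moreover have "\<exists>c\<in>B. \<one> \<ominus> b \<otimes> c \<in> M" if b: "b \<in> B - M" for b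
 proof -
  have bB: "b \<in> B" using b by blast
  let ?J = "{x \<oplus> b \<otimes> c | x c. x \<in> M \<and> c \<in> B}"
  note J = ideal_of_B_extend[OF M bB]
  have "ideal ?J (K\<lparr>carrier := B\<rparr>)" using J(1) ideal_iff by blast
  moreover have "?J ~= M" using J(3) b by blast
  moreover have "?J \<subseteq> carrier (K\<lparr>carrier := B\<rparr>)" using ideal_of_B_D[OF J(1)] by auto
  ultimately have "?J = B" using maximalideal.I_maximal[OF m, of ?J] J(2) by simp
  hence "\<one> \<in> ?J" by (metis B_one)
  then obtain x c where xc: "\<one> = x \<oplus> b \<otimes> c" "x \<in> M" "c \<in> B" by blast
  have "\<one> \<ominus> b \<otimes> c = x" unfolding xc(1) using MD(1)[OF xc(2)] xc(3) bB B_carr by algebra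
  thus ?thesis using xc(2,3) by metis
 qed
 ultimately show "max_id M" unfolding max_id_def using M by blast
next
 assume M: "max_id M"
 hence M1: "ideal_of_B M" "\<one> \<notin> M" unfolding max_id_def by auto
 show "maximalideal M (K\<lparr>carrier := B\<rparr>)"
 proof (rule maximalidealI)
  show "ideal M (K\<lparr>carrier := B\<rparr>)" using M1 ideal_iff by blast
  show "carrier (K\<lparr>carrier := B\<rparr>) ~= M" using M1 by auto
  fix J assume J: "ideal J (K\<lparr>carrier := B\<rparr>)" "M \<subseteq> J" "J \<subseteq> carrier (K\<lparr>carrier := B\<rparr>)"
  have Ji: "ideal_of_B J" using J(1) ideal_iff by blast
  show "J = M \<or> J = carrier (K\<lparr>carrier := B\<rparr>)"
  proof (cases "J = M")
   case False
   then obtain b where b: "b \<in> J" "b \<in> B - M" using J(2,3) by auto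
   then obtain c where c: "c \<in> B" "\<one> \<ominus> b \<otimes> c \<in> M" using M unfolding max_id_def by blast
   have "b \<otimes> c \<in> J" using b c ideal_of_B_D[OF Ji] by blast
   hence "(\<one> \<ominus> b \<otimes> c) \<oplus> b \<otimes> c \<in> J" using c J(2) ideal_of_B_D(3)[OF Ji] by blast
   moreover have "(\<one> \<ominus> b \<otimes> c) \<oplus> b \<otimes> c = \<one>" using b c B_carr by (simp add: a_minus_def a_assoc l_neg)
   ultimately have one: "\<one> \<in> J" by simp
   have "B \<subseteq> J"
   proof
    fix x assume "x \<in> B" thus "x \<in> J" using ideal_of_B_D(4)[OF Ji one, of x] by simp
   qed
   thus ?thesis using J(3) by auto
  qed simp
 qed
qed

lemma max_id_D:
 assumes "max_id M"
 shows "a \<in> M ==> a \<in> B" "\<zero> \<in> M" "a \<in> M ==> b \<in> M ==> a \<oplus> b \<in> M"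
  "a \<in> M ==> b \<in> B ==> a \<otimes> b \<in> M" "a \<in> M ==> b \<in> B ==> b \<otimes> a \<in> M"
  "a \<in> M ==> \<ominus> a \<in> M" "a \<in> M ==> b \<in> M ==> a \<ominus> b \<in> M" "\<one> \<notin> M" "ideal_of_B M" using assms ideal_of_B_D[of M] unfolding max_id_def by auto

lemma max_id_inverse:
 assumes "max_id M" "b \<in> B" "b \<notin> M" obtains c where "c \<in> B" "\<one> \<ominus> b \<otimes> c \<in> M" using assms unfolding max_id_def by blast

lemma max_id_prime:
 assumes M: "max_id M" and ab: "a \<in> B" "b \<in> B" "a \<otimes> b \<in> M"
 shows "a \<in> M \<or> b \<in> M"
proof (rule disjCI)
 assume "b \<notin> M"
 then obtain c where c: "c \<in> B" "\<one> \<ominus> b \<otimes> c \<in> M" using max_id_inverse M ab by metis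
 have "a \<otimes> (\<one> \<ominus> b \<otimes> c) \<oplus> (a \<otimes> b) \<otimes> c \<in> M" using c ab max_id_D[OF M] by auto
 moreover have "a \<otimes> (\<one> \<ominus> b \<otimes> c) \<oplus> (a \<otimes> b) \<otimes> c = a" using ab c(1) B_carr by algebra
 ultimately show "a \<in> M" by simp
qed

lemma max_id_compl_mult:
 assumes "max_id M" "a \<in> B - M" "b \<in> B - M" shows "a \<otimes> b \<in> B - M" using assms max_id_prime[of M a b] by auto

lemma max_id_maximal:
 assumes M: "max_id M" and N: "max_id N" and "M \<subseteq> N" shows "M = N"
proof (rule ccontr)
 assume "M ~= N"
 then obtain b where b: "b \<in> N" "b \<notin> M" using assms by blast
 hence bB: "b \<in> B" using max_id_D[OF N] by auto
 then obtain c where c: "c \<in> B" "\<one> \<ominus> b \<otimes> c \<in> M" using max_id_inverse M b by metis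
 have "(\<one> \<ominus> b \<otimes> c) \<oplus> b \<otimes> c \<in> N" using c b assms max_id_D[OF N] by blast
 moreover have "(\<one> \<ominus> b \<otimes> c) \<oplus> b \<otimes> c = \<one>" using bB c(1) B_carr by algebra
 ultimately show False using max_id_D[OF N] by simp
qed

lemma exists_max_id:
 assumes J: "ideal_of_B J" "\<one> \<notin> J" obtains M where "max_id M" "J \<subseteq> M"
proof -
 let ?A = "{I. ideal_of_B I \<and> \<one> \<notin> I \<and> J \<subseteq> I}"
 have "\<exists>M\<in>?A. \<forall>X\<in>?A. M \<subseteq> X \<longrightarrow> X = M"
 proof (rule subset_Zorn_nonempty)
  show "?A ~= {}" using J by blast
  fix C assume C: "C ~= {}" "subset.chain ?A C"
  have ch: "!!X Y. X \<in> C ==> Y \<in> C ==> X \<subseteq> Y \<or> Y \<subseteq> X" and CA: "C \<subseteq> ?A" using C(2) unfolding subset.chain_def by auto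
  have "ideal_of_B (\<Union>C)" unfolding ideal_of_B_def
  proof (intro conjI ballI)
   show "\<Union> C \<subseteq> B" using CA ideal_of_B_D(1) by blast
   show "\<zero> \<in> \<Union> C" using CA C(1) ideal_of_B_D(2) by blast
   fix a b assume a: "a \<in> \<Union> C"
   then obtain X where X: "X \<in> C" "a \<in> X" by blast
   show "b \<in> B ==> a \<otimes> b \<in> \<Union> C" using X CA ideal_of_B_D(4) by blast
   assume "b \<in> \<Union> C"
   then obtain Y where Y: "Y \<in> C" "b \<in> Y" by blast
   show "a \<oplus> b \<in> \<Union> C"
   proof (cases "X \<subseteq> Y")
    case True thus ?thesis using X Y CA ideal_of_B_D(3)[of Y a b] by blast
   next
    case False thus ?thesis using ch[OF X(1) Y(1)] X Y CA ideal_of_B_D(3)[of X a b] by blast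
   qed
  qed
  thus "\<Union> C \<in> ?A" using CA C(1) by blast
 qed
 then obtain M where M: "ideal_of_B M" "\<one> \<notin> M" "J \<subseteq> M"
  and max: "!!X. ideal_of_B X ==> \<one> \<notin> X ==> M \<subseteq> X ==> X = M" by force
 have "\<exists>c\<in>B. \<one> \<ominus> b \<otimes> c \<in> M" if b: "b \<in> B" "b \<notin> M" for b
 proof -
  let ?J = "{x \<oplus> b \<otimes> c | x c. x \<in> M \<and> c \<in> B}"
  note J' = ideal_of_B_extend[OF M(1) b(1)]
  have "\<one> \<in> ?J" using max[OF J'(1)] J' b(2) by blast
  then obtain x c where xc: "\<one> = x \<oplus> b \<otimes> c" "x \<in> M" "c \<in> B" by blast
  have "\<one> \<ominus> b \<otimes> c = x" unfolding xc(1) using ideal_of_B_D(1)[OF M(1) xc(2)] xc(3) b(1) B_carr by algebra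
  thus ?thesis using xc(2,3) by metis
 qed
 hence "max_id M" unfolding max_id_def using M by blast
 thus ?thesis using that M by blast
qed

abbreviation loc :: "'a set => 'a set" where "loc M \<equiv> local_ring_at K B M"

lemma Spec_eq: "Spec K B = {loc M | M. max_id M}" unfolding Spec_def maximalideal_iff ..

context
 fixes M assumes M: "max_id M"
begin

lemma not_in_M_nonzero: "s \<in> B - M ==> s ~= \<zero>" using max_id_D[OF M] by auto

lemma loc_I: "a \<in> B ==> s \<in> B - M ==> a \<otimes> inv s \<in> loc M" unfolding local_ring_at_def by blast

lemma loc_E: assumes "x \<in> loc M"
 obtains a s where "a \<in> B" "s \<in> B" "s \<notin> M" "s ~= \<zero>" "x = a \<otimes> inv s" using assms not_in_M_nonzero unfolding local_ring_at_def by blast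

lemma loc_iff: assumes "x \<in> carrier K"
 shows "x \<in> loc M \<longleftrightarrow> (\<exists>s\<in>B - M. x \<otimes> s \<in> B)"
proof
 assume "x \<in> loc M"
 then obtain a s where "a \<in> B" "s \<in> B" "s \<notin> M" "s ~= \<zero>" "x = a \<otimes> inv s" by (rule loc_E)
 thus "\<exists>s\<in>B - M. x \<otimes> s \<in> B" using eq_divide[of a s x] assms by (intro bexI[of _ s]) simp_all
next
 assume "\<exists>s\<in>B - M. x \<otimes> s \<in> B"
 then obtain s where s: "s \<in> B - M" "x \<otimes> s \<in> B" by blast
 hence "x = (x \<otimes> s) \<otimes> inv s" using eq_divide[of "x \<otimes> s" s x] assms not_in_M_nonzero by auto
 thus "x \<in> loc M" using s loc_I by metis
qed

lemma loc_L: "x \<in> loc M ==> x \<in> L" using loc_E L_I by metis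

lemma B_loc: "a \<in> B ==> a \<in> loc M" using loc_I[of a \<one>] max_id_D[OF M] by (simp add: B_carr)

lemma loc_mult: "x \<in> loc M ==> y \<in> loc M ==> x \<otimes> y \<in> loc M"
proof -
 assume "x \<in> loc M" "y \<in> loc M"
 then obtain a b c d where "a \<in> B" "b \<in> B - M" "b ~= \<zero>" "x = a \<otimes> inv b"
  "c \<in> B" "d \<in> B - M" "d ~= \<zero>" "y = c \<otimes> inv d" using loc_E by (metis DiffI)
 thus ?thesis using divide_mult[of a b c d] max_id_compl_mult[OF M, of b d] by (simp add: loc_I B_mult)
qed

lemma loc_add: "x \<in> loc M ==> y \<in> loc M ==> x \<oplus> y \<in> loc M"
proof -
 assume "x \<in> loc M" "y \<in> loc M"
 then obtain a b c d where "a \<in> B" "b \<in> B - M" "b ~= \<zero>" "x = a \<otimes> inv b"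
  "c \<in> B" "d \<in> B - M" "d ~= \<zero>" "y = c \<otimes> inv d" using loc_E by (metis DiffI)
 thus ?thesis using divide_add[of a b c d] max_id_compl_mult[OF M, of b d] by (simp add: loc_I B_mult B_add)
qed

lemma loc_uminus: "x \<in> loc M ==> \<ominus> x \<in> loc M" by (metis B_loc B_one B_uminus L_carr loc_L loc_mult l_minus l_one one_closed)

lemma loc_minus: "x \<in> loc M ==> y \<in> loc M ==> x \<ominus> y \<in> loc M" by (simp add: a_minus_def loc_add loc_uminus)

lemma max_ideal_loc_iff: assumes "a \<in> B" "s \<in> B - M"
 shows "a \<otimes> inv s \<in> max_ideal K (loc M) \<longleftrightarrow> a \<in> M"
proof
 have s: "s \<in> B" "s ~= \<zero>" using assms not_in_M_nonzero by auto
 assume *: "a \<otimes> inv s \<in> max_ideal K (loc M)"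
 show "a \<in> M"
 proof (rule ccontr)
  assume "a \<notin> M"
  hence a: "a \<in> B - M" "a ~= \<zero>" using assms not_in_M_nonzero by auto
  hence "inv (a \<otimes> inv s) = s \<otimes> inv a" using inv_divide[of a s] s by auto
  hence "inv (a \<otimes> inv s) \<in> loc M" using loc_I[of s a] a s by simp
  moreover have "a \<otimes> inv s ~= \<zero>" using a s by auto
  ultimately show False using * unfolding max_ideal_def by blast
 qed
next
 have s: "s \<in> B" "s ~= \<zero>" using assms not_in_M_nonzero by auto
 assume a: "a \<in> M"
 have "inv (a \<otimes> inv s) \<notin> loc M" if "a \<otimes> inv s ~= \<zero>"
 proof
  assume *: "inv (a \<otimes> inv s) \<in> loc M"
  have a0: "a ~= \<zero>" using that s by auto
  have "s \<otimes> inv a \<in> loc M" using * inv_divide[of a s] s assms a0 by auto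
  then obtain t where t: "t \<in> B - M" "s \<otimes> inv a \<otimes> t \<in> B" using loc_iff[of "s \<otimes> inv a"] s a0 assms by auto
  have "s \<otimes> t = a \<otimes> (s \<otimes> inv a \<otimes> t)"
  proof -
   have "a \<otimes> (s \<otimes> inv a \<otimes> t) = (a \<otimes> inv a) \<otimes> (s \<otimes> t)" using s t a0 assms by (simp add: m_ac del: inv_r inv_l)
   thus ?thesis using s t a0 assms by simp
  qed
  hence "s \<otimes> t \<in> M" using max_id_D(4)[OF M a t(2)] by simp
  thus False using max_id_compl_mult[OF M assms(2) t(1)] by blast
 qed
 thus "a \<otimes> inv s \<in> max_ideal K (loc M)" unfolding max_ideal_def using loc_I assms by blast
qed

lemma max_ideal_loc_B: assumes "a \<in> B" shows "a \<in> max_ideal K (loc M) \<longleftrightarrow> a \<in> M"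
 using max_ideal_loc_iff[OF assms, of \<one>] assms max_id_D[OF M] by simp

lemma max_ideal_loc: "max_ideal K (loc M) = {a \<otimes> inv s | a s. a \<in> M \<and> s \<in> B - M}"
proof (intro equalityI subsetI)
 fix x assume x: "x \<in> max_ideal K (loc M)"
 hence "x \<in> loc M" unfolding max_ideal_def by auto
 then obtain a s where "a \<in> B" "s \<in> B" "s \<notin> M" "x = a \<otimes> inv s" using loc_E by metis
 thus "x \<in> {a \<otimes> inv s | a s. a \<in> M \<and> s \<in> B - M}" using x max_ideal_loc_iff by blast
next
 fix x assume "x \<in> {a \<otimes> inv s | a s. a \<in> M \<and> s \<in> B - M}"
 thus "x \<in> max_ideal K (loc M)" using max_ideal_loc_iff max_id_D(1)[OF M] by blast
qed

end

lemma loc_inj: "max_id M ==> max_id N ==> loc M = loc N ==> M = N" using max_ideal_loc_B[of M] max_ideal_loc_B[of N] max_id_D(1)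
 by (metis subsetI subset_antisym)

lemma ideal_of_denominators:
 assumes "x \<in> carrier K" shows "ideal_of_B {s \<in> B. x \<otimes> s \<in> B}" unfolding ideal_of_B_def
proof (intro conjI ballI)
 show "\<zero> \<in> {s \<in> B. x \<otimes> s \<in> B}" using assms by simp
 fix a b assume a: "a \<in> {s \<in> B. x \<otimes> s \<in> B}"
 { assume b: "b \<in> {s \<in> B. x \<otimes> s \<in> B}"
  have "x \<otimes> (a \<oplus> b) = x \<otimes> a \<oplus> x \<otimes> b" using a b assms by (simp add: r_distr)
  thus "a \<oplus> b \<in> {s \<in> B. x \<otimes> s \<in> B}" using a b by auto }
 { assume b: "b \<in> B"
  have "x \<otimes> (a \<otimes> b) = x \<otimes> a \<otimes> b" using a b assms by (simp add: m_assoc)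
  thus "a \<otimes> b \<in> {s \<in> B. x \<otimes> s \<in> B}" using a b by auto }
qed auto

text \<open>The denominators of \<open>x\<close> form an ideal. If \<open>x\<close> lies in all the local rings, this ideal is in no maximal
 one, so that \<open>1\<close> is a denominator.\<close>
lemma in_all_loc_imp_B:
 assumes "x \<in> carrier K" "!!M. max_id M ==> x \<in> loc M" shows "x \<in> B"
proof (rule ccontr)
 assume "x \<notin> B"
 let ?J = "{s \<in> B. x \<otimes> s \<in> B}"
 have "\<one> \<notin> ?J" using assms \<open>x \<notin> B\<close> by simp
 then obtain M where M: "max_id M" "?J \<subseteq> M" using exists_max_id ideal_of_denominators[OF assms(1)] by metis
 thus False using assms(2)[OF M(1)] loc_iff[OF M(1) assms(1)] by blast
qed

end

section \<open>Places at infinity\<close>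

text \<open>A valuation \<open>v\<close> with residue field \<open>\<complex>\<close> for which already the elements of \<open>B\<close> take every value, also
 every positive one. Such a place is not centred on the affine curve, and \<open>B\<close> is dense in its completion.\<close>
locale place = affine_ring K cst B for K (structure) and cst and B +
 fixes v :: "'a => int"
 assumes v_mult: "[|x \<in> L; y \<in> L; x ~= \<zero>; y ~= \<zero>|] ==> v (x \<otimes> y) = v x + v y"
  and v_add_B: "[|a \<in> B; b \<in> B; a ~= \<zero>; b ~= \<zero>; a \<oplus> b ~= \<zero>|] ==> min (v a) (v b) \<le> v (a \<oplus> b)"
  and v_residue_B: "[|a \<in> B; b \<in> B; a ~= \<zero>; b ~= \<zero>; v a = v b|] ==>
   \<exists>c. a \<ominus> cst c \<otimes> b = \<zero> \<or> v a < v (a \<ominus> cst c \<otimes> b)"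
  and v_cst: "c ~= 0 ==> v (cst c) = 0"
  and v_surj: "\<exists>b\<in>B - {\<zero>}. v b = n"
begin

lemma L_clear: assumes "x \<in> L" obtains b where "b \<in> B" "b ~= \<zero>" "x \<otimes> b \<in> B"
proof -
 obtain a b where *: "a \<in> B" "b \<in> B" "b ~= \<zero>" "x = a \<otimes> inv b" using assms L_E by metis
 hence "x \<otimes> b = a" using eq_divide[of a b x] by auto
 thus ?thesis using that * by metis
qed

lemma v_one [simp]: "v \<one> = 0" using v_cst[of 1] by simp

lemma v_inv: "x \<in> L ==> x ~= \<zero> ==> v (inv x) = - v x" using v_mult[of x "inv x"] L_inv[of x] by (simp add: L_carr)

definition F :: "int => 'a set" where "F n = {x \<in> L. x = \<zero> \<or> n \<le> v x}"

lemma F_L [simp]: "x \<in> F n ==> x \<in> L" unfolding F_def by blast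

lemma F_carr: "x \<in> F n ==> x \<in> carrier K" using F_L L_carr by blast

lemma F_zero [simp, intro]: "\<zero> \<in> F n" unfolding F_def by simp

lemma F_I: "x \<in> L ==> n \<le> v x ==> x \<in> F n" unfolding F_def by simp

lemma F_D: "x \<in> F n ==> x ~= \<zero> ==> n \<le> v x" unfolding F_def by simp

lemma F_mono: "x \<in> F n ==> m \<le> n ==> x \<in> F m" unfolding F_def by auto

lemma F_cst [simp, intro]: "cst c \<in> F 0" by (cases "c = 0") (auto intro!: F_I simp: v_cst)

lemma F_mult: "x \<in> F m ==> y \<in> F n ==> x \<otimes> y \<in> F (m + n)"
proof (cases "x = \<zero> \<or> y = \<zero>")
 case False
 assume *: "x \<in> F m" "y \<in> F n"
 hence "v (x \<otimes> y) = v x + v y" using v_mult False by auto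
 thus ?thesis using F_D[OF *(1)] F_D[OF *(2)] False * by (intro F_I L_mult) auto
qed (auto simp: F_carr)

lemma F_cst_mult: "x \<in> F n ==> cst c \<otimes> x \<in> F n" using F_mult[OF F_cst, of x n c] by simp

lemma F_add: "x \<in> F n ==> y \<in> F n ==> x \<oplus> y \<in> F n"
proof (cases "x = \<zero> \<or> y = \<zero> \<or> x \<oplus> y = \<zero>")
 case True
 assume "x \<in> F n" "y \<in> F n" thus ?thesis using True by (auto simp: F_carr)
next
 case False
 assume *: "x \<in> F n" "y \<in> F n"
 obtain a b where ab: "a \<in> B" "b \<in> B" "b ~= \<zero>" "x = a \<otimes> inv b" using * L_E F_L by metis
 obtain c d where cd: "c \<in> B" "d \<in> B" "d ~= \<zero>" "y = c \<otimes> inv d" using * L_E F_L by metis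
 have xy: "x \<oplus> y = (a \<otimes> d \<oplus> c \<otimes> b) \<otimes> inv (b \<otimes> d)" using ab cd by (simp add: divide_add)
 have bd: "b \<otimes> d \<in> B" "b \<otimes> d ~= \<zero>" using ab cd by auto
 have q: "v (p \<otimes> inv (b \<otimes> d)) = v p - v (b \<otimes> d)" if "p \<in> B" "p ~= \<zero>" for p
 proof -
  have "inv (b \<otimes> d) ~= \<zero>" using inv_nonzero[OF B_carr[OF bd(1)] bd(2)] .
  thus ?thesis using v_mult[of p "inv (b \<otimes> d)"] bd that v_inv[of "b \<otimes> d"] L_inv[of "b \<otimes> d"] by simp
 qed
 have a0: "a ~= \<zero>" "c ~= \<zero>" using False ab cd by auto
 have x: "x = (a \<otimes> d) \<otimes> inv (b \<otimes> d)" using ab cd divide_mult[of a b d d] by simp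
 have y: "y = (c \<otimes> b) \<otimes> inv (b \<otimes> d)" using ab cd divide_mult[of b b c d] by (simp add: m_comm)
 have nz: "a \<otimes> d ~= \<zero>" "c \<otimes> b ~= \<zero>" using a0 ab cd by auto
 have s0: "a \<otimes> d \<oplus> c \<otimes> b ~= \<zero>" using False xy bd by auto
 have "min (v (a \<otimes> d)) (v (c \<otimes> b)) \<le> v (a \<otimes> d \<oplus> c \<otimes> b)" using v_add_B[of "a \<otimes> d" "c \<otimes> b"] nz s0 ab cd by (auto intro: B_mult)
 moreover have "n \<le> v (a \<otimes> d) - v (b \<otimes> d)" using F_D[OF *(1)] False x q[of "a \<otimes> d"] nz ab(1,2) cd(1,2) B_mult by metis
 moreover have "n \<le> v (c \<otimes> b) - v (b \<otimes> d)" using F_D[OF *(2)] False y q[of "c \<otimes> b"] nz ab(1,2) cd(1,2) B_mult by metis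
 ultimately have "n \<le> v (x \<oplus> y)" unfolding xy using q[of "a \<otimes> d \<oplus> c \<otimes> b"] s0 ab cd by (auto simp: B_mult B_add)
 thus ?thesis using * by (intro F_I L_add) auto
qed

lemma F_uminus: "x \<in> F n ==> \<ominus> x \<in> F n"
proof -
 assume x: "x \<in> F n"
 have "\<ominus> x = cst (-1) \<otimes> x" using x F_carr by (simp add: cst_uminus l_minus)
 thus ?thesis using F_cst_mult[OF x] by simp
qed

lemma F_minus: "x \<in> F n ==> y \<in> F n ==> x \<ominus> y \<in> F n" by (simp add: a_minus_def F_add F_uminus)

lemma F_exact: "x \<in> F n ==> x \<notin> F (n + 1) ==> x ~= \<zero> \<and> v x = n" unfolding F_def by auto

lemma F_v: "x \<in> L ==> x ~= \<zero> ==> x \<in> F n \<longleftrightarrow> n \<le> v x" unfolding F_def by auto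

lemma F_residue:
 assumes x: "x \<in> F n" and y: "y \<in> F n" "y \<notin> F (n + 1)"
 shows "\<exists>c. x \<ominus> cst c \<otimes> y \<in> F (n + 1)"
proof (cases "x \<in> F (n + 1)")
 case True
 have "x \<ominus> cst 0 \<otimes> y = x" using x y F_carr by (simp add: a_minus_def)
 thus ?thesis using True by metis
next
 case False
 have vx: "x ~= \<zero>" "v x = n" "y ~= \<zero>" "v y = n" using F_exact x y False by auto
 obtain b where b: "b \<in> B" "b ~= \<zero>" "x \<otimes> b \<in> B" using L_clear[of x] x by auto
 obtain d where d: "d \<in> B" "d ~= \<zero>" "y \<otimes> d \<in> B" using L_clear[of y] y by auto
 have bd: "b \<otimes> d \<in> B" "b \<otimes> d ~= \<zero>" using b d by auto
 have xy: "x \<in> carrier K" "y \<in> carrier K" using x y F_carr by auto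
 have "x \<otimes> (b \<otimes> d) = (x \<otimes> b) \<otimes> d" "y \<otimes> (b \<otimes> d) = (y \<otimes> d) \<otimes> b" using xy b(1) d(1) by (simp_all add: m_ac)
 hence xbd: "x \<otimes> (b \<otimes> d) \<in> B" "y \<otimes> (b \<otimes> d) \<in> B" using b d by (simp_all add: B_mult)
 have vb: "v (x \<otimes> (b \<otimes> d)) = n + v (b \<otimes> d)" "v (y \<otimes> (b \<otimes> d)) = n + v (b \<otimes> d)"
  using v_mult[of x "b \<otimes> d"] v_mult[of y "b \<otimes> d"] vx x y bd by auto
 have nz: "x \<otimes> (b \<otimes> d) ~= \<zero>" "y \<otimes> (b \<otimes> d) ~= \<zero>" using vx x y bd F_carr by auto
 obtain e where e: "x \<otimes> (b \<otimes> d) \<ominus> cst e \<otimes> (y \<otimes> (b \<otimes> d)) = \<zero> \<or>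
   n + v (b \<otimes> d) < v (x \<otimes> (b \<otimes> d) \<ominus> cst e \<otimes> (y \<otimes> (b \<otimes> d)))" using v_residue_B[OF xbd nz] vb by auto
 have eq: "x \<otimes> (b \<otimes> d) \<ominus> cst e \<otimes> (y \<otimes> (b \<otimes> d)) = (x \<ominus> cst e \<otimes> y) \<otimes> (b \<otimes> d)" using x y bd F_carr B_carr cst_closed by algebra
 let ?z = "x \<ominus> cst e \<otimes> y"
 have z: "?z \<in> L" using x y by (intro L_minus L_mult) auto
 have "?z \<in> F (n + 1)"
 proof (cases "?z = \<zero>")
  case False
  have "?z \<otimes> (b \<otimes> d) ~= \<zero>" using False z bd L_carr B_carr mult_eq_zero by metis
  moreover have "v (?z \<otimes> (b \<otimes> d)) = v ?z + v (b \<otimes> d)" using v_mult[OF z, of "b \<otimes> d"] False bd by auto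
  ultimately show ?thesis using e unfolding eq by (intro F_I[OF z]) auto
 qed simp
 thus ?thesis by blast
qed

lemma exists_B_exact: obtains b where "b \<in> B" "b ~= \<zero>" "v b = n" using v_surj[of n] by blast

text \<open>Successive approximation: the values of \<open>B\<close> exhaust the integers, so the leading term of \<open>x\<close> can be
 removed by a multiple of an element of \<open>B\<close>, again and again.\<close>
lemma F_approx:
 assumes "x \<in> L" shows "\<exists>b\<in>B. x \<ominus> b \<in> F n"
proof -
 have *: "\<exists>b\<in>B. x \<ominus> b \<in> F n" if "x \<in> F m" for m x using that
 proof (induct "nat (n - m)" arbitrary: x m)
  case 0
  hence "x \<ominus> \<zero> \<in> F n" using F_mono[of x m n] F_carr by (simp add: a_minus_def)
  thus ?case by blast
 next
  case (Suc k)
  obtain b where b: "b \<in> B" "b ~= \<zero>" "v b = m" by (rule exists_B_exact)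
  hence "b \<in> F m" "b \<notin> F (m + 1)" by (auto simp: F_v)
  then obtain c where c: "x \<ominus> cst c \<otimes> b \<in> F (m + 1)" using F_residue Suc(3) by blast
  have "k = nat (n - (m + 1))" using Suc(2) by linarith
  then obtain b' where b': "b' \<in> B" "(x \<ominus> cst c \<otimes> b) \<ominus> b' \<in> F n" using Suc(1)[of "m + 1" "x \<ominus> cst c \<otimes> b"] c by auto
  have "(x \<ominus> cst c \<otimes> b) \<ominus> b' = x \<ominus> (cst c \<otimes> b \<oplus> b')" using Suc(3) b b' F_carr B_carr cst_closed by algebra
  thus ?case using b b' by (metis B_add B_mult cst_B)
 qed
 show ?thesis
 proof (cases "x = \<zero>")
  case True thus ?thesis using *[of x n] by simp
 next
  case False thus ?thesis using *[of x "v x"] F_I[OF assms, of "v x"] by simp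
 qed
qed

lemma dvr_F0: "discrete_valuation_ring K (range cst) L (F 0)"
proof -
 have "v ` (L - {\<zero>}) = UNIV"
 proof (intro equalityI subsetI)
  fix n show "n \<in> v ` (L - {\<zero>})" using exists_B_exact[of n] by (metis B_L DiffI image_eqI singletonD)
 qed simp
 moreover have "min (v a) (v b) \<le> v (a \<oplus> b)"
  if "a \<in> L - {\<zero>}" "b \<in> L - {\<zero>}" "a \<oplus> b ~= \<zero>" for a b
 proof -
  have "a \<in> F (min (v a) (v b))" "b \<in> F (min (v a) (v b))" using that by (intro F_I; simp)+
  hence "a \<oplus> b \<in> F (min (v a) (v b))" by (rule F_add)
  thus ?thesis using F_D that by blast
 qed
 moreover have "range cst \<subseteq> F 0" using F_cst by blast
 moreover have "v (a \<otimes> b) = v a + v b" if "a \<in> L - {\<zero>}" "b \<in> L - {\<zero>}" for a b using that v_mult[of a b] by simp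
 ultimately show ?thesis unfolding discrete_valuation_ring_def F_def by blast
qed

lemma F_inv: "x \<in> F 0 ==> x \<notin> F 1 ==> inv x \<in> F 0"
proof -
 assume *: "x \<in> F 0" "x \<notin> F 1"
 hence "x ~= \<zero>" "v x = 0" using F_exact[of x 0] by auto
 thus ?thesis using * v_inv[of x] by (intro F_I L_inv) auto
qed

lemma max_ideal_F0: "max_ideal K (F 0) = F 1"
proof
 show "max_ideal K (F 0) \<subseteq> F 1" unfolding max_ideal_def using F_inv by auto
 show "F 1 \<subseteq> max_ideal K (F 0)"
 proof
  fix x assume x: "x \<in> F 1"
  have "inv x \<notin> F 0" if "x ~= \<zero>"
  proof
   assume i: "inv x \<in> F 0"
   have "inv x ~= \<zero>" using that x F_carr by simp
   thus False using F_D[OF i] F_D[OF x] that v_inv[of x] x by auto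
  qed
  thus "x \<in> max_ideal K (F 0)" unfolding max_ideal_def using x F_mono[of x 1 0] by auto
 qed
qed

lemma F0_at_infinity: "F 0 \<in> points_at_infinity K (range cst) B"
proof -
 obtain b where "b \<in> B" "b ~= \<zero>" "v b = -1" by (rule exists_B_exact)
 hence "b \<notin> F 0" by (auto simp: F_v)
 thus ?thesis unfolding points_at_infinity_def using dvr_F0 \<open>b \<in> B\<close> by blast
qed

lemma v_pow: "x \<in> L ==> x ~= \<zero> ==> x [^] n \<in> L \<and> x [^] n ~= \<zero> \<and> v (x [^] n) = int n * v x" for n :: nat
 by (induct n) (auto simp: v_mult algebra_simps intro: L_mult)

text \<open>Valuation rings of rank one are maximal subrings: a strictly larger ring would contain an element of
 negative value, hence by powers of it everything.\<close>
lemma dvr_containing_F0: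
 assumes "discrete_valuation_ring K k L W" "F 0 \<subseteq> W" shows "W = F 0"
proof (rule ccontr)
 assume "W ~= F 0"
 obtain u :: "'a => int" where u: "u ` (L - {\<zero>}) = UNIV"
  and um: "!!a b. a \<in> L - {\<zero>} ==> b \<in> L - {\<zero>} ==> u (a \<otimes> b) = u a + u b"
  and W: "W = {a \<in> L. a = \<zero> \<or> 0 \<le> u a}" using assms(1) unfolding discrete_valuation_ring_def by blast
 have WL: "W \<subseteq> L" using W by auto
 have Wm: "a \<otimes> b \<in> W" if "a \<in> W" "b \<in> W" for a b
 proof (cases "a = \<zero> \<or> b = \<zero>")
  case True
  hence "a \<otimes> b = \<zero>" using that WL L_carr by (metis l_null r_null subsetD)
  thus ?thesis unfolding W by simp
 next
  case False
  hence "a \<in> L" "b \<in> L" "0 \<le> u a" "0 \<le> u b" using that unfolding W by auto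
  thus ?thesis using um[of a b] L_mult[of a b] False unfolding W by simp
 qed
 obtain a where a: "a \<in> W" "a \<notin> F 0" using \<open>W ~= F 0\<close> assms(2) by blast
 hence aL: "a \<in> L" using WL by blast
 hence a0: "a ~= \<zero>" "v a < 0" using a(2) unfolding F_def by auto
 have apow: "a [^] n \<in> W" for n :: nat
 proof (induct n)
  case 0
  have "\<one> \<in> F 0" using F_cst[of 1] by simp
  thus ?case using assms(2) by auto
 next
  case (Suc n) thus ?case using Wm[of "a [^] n" a] a(1) by simp
 qed
 have "-1 \<in> u ` (L - {\<zero>})" using u by auto
 then obtain z where z: "z \<in> L - {\<zero>}" "u z = -1" by force
 define n where "n = nat (\<bar>v z\<bar>)"
 have ap: "a [^] n \<in> L" "a [^] n ~= \<zero>" "v (a [^] n) = int n * v a" using v_pow[OF aL a0(1)] by blast+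
 define y where "y = z \<otimes> inv (a [^] n)"
 have "v y = v z - int n * v a" unfolding y_def
  using v_mult[of z "inv (a [^] n)"] z ap(3) L_inv[OF ap(1,2)] v_inv[OF ap(1,2)] inv_nonzero[OF L_carr[OF ap(1)] ap(2)] by simp
 moreover have "int n * v a \<le> int n * (-1)" using a0 by (intro mult_left_mono) auto
 ultimately have "0 \<le> v y" unfolding n_def by linarith
 moreover have "y \<in> L" unfolding y_def using z ap by (intro L_mult L_inv) simp_all
 ultimately have "y \<in> W" using assms(2) F_I[of y 0] by blast
 hence "y \<otimes> a [^] n \<in> W" using Wm[of y "a [^] n"] apow by blast
 moreover have "y \<otimes> a [^] n = z" using eq_divide[of z "a [^] n" y] ap z \<open>y \<in> L\<close> y_def by simp
 ultimately have "z \<in> W" by simp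
 hence "0 \<le> u z" using z(1) unfolding W by blast
 thus False using z(2) by simp
qed

end

section \<open>Finite codimension and principal parts\<close>

context field_over_complex
begin

definition subspace :: "'a set => bool" where
 "subspace S \<longleftrightarrow> S \<subseteq> carrier K \<and> \<zero> \<in> S \<and> (\<forall>x\<in>S. \<forall>y\<in>S. x \<oplus> y \<in> S) \<and> (\<forall>c. \<forall>x\<in>S. cst c \<otimes> x \<in> S)"

text \<open>This relation replaces dimension theory: finite codimension is a finite chain of subspaces with steps of
 codimension at most one.\<close>
definition codim_le_1 :: "'a set => 'a set => bool" where
 "codim_le_1 T S \<longleftrightarrow> T \<subseteq> S \<and> (\<forall>x\<in>S. \<forall>y\<in>S - T. \<exists>c. x \<ominus> cst c \<otimes> y \<in> T)"

lemma subspace_D: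
 assumes "subspace S"
 shows "x \<in> S ==> x \<in> carrier K" "\<zero> \<in> S" "x \<in> S ==> y \<in> S ==> x \<oplus> y \<in> S"
  "x \<in> S ==> cst c \<otimes> x \<in> S" "x \<in> S ==> \<ominus> x \<in> S" "x \<in> S ==> y \<in> S ==> x \<ominus> y \<in> S"
proof -
 show 1: "x \<in> carrier K" if "x \<in> S" for x using assms that unfolding subspace_def by blast
 show "\<zero> \<in> S" using assms unfolding subspace_def by blast
 show 2: "x \<oplus> y \<in> S" if "x \<in> S" "y \<in> S" for x y using assms that unfolding subspace_def by blast
 show 3: "cst c \<otimes> x \<in> S" if "x \<in> S" for x c using assms that unfolding subspace_def by blast
 show 4: "\<ominus> x \<in> S" if "x \<in> S" for x using 3[OF that, of "-1"] 1[OF that] by (simp add: cst_uminus l_minus)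
 show "x \<ominus> y \<in> S" if "x \<in> S" "y \<in> S" using 2 4 that by (simp add: a_minus_def)
qed

lemma subspace_mod:
 assumes V: "subspace V" and P: "subspace P" and Q: "subspace Q"
 shows "subspace {y \<in> V. \<exists>b\<in>P. y \<ominus> b \<in> Q}" (is "subspace ?S") unfolding subspace_def
proof (intro conjI ballI allI)
 note c = subspace_D(1)[OF V] subspace_D(1)[OF P]
 show "?S \<subseteq> carrier K" using c by blast
 have "\<zero> \<ominus> \<zero> = \<zero>" by (simp add: a_minus_def)
 thus "\<zero> \<in> ?S" using subspace_D(2)[OF V] subspace_D(2)[OF P] subspace_D(2)[OF Q] by (metis (mono_tags, lifting) mem_Collect_eq)
 fix x assume "x \<in> ?S"
 then obtain b where x: "x \<in> V" "b \<in> P" "x \<ominus> b \<in> Q" by blast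
 show "cst e \<otimes> x \<in> ?S" for e
 proof -
  have "cst e \<otimes> x \<ominus> cst e \<otimes> b = cst e \<otimes> (x \<ominus> b)" using c(1)[OF x(1)] c(2)[OF x(2)] cst_closed by algebra
  hence "cst e \<otimes> x \<ominus> cst e \<otimes> b \<in> Q" using subspace_D(4)[OF Q x(3)] by simp
  thus ?thesis using subspace_D(4)[OF V x(1)] subspace_D(4)[OF P x(2)] by blast
 qed
 fix y assume "y \<in> ?S"
 then obtain d where y: "y \<in> V" "d \<in> P" "y \<ominus> d \<in> Q" by blast
 have "(x \<oplus> y) \<ominus> (b \<oplus> d) = (x \<ominus> b) \<oplus> (y \<ominus> d)" using c(1)[OF x(1)] c(2)[OF x(2)] c(1)[OF y(1)] c(2)[OF y(2)] by algebra
 hence "(x \<oplus> y) \<ominus> (b \<oplus> d) \<in> Q" using subspace_D(3)[OF Q x(3) y(3)] by simp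
 thus "x \<oplus> y \<in> ?S" using subspace_D(3)[OF V x(1) y(1)] subspace_D(3)[OF P x(2) y(2)] by blast
qed

lemma codim_mod:
 assumes V: "subspace V" and P: "subspace P" and Q: "codim_le_1 Q' Q"
 shows "codim_le_1 {y \<in> V. \<exists>b\<in>P. y \<ominus> b \<in> Q'} {y \<in> V. \<exists>b\<in>P. y \<ominus> b \<in> Q}" (is "codim_le_1 ?S' ?S") unfolding codim_le_1_def
proof (intro conjI ballI)
 show "?S' \<subseteq> ?S" using Q unfolding codim_le_1_def by blast
 fix x y assume "x \<in> ?S" "y \<in> ?S - ?S'"
 then obtain b d where b: "x \<in> V" "b \<in> P" "x \<ominus> b \<in> Q" and d: "y \<in> V" "d \<in> P" "y \<ominus> d \<in> Q - Q'" by blast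
 obtain c where c: "(x \<ominus> b) \<ominus> cst c \<otimes> (y \<ominus> d) \<in> Q'" using Q b(3) d(3) unfolding codim_le_1_def by blast
 have "(x \<ominus> cst c \<otimes> y) \<ominus> (b \<ominus> cst c \<otimes> d) = (x \<ominus> b) \<ominus> cst c \<otimes> (y \<ominus> d)"
  using subspace_D(1)[OF V b(1)] subspace_D(1)[OF P b(2)] subspace_D(1)[OF V d(1)] subspace_D(1)[OF P d(2)] cst_closed by algebra
 hence "(x \<ominus> cst c \<otimes> y) \<ominus> (b \<ominus> cst c \<otimes> d) \<in> Q'" using c by simp
 thus "\<exists>c. x \<ominus> cst c \<otimes> y \<in> ?S'"
  using subspace_D(6)[OF V b(1) subspace_D(4)[OF V d(1)]] subspace_D(6)[OF P b(2) subspace_D(4)[OF P d(2)]] by blast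
qed

lemma subspace_Int: "subspace S ==> subspace T ==> subspace (S \<inter> T)" unfolding subspace_def by blast

lemma codim_Int:
 assumes "subspace P" "codim_le_1 T S" shows "codim_le_1 (P \<inter> T) (P \<inter> S)" unfolding codim_le_1_def
proof (intro conjI ballI)
 show "P \<inter> T \<subseteq> P \<inter> S" using assms(2) unfolding codim_le_1_def by blast
 fix x y assume "x \<in> P \<inter> S" "y \<in> P \<inter> S - P \<inter> T"
 hence xy: "x \<in> P" "x \<in> S" "y \<in> P" "y \<in> S - T" by auto
 then obtain c where "x \<ominus> cst c \<otimes> y \<in> T" using assms(2) unfolding codim_le_1_def by blast
 thus "\<exists>c. x \<ominus> cst c \<otimes> y \<in> P \<inter> T" using subspace_D(6)[OF assms(1) xy(1) subspace_D(4)[OF assms(1) xy(3)]] by blast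
qed

definition finite_codim :: "'a set => 'a set => bool" where
 "finite_codim J B \<longleftrightarrow> (\<exists>N (S::nat => 'a set). S 0 = B \<and> S N = J \<and>
   (\<forall>i. subspace (S i)) \<and> (\<forall>i. codim_le_1 (S (Suc i)) (S i)))"

definition eval_at :: "'a => complex poly => 'a" where
 "eval_at u p = fold_coeffs (%a x. cst a \<oplus> u \<otimes> x) p \<zero>"

context
 fixes u assumes u: "u \<in> carrier K"
begin

lemma eval_at_0 [simp]: "eval_at u 0 = \<zero>" unfolding eval_at_def by simp

lemma eval_at_pCons [simp]: "eval_at u (pCons a p) = cst a \<oplus> u \<otimes> eval_at u p" using u unfolding eval_at_def by (cases "p = 0 \<and> a = 0") auto

lemma eval_at_closed [simp, intro]: "eval_at u p \<in> carrier K" by (induct p) (use u in auto)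

lemma eval_at_add: "eval_at u (p + q) = eval_at u p \<oplus> eval_at u q"
proof (induct p q rule: poly_induct2)
 case (pCons a p b q)
 thus ?case using u by (simp add: cst_add r_distr add.m_ac)
qed simp

lemma eval_at_smult: "eval_at u (Polynomial.smult c p) = cst c \<otimes> eval_at u p"
proof (induct p)
 case (pCons a p)
 thus ?case using u by (simp add: cst_mult r_distr m_ac)
qed simp

lemma eval_at_linear_mult: "eval_at u ([:- c, 1:] * q) = (u \<ominus> cst c) \<otimes> eval_at u q"
proof -
 have "[:- c, 1:] * q = Polynomial.smult (- c) q + pCons 0 q" by simp
 hence "eval_at u ([:- c, 1:] * q) = cst (- c) \<otimes> eval_at u q \<oplus> (cst 0 \<oplus> u \<otimes> eval_at u q)"
  by (simp only: eval_at_add eval_at_smult eval_at_pCons)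
 thus ?thesis using u by (simp add: cst_uminus l_distr a_minus_def add.m_comm)
qed

end

end

context affine_ring
begin

lemma eval_at_B [intro]: "u \<in> B ==> eval_at u p \<in> B" by (induct p) (auto simp: B_add B_mult)

text \<open>Over \<open>\<complex>\<close> the polynomial splits into linear factors, and \<open>M\<close> is prime.\<close>
lemma eval_at_prime_ideal:
 assumes M: "max_id M" and u: "u \<in> B" and p: "p ~= 0" "eval_at u p \<in> M"
 shows "\<exists>c. u \<ominus> cst c \<in> M" using p
proof (induct "degree p" arbitrary: p rule: less_induct)
 case less
 have uc: "u \<in> carrier K" using u by simp
 show ?case
 proof (cases "degree p = 0")
  case True
  then obtain a where a: "p = [:a:]" by (metis degree_eq_zeroE)
  hence "cst a \<in> M" "a ~= 0" using less(2,3) uc by auto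
  hence "cst a \<otimes> cst (inverse a) \<in> M" using max_id_D(4)[OF M] by blast
  hence "\<one> \<in> M" using \<open>a ~= 0\<close> by (simp flip: cst_mult)
  thus ?thesis using max_id_D(8)[OF M] by blast
 next
  case False
  hence "\<not> constant (poly p)" by (simp add: constant_degree)
  then obtain c where "poly p c = 0" using fundamental_theorem_of_algebra by blast
  then obtain q where q: "p = [:- c, 1:] * q" using poly_eq_0_iff_dvd by blast
  have q0: "q ~= 0" using less(2) q by auto
  have dq: "degree q < degree p" using q q0 degree_mult_eq[of "[:- c, 1:]" q] by simp
  have "(u \<ominus> cst c) \<otimes> eval_at u q \<in> M" using less(3) eval_at_linear_mult[OF uc] q by simp
  hence "u \<ominus> cst c \<in> M \<or> eval_at u q \<in> M" using max_id_prime[OF M] u eval_at_B[OF u] B_minus by blast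
  thus ?thesis using less(1)[OF dq q0] by blast
 qed
qed

text \<open>The space of polynomials that are mapped into a member of the chain contains polynomials of infinitely
 many degrees: a step of codimension one costs at most the degrees up to that of one polynomial.\<close>
lemma finite_codim_algebraic:
 assumes "finite_codim J B" "u \<in> B"
 shows "\<exists>p. p ~= 0 \<and> eval_at u p \<in> J"
proof -
 obtain N S where S: "S 0 = B" "S N = J" "!!i. subspace (S i)" "!!i. codim_le_1 (S (Suc i)) (S i)"
  using assms(1) unfolding finite_codim_def by blast
 have uc: "u \<in> carrier K" using assms by simp
 have "infinite (degree ` {p. p ~= 0 \<and> eval_at u p \<in> S i})" for i
 proof (induct i)
  case 0
  have "n \<in> degree ` {p. p ~= 0 \<and> eval_at u p \<in> S 0}" for n
  proof (rule image_eqI[of _ _ "Polynomial.monom 1 n"])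
   show "n = degree (Polynomial.monom (1::complex) n)" by (simp add: degree_monom_eq)
   show "Polynomial.monom (1::complex) n \<in> {p. p ~= 0 \<and> eval_at u p \<in> S 0}" using eval_at_B[OF assms(2)] S(1) by simp
  qed
  hence "degree ` {p. p ~= 0 \<and> eval_at u p \<in> S 0} = UNIV" by blast
  thus ?case by simp
 next
  case (Suc i)
  let ?D = "degree ` {p. p ~= 0 \<and> eval_at u p \<in> S i}"
  let ?D' = "degree ` {p. p ~= 0 \<and> eval_at u p \<in> S (Suc i)}"
  have sub: "S (Suc i) \<subseteq> S i" using S(4)[of i] unfolding codim_le_1_def by blast
  show ?case
  proof (cases "\<exists>q. q ~= 0 \<and> eval_at u q \<in> S i - S (Suc i)")
   case True
   then obtain q where q: "q ~= 0" "eval_at u q \<in> S i - S (Suc i)" by blast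
   have "n \<in> ?D'" if n: "n \<in> ?D" "degree q < n" for n
   proof -
    obtain p where p: "p ~= 0" "eval_at u p \<in> S i" "n = degree p" using n(1) by blast
    obtain c where c: "eval_at u p \<ominus> cst c \<otimes> eval_at u q \<in> S (Suc i)" using S(4)[of i] p(2) q(2) unfolding codim_le_1_def by blast
    have "eval_at u (p + Polynomial.smult (- c) q) = eval_at u p \<ominus> cst c \<otimes> eval_at u q"
     unfolding eval_at_add[OF uc] eval_at_smult[OF uc] using uc by (simp add: cst_uminus l_minus a_minus_def)
    moreover have "degree (p + Polynomial.smult (- c) q) = n"
    proof -
     have "degree (Polynomial.smult (- c) q) < degree p" using degree_smult_le[of "- c" q] n(2) p(3) by linarith
     thus ?thesis using degree_add_eq_left p(3) by metis
    qed
    moreover have "p + Polynomial.smult (- c) q ~= 0" using calculation(2) n(2) by auto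
    ultimately show ?thesis using c by (intro image_eqI[of _ _ "p + Polynomial.smult (- c) q"]) auto
   qed
   hence "?D \<subseteq> ?D' \<union> {..degree q}" by (meson UnI1 UnI2 atMost_iff linorder_not_less subsetI)
   hence "infinite (?D' \<union> {..degree q})" using Suc(1) by (rule infinite_super)
   thus ?thesis unfolding finite_Un by blast
  next
   case False
   hence "{p. p ~= 0 \<and> eval_at u p \<in> S i} \<subseteq> {p. p ~= 0 \<and> eval_at u p \<in> S (Suc i)}" by blast
   hence "?D \<subseteq> ?D'" by (rule image_mono)
   thus ?thesis using Suc(1) by (rule infinite_super)
  qed
 qed
 hence "degree ` {p. p ~= 0 \<and> eval_at u p \<in> S N} ~= {}" by (metis finite.emptyI)
 thus ?thesis using S(2) by auto
qed

lemma ideal_subspace: "ideal_of_B J ==> subspace J" unfolding subspace_def using ideal_of_B_D(1-3,5)[of J] by (meson B_carr cst_B subsetI)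

definition principal :: "'a => 'a set" where "principal d = {d \<otimes> b | b. b \<in> B}"

lemma principal_ideal: "d \<in> B ==> ideal_of_B (principal d)" unfolding ideal_of_B_def principal_def
proof (intro conjI ballI)
 assume d: "d \<in> B"
 have "\<zero> = d \<otimes> \<zero>" using d by simp
 thus "\<zero> \<in> {d \<otimes> b | b. b \<in> B}" by blast
 fix x y assume "x \<in> {d \<otimes> b | b. b \<in> B}"
 then obtain a where a: "x = d \<otimes> a" "a \<in> B" by blast
 { assume "y \<in> {d \<otimes> b | b. b \<in> B}"
  then obtain b where b: "y = d \<otimes> b" "b \<in> B" by blast
  have "x \<oplus> y = d \<otimes> (a \<oplus> b)" using a b d by (simp add: r_distr)
  thus "x \<oplus> y \<in> {d \<otimes> b | b. b \<in> B}" using a b by blast }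
 { assume "y \<in> B"
  hence "x \<otimes> y = d \<otimes> (a \<otimes> y)" using a d by (simp add: m_assoc)
  thus "x \<otimes> y \<in> {d \<otimes> b | b. b \<in> B}" using a \<open>y \<in> B\<close> by blast }
qed (auto simp: B_mult)

text \<open>The ideals \<open>J + s B\<close> with \<open>s\<close> outside \<open>M\<close> have bounded codimension, so one of them is minimal. The image
 of \<open>s\<close> in \<open>B / J\<close> then generates the factor of this Artinian ring that belongs to \<open>M\<close>.\<close>
lemma finite_codim_minimal_multiple:
 assumes M: "max_id M" and J: "ideal_of_B J" "finite_codim J B"
 obtains s where "s \<in> B - M"
  "!!t. t \<in> B - M ==> \<exists>x\<in>B. s \<ominus> (s \<otimes> t) \<otimes> x \<in> J"
proof -
 obtain N S where S: "S 0 = B" "S N = J" "!!i. subspace (S i)" "!!i. codim_le_1 (S (Suc i)) (S i)"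
  using J(2) unfolding finite_codim_def by blast
 \<comment> \<open>The set of steps of the chain at which a subspace jumps plays the role of its dimension modulo J.\<close>
 define jumps where "jumps I = {i. i < N \<and> (\<exists>x\<in>I. x \<in> S i - S (Suc i))}" for I
 have fin: "finite (jumps I)" for I unfolding jumps_def by simp
 have eq: "I' \<subseteq> I"
  if I: "subspace I" "subspace I'" "J \<subseteq> I" "I \<subseteq> I'" "I' \<subseteq> B" "jumps I' \<subseteq> jumps I" for I I'
 proof -
  have "x \<in> I" if "x \<in> I'" "x \<in> S (N - k)" "k \<le> N" for x k using that
  proof (induct k arbitrary: x)
   case 0 thus ?case using S(2) I(3) by auto
  next
   case (Suc k)
   define i where "i = N - Suc k"
   have i: "i < N" "Suc i = N - k" using Suc(4) unfolding i_def by auto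
   show ?case
   proof (cases "x \<in> S (Suc i)")
    case True thus ?thesis using Suc i by auto
   next
    case False
    hence "i \<in> jumps I'" unfolding jumps_def using i Suc(2,3) unfolding i_def by auto
    then obtain y where y: "y \<in> I" "y \<in> S i - S (Suc i)" using I(6) unfolding jumps_def by blast
    obtain c where c: "x \<ominus> cst c \<otimes> y \<in> S (Suc i)" using S(4)[of i] y(2) Suc(3) unfolding codim_le_1_def i_def by blast
    have "x \<ominus> cst c \<otimes> y \<in> I'" using subspace_D[OF I(2)] Suc(2) y(1) I(4) by (meson subsetD)
    hence "x \<ominus> cst c \<otimes> y \<in> I" using Suc(1) c i Suc(4) by auto
    hence "(x \<ominus> cst c \<otimes> y) \<oplus> cst c \<otimes> y \<in> I" using subspace_D[OF I(1)] y(1) by blast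
    moreover have "(x \<ominus> cst c \<otimes> y) \<oplus> cst c \<otimes> y = x"
     using subspace_D(1)[OF I(2) Suc(2)] subspace_D(1)[OF I(1) y(1)] cst_closed by algebra
    ultimately show ?thesis by simp
   qed
  qed
  from this[of _ N] show ?thesis using I(5) S(1) by auto
 qed
 let ?I = "%s. {x \<oplus> s \<otimes> c | x c. x \<in> J \<and> c \<in> B}"
 have "\<one> \<in> B - M" using max_id_D(8)[OF M] by auto
 then obtain s where s: "s \<in> B - M" "!!t. t \<in> B - M ==> card (jumps (?I s)) \<le> card (jumps (?I t))"
  using ex_has_least_nat[of "%s. s \<in> B - M" \<one> "%s. card (jumps (?I s))"] by blast
 show ?thesis
 proof
  show "s \<in> B - M" by fact
  fix t assume t: "t \<in> B - M"
  hence st: "s \<otimes> t \<in> B - M" using max_id_compl_mult[OF M] s(1) by blast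
  have sB: "s \<in> B" "s \<otimes> t \<in> B" "t \<in> B" using s st t by auto
  note Is = ideal_of_B_extend[OF J(1) sB(1)] and Ist = ideal_of_B_extend[OF J(1) sB(2)]
  have sub: "?I (s \<otimes> t) \<subseteq> ?I s"
  proof
   fix z assume "z \<in> ?I (s \<otimes> t)"
   then obtain x c where xc: "z = x \<oplus> (s \<otimes> t) \<otimes> c" "x \<in> J" "c \<in> B" by blast
   hence "z = x \<oplus> s \<otimes> (t \<otimes> c)" using sB by (simp add: m_assoc)
   thus "z \<in> ?I s" using xc sB by blast
  qed
  hence "jumps (?I (s \<otimes> t)) \<subseteq> jumps (?I s)" unfolding jumps_def by blast
  hence "jumps (?I (s \<otimes> t)) = jumps (?I s)" using s(2)[OF st] fin by (meson card_seteq)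
  hence J': "jumps (?I s) \<subseteq> jumps (?I (s \<otimes> t))" by simp
  have IB: "?I s \<subseteq> B" using ideal_of_B_D(1)[OF Is(1)] by (rule subsetI)
  have "?I s \<subseteq> ?I (s \<otimes> t)" by (rule eq[OF ideal_subspace[OF Ist(1)] ideal_subspace[OF Is(1)] Ist(2) sub IB J'])
  hence "s \<in> ?I (s \<otimes> t)" using Is(3) by (rule subsetD)
  then obtain x c where xc: "s = x \<oplus> (s \<otimes> t) \<otimes> c" "x \<in> J" "c \<in> B" by blast
  have "x \<oplus> (s \<otimes> t) \<otimes> c \<ominus> (s \<otimes> t) \<otimes> c = x" using ideal_of_B_D(1)[OF J(1) xc(2)] sB(2) xc(3) B_carr by algebra
  hence "s \<ominus> (s \<otimes> t) \<otimes> c \<in> J" using xc by metis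
  thus "\<exists>x\<in>B. s \<ominus> (s \<otimes> t) \<otimes> x \<in> J" using xc by blast
 qed
qed

text \<open>For a domain that is finitely generated over \<open>\<complex>\<close> this says that the dimension is at most one.\<close>
definition one_dimensional :: bool where
 "one_dimensional \<longleftrightarrow> (\<forall>d\<in>B. d ~= \<zero> \<longrightarrow> finite_codim (principal d) B)"

text \<open>In the Artinian ring \<open>B / d B\<close> the element \<open>e\<close> is the idempotent of the factor that belongs to \<open>M\<close>; but
 only its local properties at the points of the curve matter.\<close>
lemma local_idempotent:
 assumes dim: one_dimensional and M: "max_id M" and d: "d \<in> B" "d ~= \<zero>"
 obtains e where "e \<in> B" "\<exists>z\<in>loc M. \<one> \<ominus> e = d \<otimes> z"
  "!!M'. max_id M' ==> M' ~= M ==> \<exists>z\<in>loc M'. e = d \<otimes> z"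
proof -
 have "finite_codim (principal d) B" using dim d unfolding one_dimensional_def by blast
 then obtain s where s: "s \<in> B - M"
  "!!t. t \<in> B - M ==> \<exists>x\<in>B. s \<ominus> (s \<otimes> t) \<otimes> x \<in> principal d" using finite_codim_minimal_multiple[OF M principal_ideal[OF d(1)]] by blast
 have sB: "s \<in> B" "s ~= \<zero>" using s(1) not_in_M_nonzero[OF M] by auto
 obtain x y where xy: "x \<in> B" "y \<in> B" "s \<ominus> (s \<otimes> s) \<otimes> x = d \<otimes> y" using s(2)[OF s(1)] unfolding principal_def by blast
 show ?thesis
 proof
  show "s \<otimes> x \<in> B" using sB xy by blast
  have "(\<one> \<ominus> s \<otimes> x) \<otimes> s = d \<otimes> y" unfolding xy(3)[symmetric] using sB(1) xy(1) B_carr by algebra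
  hence "\<one> \<ominus> s \<otimes> x = (d \<otimes> y) \<otimes> inv s" using eq_divide[of "d \<otimes> y" s "\<one> \<ominus> s \<otimes> x"] sB xy d by simp
  hence "\<one> \<ominus> s \<otimes> x = d \<otimes> (y \<otimes> inv s)" using sB xy d by (simp add: m_assoc)
  thus "\<exists>z\<in>loc M. \<one> \<ominus> s \<otimes> x = d \<otimes> z" using loc_I[OF M xy(2) s(1)] by blast
  fix M' assume M': "max_id M'" "M' ~= M"
  then obtain t where t: "t \<in> M'" "t \<notin> M" using max_id_maximal[OF M'(1) M] by blast
  hence tB: "t \<in> B" using max_id_D(1)[OF M'(1)] by blast
  then obtain x' y' where xy': "x' \<in> B" "y' \<in> B" "s \<ominus> (s \<otimes> t) \<otimes> x' = d \<otimes> y'" using s(2)[of t] t unfolding principal_def by blast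
  define r where "r = \<one> \<ominus> t \<otimes> x'"
  have rB: "r \<in> B" unfolding r_def using tB xy' by (intro B_minus B_mult) auto
  have "r \<oplus> t \<otimes> x' = \<one>" unfolding r_def using tB xy'(1) B_carr by algebra
  hence rM: "r \<in> B - M'" using rB max_id_D(3,4,8)[OF M'(1)] t(1) xy'(1) by (metis DiffI)
  hence r0: "r ~= \<zero>" using not_in_M_nonzero[OF M'(1)] by blast
  have "s \<otimes> r = d \<otimes> y'" unfolding xy'(3)[symmetric] r_def using sB(1) tB xy'(1) B_carr by algebra
  hence "s = (d \<otimes> y') \<otimes> inv r" using eq_divide[of "d \<otimes> y'" r s] sB rB r0 xy' d by simp
  hence "s \<otimes> x = (d \<otimes> y') \<otimes> inv r \<otimes> x" by simp
  also have "\<dots> = d \<otimes> ((y' \<otimes> x) \<otimes> inv r)" using rB r0 xy xy' d by (simp add: m_ac)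
  finally show "\<exists>z\<in>loc M'. s \<otimes> x = d \<otimes> z" using loc_I[OF M'(1) _ rM, of "y' \<otimes> x"] xy xy' by blast
 qed
qed

text \<open>If \<open>d\<close> is a denominator of \<open>r\<close> and \<open>e\<close> is the idempotent modulo \<open>d\<close> at \<open>M\<close>, then \<open>e r\<close> has the same
 principal part as \<open>r\<close> at \<open>M\<close> and is regular elsewhere.\<close>
lemma single_principal_part:
 assumes dim: one_dimensional and M: "max_id M" and r: "r \<in> L"
 shows "\<exists>a\<in>L. a \<ominus> r \<in> loc M \<and> (\<forall>M'. max_id M' \<longrightarrow> M' ~= M \<longrightarrow> a \<in> loc M')"
proof -
 obtain b d where bd: "b \<in> B" "d \<in> B" "d ~= \<zero>" "r = b \<otimes> inv d" using r L_E by metis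
 obtain e where e: "e \<in> B" "\<exists>z\<in>loc M. \<one> \<ominus> e = d \<otimes> z"
  "!!M'. max_id M' ==> M' ~= M ==> \<exists>z\<in>loc M'. e = d \<otimes> z" using local_idempotent[OF dim M bd(2,3)] by blast
 have dr: "r \<otimes> d = b" using eq_divide[of b d r] bd r L_carr by simp
 show ?thesis
 proof (intro bexI[of _ "e \<otimes> r"] conjI allI impI)
  show "e \<otimes> r \<in> L" using e r by (intro L_mult) auto
  obtain z where z: "z \<in> loc M" "\<one> \<ominus> e = d \<otimes> z" using e by blast
  have zc: "z \<in> carrier K" "r \<in> carrier K" using z loc_L[OF M] r L_carr by auto
  have "e \<otimes> r \<ominus> r = \<ominus> ((\<one> \<ominus> e) \<otimes> r)" using e(1) zc B_carr by algebra
  also have "(\<one> \<ominus> e) \<otimes> r = (r \<otimes> d) \<otimes> z" unfolding z(2) using zc bd(2) by (simp add: m_ac)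
  also have "\<ominus> ((r \<otimes> d) \<otimes> z) \<in> loc M" unfolding dr using z(1) bd(1) B_loc[OF M] loc_mult[OF M] loc_uminus[OF M] by blast
  finally show "e \<otimes> r \<ominus> r \<in> loc M" .
  fix M' assume M': "max_id M'" "M' ~= M"
  then obtain z where z: "z \<in> loc M'" "e = d \<otimes> z" using e by blast
  have zc: "z \<in> carrier K" "r \<in> carrier K" using z loc_L[OF M'(1)] r L_carr by auto
  have "e \<otimes> r = (r \<otimes> d) \<otimes> z" unfolding z(2) using zc bd(2) by (simp add: m_ac)
  thus "e \<otimes> r \<in> loc M'" unfolding dr using z(1) bd(1) B_loc[OF M'(1)] loc_mult[OF M'(1)] by simp
 qed
qed

lemma finite_principal_parts:
 assumes dim: one_dimensional and "finite X" "X \<subseteq> Spec K B" "!!x. x \<in> X ==> r x \<in> L"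
 shows "\<exists>a\<in>L. (\<forall>x\<in>X. r x \<ominus> a \<in> x) \<and> (\<forall>x\<in>Spec K B - X. a \<in> x)" using assms(2-4)
proof (induct X)
 case empty
 have "\<zero> \<in> x" if "x \<in> Spec K B" for x using that B_loc unfolding Spec_eq by auto
 thus ?case by (intro bexI[of _ \<zero>]) auto
next
 case (insert y X)
 then obtain a where a: "a \<in> L" "!!x. x \<in> X ==> r x \<ominus> a \<in> x" "!!x. x \<in> Spec K B - X ==> a \<in> x" by auto
 obtain M where M: "max_id M" "y = loc M" using insert(4) unfolding Spec_eq by blast
 obtain b where b: "b \<in> L" "b \<ominus> r y \<in> loc M" "!!M'. max_id M' ==> M' ~= M ==> b \<in> loc M'"
  using single_principal_part[OF dim M(1), of "r y"] insert(5) by auto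
 have b': "b \<in> x" if "x \<in> Spec K B" "x ~= y" for x using that b(3) M unfolding Spec_eq by blast
 show ?case
 proof (intro bexI[of _ "a \<oplus> b"] conjI ballI)
  show "a \<oplus> b \<in> L" using a b by blast
  fix x assume x: "x \<in> insert y X"
  hence xS: "x \<in> Spec K B" using insert by blast
  then obtain N where N: "max_id N" "x = loc N" unfolding Spec_eq by blast
  have rc: "r x \<in> carrier K" "a \<in> carrier K" "b \<in> carrier K" using insert(5) x a b by auto
  show "r x \<ominus> (a \<oplus> b) \<in> x"
  proof (cases "x = y")
   case True
   have "a \<in> x" using a(3)[of x] xS True insert(2) by simp
   hence "\<ominus> (b \<ominus> r y) \<ominus> a \<in> x" using b(2) M N True loc_minus loc_uminus by metis
   moreover have "\<ominus> (b \<ominus> r x) \<ominus> a = r x \<ominus> (a \<oplus> b)" using rc by algebra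
   ultimately show ?thesis using True by simp
  next
   case False
   hence "(r x \<ominus> a) \<ominus> b \<in> x" using a(2)[of x] b'[of x] xS x N loc_minus by blast
   moreover have "(r x \<ominus> a) \<ominus> b = r x \<ominus> (a \<oplus> b)" using rc by algebra
   ultimately show ?thesis by simp
  qed
 next
  fix x assume x: "x \<in> Spec K B - insert y X"
  then obtain N where N: "max_id N" "x = loc N" unfolding Spec_eq by blast
  thus "a \<oplus> b \<in> x" using a(3)[of x] b'[of x] x loc_add by blast
 qed
qed

text \<open>The vanishing of \<open>H\<^sup>1(Spec B, \<O>)\<close> in the language of repartitions.\<close>
lemma affine_H1_vanishes:
 assumes dim: one_dimensional and r: "!!x. x \<in> Spec K B ==> r x \<in> L"
  and fin: "finite {x \<in> Spec K B. r x \<notin> x}"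
 shows "\<exists>a\<in>L. \<forall>x\<in>Spec K B. r x \<ominus> a \<in> x"
proof -
 obtain a where a: "a \<in> L" "!!x. x \<in> Spec K B ==> r x \<notin> x ==> r x \<ominus> a \<in> x"
  "!!x. x \<in> Spec K B ==> r x \<in> x ==> a \<in> x" using finite_principal_parts[OF dim fin, of r] r by auto
 have "r x \<ominus> a \<in> x" if x: "x \<in> Spec K B" for x
 proof (cases "r x \<in> x")
  case True
  thus ?thesis using a(3) x loc_minus unfolding Spec_eq by blast
 qed (use a x in blast)
 thus ?thesis using a by blast
qed

end

section \<open>Affine curves with two points at infinity\<close>

context place
begin

lemma F_subspace: "subspace (F n)" unfolding subspace_def using F_carr F_zero F_add F_cst_mult by (meson subsetI)

lemma F_codim: "codim_le_1 (F (n + 1)) (F n)" unfolding codim_le_1_def using F_mono[of _ "n + 1" n] F_residue by auto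

end

text \<open>The unit \<open>l\<close> has divisor \<open>n (V - W)\<close> with \<open>n > 0\<close>. The inequality \<open>v b + w b \<le> 0\<close> is the part of the
 degree formula for principal divisors that concerns the points at infinity of a function which is
 regular on the affine curve.\<close>
locale two_places = affine_ring K cst B + V: place K cst B v + W: place K cst B w
 for K (structure) and cst and B and v and w +
 fixes l :: 'a
 assumes v_plus_w: "b \<in> B ==> b ~= \<zero> ==> v b + w b \<le> 0"
  and l_B [simp]: "l \<in> B" and l_nonzero [simp]: "l ~= \<zero>" and inv_l_B [simp]: "inv l \<in> B"
  and v_l_pos: "0 < v l"
begin

declare B_mult [simp] B_add [simp] B_minus [simp] B_uminus [simp]

lemma inv_l_nonzero [simp]: "inv l ~= \<zero>" by simp

lemma w_l: "w l = - v l" using v_plus_w[OF l_B] v_plus_w[OF inv_l_B] V.v_inv[of l] W.v_inv[of l] by simp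

lemma swap: "two_places K cst B w v (inv l)"
proof (intro two_places.intro two_places_axioms.intro)
 show "affine_ring K cst B" "place K cst B w" "place K cst B v" by unfold_locales
 show "w b + v b \<le> 0" if "b \<in> B" "b ~= \<zero>" for b using v_plus_w[OF that] by simp
 show "inv (inv l) \<in> B" by simp
 show "0 < w (inv l)" using w_l W.v_inv[of l] v_l_pos by simp
qed simp_all

text \<open>Multiplication by powers of \<open>l\<close> moves poles from one place to the other without changing \<open>v + w\<close>, so it
 suffices to choose \<open>b\<close> for one period of values.\<close>
lemma exact_bounded: "\<exists>C. \<forall>n. \<exists>b\<in>B. b ~= \<zero> \<and> v b = n \<and> - n - C \<le> w b"
proof -
 have "\<forall>n. \<exists>b. b \<in> B \<and> b ~= \<zero> \<and> v b = n" using V.v_surj by blast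
 then obtain e where e: "!!n. e n \<in> B" "!!n. e n ~= \<zero>" "!!n. v (e n) = n" by metis
 have "\<exists>C. \<forall>i\<in>{0..<v l}. - i - w (e i) \<le> C" using bdd_above_finite[of "(%i. - i - w (e i)) ` {0..<v l}"] by (auto simp: bdd_above_def)
 then obtain C where C: "!!i. 0 \<le> i ==> i < v l ==> - i - w (e i) \<le> C" by (meson atLeastLessThan_iff)
 define P where "P n \<longleftrightarrow> (\<exists>b\<in>B. b ~= \<zero> \<and> v b = n \<and> - n - C \<le> w b)" for n
 have shift: "P (n + v u)" if "P n" "u \<in> B" "u ~= \<zero>" "w u = - v u" for n u
 proof -
  obtain b where b: "b \<in> B" "b ~= \<zero>" "v b = n" "- n - C \<le> w b" using \<open>P n\<close> unfolding P_def by blast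
  hence "v (b \<otimes> u) = n + v u" "w (b \<otimes> u) = w b - v u" using that V.v_mult[of b u] W.v_mult[of b u] by simp_all
  thus ?thesis unfolding P_def using b that by (intro bexI[of _ "b \<otimes> u"]) auto
 qed
 have up: "P (n + v l)" if "P n" for n using shift[OF that, of l] w_l by simp
 have down: "P (n - v l)" if "P n" for n using shift[OF that, of "inv l"] w_l V.v_inv[of l] W.v_inv[of l] by simp
 have *: "P (i + v l * q)" if "0 \<le> i" "i < v l" for i q
 proof (induct q rule: int_induct[of _ 0])
  case base
  show ?case unfolding P_def using e C[OF that] by (intro bexI[of _ "e i"]) (auto simp: algebra_simps)
 next
  case (step1 q) thus ?case using up[of "i + v l * q"] by (simp add: algebra_simps)
 next
  case (step2 q) thus ?case using down[of "i + v l * q"] by (simp add: algebra_simps)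
 qed
 have "P n" for n using *[of "n mod v l" "n div v l"] v_l_pos by simp
 thus ?thesis unfolding P_def by blast
qed

lemma exact_bounded': "\<exists>C. \<forall>n. \<exists>b\<in>B. b ~= \<zero> \<and> w b = n \<and> - n - C \<le> v b" using two_places.exact_bounded[OF swap] .

text \<open>The multiples \<open>d b\<^sub>1\<close> have every sufficiently negative order at \<open>W\<close> and are regular at \<open>V\<close>; they remove
 the pole at \<open>W\<close> down to a bounded order without spoiling the order at \<open>V\<close>.\<close>
lemma reduce_w:
 assumes d: "d \<in> B" "d ~= \<zero>"
 shows "\<exists>n. \<forall>m\<le>0. \<forall>b\<in>B. b \<in> V.F m \<longrightarrow> (\<exists>b'\<in>B. b \<ominus> d \<otimes> b' \<in> V.F m \<and> b \<ominus> d \<otimes> b' \<in> W.F n)"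
proof -
 obtain C where C: "!!n. \<exists>b\<in>B. b ~= \<zero> \<and> w b = n \<and> - n - C \<le> v b" using exact_bounded' by blast
 \<comment> \<open>Below this bound the multiplier b1 is so singular at W that d b1 is regular at V.\<close>
 define n where "n = v d + w d - C"
 have *: "\<exists>b'\<in>B. b \<ominus> d \<otimes> b' \<in> V.F m \<and> b \<ominus> d \<otimes> b' \<in> W.F n"
  if "m \<le> 0" "b \<in> B" "b \<in> V.F m" "b \<in> W.F k" for b m k using that
 proof (induct "nat (n - k)" arbitrary: b k)
  case 0
  hence "b \<ominus> d \<otimes> \<zero> = b" using d by (simp add: a_minus_def)
  moreover have "b \<in> W.F n" using W.F_mono[OF 0(5), of n] 0(1) by simp
  ultimately show ?case using 0 by (intro bexI[of _ \<zero>]) auto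
 next
  case (Suc j)
  have k: "k < n" "j = nat (n - (k + 1))" using Suc(2) by linarith+
  obtain b1 where b1: "b1 \<in> B" "b1 ~= \<zero>" "w b1 = k - w d" "- (k - w d) - C \<le> v b1" using C by blast
  have db: "d \<otimes> b1 \<in> B" "d \<otimes> b1 ~= \<zero>" using d b1 by auto
  have "w (d \<otimes> b1) = k" "0 \<le> v (d \<otimes> b1)" using b1 d k V.v_mult[of d b1] W.v_mult[of d b1] unfolding n_def by simp_all
  hence dF: "d \<otimes> b1 \<in> W.F k" "d \<otimes> b1 \<notin> W.F (k + 1)" "d \<otimes> b1 \<in> V.F m"
   using Suc(3) W.F_v[OF B_L[OF db(1)] db(2)] V.F_v[OF B_L[OF db(1)] db(2)] by simp_all
  obtain c where c: "b \<ominus> cst c \<otimes> (d \<otimes> b1) \<in> W.F (k + 1)" using W.F_residue[OF Suc(6) dF(1,2)] by blast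
  let ?b = "b \<ominus> cst c \<otimes> (d \<otimes> b1)"
  have "?b \<in> B" using Suc(4) db(1) by simp
  moreover have "?b \<in> V.F m" using Suc(5) dF(3) by (intro V.F_minus V.F_cst_mult)
  ultimately obtain b2 where b2: "b2 \<in> B" "?b \<ominus> d \<otimes> b2 \<in> V.F m" "?b \<ominus> d \<otimes> b2 \<in> W.F n" using Suc(1)[OF k(2) Suc(3) _ _ c] by blast
  have "?b \<ominus> d \<otimes> b2 = b \<ominus> d \<otimes> (cst c \<otimes> b1 \<oplus> b2)" using Suc(4) d(1) b1(1) b2(1) B_carr cst_closed by algebra
  moreover have "cst c \<otimes> b1 \<oplus> b2 \<in> B" using b1(1) b2(1) by blast
  ultimately show ?case using b2 by metis
 qed
 have "\<exists>k. b \<in> W.F k" if "b \<in> B" for b using that W.F_I[of b "w b"] by auto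
 thus ?thesis using * by blast
qed

text \<open>Modulo \<open>d\<close> an element of \<open>B\<close> can be reduced to bounded pole order at both places. The space of functions
 with such poles is finite dimensional, as is seen by filtering it by the order at \<open>W\<close>: when this order
 exceeds the bound on the poles at \<open>V\<close>, only \<open>0\<close> is left.\<close>
lemma one_dim: one_dimensional unfolding one_dimensional_def
proof (intro ballI impI)
 fix d assume d: "d \<in> B" "d ~= \<zero>"
 obtain n0 where n0: "!!m b. m \<le> 0 ==> b \<in> B ==> b \<in> V.F m ==>
   \<exists>b'\<in>B. b \<ominus> d \<otimes> b' \<in> V.F m \<and> b \<ominus> d \<otimes> b' \<in> W.F n0" using reduce_w[OF d] by blast
 obtain m where m: "!!n b. n \<le> 0 ==> b \<in> B ==> b \<in> W.F n ==>
   \<exists>b'\<in>B. b \<ominus> d \<otimes> b' \<in> W.F n \<and> b \<ominus> d \<otimes> b' \<in> V.F m" using two_places.reduce_w[OF swap d] by blast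
 define n where "n = min 0 n0"
 have red: "\<exists>b'\<in>B. b \<ominus> d \<otimes> b' \<in> V.F m \<and> b \<ominus> d \<otimes> b' \<in> W.F n" if b: "b \<in> B" for b
 proof -
  have "\<exists>k\<le>0. b \<in> V.F k" using V.F_I[of b "min 0 (v b)"] b by (intro exI[of _ "min 0 (v b)"]) auto
  then obtain k where "k \<le> 0" "b \<in> V.F k" by blast
  then obtain b1 where b1: "b1 \<in> B" "b \<ominus> d \<otimes> b1 \<in> W.F n0" using n0 b by blast
  hence "b \<ominus> d \<otimes> b1 \<in> W.F n" using W.F_mono unfolding n_def by auto
  moreover have "b \<ominus> d \<otimes> b1 \<in> B" using b d b1 by blast
  ultimately obtain b2 where b2: "b2 \<in> B" "(b \<ominus> d \<otimes> b1) \<ominus> d \<otimes> b2 \<in> W.F n" "(b \<ominus> d \<otimes> b1) \<ominus> d \<otimes> b2 \<in> V.F m"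
   using m[of n "b \<ominus> d \<otimes> b1"] unfolding n_def by auto
  have "(b \<ominus> d \<otimes> b1) \<ominus> d \<otimes> b2 = b \<ominus> d \<otimes> (b1 \<oplus> b2)" using b d(1) b1(1) b2(1) B_carr by algebra
  thus ?thesis using b1 b2 B_add by metis
 qed
 \<comment> \<open>Functions that modulo d have bounded pole at V and order at least n + i at W.\<close>
 define S where "S i = {b \<in> B. \<exists>b'\<in>principal d. b \<ominus> b' \<in> V.F m \<inter> W.F (n + int i)}" for i :: nat
 define N where "N = nat (1 - m - n)"
 have P: "subspace (principal d)" by (rule ideal_subspace[OF principal_ideal[OF d(1)]])
 have B: "subspace B" by (rule ideal_subspace) (auto simp: ideal_of_B_def)
 have "S 0 = B" unfolding S_def principal_def using red by auto
 moreover have "S N = principal d"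
 proof (intro equalityI subsetI)
  fix b assume "b \<in> S N"
  then obtain b' where b: "b \<in> B" "b' \<in> principal d" "b \<ominus> b' \<in> V.F m" "b \<ominus> b' \<in> W.F (n + int N)" unfolding S_def by blast
  have b'B: "b' \<in> B" using b(2) d(1) unfolding principal_def by blast
  have "b \<ominus> b' = \<zero>"
  proof (rule ccontr)
   assume nz: "b \<ominus> b' ~= \<zero>"
   show False using v_plus_w[OF B_minus[OF b(1) b'B] nz] V.F_D[OF b(3) nz] W.F_D[OF b(4) nz] unfolding N_def by linarith
  qed
  hence "b = b'" using b(1) b'B by simp
  thus "b \<in> principal d" using b(2) by simp
 next
  fix b assume b: "b \<in> principal d"
  hence "b \<in> B" using d(1) unfolding principal_def by blast
  moreover from this have "b \<ominus> b = \<zero>" by (simp add: a_minus_def r_neg)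
  hence "b \<ominus> b \<in> V.F m \<inter> W.F (n + int N)" by simp
  ultimately show "b \<in> S N" unfolding S_def using b by blast
 qed
 moreover have "subspace (S i)" for i unfolding S_def by (intro subspace_mod subspace_Int B P V.F_subspace W.F_subspace)
 moreover have "codim_le_1 (S (Suc i)) (S i)" for i
 proof -
  have e: "n + int (Suc i) = n + int i + 1" by simp
  show ?thesis unfolding S_def e by (intro codim_mod codim_Int B P V.F_subspace W.F_codim)
 qed
 ultimately show "finite_codim (principal d) B" unfolding finite_codim_def by blast
qed

lemma algebraic_mod:
 assumes "d \<in> B" "d ~= \<zero>" "u \<in> B"
 shows "\<exists>p. p ~= 0 \<and> (\<exists>b\<in>B. eval_at u p = d \<otimes> b)"
proof -
 have "finite_codim (principal d) B" using one_dim assms(1,2) unfolding one_dimensional_def by blast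
 then obtain p where "p ~= 0" "eval_at u p \<in> principal d" using finite_codim_algebraic[OF _ assms(3)] by blast
 thus ?thesis unfolding principal_def by blast
qed

text \<open>If \<open>0\<close> were a maximal ideal, then \<open>B\<close> would be a field. But \<open>l - 1\<close> has order \<open>0\<close> at one place and a
 pole at the other, so that the inverse would violate \<open>v + w \<le> 0\<close>.\<close>
lemma max_id_nonzero: assumes M: "max_id M" shows "\<exists>d\<in>M. d ~= \<zero>"
proof (rule ccontr)
 assume "\<not> (\<exists>d\<in>M. d ~= \<zero>)"
 hence M0: "M = {\<zero>}" using max_id_D(2)[OF M] by blast
 have l1: "l \<ominus> \<one> \<in> B" by (intro B_minus) auto
 have "l \<ominus> \<one> ~= \<zero>" using v_l_pos by auto
 then obtain c where c: "c \<in> B" "\<one> \<ominus> (l \<ominus> \<one>) \<otimes> c = \<zero>" using max_id_inverse[OF M l1] M0 by auto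
 have "(l \<ominus> \<one>) \<otimes> c = \<one>" using c l1 by simp
 hence c0: "c ~= \<zero>" using l1 by auto
 have lF: "l \<in> V.F 1" "\<one> \<in> V.F 0" "\<one> \<notin> V.F 1" 
  using v_l_pos V.F_v[OF B_L[OF l_B] l_nonzero] V.F_v[OF B_L[OF B_one] one_not_zero] by simp_all
 have v: "v (l \<ominus> \<one>) = 0"
 proof -
  have "l \<ominus> \<one> \<in> V.F 0" using V.F_minus[OF V.F_mono[OF lF(1)] lF(2)] by simp
  moreover have "l \<ominus> \<one> \<notin> V.F 1"
  proof
   assume "l \<ominus> \<one> \<in> V.F 1"
   hence "l \<ominus> (l \<ominus> \<one>) \<in> V.F 1" using V.F_minus[OF lF(1)] by blast
   moreover have "l \<ominus> (l \<ominus> \<one>) = \<one>" using B_carr[OF l_B] one_closed by algebra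
   ultimately show False using lF(3) by simp
  qed
  ultimately show ?thesis using V.F_exact[of "l \<ominus> \<one>" 0] by simp
 qed
 have w: "w (l \<ominus> \<one>) \<le> - 1"
 proof (rule ccontr)
  assume "\<not> w (l \<ominus> \<one>) \<le> - 1"
  hence "l \<ominus> \<one> \<in> W.F 0" using l1 by (intro W.F_I) auto
  hence "(l \<ominus> \<one>) \<oplus> \<one> \<in> W.F 0" using W.F_cst[of 1] W.F_add by auto
  moreover have "(l \<ominus> \<one>) \<oplus> \<one> = l" using B_carr[OF l_B] one_closed by algebra
  ultimately have "l \<in> W.F 0" by simp
  thus False using w_l v_l_pos W.F_D[of l 0] by auto
 qed
 have "v (l \<ominus> \<one>) + v c = 0" "w (l \<ominus> \<one>) + w c = 0" using V.v_mult[of "l \<ominus> \<one>" c] W.v_mult[of "l \<ominus> \<one>" c] l1 c(1) c0 \<open>l \<ominus> \<one> ~= \<zero>\<close>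
   \<open>(l \<ominus> \<one>) \<otimes> c = \<one>\<close> by auto
 thus False using v w v_plus_w[OF c(1) c0] by linarith
qed

lemma residue_field: assumes M: "max_id M" and u: "u \<in> B" shows "\<exists>c. u \<ominus> cst c \<in> M"
proof -
 obtain d where d: "d \<in> M" "d ~= \<zero>" using max_id_nonzero[OF M] by blast
 hence dB: "d \<in> B" using max_id_D(1)[OF M] by blast
 obtain p b where p: "p ~= 0" "b \<in> B" "eval_at u p = d \<otimes> b" using algebraic_mod[OF dB d(2) u] by blast
 have "eval_at u p \<in> M" unfolding p(3) using max_id_D(4)[OF M d(1) p(2)] .
 thus ?thesis by (rule eval_at_prime_ideal[OF M u p(1)])
qed

end

context field_over_complex
begin

lemma finsum_subspace:
 assumes "subspace S" "finite I" "!!i. i \<in> I ==> y i \<in> S"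
 shows "(\<Oplus>i\<in>I. y i) \<in> S" using assms(2,3)
proof (induct I)
 case empty thus ?case using subspace_D(2)[OF assms(1)] by simp
next
 case (insert i I)
 have "y \<in> insert i I \<rightarrow> carrier K" using insert(4) subspace_D(1)[OF assms(1)] by blast
 thus ?case using insert subspace_D(3)[OF assms(1)] by (simp add: finsum_insert Pi_iff)
qed

lemma finsum_combination_diff:
 assumes "finite I" "!!i. i \<in> I ==> y i \<in> carrier K" "!!i. i \<in> I ==> z i \<in> carrier K"
 shows "(\<Oplus>i\<in>I. cst (c i) \<otimes> (y i \<ominus> z i)) = (\<Oplus>i\<in>I. cst (c i) \<otimes> y i) \<ominus> (\<Oplus>i\<in>I. cst (c i) \<otimes> z i)" using assms
proof (induct I)
 case empty thus ?case by (simp add: a_minus_def)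
next
 case (insert i I)
 define Y Z where "Y = (\<Oplus>i\<in>I. cst (c i) \<otimes> y i)" and "Z = (\<Oplus>i\<in>I. cst (c i) \<otimes> z i)"
 have c: "Y \<in> carrier K" "Z \<in> carrier K" "y i \<in> carrier K" "z i \<in> carrier K"
  unfolding Y_def Z_def using insert by (auto intro!: finsum_closed)
 have "(\<Oplus>i\<in>insert i I. cst (c i) \<otimes> (y i \<ominus> z i)) = cst (c i) \<otimes> (y i \<ominus> z i) \<oplus> (Y \<ominus> Z)"
  unfolding Y_def Z_def using insert by (subst finsum_insert) auto
 also have "\<dots> = (cst (c i) \<otimes> y i \<oplus> Y) \<ominus> (cst (c i) \<otimes> z i \<oplus> Z)" using c cst_closed by algebra
 also have "\<dots> = (\<Oplus>i\<in>insert i I. cst (c i) \<otimes> y i) \<ominus> (\<Oplus>i\<in>insert i I. cst (c i) \<otimes> z i)"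
  unfolding Y_def Z_def using insert by (subst (1 2) finsum_insert) auto
 finally show ?case .
qed

lemma finsum_multiples:
 assumes "finite I" "z \<in> carrier K"
 shows "(\<Oplus>i\<in>I. cst (c i) \<otimes> (cst (e i) \<otimes> z)) = cst (\<Sum>i\<in>I. c i * e i) \<otimes> z" using assms(1)
proof (induct I)
 case (insert i I)
 thus ?case using assms(2) by (subst finsum_insert) (auto simp: cst_add cst_mult l_distr m_assoc)
qed (use assms in simp)

text \<open>Linear algebra for a chain of subspaces: more elements than proper steps are dependent modulo the first
 member.\<close>
lemma dependent_in_chain:
 fixes S :: "nat => 'a set"
 assumes sub: "!!i. subspace (S i)"
  and gap: "!!i. i \<in> G ==> codim_le_1 (S i) (S (Suc i))"
  and nogap: "!!i. i \<notin> G ==> S (Suc i) \<subseteq> S i"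
  and "finite I" "!!i. i \<in> I ==> y i \<in> S N" "card (G \<inter> {..<N}) < card I"
 shows "\<exists>c. (\<exists>i\<in>I. c i ~= 0) \<and> (\<Oplus>i\<in>I. cst (c i) \<otimes> y i) \<in> S 0" using assms(4-6)
proof (induct N arbitrary: I y)
 case 0
 hence "I ~= {}" by auto
 moreover have "(\<Oplus>i\<in>I. cst 1 \<otimes> y i) \<in> S 0" by (intro finsum_subspace[OF sub] subspace_D(4)[OF sub] 0)
 ultimately show ?case by (intro exI[of _ "%_. 1"]) auto
next
 case (Suc N)
 have mono: "card (G \<inter> {..<N}) \<le> card (G \<inter> {..<Suc N})" by (intro card_mono) auto
 show ?case
 proof (cases "\<forall>i\<in>I. y i \<in> S N")
  case True
  thus ?thesis using Suc(1)[of I y] Suc(2,4) mono by auto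
 next
  case False
  then obtain j where j: "j \<in> I" "y j \<notin> S N" by blast
  hence NG: "N \<in> G" using nogap[of N] Suc(3) by blast
  have "\<forall>i\<in>I - {j}. \<exists>e. y i \<ominus> cst e \<otimes> y j \<in> S N" using gap[OF NG] Suc(3) j unfolding codim_le_1_def by blast
  then obtain e where e: "!!i. i \<in> I - {j} ==> y i \<ominus> cst (e i) \<otimes> y j \<in> S N" by metis
  have "G \<inter> {..<Suc N} = insert N (G \<inter> {..<N})" using NG by auto
  hence "card (G \<inter> {..<N}) < card (I - {j})" using Suc(2,4) j(1) by (simp add: card_Diff_singleton)
  then obtain c where c: "\<exists>i\<in>I - {j}. c i ~= 0"
   "(\<Oplus>i\<in>I - {j}. cst (c i) \<otimes> (y i \<ominus> cst (e i) \<otimes> y j)) \<in> S 0" using Suc(1)[of "I - {j}" "%i. y i \<ominus> cst (e i) \<otimes> y j"] Suc(2) e by blast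
  define s where "s = (\<Sum>i\<in>I - {j}. c i * e i)"
  define c' where "c' = c(j := - s)"
  have yc: "!!i. i \<in> I ==> y i \<in> carrier K" using Suc(3) subspace_D(1)[OF sub] by blast
  define Y where "Y = (\<Oplus>i\<in>I - {j}. cst (c i) \<otimes> y i)"
  have Yc: "Y \<in> carrier K" unfolding Y_def using yc by (intro finsum_closed) auto
  have "(\<Oplus>i\<in>I - {j}. cst (c i) \<otimes> (y i \<ominus> cst (e i) \<otimes> y j)) = Y \<ominus> cst s \<otimes> y j" unfolding Y_def s_def using Suc(2) yc j(1)
   by (subst finsum_combination_diff) (auto simp: finsum_multiples)
  moreover have "(\<Oplus>i\<in>I. cst (c' i) \<otimes> y i) = cst (- s) \<otimes> y j \<oplus> Y"
  proof -
   have I: "I = insert j (I - {j})" using j by blast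
   have "(\<Oplus>i\<in>insert j (I - {j}). cst (c' i) \<otimes> y i)
     = cst (c' j) \<otimes> y j \<oplus> (\<Oplus>i\<in>I - {j}. cst (c' i) \<otimes> y i)" using Suc(2) yc j by (intro finsum_insert) auto
   moreover have "(\<Oplus>i\<in>I - {j}. cst (c' i) \<otimes> y i) = Y" unfolding Y_def c'_def using yc by (intro finsum_cong') auto
   ultimately show ?thesis using I unfolding c'_def by simp
  qed
  moreover have "cst (- s) \<otimes> y j \<oplus> Y = Y \<ominus> cst s \<otimes> y j" using Yc yc[OF j(1)] by (simp add: cst_uminus l_minus a_minus_def add.m_comm)
  ultimately have "(\<Oplus>i\<in>I. cst (c' i) \<otimes> y i) \<in> S 0" using c(2) by simp
  moreover have "\<exists>i\<in>I. c' i ~= 0" using c(1) unfolding c'_def by auto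
  ultimately show ?thesis by blast
 qed
qed

end

context affine_ring
begin

lemma dvr_valuation:
 assumes Z: "discrete_valuation_ring K (range cst) L Z"
 obtains G u where
  "!!x m. x \<in> G m \<longleftrightarrow> x \<in> L \<and> (x = \<zero> \<or> (m::int) \<le> u x)" "Z = G 0" "!!m. subspace (G m)"
  "!!x y m n. x \<in> G m ==> y \<in> G n ==> x \<otimes> y \<in> G (m + n)"
  "!!x y. x \<in> L ==> y \<in> L ==> x ~= \<zero> ==> y ~= \<zero> ==> u (x \<otimes> y) = u x + u y"
  "!!c. c ~= 0 ==> u (cst c) = 0"
proof -
 obtain u :: "'a => int" where k: "range cst \<subseteq> Z"
  and um: "!!a b. a \<in> L - {\<zero>} ==> b \<in> L - {\<zero>} ==> u (a \<otimes> b) = u a + u b"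
  and ua: "!!a b. a \<in> L - {\<zero>} ==> b \<in> L - {\<zero>} ==> a \<oplus> b ~= \<zero> ==> min (u a) (u b) \<le> u (a \<oplus> b)"
  and Z: "Z = {a \<in> L. a = \<zero> \<or> 0 \<le> u a}" using Z unfolding discrete_valuation_ring_def by blast
 define G where "G m = {x \<in> L. x = \<zero> \<or> m \<le> u x}" for m
 have Gm: "x \<otimes> y \<in> G (m + n)" if "x \<in> G m" "y \<in> G n" for x y m n
 proof (cases "x = \<zero> \<or> y = \<zero>")
  case True
  hence "x \<otimes> y = \<zero>" using that unfolding G_def by auto
  thus ?thesis unfolding G_def by simp
 next
  case False
  hence "m \<le> u x" "n \<le> u y" "x \<in> L" "y \<in> L" using that unfolding G_def by auto
  thus ?thesis using um[of x y] False L_mult[of x y] unfolding G_def by simp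
 qed
 have uk: "u (cst c) = 0" if "c ~= 0" for c
 proof -
  have "0 \<le> u (cst c)" if "c ~= 0" for c
  proof -
   have "cst c \<in> Z" using k by blast
   hence "cst c = \<zero> \<or> 0 \<le> u (cst c)" unfolding Z by blast
   thus ?thesis using \<open>c ~= 0\<close> by simp
  qed
  moreover have "u (cst 1) = u (cst c) + u (cst (inverse c))"
   using um[of "cst c" "cst (inverse c)"] that B_L[OF cst_B] by (simp flip: cst_mult)
  moreover have "u (cst 1) = u (cst 1) + u (cst 1)" using um[of "cst 1" "cst 1"] B_L[OF cst_B[of 1]] by simp
  ultimately show ?thesis using that by (smt (verit) inverse_nonzero_iff_nonzero)
 qed
 have Gs: "subspace (G m)" for m unfolding subspace_def
 proof (intro conjI ballI allI)
  show "G m \<subseteq> carrier K" unfolding G_def by auto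
  show "\<zero> \<in> G m" unfolding G_def by simp
  fix x assume x: "x \<in> G m"
  have "cst c \<in> G 0" for c using uk[of c] unfolding G_def by (cases "c = 0") auto
  thus "cst c \<otimes> x \<in> G m" for c using Gm[of "cst c" 0 x m] x by simp
  fix y assume y: "y \<in> G m"
  show "x \<oplus> y \<in> G m"
  proof (cases "x = \<zero> \<or> y = \<zero> \<or> x \<oplus> y = \<zero>")
   case True
   thus ?thesis using x y unfolding G_def by auto
  next
   case False
   thus ?thesis using x y ua[of x y] L_add[of x y] unfolding G_def by auto
  qed
 qed
 show ?thesis
 proof
  show "x \<in> G m \<longleftrightarrow> x \<in> L \<and> (x = \<zero> \<or> m \<le> u x)" for x m unfolding G_def by simp
  show "Z = G 0" unfolding G_def Z ..
 qed (use Gs Gm um uk in auto)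
qed

end

context two_places
begin

text \<open>The functions in \<open>B\<close> that are regular at \<open>V\<close> form a finitely generated module over \<open>\<complex>[l]\<close>. The
 conclusion is stated as a principle of induction, since it is applied with \<open>S\<close> a member of the
 filtration of another valuation.\<close>
lemma nonneg_part_generated:
 "\<exists>E. finite E \<and> E \<subseteq> B \<and> (\<forall>S. subspace S \<longrightarrow> E \<subseteq> S \<longrightarrow> (\<forall>x\<in>S. l \<otimes> x \<in> S) \<longrightarrow>
   (\<forall>b\<in>B. b \<in> V.F 0 \<longrightarrow> b \<in> S))"
proof -
 obtain C where C: "!!n. \<exists>b\<in>B. b ~= \<zero> \<and> w b = n \<and> - n - C \<le> v b" using exact_bounded' by blast
 \<comment> \<open>Up to n0 every order at W is taken by a function regular at V; finitely many orders lie above.\<close>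
 define n0 where "n0 = min 0 (- C)"
 define P where "P n b \<longleftrightarrow> b \<in> B \<and> b ~= \<zero> \<and> 0 \<le> v b \<and> w b = n" for n b
 define e where "e n = (if \<exists>b. P n b then SOME b. P n b else \<zero>)" for n
 have e: "P n (e n)" if "P n b" for n b using that someI[of "P n" b] unfolding e_def by auto
 have eB: "e n \<in> B" for n
 proof (cases "\<exists>b. P n b")
  case True thus ?thesis using e unfolding P_def by blast
 qed (simp add: e_def)
 define E where "E = e ` {n0 - v l..0}"
 have main: "b \<in> S"
  if S: "subspace S" "E \<subseteq> S" "!!x. x \<in> S ==> l \<otimes> x \<in> S" and b: "b \<in> B" "b \<in> V.F 0" for S b
 proof -
  have mult: "\<exists>x. x \<in> S \<and> P n x" if n: "P n b" for n b
  proof -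
   have nonpos: "n \<le> 0" using n v_plus_w[of b] unfolding P_def by auto
   have *: "\<exists>x. x \<in> S \<and> P m x" if "n \<le> m" "m \<le> n0" for m using that
   proof (induct "nat (n0 - m)" arbitrary: m rule: less_induct)
    case less
    show ?case
    proof (cases "n0 - v l \<le> m")
     case True
     obtain b where "b \<in> B" "b ~= \<zero>" "w b = m" "- m - C \<le> v b" using C by blast
     hence "P m b" using less(3) unfolding P_def n0_def by auto
     hence "P m (e m)" by (rule e)
     moreover have "e m \<in> S" using True less(3) S(2) unfolding E_def n0_def by auto
     ultimately show ?thesis by blast
    next
     case False
     then obtain x where x: "x \<in> S" "P (m + v l) x" using less(1)[of "m + v l"] less(2) v_l_pos by auto
     hence "v (l \<otimes> x) = v l + v x" "w (l \<otimes> x) = w l + w x" using V.v_mult[of l x] W.v_mult[of l x] unfolding P_def by auto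
     moreover have "l \<otimes> x \<in> B" "l \<otimes> x ~= \<zero>" using x unfolding P_def by auto
     ultimately have "P m (l \<otimes> x)" using x v_l_pos w_l unfolding P_def by simp
     thus ?thesis using S(3) x by blast
    qed
   qed
   show ?thesis
   proof (cases "n \<le> n0")
    case True thus ?thesis using * by blast
   next
    case False
    hence "e n \<in> S" using nonpos S(2) v_l_pos unfolding E_def by auto
    thus ?thesis using e[OF n] by blast
   qed
  qed
  have "b \<in> S" if "b \<in> B" "b \<in> V.F 0" "b \<in> W.F k" for b k using that
  proof (induct "nat (1 - k)" arbitrary: b k)
   case 0
   have "b = \<zero>"
   proof (rule ccontr)
    assume "b ~= \<zero>"
    thus False using v_plus_w[of b] 0 V.F_D[OF 0(3)] W.F_D[OF 0(4)] by auto
   qed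
   thus ?case using subspace_D(2)[OF S(1)] by simp
  next
   case (Suc j)
   have j: "j = nat (1 - (k + 1))" using Suc(2) by linarith
   show ?case
   proof (cases "b \<in> W.F (k + 1)")
    case True thus ?thesis using Suc(1)[OF j] Suc by blast
   next
    case False
    hence "b ~= \<zero>" "w b = k" using W.F_exact[OF Suc(5)] by auto
    hence "P k b" using Suc(3) V.F_D[OF Suc(4)] unfolding P_def by auto
    then obtain x where x: "x \<in> S" "x \<in> B" "x ~= \<zero>" "0 \<le> v x" "w x = k" using mult unfolding P_def by blast
    hence xF: "x \<in> W.F k" "x \<notin> W.F (k + 1)" "x \<in> V.F 0" using W.F_v[OF B_L[OF x(2)] x(3)] V.F_v[OF B_L[OF x(2)] x(3)] by simp_all
    obtain c where c: "b \<ominus> cst c \<otimes> x \<in> W.F (k + 1)" using W.F_residue[OF Suc(5) xF(1,2)] by blast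
    have "b \<ominus> cst c \<otimes> x \<in> B" using Suc(3) x(2) by simp
    hence "b \<ominus> cst c \<otimes> x \<in> S" using Suc(1)[OF j _ V.F_minus[OF Suc(4) V.F_cst_mult[OF xF(3)]] c] by blast
    hence "(b \<ominus> cst c \<otimes> x) \<oplus> cst c \<otimes> x \<in> S" using subspace_D(3)[OF S(1)] subspace_D(4)[OF S(1) x(1)] by blast
    moreover have "(b \<ominus> cst c \<otimes> x) \<oplus> cst c \<otimes> x = b" using Suc(3) x(2) B_carr cst_closed by algebra
    ultimately show ?thesis by simp
   qed
  qed
  moreover have "b \<in> W.F (if b = \<zero> then 0 else w b)" using W.F_I[of b "w b"] b by simp
  ultimately show ?thesis using b by blast
 qed
 show ?thesis
 proof (intro exI[of _ E] conjI allI impI ballI)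
  show "finite E" "E \<subseteq> B" unfolding E_def using eB by auto
  show "b \<in> S" if "subspace S" "E \<subseteq> S" "\<forall>x\<in>S. l \<otimes> x \<in> S" "b \<in> B" "b \<in> V.F 0" for S b by (rule main[OF that(1,2)]) (use that in auto)
 qed
qed

text \<open>Some nonzero polynomial in \<open>l\<close> is divisible by \<open>d\<close>; after division by a power of the unit \<open>l\<close> its
 constant term does not vanish.\<close>
lemma algebraic_mod_unit:
 assumes d: "d \<in> B" "d ~= \<zero>"
 shows "\<exists>a q b. a ~= 0 \<and> b \<in> B \<and> cst a \<oplus> l \<otimes> eval_at l q = d \<otimes> b"
proof -
 have lc: "l \<in> carrier K" by simp
 obtain p b where "p ~= 0" "b \<in> B" "eval_at l p = d \<otimes> b" using algebraic_mod[OF d l_B] by blast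
 thus ?thesis
 proof (induct p arbitrary: b)
  case (pCons a p)
  show ?case
  proof (cases "a = 0")
   case False
   thus ?thesis using pCons lc by auto
  next
   case True
   hence p0: "p ~= 0" using pCons(1) by auto
   have "l \<otimes> eval_at l p = d \<otimes> b" using pCons(5) True lc by simp
   hence "inv l \<otimes> (l \<otimes> eval_at l p) = inv l \<otimes> (d \<otimes> b)" by simp
   moreover have "inv l \<otimes> (l \<otimes> eval_at l p) = eval_at l p" using lc eval_at_closed[OF lc] by (simp flip: m_assoc)
   moreover have "inv l \<otimes> (d \<otimes> b) = d \<otimes> (inv l \<otimes> b)" using d pCons(4) by (simp add: m_lcomm)
   ultimately have "eval_at l p = d \<otimes> (inv l \<otimes> b)" by simp
   thus ?thesis using pCons(2)[OF p0, of "inv l \<otimes> b"] pCons(4) by simp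
  qed
 qed simp
qed

text \<open>By finite generation over \<open>\<complex>[l]\<close>, the values in \<open>Z\<close> of functions in \<open>B\<close> regular at \<open>V\<close> are bounded
 below, hence nonnegative, as powers show. A general \<open>x\<close> regular at \<open>V\<close> is multiplied by a polynomial \<open>y\<close>
 in \<open>l\<close> with nonzero constant term that clears its denominator: such \<open>y\<close> is a unit at \<open>V\<close> and in \<open>Z\<close>.\<close>
lemma dvr_positive_at_l:
 assumes Z: "discrete_valuation_ring K (range cst) L Z" and l: "l \<in> Z" "inv l \<notin> Z"
 shows "Z = V.F 0"
proof -
 obtain G u where G: "!!x m. x \<in> G m \<longleftrightarrow> x \<in> L \<and> (x = \<zero> \<or> (m::int) \<le> u x)" and Z0: "Z = G 0"
  and Gs: "!!m. subspace (G m)" and Gm: "!!x y m n. x \<in> G m ==> y \<in> G n ==> x \<otimes> y \<in> G (m + n)"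
  and um: "!!x y. x \<in> L ==> y \<in> L ==> x ~= \<zero> ==> y ~= \<zero> ==> u (x \<otimes> y) = u x + u y"
  and uk: "!!c. c ~= 0 ==> u (cst c) = 0" by (rule dvr_valuation[OF Z], rule that)
 have uinv: "u (inv x) = - u x" if "x \<in> L" "x ~= \<zero>" for x using um[of x "inv x"] that L_inv[of x] uk[of 1] by simp
 have l1: "l \<in> G 1"
 proof -
  have "\<not> 0 \<le> u (inv l)" using l(2) G[of "inv l" 0] unfolding Z0 by simp
  thus ?thesis using G[of l 1] uinv[of l] by simp
 qed
 have plus: "b \<in> Z" if b: "b \<in> B" "b \<in> V.F 0" for b
 proof (rule ccontr)
  assume "b \<notin> Z"
  hence b0: "b ~= \<zero>" "u b < 0" using G[of b 0] b unfolding Z0 by auto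
  obtain E where E: "finite E" "E \<subseteq> B"
   "!!S. subspace S ==> E \<subseteq> S ==> (\<forall>x\<in>S. l \<otimes> x \<in> S) ==> (\<forall>b\<in>B. b \<in> V.F 0 \<longrightarrow> b \<in> S)" using nonneg_part_generated by blast
  have "\<exists>m. \<forall>x\<in>E. m \<le> u x" using E(1) bdd_below_finite[of "u ` E"] by (auto simp: bdd_below_def)
  then obtain m where m: "!!x. x \<in> E ==> m \<le> u x" by blast
  have "E \<subseteq> G m" using m E(2) G by auto
  moreover have "l \<otimes> x \<in> G m" if "x \<in> G m" for x
  proof -
   have "l \<otimes> x \<in> G (1 + m)" using Gm[OF l1 that] .
   thus ?thesis using G[of "l \<otimes> x" "1 + m"] G[of "l \<otimes> x" m] by auto
  qed
  ultimately have all: "!!b. b \<in> B ==> b \<in> V.F 0 ==> b \<in> G m" using E(3)[OF Gs] by blast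
  have pow: "b [^] k \<in> V.F 0 \<and> u (b [^] k) = int k * u b \<and> b [^] k ~= \<zero>" for k :: nat
  proof (induct k)
   case 0
   show ?case using V.F_cst[of 1] uk[of 1] by simp
  next
   case (Suc k)
   have "b [^] k \<otimes> b \<in> V.F 0" using V.F_mult[of "b [^] k" 0 b 0] Suc b by simp
   moreover have "u (b [^] k \<otimes> b) = u (b [^] k) + u b" using um[of "b [^] k" b] Suc b0 b B_pow[OF b(1)] by simp
   ultimately show ?case using Suc b0 b B_pow[OF b(1)] by (simp add: algebra_simps)
  qed
  define k where "k = Suc (nat (- m))"
  have "b [^] k \<in> G m" using all[of "b [^] k"] pow B_pow[OF b(1)] by blast
  hence "m \<le> int k * u b" using G[of "b [^] k" m] pow[of k] by simp
  moreover have "int k * u b \<le> int k * (-1)" using b0 by (intro mult_left_mono) auto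
  moreover have "- m < int k" unfolding k_def by simp
   ultimately show False by linarith
 qed
 have "V.F 0 \<subseteq> Z"
 proof
  fix x assume x: "x \<in> V.F 0"
  then obtain d where d: "d \<in> B" "d ~= \<zero>" "x \<otimes> d \<in> B" using V.L_clear[of x] by auto
  obtain a q b where q: "a ~= 0" "b \<in> B" "cst a \<oplus> l \<otimes> eval_at l q = d \<otimes> b" using algebraic_mod_unit[OF d(1,2)] by blast
  define y where "y = cst a \<oplus> l \<otimes> eval_at l q"
  have evB: "eval_at l q \<in> B" using eval_at_B by simp
  have yB: "y \<in> B" unfolding y_def using evB by simp
  have lF: "l \<in> V.F 1" using V.F_v[of l 1] v_l_pos by simp
  have evF: "eval_at l q \<in> V.F 0"
  proof (induct q)
   case (pCons a q)
   have "l \<otimes> eval_at l q \<in> V.F 0" using V.F_mono[OF V.F_mult[OF lF pCons(2)], of 0] by simp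
   thus ?case using V.F_add[OF V.F_cst] by simp
  qed simp
  have yF: "y \<in> V.F 0" unfolding y_def using V.F_add[OF V.F_cst V.F_mono[OF V.F_mult[OF lF evF], of 0]] by simp
  have "d \<otimes> b \<in> V.F 0" using yF q(3) unfolding y_def by simp
  have "x \<otimes> y \<in> V.F 0" using V.F_mult[OF x yF] by simp
  moreover have "x \<otimes> y = (x \<otimes> d) \<otimes> b" unfolding y_def q(3) using x d(1) q(2) V.F_carr by (simp add: m_assoc)
  moreover have "(x \<otimes> d) \<otimes> b \<in> B" using d q by simp
  ultimately have xyZ: "x \<otimes> y \<in> Z" using plus by simp
  have "eval_at l q \<in> G 0" using plus[OF evB evF] unfolding Z0 .
  hence lev: "l \<otimes> eval_at l q \<in> G 1" using Gm[OF l1] by fastforce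
  have cstG: "cst a \<in> G 0" "cst a \<notin> G 1" using G[of "cst a"] uk[OF q(1)] q(1) B_L[OF cst_B] by auto
  have "l \<otimes> eval_at l q \<in> G 0" using lev G[of _ 1] G[of _ 0] by auto
  hence "y \<in> G 0" unfolding y_def using subspace_D(3)[OF Gs cstG(1)] by simp
  moreover have "y \<notin> G 1"
  proof
   assume "y \<in> G 1"
   hence "y \<ominus> l \<otimes> eval_at l q \<in> G 1" using subspace_D(6)[OF Gs] lev by blast
   moreover have "y \<ominus> l \<otimes> eval_at l q = cst a" unfolding y_def using B_carr[OF evB] B_carr[OF l_B] cst_closed by algebra
   ultimately show False using cstG(2) by simp
  qed
  ultimately have y: "y \<in> L" "y ~= \<zero>" "u y = 0" using G[of y] by auto
  hence "inv y \<in> G 0" using G[of "inv y" 0] uinv[of y] L_inv[of y] by auto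
  hence "(x \<otimes> y) \<otimes> inv y \<in> G 0" using Gm[of "x \<otimes> y" 0 "inv y" 0] xyZ unfolding Z0 by simp
  moreover have "(x \<otimes> y) \<otimes> inv y = x" using y x V.F_carr by (simp add: m_assoc)
  ultimately show "x \<in> Z" unfolding Z0 by simp
 qed
 thus ?thesis by (rule V.dvr_containing_F0[OF Z])
qed

text \<open>If \<open>l\<close> is a unit in \<open>Z\<close>, then the values of all elements of \<open>B\<close> are bounded below, because a power of
 \<open>l\<close> makes them regular at \<open>V\<close>. Powers show that they are nonnegative.\<close>
lemma dvr_not_containing_B:
 assumes Z: "discrete_valuation_ring K (range cst) L Z" and "l \<in> Z" "inv l \<in> Z" shows "B \<subseteq> Z"
proof -
 obtain G u where G: "!!x m. x \<in> G m \<longleftrightarrow> x \<in> L \<and> (x = \<zero> \<or> (m::int) \<le> u x)" and Z0: "Z = G 0"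
  and Gs: "!!m. subspace (G m)" and Gm: "!!x y m n. x \<in> G m ==> y \<in> G n ==> x \<otimes> y \<in> G (m + n)"
  and um: "!!x y. x \<in> L ==> y \<in> L ==> x ~= \<zero> ==> y ~= \<zero> ==> u (x \<otimes> y) = u x + u y"
  and uk: "!!c. c ~= 0 ==> u (cst c) = 0" by (rule dvr_valuation[OF Z], rule that)
 have lG: "l \<in> G 0" "inv l \<in> G 0" using assms(2,3) unfolding Z0 by auto
 obtain E where E: "finite E" "E \<subseteq> B"
  "!!S. subspace S ==> E \<subseteq> S ==> (\<forall>x\<in>S. l \<otimes> x \<in> S) ==> (\<forall>b\<in>B. b \<in> V.F 0 \<longrightarrow> b \<in> S)" using nonneg_part_generated by blast
 have "\<exists>m. \<forall>x\<in>E. m \<le> u x" using E(1) bdd_below_finite[of "u ` E"] by (auto simp: bdd_below_def)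
 then obtain m where m: "!!x. x \<in> E ==> m \<le> u x" by blast
 have "E \<subseteq> G m" using m E(2) G by auto
 moreover have "l \<otimes> x \<in> G m" if "x \<in> G m" for x using Gm[OF lG(1) that] by simp
 ultimately have plus: "!!b. b \<in> B ==> b \<in> V.F 0 ==> b \<in> G m" using E(3)[OF Gs] by blast
 have all: "b \<in> G m" if b: "b \<in> B" "b \<in> V.F k" for b k using b
 proof (induct "nat (- k)" arbitrary: b k)
  case 0
  hence "b \<in> V.F 0" using V.F_mono[of b k 0] by simp
  thus ?case using plus 0 by blast
 next
  case (Suc j)
  have lb: "l \<otimes> b \<in> V.F (k + 1)" using V.F_mono[OF V.F_mult[OF _ Suc(4), of l "v l"], of "k + 1"]
   V.F_I[of l "v l"] v_l_pos by simp
  have "j = nat (- (k + 1))" using Suc(2) by linarith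
  hence "l \<otimes> b \<in> G m" using Suc(1)[of "k + 1" "l \<otimes> b"] lb Suc(3) by simp
  hence "inv l \<otimes> (l \<otimes> b) \<in> G m" using Gm[OF lG(2)] by fastforce
  moreover have "inv l \<otimes> (l \<otimes> b) = b" using Suc(3) by (simp flip: m_assoc)
  ultimately show ?case by simp
 qed
 show ?thesis
 proof
  fix b assume b: "b \<in> B"
  show "b \<in> Z"
  proof (rule ccontr)
   assume "b \<notin> Z"
   hence b0: "b ~= \<zero>" "u b < 0" using G[of b 0] b unfolding Z0 by auto
   have pow: "u (b [^] k) = int k * u b \<and> b [^] k ~= \<zero>" for k :: nat
   proof (induct k)
    case 0
    show ?case using uk[of 1] by simp
   next
    case (Suc k)
    have "u (b [^] k \<otimes> b) = u (b [^] k) + u b" using um[of "b [^] k" b] Suc b0 b B_pow[OF b(1)] by simp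
    thus ?case using Suc b0 b B_pow[OF b(1)] by (simp add: algebra_simps)
   qed
   define k where "k = Suc (nat (- m))"
   have "b [^] k \<in> G m" using all[of "b [^] k" "v (b [^] k)"] V.F_I B_pow[OF b(1)] by simp
   hence "m \<le> int k * u b" using G[of "b [^] k" m] pow[of k] by simp
   moreover have "int k * u b \<le> int k * (-1)" using b0 by (intro mult_left_mono) auto
   moreover have "- m < int k" unfolding k_def by simp
   ultimately show False by linarith
  qed
 qed
qed

lemma points_at_infinity_eq: "points_at_infinity K (range cst) B = {V.F 0, W.F 0}"
proof (intro equalityI subsetI)
 fix Z assume "Z \<in> points_at_infinity K (range cst) B"
 hence Z: "discrete_valuation_ring K (range cst) L Z" "\<not> B \<subseteq> Z" unfolding points_at_infinity_def by auto
 hence "l \<notin> Z \<or> inv l \<notin> Z" using dvr_not_containing_B by blast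
 moreover have "l \<in> Z \<or> inv l \<in> Z"
 proof -
  obtain G u where G: "!!x m. x \<in> G m \<longleftrightarrow> x \<in> L \<and> (x = \<zero> \<or> (m::int) \<le> u x)" and Z0: "Z = G 0"
   and "!!m. subspace (G m)" "!!x y m n. x \<in> G m ==> y \<in> G n ==> x \<otimes> y \<in> G (m + n)"
   and um: "!!x y. x \<in> L ==> y \<in> L ==> x ~= \<zero> ==> y ~= \<zero> ==> u (x \<otimes> y) = u x + u y"
   and uk: "!!c. c ~= 0 ==> u (cst c) = 0" by (rule dvr_valuation[OF Z(1)], rule that)
  have "u l + u (inv l) = 0" using um[of l "inv l"] uk[of 1] by simp
  thus ?thesis using G unfolding Z0 by auto
 qed
 ultimately show "Z \<in> {V.F 0, W.F 0}" using dvr_positive_at_l[OF Z(1)] two_places.dvr_positive_at_l[OF swap Z(1)] by auto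
next
 fix Z assume "Z \<in> {V.F 0, W.F 0}"
 thus "Z \<in> points_at_infinity K (range cst) B" using V.F0_at_infinity W.F0_at_infinity by blast
qed

lemma F0_distinct: "V.F 0 ~= W.F 0"
proof
 assume "V.F 0 = W.F 0"
 moreover have "l \<in> V.F 0" using V.F_I[of l 0] v_l_pos by simp
 ultimately show False using W.F_D[of l 0] w_l v_l_pos by simp
qed

end

section \<open>The genus as a number of gaps\<close>

context affine_ring
begin

lemma loc_subspace: "max_id M ==> subspace (loc M)" unfolding subspace_def
 using loc_L[of M] B_loc[of M] loc_add[of M] loc_mult[of M] by (meson B_zero L_carr cst_B subsetI)

end

context two_places
begin

text \<open>The Weierstrass gaps at \<open>W\<close>: the pole orders that do not occur for functions regular elsewhere.\<close>
definition gaps :: "nat set" where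
 "gaps = {n. \<not> (\<exists>b\<in>B. b ~= \<zero> \<and> 0 \<le> v b \<and> w b = - int n)}"

lemma gaps_finite: "finite gaps"
proof -
 obtain C where C: "!!n. \<exists>b\<in>B. b ~= \<zero> \<and> w b = n \<and> - n - C \<le> v b" using exact_bounded' by blast
 have "gaps \<subseteq> {..nat C}"
 proof
  fix n assume n: "n \<in> gaps"
  obtain b where b: "b \<in> B" "b ~= \<zero>" "w b = - int n" "- (- int n) - C \<le> v b" using C by blast
  hence "\<not> 0 \<le> v b" using n unfolding gaps_def by blast
  thus "n \<in> {..nat C}" using b(4) by auto
 qed
 thus ?thesis using finite_subset by blast
qed

lemma zero_not_gap: "0 \<notin> gaps" unfolding gaps_def using W.v_one V.v_one B_one one_not_zero by force

abbreviation X :: "'a set set" where "X \<equiv> smooth_completion K (range cst) B"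

lemma X_eq: "X = Spec K B \<union> {V.F 0, W.F 0}" unfolding smooth_completion_def points_at_infinity_eq ..

lemma infinity_not_Spec: "V.F 0 \<notin> Spec K B" "W.F 0 \<notin> Spec K B"
proof -
 have "B \<subseteq> x" if "x \<in> Spec K B" for x using that B_loc unfolding Spec_eq by blast
 moreover have "\<not> B \<subseteq> V.F 0" "\<not> B \<subseteq> W.F 0" using V.F0_at_infinity W.F0_at_infinity unfolding points_at_infinity_def by auto
 ultimately show "V.F 0 \<notin> Spec K B" "W.F 0 \<notin> Spec K B" by blast+
qed

lemma point_subspace: "x \<in> X ==> subspace x" unfolding X_eq Spec_eq using V.F_subspace W.F_subspace loc_subspace by blast

lemma point_L: "x \<in> X ==> a \<in> x ==> a \<in> L" unfolding X_eq Spec_eq using loc_L by auto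

lemma in_Spec_imp_B: "a \<in> carrier K ==> (!!x. x \<in> Spec K B ==> a \<in> x) ==> a \<in> B" by (rule in_all_loc_imp_B) (auto simp: Spec_eq)

text \<open>For each gap \<open>n\<close> take a pole of order \<open>n\<close> at \<open>W\<close> and nothing elsewhere. A relation would yield a
 function whose only pole is at \<open>W\<close> and whose order there is the largest gap involved.\<close>
lemma independent_gap_repartitions:
 "\<exists>r. (\<forall>i<card gaps. r i \<in> repartitions K (range cst) B) \<and>
   independent_in_H1 K (range cst) B (card gaps) r"
proof -
 obtain g where g: "bij_betw g {..<card gaps} gaps" using ex_bij_betw_nat_finite[OF gaps_finite] by (auto simp: atLeast0LessThan)
 have "\<forall>n. \<exists>b. b \<in> B \<and> b ~= \<zero> \<and> w b = - int n" using W.v_surj by blast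
 then obtain e where e: "!!n. e n \<in> B" "!!n. e n ~= \<zero>" "!!n. w (e n) = - int n" by metis
 define r where "r i x = (if x = W.F 0 then e (g i) else \<zero>)" for i :: nat and x
 have "r i \<in> repartitions K (range cst) B" for i
 proof -
  have "r i \<in> X \<rightarrow> L" unfolding r_def using e(1) by auto
  moreover have "{x \<in> X. r i x \<notin> x} \<subseteq> {W.F 0}" unfolding r_def using subspace_D(2)[OF point_subspace] by auto
  ultimately show ?thesis unfolding repartitions_def using finite_subset by blast
 qed
 moreover have "independent_in_H1 K (range cst) B (card gaps) r" unfolding independent_in_H1_def
 proof (intro allI impI)
  fix c0 i0
  assume c0: "\<forall>i<card gaps. c0 i \<in> range cst"
   and ex: "\<exists>a\<in>L. \<forall>x\<in>X. (\<Oplus>i\<in>{..<card gaps}. c0 i \<otimes> r i x) \<ominus> a \<in> x" and i0: "i0 < card gaps"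
  have "\<forall>i. \<exists>d. i < card gaps \<longrightarrow> c0 i = cst d" using c0 by blast
  then obtain c where c: "!!i. i < card gaps ==> c0 i = cst (c i)" by metis
  obtain a where aL: "a \<in> L" and a: "!!x. x \<in> X ==> (\<Oplus>i\<in>{..<card gaps}. c0 i \<otimes> r i x) \<ominus> a \<in> x" using ex by blast
  have sum: "(\<Oplus>i\<in>{..<card gaps}. c0 i \<otimes> r i x) = (\<Oplus>i\<in>{..<card gaps}. cst (c i) \<otimes> r i x)" for x
   unfolding r_def using c e(1) by (intro finsum_cong') auto
  have away: "a \<in> x" if "x \<in> X" "x ~= W.F 0" for x
  proof -
   have "(\<Oplus>i\<in>{..<card gaps}. cst (c i) \<otimes> r i x) = (\<Oplus>i\<in>{..<card gaps}. \<zero>)" unfolding r_def using that by (intro finsum_cong') auto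
   hence "\<zero> \<ominus> a \<in> x" using a[OF that(1)] unfolding sum by simp
   hence "\<zero> \<ominus> (\<zero> \<ominus> a) \<in> x" using subspace_D(2,6)[OF point_subspace[OF that(1)]] by metis
   moreover have "\<zero> \<ominus> (\<zero> \<ominus> a) = a" using L_carr[OF aL] zero_closed by algebra
   ultimately show ?thesis by simp
  qed
  have aB: "a \<in> B" using away infinity_not_Spec(2) by (intro in_Spec_imp_B L_carr aL) (auto simp: X_eq)
  have aV: "a \<in> V.F 0" using away[of "V.F 0"] F0_distinct by (simp add: X_eq)
  define s where "s = (\<Oplus>i\<in>{..<card gaps}. cst (c i) \<otimes> e (g i))"
  have "(\<Oplus>i\<in>{..<card gaps}. cst (c i) \<otimes> r i (W.F 0)) = s" unfolding s_def r_def using e(1) by (intro finsum_cong') auto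
  hence sa: "s \<ominus> a \<in> W.F 0" using a[of "W.F 0"] unfolding sum by (simp add: X_eq)
  show "c0 i0 = \<zero>"
  proof (rule ccontr)
   assume "c0 i0 ~= \<zero>"
   define A where "A = {i. i < card gaps \<and> c i ~= 0}"
   have A: "finite A" "A ~= {}" using \<open>c0 i0 ~= \<zero>\<close> c i0 unfolding A_def by auto
   define n where "n = Max (g ` A)"
   have "n \<in> g ` A" unfolding n_def using A by (intro Max_in) auto
   then obtain j where j: "j \<in> A" "g j = n" by blast
   have jc: "j < card gaps" "c j ~= 0" using j unfolding A_def by auto
   have n_gap: "n \<in> gaps" using g j(2) jc(1) unfolding bij_betw_def by auto
   hence n0: "0 < n" using zero_not_gap by (cases n) auto
   have less: "g i < n" if "i < card gaps" "i ~= j" "c i ~= 0" for i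
   proof -
    have "g i \<le> n" unfolding n_def using that A by (intro Max_ge) (auto simp: A_def)
    moreover have "g i ~= g j" using g that jc unfolding bij_betw_def inj_on_def by auto
    ultimately show ?thesis using j(2) by simp
   qed
   have rest: "cst (c i) \<otimes> e (g i) \<in> W.F (- int n + 1)" if "i \<in> {..<card gaps} - {j}" for i
   proof (cases "c i = 0")
    case True thus ?thesis using e(1) by simp
   next
    case False
    hence "e (g i) \<in> W.F (- int n + 1)" using less[of i] that e by (intro W.F_I) auto
    thus ?thesis by (rule W.F_cst_mult)
   qed
   define t where "t = (\<Oplus>i\<in>{..<card gaps} - {j}. cst (c i) \<otimes> e (g i))"
   have t: "t \<in> W.F (- int n + 1)" unfolding t_def using rest by (intro finsum_subspace[OF W.F_subspace]) auto
   have "s = (\<Oplus>i\<in>insert j ({..<card gaps} - {j}). cst (c i) \<otimes> e (g i))" unfolding s_def using jc by (simp add: insert_absorb)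
   also have "\<dots> = cst (c j) \<otimes> e n \<oplus> t" unfolding t_def using e(1) j(2) by (subst finsum_insert) auto
   finally have s: "s = cst (c j) \<otimes> e n \<oplus> t" .
   have cen: "cst (c j) \<otimes> e n \<in> B" "cst (c j) \<otimes> e n ~= \<zero>" "w (cst (c j) \<otimes> e n) = - int n"
    using W.v_mult[of "cst (c j)" "e n"] e jc(2) W.v_cst[OF jc(2)] by auto
   define q where "q = (s \<ominus> a) \<ominus> t"
   have "s \<ominus> a \<in> W.F (- int n + 1)" using W.F_mono[OF sa] n0 by simp
   hence q: "q \<in> W.F (- int n + 1)" unfolding q_def using t by (rule W.F_minus)
   have aq: "a = cst (c j) \<otimes> e n \<ominus> q" unfolding q_def s using B_carr[OF cen(1)] W.F_carr[OF t] L_carr[OF aL] by algebra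
   have cenF: "cst (c j) \<otimes> e n \<in> W.F (- int n)" "cst (c j) \<otimes> e n \<notin> W.F (- int n + 1)"
    using W.F_v[OF B_L[OF cen(1)] cen(2)] cen(3) by simp_all
   have "a \<in> W.F (- int n)" unfolding aq using W.F_minus[OF cenF(1) W.F_mono[OF q]] by simp
   moreover have "a \<notin> W.F (- int n + 1)"
   proof
    assume "a \<in> W.F (- int n + 1)"
    hence "a \<oplus> q \<in> W.F (- int n + 1)" using q by (rule W.F_add)
    moreover have "a \<oplus> q = cst (c j) \<otimes> e n" unfolding aq using B_carr[OF cen(1)] W.F_carr[OF q] by algebra
    ultimately show False using cenF(2) by simp
   qed
   ultimately have "a ~= \<zero>" "w a = - int n" using W.F_exact by blast+
   thus False using n_gap aB V.F_D[OF aV] unfolding gaps_def by blast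
  qed
 qed
 ultimately show ?thesis by blast
qed

text \<open>The affine part is removed by vanishing of the affine cohomology and the part at \<open>V\<close> by density of \<open>B\<close>;
 a class in \<open>H\<^sup>1\<close> is thus represented by a principal part at \<open>W\<close>.\<close>
lemma repartition_normal_form:
 assumes r: "r \<in> repartitions K (range cst) B"
 shows "\<exists>a\<in>L. \<forall>x\<in>X. x ~= W.F 0 \<longrightarrow> r x \<ominus> a \<in> x"
proof -
 have rL: "r x \<in> L" if "x \<in> X" for x using r that unfolding repartitions_def by auto
 have fin: "finite {x \<in> X. r x \<notin> x}" using r unfolding repartitions_def by auto
 have "finite {x \<in> Spec K B. r x \<notin> x}" by (rule finite_subset[OF _ fin]) (auto simp: X_eq)
 then obtain a where a: "a \<in> L" "!!x. x \<in> Spec K B ==> r x \<ominus> a \<in> x" using affine_H1_vanishes[OF one_dim, of r] rL unfolding X_eq by blast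
 have rV: "r (V.F 0) \<in> L" using rL unfolding X_eq by blast
 then obtain b where b: "b \<in> B" "(r (V.F 0) \<ominus> a) \<ominus> b \<in> V.F 0" using V.F_approx[of "r (V.F 0) \<ominus> a" 0] a by blast
 show ?thesis
 proof (intro bexI[of _ "a \<oplus> b"] ballI impI)
  show "a \<oplus> b \<in> L" using a(1) b(1) by blast
  fix x assume x: "x \<in> X" "x ~= W.F 0"
  have rx: "r x \<in> L" by (rule rL[OF x(1)])
  have eq: "r x \<ominus> (a \<oplus> b) = (r x \<ominus> a) \<ominus> b" using L_carr[OF rx] L_carr[OF a(1)] B_carr[OF b(1)] by algebra
  show "r x \<ominus> (a \<oplus> b) \<in> x"
  proof (cases "x = V.F 0")
   case True thus ?thesis using b(2) unfolding eq by simp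
  next
   case False
   hence xS: "x \<in> Spec K B" using x unfolding X_eq by blast
   hence "b \<in> x" using b(1) B_loc unfolding Spec_eq by auto
   thus ?thesis unfolding eq using a(2)[OF xS] subspace_D(6)[OF point_subspace[OF x(1)]] by blast
  qed
 qed
qed

text \<open>Principal parts at \<open>W\<close> are filtered by pole order, modulo functions with poles at \<open>W\<close> only. The
 filtration jumps at most by one, and only at gaps.\<close>
lemma repartitions_dependent:
 assumes r: "!!i. i < n ==> r i \<in> repartitions K (range cst) B" and n: "card gaps < n"
 shows "\<not> independent_in_H1 K (range cst) B n r"
proof
 assume ind: "independent_in_H1 K (range cst) B n r"
 have "\<forall>i. \<exists>a. i < n \<longrightarrow> a \<in> L \<and> (\<forall>x\<in>X. x ~= W.F 0 \<longrightarrow> r i x \<ominus> a \<in> x)" using repartition_normal_form[OF r] by blast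
 then obtain a where a: "!!i. i < n ==> a i \<in> L"
  "!!i x. i < n ==> x \<in> X ==> x ~= W.F 0 ==> r i x \<ominus> a i \<in> x" by metis
 have rL: "r i x \<in> L" if "i < n" "x \<in> X" for i x using r[OF that(1)] that(2) unfolding repartitions_def by auto
 have WX: "W.F 0 \<in> X" unfolding X_eq by blast
 have Lsub: "subspace L" unfolding subspace_def using L_carr L_add L_mult B_L[OF B_zero] B_L[OF cst_B] by (meson subsetI)
 have "subspace B" by (rule ideal_subspace) (auto simp: ideal_of_B_def)
 hence P: "subspace (B \<inter> V.F 0)" by (rule subspace_Int[OF _ V.F_subspace])
 \<comment> \<open>Principal parts at W of pole order at most j, modulo functions regular elsewhere.\<close>
 define S where "S j = {y \<in> L. \<exists>b\<in>B \<inter> V.F 0. y \<ominus> b \<in> W.F (- int j)}" for j :: nat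
 have Ssub: "subspace (S j)" for j unfolding S_def by (rule subspace_mod[OF Lsub P W.F_subspace])
 define G where "G = {j. Suc j \<in> gaps}"
 have gap: "codim_le_1 (S j) (S (Suc j))" for j using codim_mod[OF Lsub P W.F_codim[of "- int (Suc j)"]] unfolding S_def by simp
 have nogap: "S (Suc j) \<subseteq> S j" if "j \<notin> G" for j
 proof
  fix x assume x: "x \<in> S (Suc j)"
  have "Suc j \<notin> gaps" using that unfolding G_def by simp
  hence "\<exists>e\<in>B. e ~= \<zero> \<and> 0 \<le> v e \<and> w e = - int (Suc j)" unfolding gaps_def mem_Collect_eq not_not .
  then obtain e where e: "e \<in> B" "e ~= \<zero>" "0 \<le> v e" "w e = - int (Suc j)" by blast
  obtain b where b: "x \<in> L" "b \<in> B" "b \<in> V.F 0" "x \<ominus> b \<in> W.F (- int (Suc j))" using x unfolding S_def by blast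
  have j1: "- int (Suc j) + 1 = - int j" by simp
  have eF: "e \<in> W.F (- int (Suc j))" "e \<notin> W.F (- int (Suc j) + 1)" "e \<in> V.F 0"
   using W.F_v[OF B_L[OF e(1)] e(2)] V.F_v[OF B_L[OF e(1)] e(2)] e(3,4) by simp_all
  obtain c where c: "(x \<ominus> b) \<ominus> cst c \<otimes> e \<in> W.F (- int j)" using W.F_residue[OF b(4) eF(1,2)] unfolding j1 by blast
  have beF: "b \<oplus> cst c \<otimes> e \<in> V.F 0" by (rule V.F_add[OF b(3) V.F_cst_mult[OF eF(3)]])
  have beB: "b \<oplus> cst c \<otimes> e \<in> B" using b(2) e(1) by simp
  have eq: "(x \<ominus> b) \<ominus> cst c \<otimes> e = x \<ominus> (b \<oplus> cst c \<otimes> e)" using L_carr[OF b(1)] B_carr[OF b(2)] B_carr[OF e(1)] cst_closed by algebra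
  show "x \<in> S j" unfolding S_def using c[unfolded eq] b(1) beB beF by blast
 qed
 define y where "y i = r i (W.F 0) \<ominus> a i" for i
 have yL: "y i \<in> L" if "i < n" for i unfolding y_def using rL[OF that WX] a(1)[OF that] by blast
 define N where "N = nat (Max ((%i. \<bar>w (y i)\<bar>) ` {..<n}))"
 have yS: "y i \<in> S N" if "i \<in> {..<n}" for i
 proof -
  have "\<bar>w (y i)\<bar> \<le> Max ((%i. \<bar>w (y i)\<bar>) ` {..<n})" using that by (intro Max_ge) auto
  hence "- int N \<le> w (y i)" unfolding N_def by linarith
  hence "y i \<in> W.F (- int N)" using yL that by (intro W.F_I) auto
  moreover have "y i \<ominus> \<zero> = y i" using yL that by (simp add: a_minus_def)
  ultimately have "y i \<ominus> \<zero> \<in> W.F (- int N)" by simp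
  thus ?thesis unfolding S_def using yL that B_zero V.F_zero by blast
 qed
 have "card (G \<inter> {..<N}) \<le> card gaps"
 proof -
  have "card (G \<inter> {..<N}) = card (Suc ` (G \<inter> {..<N}))" by (simp add: card_image)
  also have "\<dots> \<le> card gaps" by (intro card_mono gaps_finite) (auto simp: G_def)
  finally show ?thesis .
 qed
 then obtain c where c: "\<exists>i\<in>{..<n}. c i ~= 0" "(\<Oplus>i\<in>{..<n}. cst (c i) \<otimes> y i) \<in> S 0"
  using dependent_in_chain[of S G "{..<n}" y N] Ssub gap nogap yS n by auto
 obtain b where b: "b \<in> B" "b \<in> V.F 0" "(\<Oplus>i\<in>{..<n}. cst (c i) \<otimes> y i) \<ominus> b \<in> W.F 0" using c(2) unfolding S_def by auto
 define A where "A = (\<Oplus>i\<in>{..<n}. cst (c i) \<otimes> a i)"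
 have AL: "A \<in> L" unfolding A_def using a(1) subspace_D(4)[OF Lsub] by (intro finsum_subspace[OF Lsub]) auto
 have mem: "(\<Oplus>i\<in>{..<n}. cst (c i) \<otimes> r i x) \<ominus> (A \<oplus> b) \<in> x" if x: "x \<in> X" for x
 proof -
  have Rc: "(\<Oplus>i\<in>{..<n}. cst (c i) \<otimes> r i x) \<in> carrier K" using rL x by (intro finsum_closed) auto
  have "(\<Oplus>i\<in>{..<n}. cst (c i) \<otimes> (r i x \<ominus> a i)) = (\<Oplus>i\<in>{..<n}. cst (c i) \<otimes> r i x) \<ominus> A"
   unfolding A_def using rL[OF _ x] a(1) by (intro finsum_combination_diff) auto
  moreover have "R \<ominus> (A \<oplus> b) = (R \<ominus> A) \<ominus> b" if "R \<in> carrier K" for R using that L_carr[OF AL] B_carr[OF b(1)] by algebra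
  note this[OF Rc]
  ultimately have eq: "(\<Oplus>i\<in>{..<n}. cst (c i) \<otimes> r i x) \<ominus> (A \<oplus> b)
    = (\<Oplus>i\<in>{..<n}. cst (c i) \<otimes> (r i x \<ominus> a i)) \<ominus> b" by simp
  note sx = point_subspace[OF x]
  show ?thesis
  proof (cases "x = W.F 0")
   case True
   thus ?thesis unfolding eq using b(3) unfolding y_def by simp
  next
   case False
   have "(\<Oplus>i\<in>{..<n}. cst (c i) \<otimes> (r i x \<ominus> a i)) \<in> x" using a(2)[OF _ x False] subspace_D(4)[OF sx] by (intro finsum_subspace[OF sx]) auto
   moreover have "b \<in> x" using x False b(1,2) B_loc unfolding X_eq Spec_eq by auto
   ultimately show ?thesis unfolding eq using subspace_D(6)[OF sx] by blast
  qed
 qed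
 have AbL: "A \<oplus> b \<in> L" using AL b(1) by blast
 have "\<forall>i<n. cst (c i) = \<zero>" using ind[unfolded independent_in_H1_def, rule_format, of "%i. cst (c i)"] AbL mem by blast
 thus False using c(1) by auto
qed

theorem genus_eq_card_gaps: "arithmetic_genus K (range cst) B = enat (card gaps)" unfolding arithmetic_genus_def
proof (rule antisym)
 show "Sup {enat n |n. \<exists>r. (\<forall>i<n. r i \<in> repartitions K (range cst) B) \<and> independent_in_H1 K (range cst) B n r}
   \<le> enat (card gaps)" by (rule Sup_least) (use repartitions_dependent in \<open>fastforce simp: not_less[symmetric]\<close>)
 show "enat (card gaps) \<le> Sup {enat n |n. \<exists>r. (\<forall>i<n. r i \<in> repartitions K (range cst) B) \<and> independent_in_H1 K (range cst) B n r}"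
  by (rule Sup_upper) (use independent_gap_repartitions in blast)
qed

end

context two_places
begin

text \<open>Let \<open>\<L>\<close> be the bundle of functions with at most a simple pole at \<open>V\<close> and at least a simple zero at \<open>W\<close>.
 Its gaps are compared with those of the bundle \<open>\<O>(- W)\<close>, which are \<open>0\<close> and the shifted ordinary gaps:
 admitting a simple pole at \<open>V\<close> fills exactly one gap, the least order at which a function with such a
 pole occurs.\<close>
lemma card_gaps_twisted:
 "card {k::nat. \<not> (\<exists>b\<in>B. b ~= \<zero> \<and> - 1 \<le> v b \<and> w b = 1 - int k)} = card gaps"
proof -
 let ?D = "{k::nat. \<not> (\<exists>b\<in>B. b ~= \<zero> \<and> - 1 \<le> v b \<and> w b = 1 - int k)}"
 \<comment> \<open>The orders at W of functions with exactly a simple pole at V; k0 is the least one.\<close>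
 define U where "U = {k::nat. \<exists>b\<in>B. b ~= \<zero> \<and> v b = - 1 \<and> w b = 1 - int k}"
 obtain b1 where b1: "b1 \<in> B" "b1 ~= \<zero>" "v b1 = - 1" by (rule V.exists_B_exact)
 hence "w b1 = 1 - int (nat (1 - w b1))" using v_plus_w[OF b1(1,2)] by simp
 hence "nat (1 - w b1) \<in> U" unfolding U_def using b1 by blast
 hence "(LEAST k. k \<in> U) \<in> U" by (rule LeastI)
 then obtain k0 where k0: "k0 \<in> U" "!!k. k \<in> U ==> k0 \<le> k" using Least_le[of "%k. k \<in> U"] by blast
 obtain e where e: "e \<in> B" "e ~= \<zero>" "v e = - 1" "w e = 1 - int k0" using k0(1) unfolding U_def by blast
 have eF: "e \<in> V.F (- 1)" "e \<notin> V.F (- 1 + 1)" "e \<in> W.F (1 - int k0)" "e \<notin> W.F (1 - int k0 + 1)"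
  using V.F_v[OF B_L[OF e(1)] e(2)] W.F_v[OF B_L[OF e(1)] e(2)] e(3,4) by simp_all
 have gap_iff: "k = 0 \<or> k - 1 \<in> gaps \<longleftrightarrow> \<not> (\<exists>b\<in>B. b ~= \<zero> \<and> 0 \<le> v b \<and> w b = 1 - int k)" for k
 proof (cases "k = 0")
  case True
  thus ?thesis using v_plus_w by fastforce
 next
  case False
  hence "- int (k - 1) = 1 - int k" by simp
  thus ?thesis unfolding gaps_def using False by simp
 qed
 have k0_gap: "k0 = 0 \<or> k0 - 1 \<in> gaps" unfolding gap_iff
 proof
  assume "\<exists>b\<in>B. b ~= \<zero> \<and> 0 \<le> v b \<and> w b = 1 - int k0"
  then obtain b where b: "b \<in> B" "b ~= \<zero>" "0 \<le> v b" "w b = 1 - int k0" by blast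
  have bF: "b \<in> V.F 0" "b \<in> W.F (1 - int k0)" "b \<notin> W.F (1 - int k0 + 1)"
   using V.F_v[OF B_L[OF b(1)] b(2)] W.F_v[OF B_L[OF b(1)] b(2)] b(3,4) by simp_all
  obtain c where c: "e \<ominus> cst c \<otimes> b \<in> W.F (1 - int k0 + 1)" using W.F_residue[OF eF(3) bF(2,3)] by blast
  let ?z = "e \<ominus> cst c \<otimes> b"
  have zB: "?z \<in> B" using e(1) b(1) by simp
  have cb: "cst c \<otimes> b \<in> V.F 0" using V.F_cst_mult[OF bF(1)] .
  have "?z \<in> V.F (- 1)" using V.F_minus[OF eF(1) V.F_mono[OF cb]] by simp
  moreover have "?z \<notin> V.F (- 1 + 1)"
  proof
   assume "?z \<in> V.F (- 1 + 1)"
   hence "?z \<oplus> cst c \<otimes> b \<in> V.F 0" using V.F_add[OF _ cb] by simp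
   moreover have "?z \<oplus> cst c \<otimes> b = e" using B_carr[OF e(1)] B_carr[OF b(1)] cst_closed by algebra
   ultimately show False using eF(2) by simp
  qed
  ultimately have z: "?z ~= \<zero>" "v ?z = - 1" using V.F_exact by blast+
  have "w ?z = 1 - int (nat (1 - w ?z))" using v_plus_w[OF zB z(1)] z(2) by simp
  hence "nat (1 - w ?z) \<in> U" unfolding U_def using zB z by blast
  hence "k0 \<le> nat (1 - w ?z)" by (rule k0(2))
  thus False using W.F_D[OF c z(1)] v_plus_w[OF zB z(1)] z(2) by linarith
 qed
 have "?D \<union> {k0} = insert 0 (Suc ` gaps)"
 proof (intro equalityI subsetI)
  fix k assume "k \<in> ?D \<union> {k0}"
  hence "k = 0 \<or> k - 1 \<in> gaps"
  proof
   assume "k \<in> ?D"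
   thus ?thesis unfolding gap_iff by fastforce
  qed (use k0_gap in simp)
  thus "k \<in> insert 0 (Suc ` gaps)" by (cases k) auto
 next
  fix k assume "k \<in> insert 0 (Suc ` gaps)"
  hence "k = 0 \<or> k - 1 \<in> gaps" by auto
  hence no: "\<not> (\<exists>b\<in>B. b ~= \<zero> \<and> 0 \<le> v b \<and> w b = 1 - int k)" unfolding gap_iff .
  show "k \<in> ?D \<union> {k0}"
  proof (cases "k = k0")
   case False
   have "\<not> (\<exists>b\<in>B. b ~= \<zero> \<and> - 1 \<le> v b \<and> w b = 1 - int k)"
   proof
    assume "\<exists>b\<in>B. b ~= \<zero> \<and> - 1 \<le> v b \<and> w b = 1 - int k"
    then obtain b where b: "b \<in> B" "b ~= \<zero>" "- 1 \<le> v b" "w b = 1 - int k" by blast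
    have "\<not> 0 \<le> v b" using no b by blast
    hence vb: "v b = - 1" using b(3) by simp
    hence "k \<in> U" unfolding U_def using b by blast
    hence less: "k0 < k" using k0(2) False by fastforce
    have bF: "b \<in> V.F (- 1)" "b \<in> W.F (1 - int k)" "b \<notin> W.F (1 - int k + 1)"
     using V.F_v[OF B_L[OF b(1)] b(2)] W.F_v[OF B_L[OF b(1)] b(2)] b(4) vb by simp_all
    obtain c where c: "b \<ominus> cst c \<otimes> e \<in> V.F (- 1 + 1)" using V.F_residue[OF bF(1) eF(1,2)] by blast
    let ?z = "b \<ominus> cst c \<otimes> e"
    have zB: "?z \<in> B" using e(1) b(1) by simp
    have ce: "cst c \<otimes> e \<in> W.F (1 - int k + 1)" using W.F_cst_mult[OF W.F_mono[OF eF(3)]] less by simp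
    have "?z \<in> W.F (1 - int k)" using W.F_minus[OF bF(2) W.F_mono[OF ce]] by simp
    moreover have "?z \<notin> W.F (1 - int k + 1)"
    proof
     assume "?z \<in> W.F (1 - int k + 1)"
     hence "?z \<oplus> cst c \<otimes> e \<in> W.F (1 - int k + 1)" using W.F_add[OF _ ce] by simp
     moreover have "?z \<oplus> cst c \<otimes> e = b" using B_carr[OF e(1)] B_carr[OF b(1)] cst_closed by algebra
     ultimately show False using bF(3) by simp
    qed
    ultimately have z: "?z ~= \<zero>" "w ?z = 1 - int k" using W.F_exact by blast+
    have "0 \<le> v ?z" using V.F_D[OF c z(1)] by simp
    thus False using no zB z by blast
   qed
   thus ?thesis by blast
  qed simp
 qed
 moreover have "k0 \<notin> ?D" using e by (auto intro!: bexI[of _ e])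
 moreover have "finite (insert 0 (Suc ` gaps))" using gaps_finite by simp
 ultimately have "card ?D + 1 = card (insert 0 (Suc ` gaps))"
  by (metis (no_types, lifting) Suc_eq_plus1 Un_empty_right Un_insert_right card_insert_disjoint finite_insert)
 also have "\<dots> = card gaps + 1" using gaps_finite by (simp add: card_image image_iff)
 finally show ?thesis by simp
qed

lemma point_eqI:
 assumes x: "x \<in> X" "x' \<in> X" and sub: "x \<subseteq> x'" and dom: "max_ideal K x = max_ideal K x' \<inter> x"
 shows "x = x'"
proof -
 have lV: "l \<in> V.F 0" "l \<in> V.F 1" using V.F_v[of l 0] V.F_v[of l 1] v_l_pos by simp_all
 have w_inv: "w (inv l) = v l" "v (inv l) = - v l" using W.v_inv[of l] V.v_inv[of l] w_l by simp_all
 hence lW: "inv l \<in> W.F 0" "inv l \<in> W.F 1" using W.F_v[of "inv l" 0] W.F_v[of "inv l" 1] v_l_pos by simp_all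
 have nW: "l \<notin> W.F 0" "inv l \<notin> V.F 0" using W.F_v[of l 0] V.F_v[of "inv l" 0] w_l w_inv v_l_pos by simp_all
 have unit: "l \<notin> max_ideal K (loc M)" "inv l \<notin> max_ideal K (loc M)" if "max_id M" for M
  using B_loc[OF that l_B] B_loc[OF that inv_l_B] unfolding max_ideal_def by auto
 consider M M' where "max_id M" "x = loc M" "max_id M'" "x' = loc M'"
  | M where "max_id M" "x = loc M" "x' \<in> {V.F 0, W.F 0}"
  | M where "max_id M" "x' = loc M" "x \<in> {V.F 0, W.F 0}"
  | "x \<in> {V.F 0, W.F 0}" "x' \<in> {V.F 0, W.F 0}" using x unfolding X_eq Spec_eq by blast
 thus ?thesis
 proof cases
  case 1
  have "a \<in> M \<longleftrightarrow> a \<in> M'" if "a \<in> B" for a using max_ideal_loc_B[OF 1(1) that] max_ideal_loc_B[OF 1(3) that] dom B_loc[OF 1(1) that]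
   unfolding 1(2,4) by blast
  hence "M = M'" using max_id_D(1)[OF 1(1)] max_id_D(1)[OF 1(3)] by blast
  thus ?thesis using 1 by simp
 next
  case 2
  hence "B \<subseteq> x'" using B_loc[OF 2(1)] sub by blast
  thus ?thesis using 2(3) V.F0_at_infinity W.F0_at_infinity unfolding points_at_infinity_def by blast
 next
  case 3
  thus ?thesis using dom unit[OF 3(1)] lV(2) lW(2) V.max_ideal_F0 W.max_ideal_F0 unfolding 3(2) by blast
 next
  case 4
  thus ?thesis using sub lV(1) lW(1) nW by blast
 qed
qed

end

section \<open>Automorphisms of order two and double covers\<close>

text \<open>The parity axioms say that \<open>\<sigma>\<close> acts on the leading term of \<open>a\<close> at \<open>V\<close> by \<open>(-1)\<close> to the power \<open>v a\<close>, and
 likewise at \<open>W\<close>: both points are fixed and \<open>\<sigma>\<close> acts by \<open>-1\<close> on their tangent lines.\<close>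
locale double_cover = two_places K cst A v w l for K (structure) and cst and A and v and w and l +
 fixes \<sigma> :: "'a => 'a"
 assumes K_eq: "quotients K A = carrier K"
  and \<sigma>_closed [simp, intro]: "x \<in> carrier K ==> \<sigma> x \<in> carrier K"
  and \<sigma>_add: "x \<in> carrier K ==> y \<in> carrier K ==> \<sigma> (x \<oplus> y) = \<sigma> x \<oplus> \<sigma> y"
  and \<sigma>_mult: "x \<in> carrier K ==> y \<in> carrier K ==> \<sigma> (x \<otimes> y) = \<sigma> x \<otimes> \<sigma> y"
  and \<sigma>_\<sigma> [simp]: "x \<in> carrier K ==> \<sigma> (\<sigma> x) = x"
  and \<sigma>_cst [simp]: "\<sigma> (cst c) = cst c"
  and \<sigma>_A [simp, intro]: "a \<in> A ==> \<sigma> a \<in> A"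
  and \<sigma>_l: "\<sigma> l = \<ominus> l"
  and v_l: "v l = 3"
  and v_parity: "a \<in> A ==> a ~= \<zero> ==> (if even (v a) then \<sigma> a \<ominus> a else \<sigma> a \<oplus> a) \<in> V.F (v a + 1)"
  and w_parity: "a \<in> A ==> a ~= \<zero> ==> (if even (w a) then \<sigma> a \<ominus> a else \<sigma> a \<oplus> a) \<in> W.F (w a + 1)"
begin

lemma \<sigma>_zero [simp]: "\<sigma> \<zero> = \<zero>" using \<sigma>_cst[of 0] by simp
lemma \<sigma>_one [simp]: "\<sigma> \<one> = \<one>" using \<sigma>_cst[of 1] by simp

lemma \<sigma>_uminus: "x \<in> carrier K ==> \<sigma> (\<ominus> x) = \<ominus> \<sigma> x"
proof -
 assume x: "x \<in> carrier K"
 have "\<sigma> (\<ominus> x) \<oplus> \<sigma> x = \<zero>" using x \<sigma>_add[of "\<ominus> x" x] by (simp add: l_neg)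
 thus ?thesis using x minus_equality by (metis \<sigma>_closed a_inv_closed)
qed

lemma \<sigma>_minus: "x \<in> carrier K ==> y \<in> carrier K ==> \<sigma> (x \<ominus> y) = \<sigma> x \<ominus> \<sigma> y" by (simp add: a_minus_def \<sigma>_add \<sigma>_uminus)

lemma \<sigma>_eq_zero: "x \<in> carrier K ==> \<sigma> x = \<zero> \<longleftrightarrow> x = \<zero>" by (metis \<sigma>_\<sigma> \<sigma>_zero)

lemma \<sigma>_inv: "x \<in> carrier K ==> x ~= \<zero> ==> \<sigma> (inv x) = inv (\<sigma> x)"
proof -
 assume x: "x \<in> carrier K" "x ~= \<zero>"
 have s0: "\<sigma> x ~= \<zero>" using x \<sigma>_eq_zero by simp
 have "\<sigma> (inv x) \<otimes> \<sigma> x = \<one>" using x \<sigma>_mult[of "inv x" x] by simp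
 hence "\<sigma> (inv x) = \<one> \<otimes> inv (\<sigma> x)" using x s0 eq_divide[of \<one> "\<sigma> x" "\<sigma> (inv x)"] by simp
 thus ?thesis using x s0 by simp
qed

definition even_part :: "'a => 'a" where "even_part x = cst (1/2) \<otimes> (x \<oplus> \<sigma> x)"
definition odd_part :: "'a => 'a" where "odd_part x = cst (1/2) \<otimes> (x \<ominus> \<sigma> x)"

lemma half: "x \<in> carrier K ==> cst (1/2) \<otimes> (x \<oplus> x) = x"
proof -
 assume x: "x \<in> carrier K"
 have "cst (1/2) \<oplus> cst (1/2) = \<one>" by (simp flip: cst_add)
 hence "(cst (1/2) \<oplus> cst (1/2)) \<otimes> x = x" using x by simp
 moreover have "(cst (1/2) \<oplus> cst (1/2)) \<otimes> x = cst (1/2) \<otimes> (x \<oplus> x)" using x cst_closed by algebra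
 ultimately show ?thesis by simp
qed

lemma parts:
 assumes x: "x \<in> carrier K"
 shows "even_part x \<in> carrier K" "odd_part x \<in> carrier K" "even_part x \<oplus> odd_part x = x"
  "\<sigma> (even_part x) = even_part x" "\<sigma> (odd_part x) = \<ominus> odd_part x"
proof -
 note c = x \<sigma>_closed[OF x] cst_closed
 show "even_part x \<in> carrier K" "odd_part x \<in> carrier K" unfolding even_part_def odd_part_def using x by auto
 have "even_part x \<oplus> odd_part x = cst (1/2) \<otimes> (x \<oplus> x)" unfolding even_part_def odd_part_def using c by algebra
 thus "even_part x \<oplus> odd_part x = x" using half[OF x] by simp
 have "\<sigma> (even_part x) = cst (1/2) \<otimes> (\<sigma> x \<oplus> x)" unfolding even_part_def using x by (simp add: \<sigma>_mult \<sigma>_add)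
 also have "\<dots> = even_part x" unfolding even_part_def using c by algebra
 finally show "\<sigma> (even_part x) = even_part x" .
 have "\<sigma> (odd_part x) = cst (1/2) \<otimes> (\<sigma> x \<ominus> x)" unfolding odd_part_def using x by (simp add: \<sigma>_mult \<sigma>_minus)
 also have "\<dots> = \<ominus> odd_part x" unfolding odd_part_def using c by algebra
 finally show "\<sigma> (odd_part x) = \<ominus> odd_part x" .
qed

lemma parts_A: "a \<in> A ==> even_part a \<in> A" "a \<in> A ==> odd_part a \<in> A" unfolding even_part_def odd_part_def by simp_all

lemma even_part_add_antiinvariant:
 assumes "x \<in> carrier K" "y \<in> carrier K" "\<sigma> x = x" "\<sigma> y = \<ominus> y"
 shows "even_part (x \<oplus> y) = x"
proof -
 have "even_part (x \<oplus> y) = cst (1/2) \<otimes> ((x \<oplus> y) \<oplus> (x \<oplus> \<ominus> y))" unfolding even_part_def using assms by (simp add: \<sigma>_add)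
 also have "(x \<oplus> y) \<oplus> (x \<oplus> \<ominus> y) = x \<oplus> x" using assms(1,2) by algebra
 finally show ?thesis using half[OF assms(1)] by simp
qed

lemma parity_even:
 assumes "a \<in> A" "a ~= \<zero>" "even (v a)"
 shows "even_part a ~= \<zero>" "v (even_part a) = v a"
proof -
 have d: "\<sigma> a \<ominus> a \<in> V.F (v a + 1)" using v_parity[OF assms(1,2)] assms(3) by simp
 have aF: "a \<in> V.F (v a)" "a \<notin> V.F (v a + 1)" using V.F_v[OF B_L[OF assms(1)] assms(2)] by simp_all
 have kd: "cst (1/2) \<otimes> (\<sigma> a \<ominus> a) \<in> V.F (v a + 1)" using V.F_cst_mult[OF d] .
 have "cst (1/2) \<otimes> (a \<oplus> a) \<oplus> cst (1/2) \<otimes> (\<sigma> a \<ominus> a) = even_part a" unfolding even_part_def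
  using B_carr[OF assms(1)] \<sigma>_closed[OF B_carr[OF assms(1)]] cst_closed by algebra
 hence eq: "even_part a = a \<oplus> cst (1/2) \<otimes> (\<sigma> a \<ominus> a)" using half[OF B_carr[OF assms(1)]] by simp
 have "even_part a \<in> V.F (v a)" unfolding eq using V.F_add[OF aF(1) V.F_mono[OF kd]] by simp
 moreover have "even_part a \<notin> V.F (v a + 1)"
 proof
  assume "even_part a \<in> V.F (v a + 1)"
  hence "even_part a \<ominus> cst (1/2) \<otimes> (\<sigma> a \<ominus> a) \<in> V.F (v a + 1)" using kd by (rule V.F_minus)
  moreover have "even_part a \<ominus> cst (1/2) \<otimes> (\<sigma> a \<ominus> a) = a" unfolding eq
   using B_carr[OF assms(1)] \<sigma>_closed[OF B_carr[OF assms(1)]] cst_closed by algebra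
  ultimately show False using aF(2) by simp
 qed
 ultimately show "even_part a ~= \<zero>" "v (even_part a) = v a" using V.F_exact by blast+
qed

lemma parity_odd:
 assumes "a \<in> A" "a ~= \<zero>" "odd (v a)"
 shows "odd_part a ~= \<zero>" "v (odd_part a) = v a"
proof -
 have d: "\<sigma> a \<oplus> a \<in> V.F (v a + 1)" using v_parity[OF assms(1,2)] assms(3) by simp
 have aF: "a \<in> V.F (v a)" "a \<notin> V.F (v a + 1)" using V.F_v[OF B_L[OF assms(1)] assms(2)] by simp_all
 have kd: "cst (1/2) \<otimes> (\<sigma> a \<oplus> a) \<in> V.F (v a + 1)" using V.F_cst_mult[OF d] .
 have "cst (1/2) \<otimes> (a \<oplus> a) \<ominus> cst (1/2) \<otimes> (\<sigma> a \<oplus> a) = odd_part a" unfolding odd_part_def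
  using B_carr[OF assms(1)] \<sigma>_closed[OF B_carr[OF assms(1)]] cst_closed by algebra
 hence eq: "odd_part a = a \<ominus> cst (1/2) \<otimes> (\<sigma> a \<oplus> a)" using half[OF B_carr[OF assms(1)]] by simp
 have "odd_part a \<in> V.F (v a)" unfolding eq using V.F_minus[OF aF(1) V.F_mono[OF kd]] by simp
 moreover have "odd_part a \<notin> V.F (v a + 1)"
 proof
  assume "odd_part a \<in> V.F (v a + 1)"
  hence "odd_part a \<oplus> cst (1/2) \<otimes> (\<sigma> a \<oplus> a) \<in> V.F (v a + 1)" using kd by (rule V.F_add)
  moreover have "odd_part a \<oplus> cst (1/2) \<otimes> (\<sigma> a \<oplus> a) = a" unfolding eq
   using B_carr[OF assms(1)] \<sigma>_closed[OF B_carr[OF assms(1)]] cst_closed by algebra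
  ultimately show False using aF(2) by simp
 qed
 ultimately show "odd_part a ~= \<zero>" "v (odd_part a) = v a" using V.F_exact by blast+
qed

lemma carrier_L [simp]: "L = carrier K" by (rule K_eq)

lemma v_\<sigma>_A: assumes "a \<in> A" "a ~= \<zero>" shows "v (\<sigma> a) = v a"
proof -
 have aF: "a \<in> V.F (v a)" "a \<notin> V.F (v a + 1)" using V.F_v[OF B_L[OF assms(1)] assms(2)] by simp_all
 note c = B_carr[OF assms(1)] \<sigma>_closed[OF B_carr[OF assms(1)]]
 obtain z where z: "z \<in> V.F (v a + 1)" "\<sigma> a = a \<oplus> z \<or> \<sigma> a = z \<ominus> a"
 proof (cases "even (v a)")
  case True
  have "\<sigma> a = a \<oplus> (\<sigma> a \<ominus> a)" using c by algebra
  thus ?thesis using v_parity[OF assms] True that by auto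
 next
  case False
  have "\<sigma> a = (\<sigma> a \<oplus> a) \<ominus> a" using c by algebra
  thus ?thesis using v_parity[OF assms] False that by auto
 qed
 have zc: "z \<in> carrier K" using z(1) V.F_carr by blast
 have "\<sigma> a \<in> V.F (v a)" using z V.F_add[OF aF(1) V.F_mono[OF z(1)]] V.F_minus[OF V.F_mono[OF z(1)] aF(1)] by auto
 moreover have "\<sigma> a \<notin> V.F (v a + 1)"
 proof
  assume s: "\<sigma> a \<in> V.F (v a + 1)"
  have "(a \<oplus> z) \<ominus> z = a" "z \<ominus> (z \<ominus> a) = a" using c(1) zc by algebra+
  hence "a \<in> V.F (v a + 1)" using z(2) V.F_minus[OF s z(1)] V.F_minus[OF z(1) s] by auto
  thus False using aF by blast
 qed
 ultimately show ?thesis using V.F_exact by blast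
qed

lemma v_\<sigma>: assumes "x \<in> carrier K" "x ~= \<zero>" shows "v (\<sigma> x) = v x"
proof -
 have "x \<in> L" using assms by simp
 then obtain a b where ab: "a \<in> A" "b \<in> A" "b ~= \<zero>" "x = a \<otimes> inv b" using L_E by metis
 have a0: "a ~= \<zero>" using assms ab by auto
 have sb: "\<sigma> a ~= \<zero>" "\<sigma> b ~= \<zero>" using ab a0 \<sigma>_eq_zero by auto
 have "\<sigma> x = \<sigma> a \<otimes> inv (\<sigma> b)" using ab by (simp add: \<sigma>_mult \<sigma>_inv)
 moreover have "v (c \<otimes> inv d) = v c - v d" if "c \<in> carrier K" "d \<in> carrier K" "c ~= \<zero>" "d ~= \<zero>" for c d
  using that V.v_mult[of c "inv d"] V.v_inv[of d] by simp
 ultimately show ?thesis using ab a0 sb v_\<sigma>_A by simp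
qed

lemma F_\<sigma>: "x \<in> V.F n ==> \<sigma> x \<in> V.F n"
proof (cases "x = \<zero>")
 case False
 assume x: "x \<in> V.F n"
 hence "v (\<sigma> x) = v x" "\<sigma> x \<in> carrier K" using False v_\<sigma> V.F_carr by auto
 thus ?thesis using V.F_D[OF x False] by (intro V.F_I) simp_all
qed simp

lemma swap_cover: "double_cover K cst A w v (inv l) \<sigma>"
proof (intro double_cover.intro double_cover_axioms.intro)
 show "two_places K cst A w v (inv l)" by (rule swap)
 have "\<sigma> (inv l) \<otimes> l = \<ominus> \<one>"
 proof -
  have "\<sigma> (inv l) \<otimes> \<sigma> l = \<one>" using \<sigma>_mult[of "inv l" l] by simp
  hence "\<ominus> (\<sigma> (inv l) \<otimes> l) = \<one>" unfolding \<sigma>_l by (simp add: r_minus)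
  thus ?thesis by (metis B_carr \<sigma>_A inv_l_B l_B m_closed minus_minus)
 qed
 hence "\<sigma> (inv l) = (\<ominus> \<one>) \<otimes> inv l" using eq_divide[of "\<ominus> \<one>" l "\<sigma> (inv l)"] by simp
 thus "\<sigma> (inv l) = \<ominus> (inv l)" by (simp add: l_minus)
 show "w (inv l) = 3" using W.v_inv[of l] w_l v_l by simp
 show "quotients K A = carrier K" by (rule K_eq)
 show "(if even (w a) then \<sigma> a \<ominus> a else \<sigma> a \<oplus> a) \<in> W.F (w a + 1)" if "a \<in> A" "a ~= \<zero>" for a by (rule w_parity[OF that])
 show "(if even (v a) then \<sigma> a \<ominus> a else \<sigma> a \<oplus> a) \<in> V.F (v a + 1)" if "a \<in> A" "a ~= \<zero>" for a by (rule v_parity[OF that])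
qed (simp_all add: \<sigma>_add \<sigma>_mult)

definition A0 :: "'a set" where "A0 = {a \<in> A. \<sigma> a = a}"

lemma A0_A: "a \<in> A0 ==> a \<in> A" and A0_\<sigma>: "a \<in> A0 ==> \<sigma> a = a" unfolding A0_def by auto

lemma A0_ring: "affine_ring K cst A0"
proof (intro affine_ring.intro affine_ring_axioms.intro)
 show "field_over_complex K cst" by unfold_locales
 show "subring A0 K" by (rule subringI) (auto simp: A0_def \<sigma>_uminus \<sigma>_add \<sigma>_mult)
 show "cst c \<in> A0" for c unfolding A0_def by simp
qed

lemma A0_I: "a \<in> A ==> \<sigma> a = a ==> a \<in> A0" unfolding A0_def by simp

lemma quotients_A0: "quotients K A0 = {x \<in> carrier K. \<sigma> x = x}"
proof (intro equalityI subsetI)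
 fix x assume "x \<in> quotients K A0"
 then obtain a b where "a \<in> A0" "b \<in> A0" "b ~= \<zero>" "x = a \<otimes> inv b" unfolding quotients_def by blast
 thus "x \<in> {x \<in> carrier K. \<sigma> x = x}" using A0_A A0_\<sigma> by (auto simp: \<sigma>_mult \<sigma>_inv)
next
 fix x assume "x \<in> {x \<in> carrier K. \<sigma> x = x}"
 hence x: "x \<in> carrier K" "\<sigma> x = x" by auto
 then obtain b where b: "b \<in> A" "b ~= \<zero>" "x \<otimes> b \<in> A" using V.L_clear[of x] by auto
 have sb: "\<sigma> b ~= \<zero>" using b \<sigma>_eq_zero by auto
 have d: "b \<otimes> \<sigma> b \<in> A0" "b \<otimes> \<sigma> b ~= \<zero>" using b sb by (auto simp: A0_def \<sigma>_mult m_comm)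
 have n: "x \<otimes> (b \<otimes> \<sigma> b) \<in> A0"
 proof (rule A0_I)
  have "x \<otimes> (b \<otimes> \<sigma> b) = (x \<otimes> b) \<otimes> \<sigma> b" using x b by (simp add: m_assoc)
  thus "x \<otimes> (b \<otimes> \<sigma> b) \<in> A" using b by simp
  show "\<sigma> (x \<otimes> (b \<otimes> \<sigma> b)) = x \<otimes> (b \<otimes> \<sigma> b)" using x b by (simp add: \<sigma>_mult m_comm)
 qed
 have "x = (x \<otimes> (b \<otimes> \<sigma> b)) \<otimes> inv (b \<otimes> \<sigma> b)" using x b sb d eq_divide[of "x \<otimes> (b \<otimes> \<sigma> b)" "b \<otimes> \<sigma> b" x] by simp
 thus "x \<in> quotients K A0" unfolding quotients_def using n d by blast
qed

lemma invariant_even_A: assumes "a \<in> A" "a ~= \<zero>" "\<sigma> a = a" shows "even (v a)"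
proof (rule ccontr)
 assume "odd (v a)"
 hence "odd_part a ~= \<zero>" by (rule parity_odd[OF assms(1,2)])
 moreover have "odd_part a = \<zero>" unfolding odd_part_def using assms by (simp add: a_minus_def r_neg)
 ultimately show False by simp
qed

lemma invariant_even: assumes "x \<in> carrier K" "x ~= \<zero>" "\<sigma> x = x" shows "even (v x)"
proof -
 have "x \<in> quotients K A0" using assms quotients_A0 by simp
 then obtain a b where ab: "a \<in> A0" "b \<in> A0" "b ~= \<zero>" "x = a \<otimes> inv b" unfolding quotients_def by blast
 hence "a ~= \<zero>" using assms A0_A by auto
 hence "v x = v a - v b" using V.v_mult[of a "inv b"] V.v_inv[of b] ab A0_A by simp
 thus ?thesis using invariant_even_A ab A0_A A0_\<sigma> \<open>a ~= \<zero>\<close> by simp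
qed

text \<open>Invariant functions have even order, and an element of even order can be replaced by its invariant part
 without changing the order. So half of \<open>v\<close> is again onto the integers.\<close>
lemma place_A0: "place K cst A0 (%x. v x div 2)"
proof (intro place.intro place_axioms.intro)
 show "affine_ring K cst A0" by (rule A0_ring)
 show "v (x \<otimes> y) div 2 = v x div 2 + v y div 2"
  if "x \<in> quotients K A0" "y \<in> quotients K A0" "x ~= \<zero>" "y ~= \<zero>" for x y
  using that V.v_mult[of x y] invariant_even[of x] invariant_even[of y] unfolding quotients_A0 by simp
 show "min (v a div 2) (v b div 2) \<le> v (a \<oplus> b) div 2"
  if "a \<in> A0" "b \<in> A0" "a ~= \<zero>" "b ~= \<zero>" "a \<oplus> b ~= \<zero>" for a b
  using V.v_add_B[of a b] that A0_A by (auto simp: min_def zdiv_mono1 split: if_splits)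
 show "\<exists>c. a \<ominus> cst c \<otimes> b = \<zero> \<or> v a div 2 < v (a \<ominus> cst c \<otimes> b) div 2"
  if ab: "a \<in> A0" "b \<in> A0" "a ~= \<zero>" "b ~= \<zero>" "v a div 2 = v b div 2" for a b
 proof -
  have ev: "even (v a)" "even (v b)" using ab invariant_even_A A0_A A0_\<sigma> by auto
  hence "v a = v b" using ab(5) by (metis dvd_div_eq_cancel dvd_div_mult_self)
  then obtain c where c: "a \<ominus> cst c \<otimes> b = \<zero> \<or> v a < v (a \<ominus> cst c \<otimes> b)" using V.v_residue_B[of a b] ab A0_A by auto
  have "v a div 2 < v z div 2" if "v a < v z" "even (v z)" for z using ev that by (auto elim!: evenE)
  moreover have "even (v (a \<ominus> cst c \<otimes> b))" if "a \<ominus> cst c \<otimes> b ~= \<zero>"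
   using ab A0_A A0_\<sigma> that by (intro invariant_even_A) (simp_all add: \<sigma>_minus \<sigma>_mult)
  ultimately show ?thesis using c by (cases "a \<ominus> cst c \<otimes> b = \<zero>") blast+
 qed
 show "v (cst c) div 2 = 0" if "c ~= 0" for c using V.v_cst[OF that] by simp
 show "\<exists>b\<in>A0 - {\<zero>}. v b div 2 = n" for n
 proof -
  obtain a where a: "a \<in> A" "a ~= \<zero>" "v a = 2 * n" by (rule V.exists_B_exact)
  have "even_part a \<in> A0" using a parts[of a] parts_A by (intro A0_I) auto
  moreover have "even_part a ~= \<zero>" "v (even_part a) = v a" using parity_even[OF a(1,2)] a(3) by auto
  ultimately show ?thesis using a(3) by (intro bexI[of _ "even_part a"]) auto
 qed
qed

end

context double_cover
begin

declare L_carr [simp del, rule del]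

lemma two_places_A0: "two_places K cst A0 (%x. v x div 2) (%x. w x div 2) (l \<otimes> l)"
proof (intro two_places.intro two_places_axioms.intro)
 show "affine_ring K cst A0" by (rule A0_ring)
 show "place K cst A0 (%x. v x div 2)" by (rule place_A0)
 show "place K cst A0 (%x. w x div 2)" using double_cover.place_A0[OF swap_cover] unfolding double_cover.A0_def[OF swap_cover] A0_def .
 show "v b div 2 + w b div 2 \<le> 0" if "b \<in> A0" "b ~= \<zero>" for b using v_plus_w[of b] A0_A that by auto
 show ll: "l \<otimes> l \<in> A0" by (rule A0_I) (simp_all add: \<sigma>_mult \<sigma>_l l_minus r_minus)
 show "l \<otimes> l ~= \<zero>" by simp
 have "inv (l \<otimes> l) = inv l \<otimes> inv l" using divide_mult[of \<one> l \<one> l] by simp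
 hence "inv (l \<otimes> l) \<in> A" by simp
 moreover have "\<sigma> (inv (l \<otimes> l)) = inv (l \<otimes> l)" using \<sigma>_inv[of "l \<otimes> l"] A0_\<sigma>[OF ll] by simp
 ultimately show "inv (l \<otimes> l) \<in> A0" by (rule A0_I)
 show "0 < v (l \<otimes> l) div 2" using V.v_mult[of l l] v_l by simp
qed

sublocale Y: two_places K cst A0 "%x. v x div 2" "%x. w x div 2" "l \<otimes> l" by (rule two_places_A0)

abbreviation L0 :: "'a set" where "L0 \<equiv> quotients K A0"
abbreviation loc0 :: "'a set => 'a set" where "loc0 N \<equiv> local_ring_at K A0 N"

lemma L0_iff: "x \<in> L0 \<longleftrightarrow> x \<in> carrier K \<and> \<sigma> x = x" unfolding quotients_A0 by simp

lemma YF0: "Y.V.F 0 = V.F 0 \<inter> L0" unfolding Y.V.F_def V.F_def K_eq using L0_iff by (auto simp: pos_imp_zdiv_nonneg_iff)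

lemma YW0: "Y.W.F 0 = W.F 0 \<inter> L0" unfolding Y.W.F_def W.F_def K_eq using L0_iff by (auto simp: pos_imp_zdiv_nonneg_iff)

lemma restrict_max_id: assumes M: "max_id M" shows "Y.max_id (M \<inter> A0)" unfolding Y.max_id_def Y.ideal_of_B_def
proof (intro conjI ballI)
 fix b assume b: "b \<in> A0 - M \<inter> A0"
 hence bA: "b \<in> A" "b \<notin> M" "b \<in> A0" using A0_A by auto
 obtain c where c: "b \<ominus> cst c \<in> M" using residue_field[OF M bA(1)] by blast
 have c0: "c ~= 0" using c bA(2) B_carr[OF bA(1)] by (auto simp: a_minus_def)
 have "\<one> \<ominus> b \<otimes> cst (inverse c) = cst c \<otimes> cst (inverse c) \<ominus> b \<otimes> cst (inverse c)" using c0 by (simp flip: cst_mult)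
 also have "\<dots> = \<ominus> ((b \<ominus> cst c) \<otimes> cst (inverse c))" using B_carr[OF bA(1)] cst_closed by algebra
 finally have "\<one> \<ominus> b \<otimes> cst (inverse c) \<in> M" using max_id_D(6)[OF M max_id_D(4)[OF M c cst_B]] by simp
 moreover have "\<one> \<ominus> b \<otimes> cst (inverse c) \<in> A0" using bA(3) Y.cst_B Y.B_one by (intro Y.B_minus Y.B_mult)
 ultimately show "\<exists>c\<in>A0. \<one> \<ominus> b \<otimes> c \<in> M \<inter> A0" using Y.cst_B by blast
qed (use max_id_D[OF M] A0_A in \<open>auto intro: Y.B_add Y.B_mult\<close>)

definition \<sigma>M :: "'a set => 'a set" where "\<sigma>M M = {a \<in> A. \<sigma> a \<in> M}"

lemma \<sigma>M_max_id: assumes M: "max_id M" shows "max_id (\<sigma>M M)" unfolding max_id_def ideal_of_B_def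
proof (intro conjI ballI)
 fix b assume b: "b \<in> A - \<sigma>M M"
 hence sb: "\<sigma> b \<in> A" "\<sigma> b \<notin> M" unfolding \<sigma>M_def by auto
 obtain c where c: "c \<in> A" "\<one> \<ominus> \<sigma> b \<otimes> c \<in> M" by (rule max_id_inverse[OF M sb])
 have "\<sigma> (\<one> \<ominus> b \<otimes> \<sigma> c) = \<one> \<ominus> \<sigma> b \<otimes> c" using b c(1) by (simp add: \<sigma>_minus \<sigma>_mult)
 hence "\<one> \<ominus> b \<otimes> \<sigma> c \<in> \<sigma>M M" unfolding \<sigma>M_def using b c by simp
 thus "\<exists>c\<in>A. \<one> \<ominus> b \<otimes> c \<in> \<sigma>M M" using c(1) by blast
qed (use max_id_D[OF M] in \<open>auto simp: \<sigma>M_def \<sigma>_add \<sigma>_mult\<close>)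

text \<open>Some \<open>l - c\<close> lies in \<open>M\<close> and \<open>- l - c\<close> in its image. If both were in \<open>M\<close>, then so would be the unit \<open>l\<close>.\<close>
lemma \<sigma>M_distinct: assumes M: "max_id M" shows "\<sigma>M M ~= M"
proof
 assume eq: "\<sigma>M M = M"
 obtain c where c: "l \<ominus> cst c \<in> M" using residue_field[OF M l_B] by blast
 have "\<sigma> (l \<ominus> cst c) \<in> M" using c eq unfolding \<sigma>M_def by blast
 hence "\<ominus> l \<ominus> cst c \<in> M" by (simp add: \<sigma>_minus \<sigma>_l)
 hence "(l \<ominus> cst c) \<ominus> (\<ominus> l \<ominus> cst c) \<in> M" by (rule max_id_D(7)[OF M c])
 moreover have "(l \<ominus> cst c) \<ominus> (\<ominus> l \<ominus> cst c) = l \<oplus> l" using B_carr[OF l_B] cst_closed by algebra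
 ultimately have "cst (1/2) \<otimes> (l \<oplus> l) \<in> M" using max_id_D(5)[OF M] cst_B by simp
 hence "l \<in> M" using half[OF B_carr[OF l_B]] by simp
 hence "l \<otimes> inv l \<in> M" by (rule max_id_D(4)[OF M _ inv_l_B])
 thus False using max_id_D(8)[OF M] by simp
qed

lemma avoid_two:
 assumes M: "max_id M" and N: "max_id N" and J: "ideal_of_B J" and "\<not> J \<subseteq> M" "\<not> J \<subseteq> N"
 shows "\<exists>s\<in>J. s \<notin> M \<and> s \<notin> N"
proof (rule ccontr)
 assume no: "\<not> (\<exists>s\<in>J. s \<notin> M \<and> s \<notin> N)"
 obtain s t where st: "s \<in> J" "s \<notin> M" "t \<in> J" "t \<notin> N" using assms by blast
 hence st': "s \<in> N" "t \<in> M" using no by blast+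
 have stB: "s \<in> carrier K" "t \<in> carrier K" using st ideal_of_B_D(1)[OF J] by auto
 have "s \<oplus> t \<in> J" using st ideal_of_B_D(3)[OF J] by blast
 then consider "s \<oplus> t \<in> M" | "s \<oplus> t \<in> N" using no by blast
 thus False
 proof cases
  case 1
  hence "(s \<oplus> t) \<ominus> t \<in> M" using st'(2) by (rule max_id_D(7)[OF M])
  moreover have "(s \<oplus> t) \<ominus> t = s" using stB by algebra
  ultimately show False using st(2) by simp
 next
  case 2
  hence "(s \<oplus> t) \<ominus> s \<in> N" using st'(1) by (rule max_id_D(7)[OF N])
  moreover have "(s \<oplus> t) \<ominus> s = t" using stB by algebra
  ultimately show False using st(4) by simp
 qed
qed

text \<open>Otherwise prime avoidance gives an element of \<open>M'\<close> outside \<open>M\<close> and its image, and the norm of this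
 element lies in \<open>M'\<close> but not in \<open>M\<close>, although it is invariant.\<close>
lemma fibre_max_id:
 assumes M: "max_id M" and M': "max_id M'" and eq: "M \<inter> A0 = M' \<inter> A0"
 shows "M' = M \<or> M' = \<sigma>M M"
proof (rule ccontr)
 assume no: "\<not> (M' = M \<or> M' = \<sigma>M M)"
 note sM = \<sigma>M_max_id[OF M]
 have "\<not> M' \<subseteq> M" "\<not> M' \<subseteq> \<sigma>M M" using no max_id_maximal[OF M'] M sM by blast+
 then obtain s where s: "s \<in> M'" "s \<notin> M" "s \<notin> \<sigma>M M" using avoid_two[OF M sM max_id_D(9)[OF M']] by blast
 have sA: "s \<in> A" using max_id_D(1)[OF M' s(1)] .
 have "s \<otimes> \<sigma> s \<in> A0" using sA by (intro A0_I) (simp_all add: \<sigma>_mult m_comm)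
 moreover have "s \<otimes> \<sigma> s \<in> M'" using max_id_D(4)[OF M' s(1) \<sigma>_A[OF sA]] .
 ultimately have "s \<otimes> \<sigma> s \<in> M" using eq by blast
 hence "s \<in> M \<or> \<sigma> s \<in> M" using max_id_prime[OF M sA] sA by blast
 thus False using s sA unfolding \<sigma>M_def by blast
qed

lemma restrict_loc: assumes M: "max_id M" shows "loc M \<inter> L0 = loc0 (M \<inter> A0)"
proof (intro equalityI subsetI)
 note N = restrict_max_id[OF M]
 fix x assume x: "x \<in> loc M \<inter> L0"
 hence xc: "x \<in> carrier K" "\<sigma> x = x" using L0_iff by auto
 let ?J = "{s \<in> A. x \<otimes> s \<in> A}"
 have J: "ideal_of_B ?J" by (rule ideal_of_denominators[OF xc(1)])
 obtain s where s: "s \<in> A - M" "x \<otimes> s \<in> A" using x loc_iff[OF M xc(1)] by blast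
 have "\<sigma> (x \<otimes> s) \<in> A" using s by blast
 moreover have "\<sigma> (x \<otimes> s) = x \<otimes> \<sigma> s" using s(1) xc by (simp add: \<sigma>_mult)
 ultimately have "\<sigma> s \<in> ?J" using s(1) by simp
 moreover have "\<sigma> s \<notin> \<sigma>M M" using s unfolding \<sigma>M_def by auto
 ultimately have "\<not> ?J \<subseteq> \<sigma>M M" by blast
 moreover have "\<not> ?J \<subseteq> M" using s by blast
 ultimately obtain t where t: "t \<in> ?J" "t \<notin> M" "t \<notin> \<sigma>M M" using avoid_two[OF M \<sigma>M_max_id[OF M] J] by blast
 have tA: "t \<in> A" "\<sigma> t \<in> A" "\<sigma> t \<notin> M" using t unfolding \<sigma>M_def by auto
 have d: "t \<otimes> \<sigma> t \<in> A0" using tA by (intro A0_I) (simp_all add: \<sigma>_mult m_comm)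
 have "t \<otimes> \<sigma> t \<notin> M" using max_id_compl_mult[OF M, of t "\<sigma> t"] tA t(2) by blast
 moreover have "x \<otimes> (t \<otimes> \<sigma> t) \<in> A0"
 proof (rule A0_I)
  have "x \<otimes> (t \<otimes> \<sigma> t) = (x \<otimes> t) \<otimes> \<sigma> t" using xc tA by (simp add: m_assoc)
  thus "x \<otimes> (t \<otimes> \<sigma> t) \<in> A" using t(1) tA by simp
  show "\<sigma> (x \<otimes> (t \<otimes> \<sigma> t)) = x \<otimes> (t \<otimes> \<sigma> t)" using xc tA by (simp add: \<sigma>_mult m_comm)
 qed
 ultimately show "x \<in> loc0 (M \<inter> A0)" using Y.loc_iff[OF N xc(1)] d by blast
next
 note N = restrict_max_id[OF M]
 fix x assume x: "x \<in> loc0 (M \<inter> A0)"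
 hence xL: "x \<in> L0" by (rule Y.loc_L[OF N])
 hence xc: "x \<in> carrier K" using L0_iff by blast
 obtain s where "s \<in> A0 - M \<inter> A0" "x \<otimes> s \<in> A0" using x Y.loc_iff[OF N xc] by blast
 hence "x \<in> loc M" using loc_iff[OF M xc] A0_A by blast
 thus "x \<in> loc M \<inter> L0" using xL by blast
qed

lemma point_cases:
 assumes "x \<in> X"
 obtains M where "max_id M" "x = loc M" | "x = V.F 0" | "x = W.F 0" using assms unfolding X_eq Spec_eq by blast

lemma restrict_point: assumes "x \<in> X" shows "x \<inter> L0 \<in> Y.X" using assms
proof (cases rule: point_cases)
 case (1 M)
 thus ?thesis unfolding 1(2) restrict_loc[OF 1(1)] Y.X_eq Y.Spec_eq using restrict_max_id by blast
next
 case 2 thus ?thesis unfolding Y.X_eq YF0 by blast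
next
 case 3 thus ?thesis unfolding Y.X_eq YW0 by blast
qed

lemma dominates_restrict: "dominates K x (x \<inter> L0)" unfolding dominates_def max_ideal_def using Y.L_inv by auto

lemma dominated_unique:
 assumes x: "x \<in> X" and y: "y \<in> Y.X" "dominates K x y" shows "y = x \<inter> L0"
proof (rule Y.point_eqI[OF y(1) restrict_point[OF x]])
 have d: "y \<subseteq> x" "max_ideal K y = max_ideal K x \<inter> y" using y(2) unfolding dominates_def by auto
 show s: "y \<subseteq> x \<inter> L0" using d(1) Y.point_L[OF y(1)] by blast
 have "max_ideal K (x \<inter> L0) = max_ideal K x \<inter> (x \<inter> L0)" using dominates_restrict[of x] unfolding dominates_def by blast
 thus "max_ideal K y = max_ideal K (x \<inter> L0) \<inter> y" using d s by blast
qed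

lemma dual_map_eq: assumes "x \<in> X" shows "dual_map K (range cst) A0 x = x \<inter> L0" unfolding dual_map_def
proof (rule the_equality)
 show "x \<inter> L0 \<in> Y.X \<and> dominates K x (x \<inter> L0)" using restrict_point[OF assms] dominates_restrict by blast
 show "y = x \<inter> L0" if "y \<in> Y.X \<and> dominates K x y" for y using dominated_unique[OF assms] that by blast
qed

lemma restrict_infinity:
 assumes x: "x \<in> X" shows "x \<inter> L0 = V.F 0 \<inter> L0 \<longleftrightarrow> x = V.F 0" "x \<inter> L0 = W.F 0 \<inter> L0 \<longleftrightarrow> x = W.F 0"
proof -
 have S: "loc M \<inter> L0 \<in> Spec K A0" if "max_id M" for M unfolding restrict_loc[OF that] Y.Spec_eq using restrict_max_id[OF that] by blast
 have ne: "V.F 0 \<inter> L0 ~= W.F 0 \<inter> L0" using Y.F0_distinct unfolding YF0 YW0 .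
 note nS = Y.infinity_not_Spec[unfolded YF0 YW0]
 show "x \<inter> L0 = V.F 0 \<inter> L0 \<longleftrightarrow> x = V.F 0" using x by (cases rule: point_cases) (use S ne nS in metis)+
 show "x \<inter> L0 = W.F 0 \<inter> L0 \<longleftrightarrow> x = W.F 0" using x by (cases rule: point_cases) (use S ne nS in metis)+
qed

lemma restrict_Spec: assumes x: "x \<in> X" and N: "Y.max_id N"
 shows "x \<inter> L0 = loc0 N \<longleftrightarrow> (\<exists>M. max_id M \<and> x = loc M \<and> M \<inter> A0 = N)"
proof
 assume eq: "x \<inter> L0 = loc0 N"
 have nS: "x \<inter> L0 \<in> Spec K A0" unfolding eq Y.Spec_eq using N by blast
 show "\<exists>M. max_id M \<and> x = loc M \<and> M \<inter> A0 = N" using x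
 proof (cases rule: point_cases)
  case (1 M)
  hence "loc0 (M \<inter> A0) = loc0 N" using eq restrict_loc by simp
  hence "M \<inter> A0 = N" using Y.loc_inj[OF restrict_max_id[OF 1(1)] N] by blast
  thus ?thesis using 1 by blast
 qed (use nS Y.infinity_not_Spec[unfolded YF0 YW0] in auto)
qed (use restrict_loc in auto)

text \<open>If an ideal \<open>N\<close> of the invariants generated the unit ideal of \<open>A\<close>, then taking invariant parts in \<open>1 = n
 + l n'\<close> would put \<open>1\<close> into \<open>N\<close>.\<close>
lemma lying_over: assumes N: "Y.max_id N" shows "\<exists>M. max_id M \<and> M \<inter> A0 = N"
proof -
 note ND = Y.max_id_D[OF N]
 have NA: "a \<in> A0" "a \<in> A" "a \<in> carrier K" "\<sigma> a = a" if "a \<in> N" for a using ND(1)[OF that] A0_A A0_\<sigma> by auto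
 let ?J = "{a \<oplus> l \<otimes> b | a b. a \<in> N \<and> b \<in> N}"
 have "ideal_of_B ?J" unfolding ideal_of_B_def
 proof (intro conjI ballI)
  show "?J \<subseteq> A" using NA by auto
  have "\<zero> = \<zero> \<oplus> l \<otimes> \<zero>" by simp
  thus "\<zero> \<in> ?J" using ND(2) by blast
 next
  fix x y assume "x \<in> ?J" "y \<in> ?J"
  then obtain a b c d where *: "x = a \<oplus> l \<otimes> b" "y = c \<oplus> l \<otimes> d" "a \<in> N" "b \<in> N" "c \<in> N" "d \<in> N" by blast
  have "x \<oplus> y = (a \<oplus> c) \<oplus> l \<otimes> (b \<oplus> d)" unfolding *(1,2)
   using NA(3)[OF *(3)] NA(3)[OF *(4)] NA(3)[OF *(5)] NA(3)[OF *(6)] B_carr[OF l_B] by algebra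
  thus "x \<oplus> y \<in> ?J" using ND(3)[OF *(3,5)] ND(3)[OF *(4,6)] by blast
 next
  fix x y assume "x \<in> ?J" "y \<in> A"
  then obtain a b where *: "x = a \<oplus> l \<otimes> b" "a \<in> N" "b \<in> N" by blast
  have yc: "y \<in> carrier K" using \<open>y \<in> A\<close> by simp
  define e o' where "e = even_part y" and "o' = inv l \<otimes> odd_part y"
  have eA: "e \<in> A0" unfolding e_def using parts[OF yc] parts_A(1)[OF \<open>y \<in> A\<close>] by (intro A0_I) auto
  have \<sigma>il: "\<sigma> (inv l) = \<ominus> (inv l)" using double_cover.\<sigma>_l[OF swap_cover] .
  have oA: "o' \<in> A0" unfolding o'_def using parts[OF yc] parts_A(2)[OF \<open>y \<in> A\<close>] by (intro A0_I) (simp_all add: \<sigma>_mult \<sigma>il l_minus r_minus)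
  have "l \<otimes> o' = odd_part y" unfolding o'_def using parts(2)[OF yc] by (simp flip: m_assoc)
  hence y: "y = e \<oplus> l \<otimes> o'" unfolding e_def using parts(3)[OF yc] by simp
  have "x \<otimes> y = (a \<otimes> e \<oplus> b \<otimes> ((l \<otimes> l) \<otimes> o')) \<oplus> l \<otimes> (a \<otimes> o' \<oplus> b \<otimes> e)" unfolding *(1) y
   using NA(3)[OF *(2)] NA(3)[OF *(3)] Y.B_carr[OF eA] Y.B_carr[OF oA] B_carr[OF l_B] by algebra
  moreover have "a \<otimes> e \<oplus> b \<otimes> ((l \<otimes> l) \<otimes> o') \<in> N" "a \<otimes> o' \<oplus> b \<otimes> e \<in> N"
   using ND(4)[OF *(2)] ND(4)[OF *(3)] eA oA Y.B_mult[OF Y.l_B oA] by (simp_all add: ND(3))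
  ultimately show "x \<otimes> y \<in> ?J" by blast
 qed
 moreover have "\<one> \<notin> ?J"
 proof
  assume "\<one> \<in> ?J"
  then obtain a b where *: "\<one> = a \<oplus> l \<otimes> b" "a \<in> N" "b \<in> N" by blast
  have "even_part (a \<oplus> l \<otimes> b) = a" using *(2,3) NA by (intro even_part_add_antiinvariant) (simp_all add: \<sigma>_mult \<sigma>_l l_minus)
  moreover have "even_part \<one> = \<one>" unfolding even_part_def using half[OF one_closed] by simp
  ultimately show False using * ND(8) by simp
 qed
 ultimately obtain M where M: "max_id M" "?J \<subseteq> M" by (rule exists_max_id)
 have "N \<subseteq> M \<inter> A0"
 proof
  fix a assume a: "a \<in> N"
  hence "a = a \<oplus> l \<otimes> \<zero>" using NA by simp
  hence "a \<in> ?J" using a ND(2) by blast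
  thus "a \<in> M \<inter> A0" using M(2) NA(1)[OF a] by blast
 qed
 thus ?thesis using Y.max_id_maximal[OF N restrict_max_id[OF M(1)]] M(1) by blast
qed

lemma surj_points: assumes "y \<in> Y.X" shows "\<exists>x\<in>X. x \<inter> L0 = y"
proof -
 consider N where "Y.max_id N" "y = loc0 N" | "y = V.F 0 \<inter> L0" | "y = W.F 0 \<inter> L0" using assms unfolding Y.X_eq Y.Spec_eq YF0 YW0 by blast
 thus ?thesis
 proof cases
  case 1
  then obtain M where M: "max_id M" "M \<inter> A0 = N" using lying_over by blast
  have "loc M \<in> X" unfolding X_eq Spec_eq using M by blast
  thus ?thesis using restrict_loc[OF M(1)] M(2) 1 by blast
 qed (auto simp: X_eq)
qed

end

context double_cover
begin

definition \<mu> :: "'a set => 'a set" where "\<mu> x = {a \<in> carrier K. \<sigma> a \<in> x}"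

lemma \<mu>_loc: assumes M: "max_id M" shows "\<mu> (loc M) = loc (\<sigma>M M)"
proof (rule Set.set_eqI)
 fix a
 note sM = \<sigma>M_max_id[OF M]
 have "(\<exists>s\<in>A - M. \<sigma> a \<otimes> s \<in> A) \<longleftrightarrow> (\<exists>s\<in>A - \<sigma>M M. a \<otimes> s \<in> A)" if a: "a \<in> carrier K"
 proof
  assume "\<exists>s\<in>A - M. \<sigma> a \<otimes> s \<in> A"
  then obtain s where s: "s \<in> A" "s \<notin> M" "\<sigma> a \<otimes> s \<in> A" by blast
  have "\<sigma> (\<sigma> a \<otimes> s) = a \<otimes> \<sigma> s" using a s(1) by (simp add: \<sigma>_mult)
  hence "a \<otimes> \<sigma> s \<in> A" using \<sigma>_A[OF s(3)] by simp
  moreover have "\<sigma> s \<in> A - \<sigma>M M" unfolding \<sigma>M_def using s(1,2) by simp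
  ultimately show "\<exists>s\<in>A - \<sigma>M M. a \<otimes> s \<in> A" by blast
 next
  assume "\<exists>s\<in>A - \<sigma>M M. a \<otimes> s \<in> A"
  then obtain s where s: "s \<in> A" "s \<notin> \<sigma>M M" "a \<otimes> s \<in> A" by blast
  have "\<sigma> (a \<otimes> s) = \<sigma> a \<otimes> \<sigma> s" using a s(1) by (simp add: \<sigma>_mult)
  hence "\<sigma> a \<otimes> \<sigma> s \<in> A" using \<sigma>_A[OF s(3)] by simp
  moreover have "\<sigma> s \<in> A - M" using s(1,2) unfolding \<sigma>M_def by simp
  ultimately show "\<exists>s\<in>A - M. \<sigma> a \<otimes> s \<in> A" by blast
 qed
 thus "a \<in> \<mu> (loc M) \<longleftrightarrow> a \<in> loc (\<sigma>M M)" using loc_iff[OF M, of "\<sigma> a"] loc_iff[OF sM, of a] loc_L[OF sM, of a] \<sigma>_closed[of a]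
  unfolding \<mu>_def K_eq by blast
qed

lemma \<mu>_V: "\<mu> (V.F 0) = V.F 0" using F_\<sigma>[of _ 0] V.F_carr \<sigma>_\<sigma> unfolding \<mu>_def by force

lemma \<mu>_W: "\<mu> (W.F 0) = W.F 0" using double_cover.\<mu>_V[OF swap_cover] unfolding double_cover.\<mu>_def[OF swap_cover] \<mu>_def .

lemma \<mu>_point: assumes "x \<in> X" shows "\<mu> x \<in> X" using assms
proof (cases rule: point_cases)
 case (1 M)
 thus ?thesis unfolding 1(2) \<mu>_loc[OF 1(1)] X_eq Spec_eq using \<sigma>M_max_id by blast
qed (simp_all add: \<mu>_V \<mu>_W X_eq)

lemma point_carr: "x \<in> X ==> a \<in> x ==> a \<in> carrier K" using point_L[of x a] by simp

lemma \<mu>_\<mu>: "x \<in> X ==> \<mu> (\<mu> x) = x" unfolding \<mu>_def using point_carr by auto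

lemma \<mu>_restrict: "\<mu> x \<inter> L0 = x \<inter> L0" unfolding \<mu>_def using L0_iff by auto

lemma fibre: assumes x: "x \<in> X" shows "{x' \<in> X. x' \<inter> L0 = x \<inter> L0} = {x, \<mu> x}"
proof (intro equalityI subsetI)
 fix x' assume "x' \<in> {x' \<in> X. x' \<inter> L0 = x \<inter> L0}"
 hence x': "x' \<in> X" "x' \<inter> L0 = x \<inter> L0" by auto
 show "x' \<in> {x, \<mu> x}" using x
 proof (cases rule: point_cases)
  case (1 M)
  hence "x' \<inter> L0 = loc0 (M \<inter> A0)" using x' restrict_loc by simp
  then obtain M' where "max_id M'" "x' = loc M'" "M' \<inter> A0 = M \<inter> A0" using restrict_Spec[OF x'(1) restrict_max_id[OF 1(1)]] by blast
  thus ?thesis using fibre_max_id[OF 1(1), of M'] \<mu>_loc[OF 1(1)] 1(2) by auto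
 next
  case 2 thus ?thesis using restrict_infinity(1)[OF x'(1)] x'(2) by simp
 next
  case 3 thus ?thesis using restrict_infinity(2)[OF x'(1)] x'(2) by simp
 qed
qed (use x \<mu>_point \<mu>_restrict in auto)

lemma \<mu>_fixed: assumes x: "x \<in> X" shows "\<mu> x = x \<longleftrightarrow> x \<in> {V.F 0, W.F 0}" using x
proof (cases rule: point_cases)
 case (1 M)
 have "loc (\<sigma>M M) ~= loc M" using loc_inj[OF \<sigma>M_max_id[OF 1(1)] 1(1)] \<sigma>M_distinct[OF 1(1)] by blast
 moreover have "loc M \<in> Spec K A" unfolding Spec_eq using 1(1) by blast
 hence "loc M ~= V.F 0" "loc M ~= W.F 0" using infinity_not_Spec by metis+
 ultimately show ?thesis unfolding 1(2) \<mu>_loc[OF 1(1)] by simp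
qed (simp_all add: \<mu>_V \<mu>_W)

lemma point_ring: assumes "x \<in> X" shows "affine_ring K cst x"
proof (intro affine_ring.intro affine_ring_axioms.intro)
 show "field_over_complex K cst" by unfold_locales
 note s = subspace_D[OF point_subspace[OF assms]]
 have "\<one> \<in> x \<and> (\<forall>a\<in>x. \<forall>b\<in>x. a \<otimes> b \<in> x) \<and> (\<forall>c. cst c \<in> x)" using assms
 proof (cases rule: point_cases)
  case (1 M)
  thus ?thesis using B_loc[OF 1(1)] loc_mult[OF 1(1)] by auto
 next
  case 2
  thus ?thesis using V.F_cst[of 1] V.F_mult[of _ 0 _ 0] by auto
 next
  case 3
  thus ?thesis using W.F_cst[of 1] W.F_mult[of _ 0 _ 0] by auto
 qed
 hence m: "\<one> \<in> x" "!!a b. a \<in> x ==> b \<in> x ==> a \<otimes> b \<in> x" "!!c. cst c \<in> x" by blast+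
 show "subring x K" by (rule subringI) (use m s point_carr[OF assms] in auto)
 show "cst c \<in> x" for c by (rule m(3))
qed

abbreviation stalk :: "'a set => 'a set" where "stalk y \<equiv> direct_image_stalk K (range cst) A A0 y"

lemma stalk_eq: "stalk y = {a \<in> carrier K. \<forall>x\<in>X. x \<inter> L0 = y \<longrightarrow> a \<in> x}" unfolding direct_image_stalk_def K_eq using dual_map_eq by auto

text \<open>The decomposition into invariant and anti-invariant parts: the second is generated by any anti-invariant
 \<open>\<tau>\<close> that divides all of it.\<close>
lemma free_of_rank_2:
 assumes E: "affine_ring K cst E" "!!a. a \<in> E ==> \<sigma> a \<in> E" and y: "E \<inter> L0 = y"
  and \<tau>: "\<tau> \<in> E" "\<tau> ~= \<zero>" "\<sigma> \<tau> = \<ominus> \<tau>" "!!a. a \<in> E ==> odd_part a \<otimes> inv \<tau> \<in> E"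
 shows "free_of_rank K 2 y E"
proof -
 interpret E: affine_ring K cst E by (rule E(1))
 define e where "e i = (if i = 0 then \<one> else \<tau>)" for i :: nat
 have \<tau>c: "\<tau> \<in> carrier K" using \<tau>(1) by (rule E.B_carr)
 have yE: "a \<in> E" "a \<in> carrier K" "\<sigma> a = a" if "a \<in> y" for a using that y L0_iff E.B_carr by auto
 have sum: "(\<Oplus>i\<in>{..<2}. c i \<otimes> e i) = c 0 \<oplus> c 1 \<otimes> \<tau>" if "c \<in> {..<2} \<rightarrow>\<^sub>E y" for c
 proof -
  have c: "c 0 \<in> carrier K" "c 1 \<in> carrier K" using that yE(2) by (auto simp: PiE_iff)
  have "{..<2::nat} = insert 0 {1}" by auto
  hence "(\<Oplus>i\<in>{..<2}. c i \<otimes> e i) = (\<Oplus>i\<in>insert 0 {1}. c i \<otimes> e i)" by simp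
  also have "\<dots> = c 0 \<otimes> e 0 \<oplus> (\<Oplus>i\<in>{1}. c i \<otimes> e i)" using c \<tau>c unfolding e_def by (intro finsum_insert) auto
  also have "(\<Oplus>i\<in>{1}. c i \<otimes> e i) = c 1 \<otimes> e 1" using c \<tau>c finsum_insert[of "{}" 1 "%i. c i \<otimes> e i"] unfolding e_def by simp
  finally show ?thesis using c unfolding e_def by simp
 qed
 have even: "even_part (a \<oplus> b \<otimes> \<tau>) = a" if "a \<in> y" "b \<in> y" for a b using yE[OF that(1)] yE[OF that(2)] \<tau>c \<tau>(3)
  by (intro even_part_add_antiinvariant) (simp_all add: \<sigma>_mult r_minus)
 let ?f = "%c. \<Oplus>i\<in>{..<2}. c i \<otimes> e i"
 have "bij_betw ?f ({..<2} \<rightarrow>\<^sub>E y) E"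
 proof (rule bij_betw_imageI)
  show "inj_on ?f ({..<2} \<rightarrow>\<^sub>E y)"
  proof (rule inj_onI)
   fix c d assume c: "c \<in> {..<2} \<rightarrow>\<^sub>E y" and d: "d \<in> {..<2} \<rightarrow>\<^sub>E y" and eq: "?f c = ?f d"
   have cy: "c 0 \<in> y" "c 1 \<in> y" "d 0 \<in> y" "d 1 \<in> y" using c d by (auto simp: PiE_iff)
   have eq': "c 0 \<oplus> c 1 \<otimes> \<tau> = d 0 \<oplus> d 1 \<otimes> \<tau>" using eq sum[OF c] sum[OF d] by simp
   hence 0: "c 0 = d 0" using even[OF cy(1,2)] even[OF cy(3,4)] by simp
   hence "c 1 \<otimes> \<tau> = d 1 \<otimes> \<tau>" using eq' cy yE(2) \<tau>c by simp
   hence "c 1 = d 1" using m_rcancel[of \<tau> "c 1" "d 1"] \<tau>c \<tau>(2) cy yE(2) by simp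
   thus "c = d" using c d 0 by (intro PiE_ext[OF c d]) (auto simp: less_2_cases_iff)
  qed
  show "?f ` ({..<2} \<rightarrow>\<^sub>E y) = E"
  proof (intro equalityI subsetI)
   fix a assume "a \<in> ?f ` ({..<2} \<rightarrow>\<^sub>E y)"
   then obtain c where c: "c \<in> {..<2} \<rightarrow>\<^sub>E y" "a = ?f c" by blast
   hence "c 0 \<in> E" "c 1 \<in> E" using yE(1) by (auto simp: PiE_iff)
   thus "a \<in> E" unfolding c(2) sum[OF c(1)] using \<tau>(1) by blast
  next
   fix a assume a: "a \<in> E"
   have ac: "a \<in> carrier K" using a by (rule E.B_carr)
   define c where "c i = (if i = 0 then even_part a else if i = 1 then odd_part a \<otimes> inv \<tau> else undefined)" for i :: nat
   have "even_part a \<in> E" unfolding even_part_def using a E(2) by blast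
   hence "even_part a \<in> y" using y L0_iff parts[OF ac] by blast
   moreover have "odd_part a \<otimes> inv \<tau> \<in> y"
   proof -
    have "\<sigma> (odd_part a \<otimes> inv \<tau>) = (\<ominus> odd_part a) \<otimes> inv (\<ominus> \<tau>)" using parts[OF ac] \<tau>c \<tau>(2,3) by (simp add: \<sigma>_mult \<sigma>_inv)
    also have "inv (\<ominus> \<tau>) = \<ominus> (inv \<tau>)"
    proof -
     have "(\<ominus> (inv \<tau>)) \<otimes> (\<ominus> \<tau>) = \<one>" using \<tau>c \<tau>(2) by (simp add: l_minus r_minus)
     moreover have "\<ominus> \<tau> ~= \<zero>" using \<tau>c \<tau>(2) by (metis minus_minus minus_zero)
     ultimately show ?thesis using eq_divide[of \<one> "\<ominus> \<tau>" "\<ominus> (inv \<tau>)"] \<tau>c \<tau>(2) by simp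
    qed
    finally have "\<sigma> (odd_part a \<otimes> inv \<tau>) = odd_part a \<otimes> inv \<tau>" using parts(2)[OF ac] \<tau>c \<tau>(2) by (simp add: l_minus r_minus)
    thus ?thesis using \<tau>(4)[OF a] y L0_iff E.B_carr by blast
   qed
   ultimately have c: "c \<in> {..<2} \<rightarrow>\<^sub>E y" unfolding c_def by (auto simp: PiE_iff extensional_def)
   have "?f c = even_part a \<oplus> (odd_part a \<otimes> inv \<tau>) \<otimes> \<tau>" unfolding sum[OF c] unfolding c_def by simp
   also have "\<dots> = a" using parts[OF ac] \<tau>c \<tau>(2) by (simp add: m_assoc)
   finally show "a \<in> ?f ` ({..<2} \<rightarrow>\<^sub>E y)" using c by blast
  qed
 qed
 moreover have "e i \<in> E" for i unfolding e_def using \<tau>(1) by simp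
 ultimately show ?thesis unfolding free_of_rank_def by blast
qed

text \<open>The invariant part of a function regular on the fibre over \<open>y\<close> is regular at \<open>y\<close>; existence of a point
 in the fibre enters here.\<close>
lemma stalk_ring: assumes "y \<in> Y.X"
 shows "affine_ring K cst (stalk y)" "!!a. a \<in> stalk y ==> \<sigma> a \<in> stalk y" "stalk y \<inter> L0 = y"
proof -
 show "affine_ring K cst (stalk y)"
 proof (intro affine_ring.intro affine_ring_axioms.intro)
  show "field_over_complex K cst" by unfold_locales
  note * = affine_ring.B_one[OF point_ring] affine_ring.B_add[OF point_ring]
   affine_ring.B_mult[OF point_ring] affine_ring.B_uminus[OF point_ring]
  show "subring (stalk y) K" by (rule subringI) (auto simp: stalk_eq intro: *)
  show "cst c \<in> stalk y" for c using affine_ring.cst_B[OF point_ring] by (simp add: stalk_eq)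
 qed
 show "\<sigma> a \<in> stalk y" if a: "a \<in> stalk y" for a unfolding stalk_eq
 proof (intro CollectI conjI ballI impI)
  show "\<sigma> a \<in> carrier K" using a unfolding stalk_eq by auto
  fix x assume x: "x \<in> X" "x \<inter> L0 = y"
  hence "a \<in> \<mu> x" using a \<mu>_point[OF x(1)] \<mu>_restrict[of x] unfolding stalk_eq by auto
  thus "\<sigma> a \<in> x" unfolding \<mu>_def by blast
 qed
 obtain x where "x \<in> X" "x \<inter> L0 = y" using surj_points[OF assms] by blast
 thus "stalk y \<inter> L0 = y" unfolding stalk_eq using L0_iff by auto
qed

lemma antiinvariant_parameter: obtains \<tau> where "\<tau> \<in> carrier K" "\<tau> ~= \<zero>" "\<sigma> \<tau> = \<ominus> \<tau>" "v \<tau> = 1"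
proof -
 obtain a where a: "a \<in> A" "a ~= \<zero>" "v a = 1" by (rule V.exists_B_exact)
 have "odd_part a ~= \<zero>" "v (odd_part a) = 1" using parity_odd[OF a(1,2)] a(3) by auto
 thus ?thesis using that parts[OF B_carr[OF a(1)]] by blast
qed

lemma antiinvariant_odd: assumes x: "x \<in> carrier K" "x ~= \<zero>" "\<sigma> x = \<ominus> x" shows "odd (v x)"
proof -
 have "\<sigma> (x \<otimes> l) = x \<otimes> l" using x by (simp add: \<sigma>_mult \<sigma>_l l_minus r_minus)
 hence "even (v (x \<otimes> l))" using x by (intro invariant_even) auto
 thus ?thesis using V.v_mult[of x l] x v_l by simp
qed

lemma odd_part_F: assumes "x \<in> V.F n" shows "odd_part x \<in> V.F n"
 unfolding odd_part_def using V.F_cst_mult[OF V.F_minus[OF assms F_\<sigma>[OF assms]]] .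

text \<open>At the ramification point the generator is an anti-invariant local parameter; elsewhere the unit \<open>l\<close>
 serves.\<close>
lemma free_at_V: "free_of_rank K 2 (V.F 0 \<inter> L0) (stalk (V.F 0 \<inter> L0))"
proof -
 have VX: "V.F 0 \<in> X" unfolding X_eq by blast
 have E: "stalk (V.F 0 \<inter> L0) = V.F 0" unfolding stalk_eq using restrict_infinity(1) VX V.F_carr by auto
 have Yp: "V.F 0 \<inter> L0 \<in> Y.X" by (rule restrict_point[OF VX])
 obtain \<tau> where \<tau>: "\<tau> \<in> carrier K" "\<tau> ~= \<zero>" "\<sigma> \<tau> = \<ominus> \<tau>" "v \<tau> = 1" by (rule antiinvariant_parameter)
 show ?thesis
 proof (rule free_of_rank_2[OF stalk_ring[OF Yp], of \<tau>])
  show "\<tau> \<in> stalk (V.F 0 \<inter> L0)" unfolding E using V.F_v[of \<tau> 0] \<tau> by simp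
  fix a assume "a \<in> stalk (V.F 0 \<inter> L0)"
  hence a: "a \<in> V.F 0" unfolding E .
  have o: "odd_part a \<in> V.F 0" by (rule odd_part_F[OF a])
  show "odd_part a \<otimes> inv \<tau> \<in> stalk (V.F 0 \<inter> L0)" unfolding E
  proof (cases "odd_part a = \<zero>")
   case True thus "odd_part a \<otimes> inv \<tau> \<in> V.F 0" using \<tau> by simp
  next
   case False
   have pc: "odd_part a \<in> carrier K" "\<sigma> (odd_part a) = \<ominus> odd_part a" using parts V.F_carr[OF a] by auto
   have "odd (v (odd_part a))" using antiinvariant_odd[OF pc(1) False pc(2)] .
   moreover have "0 \<le> v (odd_part a)" using V.F_D[OF o False] .
   ultimately have "1 \<le> v (odd_part a)" by (cases "v (odd_part a) = 0") auto
   thus "odd_part a \<otimes> inv \<tau> \<in> V.F 0" using V.v_mult[of "odd_part a" "inv \<tau>"] V.v_inv[of \<tau>] pc(1) False \<tau> by (intro V.F_I) auto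
  qed
 qed (use \<tau> in auto)
qed

lemma free_at_W: "free_of_rank K 2 (W.F 0 \<inter> L0) (stalk (W.F 0 \<inter> L0))"
 using double_cover.free_at_V[OF swap_cover] unfolding double_cover.A0_def[OF swap_cover] A0_def .

lemma free_at_loc: assumes N: "Y.max_id N" shows "free_of_rank K 2 (loc0 N) (stalk (loc0 N))"
proof -
 have Yp: "loc0 N \<in> Y.X" unfolding Y.X_eq Y.Spec_eq using N by blast
 interpret E: affine_ring K cst "stalk (loc0 N)" by (rule stalk_ring(1)[OF Yp])
 have AE: "a \<in> stalk (loc0 N)" if "a \<in> A" for a
 proof -
  have "a \<in> x" if "x \<in> X" "x \<inter> L0 = loc0 N" for x using that restrict_Spec[OF that(1) N] B_loc \<open>a \<in> A\<close> by auto
  thus ?thesis unfolding stalk_eq using \<open>a \<in> A\<close> by simp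
 qed
 show ?thesis
 proof (rule free_of_rank_2[OF stalk_ring[OF Yp], of l])
  show "odd_part a \<otimes> inv l \<in> stalk (loc0 N)" if a: "a \<in> stalk (loc0 N)" for a
   unfolding odd_part_def using a stalk_ring(2)[OF Yp a] AE[OF inv_l_B] E.cst_B by (intro E.B_mult E.B_minus) auto
 qed (simp_all add: AE \<sigma>_l)
qed

theorem dual_to_double_cover: "dual_to_cover K (range cst) 2 A A0" unfolding dual_to_cover_def
proof (intro conjI ballI)
 fix x assume x: "x \<in> X"
 show "\<exists>!y. y \<in> Y.X \<and> dominates K x y" by (rule ex1I[of _ "x \<inter> L0"])
   (use restrict_point[OF x] dominates_restrict dominated_unique[OF x] in blast)+
next
 fix y assume "y \<in> Y.X"
 then consider N where "Y.max_id N" "y = loc0 N" | "y = V.F 0 \<inter> L0" | "y = W.F 0 \<inter> L0" unfolding Y.X_eq Y.Spec_eq YF0 YW0 by blast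
 thus "free_of_rank K 2 y (stalk y)" by cases (simp_all add: free_at_V free_at_W free_at_loc)
qed

text \<open>Invariant functions that vanish at \<open>V\<close> vanish to order at least two.\<close>
lemma ramified_at_V: "ramified_at K (range cst) A0 (V.F 0)"
proof -
 have VX: "V.F 0 \<in> X" unfolding X_eq by blast
 interpret R: affine_ring K cst "V.F 0" by (rule point_ring[OF VX])
 obtain \<tau> where \<tau>: "\<tau> \<in> carrier K" "\<tau> ~= \<zero>" "\<sigma> \<tau> = \<ominus> \<tau>" "v \<tau> = 1" by (rule antiinvariant_parameter)
 have "R.ideal_of_B (V.F 2)" unfolding R.ideal_of_B_def using V.F_mono[of _ 2 0] V.F_add[of _ 2] V.F_mult[of _ 2 _ 0] by auto
 hence I: "ideal (V.F 2) (K\<lparr>carrier := V.F 0\<rparr>)" using R.ideal_iff by blast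
 have "max_ideal K (V.F 0 \<inter> L0) \<subseteq> V.F 2"
 proof
  fix a assume "a \<in> max_ideal K (V.F 0 \<inter> L0)"
  hence a: "a \<in> V.F 1" "a \<in> L0" using dominates_restrict[of "V.F 0"] V.max_ideal_F0 unfolding dominates_def by blast+
  show "a \<in> V.F 2"
  proof (cases "a = \<zero>")
   case False
   have "even (v a)" using a(2) False L0_iff invariant_even by blast
   moreover have "1 \<le> v a" using V.F_D[OF a(1) False] .
   ultimately have "2 \<le> v a" by (cases "v a = 1") auto
   thus ?thesis using a(2) L0_iff by (intro V.F_I) auto
  qed simp
 qed
 hence "Idl\<^bsub>K\<lparr>carrier := V.F 0\<rparr>\<^esub> (max_ideal K (V.F 0 \<inter> L0)) \<subseteq> V.F 2" unfolding genideal_def using I by blast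
 moreover have "\<tau> \<in> V.F 1" "\<tau> \<notin> V.F 2" using V.F_v[of \<tau> 1] V.F_v[of \<tau> 2] \<tau> by simp_all
 ultimately show ?thesis unfolding ramified_at_def dual_map_eq[OF VX] V.max_ideal_F0 by blast
qed

lemma ramified_at_W: "ramified_at K (range cst) A0 (W.F 0)"
 using double_cover.ramified_at_V[OF swap_cover] unfolding double_cover.A0_def[OF swap_cover] A0_def .

text \<open>With \<open>l - c\<close> in \<open>M\<close>, the invariant \<open>(l - c) (l + c)\<close> generates the same ideal as \<open>l - c\<close> in the local
 ring, as \<open>l + c\<close> is a unit. Every element of \<open>M\<close> is an invariant element plus a multiple of \<open>l - c\<close>.\<close>
lemma unramified_at_loc: assumes M: "max_id M" shows "\<not> ramified_at K (range cst) A0 (loc M)"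
proof -
 have MX: "loc M \<in> X" unfolding X_eq Spec_eq using M by blast
 interpret R: affine_ring K cst "loc M" by (rule point_ring[OF MX])
 let ?S = "max_ideal K (loc M \<inter> L0)"
 have S: "?S = max_ideal K (loc M) \<inter> (loc M \<inter> L0)" using dominates_restrict unfolding dominates_def by blast
 obtain c where c: "l \<ominus> cst c \<in> M" using residue_field[OF M l_B] by blast
 have lc: "l \<oplus> cst c \<in> A - M"
 proof -
  have "l \<oplus> cst c \<notin> M"
  proof
   assume "l \<oplus> cst c \<in> M"
   hence "(l \<ominus> cst c) \<oplus> (l \<oplus> cst c) \<in> M" using c max_id_D(3)[OF M] by blast
   moreover have "(l \<ominus> cst c) \<oplus> (l \<oplus> cst c) = l \<oplus> l" using B_carr[OF l_B] cst_closed by algebra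
   ultimately have "cst (1/2) \<otimes> (l \<oplus> l) \<in> M" using max_id_D(5)[OF M] cst_B by simp
   hence "l \<in> M" using half[OF B_carr[OF l_B]] by simp
   hence "l \<otimes> inv l \<in> M" by (rule max_id_D(4)[OF M _ inv_l_B])
   thus False using max_id_D(8)[OF M] by simp
  qed
  thus ?thesis by simp
 qed
 have A0S: "a \<in> ?S" if "a \<in> A0" "a \<in> M" for a unfolding S using that max_ideal_loc_B[OF M] B_loc[OF M] A0_A Y.B_L by blast
 have "max_ideal K (loc M) \<subseteq> I" if I: "ideal I (K\<lparr>carrier := loc M\<rparr>)" "?S \<subseteq> I" for I
 proof
  have Ii: "R.ideal_of_B I" using I(1) R.ideal_iff by blast
  note ID = R.ideal_of_B_D[OF Ii]
  fix x assume "x \<in> max_ideal K (loc M)"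
  then obtain a s where as: "a \<in> M" "s \<in> A - M" "x = a \<otimes> inv s" unfolding max_ideal_loc[OF M] by blast
  have aA: "a \<in> A" using max_id_D(1)[OF M as(1)] .
  have ac: "a \<in> carrier K" using aA by simp
  define e o' where "e = even_part a" and "o' = inv l \<otimes> odd_part a"
  have eA: "e \<in> A0" unfolding e_def using parts[OF ac] parts_A(1)[OF aA] by (intro A0_I) auto
  have \<sigma>il: "\<sigma> (inv l) = \<ominus> (inv l)" using double_cover.\<sigma>_l[OF swap_cover] .
  have oA: "o' \<in> A0" unfolding o'_def using parts[OF ac] parts_A(2)[OF aA] by (intro A0_I) (simp_all add: \<sigma>_mult \<sigma>il l_minus r_minus)
  have "l \<otimes> o' = odd_part a" unfolding o'_def using parts(2)[OF ac] by (simp flip: m_assoc)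
  hence a: "a = e \<oplus> l \<otimes> o'" unfolding e_def using parts(3)[OF ac] by simp
  define n where "n = e \<oplus> cst c \<otimes> o'"
  have nA: "n \<in> A0" unfolding n_def using eA oA Y.cst_B by blast
  have a_eq: "a = n \<oplus> (l \<ominus> cst c) \<otimes> o'" unfolding a n_def using Y.B_carr[OF eA] Y.B_carr[OF oA] B_carr[OF l_B] cst_closed by algebra
  have "n = a \<ominus> (l \<ominus> cst c) \<otimes> o'" unfolding a n_def using Y.B_carr[OF eA] Y.B_carr[OF oA] B_carr[OF l_B] cst_closed by algebra
  hence "n \<in> M" using max_id_D(7)[OF M as(1)] max_id_D(4)[OF M c] A0_A[OF oA] by simp
  hence nI: "n \<in> I" using A0S[OF nA] I(2) by blast
  have lc0: "l \<oplus> cst c \<in> carrier K" "l \<oplus> cst c ~= \<zero>" using lc not_in_M_nonzero[OF M lc] by auto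
  have q: "(l \<ominus> cst c) \<otimes> (l \<oplus> cst c) \<in> I"
  proof -
   have "(l \<ominus> cst c) \<otimes> (l \<oplus> cst c) = l \<otimes> l \<ominus> cst c \<otimes> cst c" using B_carr[OF l_B] cst_closed by algebra
   also have "\<dots> \<in> A0" using Y.l_B Y.cst_B by blast
   finally show ?thesis using A0S max_id_D(4)[OF M c, of "l \<oplus> cst c"] lc I(2) by blast
  qed
  have il: "inv (l \<oplus> cst c) \<in> loc M" using loc_I[OF M B_one lc] lc0 by simp
  have "((l \<ominus> cst c) \<otimes> (l \<oplus> cst c)) \<otimes> inv (l \<oplus> cst c) = (l \<ominus> cst c)" using lc0 B_carr[OF l_B] by (simp add: m_assoc)
  hence "l \<ominus> cst c \<in> I" using ID(4)[OF q il] by simp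
  hence "(l \<ominus> cst c) \<otimes> o' \<in> I" using ID(4) B_loc[OF M A0_A[OF oA]] by blast
  hence "a \<in> I" unfolding a_eq using ID(3)[OF nI] by blast
  moreover have "inv s \<in> loc M" using loc_I[OF M B_one as(2)] not_in_M_nonzero[OF M as(2)] as(2) by simp
  ultimately show "x \<in> I" unfolding as(3) using ID(4) by blast
 qed
 hence "max_ideal K (loc M) \<subseteq> Idl\<^bsub>K\<lparr>carrier := loc M\<rparr>\<^esub> ?S" unfolding genideal_def by blast
 moreover have "Idl\<^bsub>K\<lparr>carrier := loc M\<rparr>\<^esub> ?S \<subseteq> max_ideal K (loc M)"
 proof -
  have "R.ideal_of_B (max_ideal K (loc M))" unfolding R.ideal_of_B_def
  proof (intro conjI ballI)
   show "max_ideal K (loc M) \<subseteq> loc M" unfolding max_ideal_def by blast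
   show "\<zero> \<in> max_ideal K (loc M)" using max_ideal_loc_B[OF M B_zero] max_id_D(2)[OF M] by blast
  next
   fix x y assume x: "x \<in> max_ideal K (loc M)"
   then obtain a s where as: "a \<in> M" "s \<in> A - M" "x = a \<otimes> inv s" unfolding max_ideal_loc[OF M] by blast
   have c1: "a \<in> carrier K" "s \<in> carrier K" "s ~= \<zero>" using max_id_D(1)[OF M as(1)] as(2) not_in_M_nonzero[OF M as(2)] by auto
   { assume "y \<in> max_ideal K (loc M)"
    then obtain b t where bt: "b \<in> M" "t \<in> A - M" "y = b \<otimes> inv t" unfolding max_ideal_loc[OF M] by blast
    have c2: "b \<in> carrier K" "t \<in> carrier K" "t ~= \<zero>" using max_id_D(1)[OF M bt(1)] bt(2) not_in_M_nonzero[OF M bt(2)] by auto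
    have "x \<oplus> y = (a \<otimes> t \<oplus> b \<otimes> s) \<otimes> inv (s \<otimes> t)" unfolding as(3) bt(3) using c1 c2 by (intro divide_add)
    moreover have "a \<otimes> t \<oplus> b \<otimes> s \<in> M" using as bt max_id_D(3,4)[OF M] by blast
    moreover have "s \<otimes> t \<in> A - M" using max_id_compl_mult[OF M as(2) bt(2)] .
    ultimately show "x \<oplus> y \<in> max_ideal K (loc M)" unfolding max_ideal_loc[OF M] by blast }
   { assume "y \<in> loc M"
    then obtain b t where bt: "b \<in> A" "t \<in> A" "t \<notin> M" "t ~= \<zero>" "y = b \<otimes> inv t" by (rule loc_E[OF M])
    have "x \<otimes> y = (a \<otimes> b) \<otimes> inv (s \<otimes> t)" unfolding as(3) bt(5) using c1 bt by (intro divide_mult) auto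
    moreover have "a \<otimes> b \<in> M" using as bt max_id_D(4)[OF M] by blast
    moreover have "s \<otimes> t \<in> A - M" using max_id_compl_mult[OF M as(2)] bt by blast
    ultimately show "x \<otimes> y \<in> max_ideal K (loc M)" unfolding max_ideal_loc[OF M] by blast }
  qed
  hence "ideal (max_ideal K (loc M)) (K\<lparr>carrier := loc M\<rparr>)" using R.ideal_iff by blast
  thus ?thesis unfolding genideal_def S by blast
 qed
 ultimately show ?thesis unfolding ramified_at_def dual_map_eq[OF MX] by blast
qed

theorem ramification: "{x \<in> X. ramified_at K (range cst) A0 x} = {V.F 0, W.F 0}"
proof (intro equalityI subsetI)
 fix x assume "x \<in> {x \<in> X. ramified_at K (range cst) A0 x}"
 hence x: "x \<in> X" "ramified_at K (range cst) A0 x" by auto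
 thus "x \<in> {V.F 0, W.F 0}" by (cases rule: point_cases) (use unramified_at_loc in auto)
qed (use ramified_at_V ramified_at_W in \<open>auto simp: X_eq\<close>)

lemma even_gap: "2 * m \<in> gaps \<longleftrightarrow> m \<in> Y.gaps"
proof -
 have "(\<exists>b\<in>A. b ~= \<zero> \<and> 0 \<le> v b \<and> w b = - int (2 * m)) \<longleftrightarrow>
  (\<exists>b\<in>A0. b ~= \<zero> \<and> 0 \<le> v b div 2 \<and> w b div 2 = - int m)"
 proof
  assume "\<exists>b\<in>A. b ~= \<zero> \<and> 0 \<le> v b \<and> w b = - int (2 * m)"
  then obtain b where b: "b \<in> A" "b ~= \<zero>" "0 \<le> v b" "w b = - int (2 * m)" by blast
  have ev: "even (w b)" using b(4) by simp
  have e: "even_part b ~= \<zero>" "w (even_part b) = w b" using double_cover.parity_even[OF swap_cover b(1,2) ev]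
   unfolding double_cover.even_part_def[OF swap_cover] even_part_def by auto
  have bF: "b \<in> V.F 0" using V.F_v[of b 0] b by simp
  have "even_part b \<in> V.F 0" unfolding even_part_def using V.F_cst_mult[OF V.F_add[OF bF F_\<sigma>[OF bF]]] .
  hence "0 \<le> v (even_part b)" using V.F_D e(1) by blast
  moreover have "even_part b \<in> A0" using parts[OF B_carr[OF b(1)]] parts_A(1)[OF b(1)] by (intro A0_I)
  ultimately show "\<exists>b\<in>A0. b ~= \<zero> \<and> 0 \<le> v b div 2 \<and> w b div 2 = - int m" using e b(4) by (intro bexI[of _ "even_part b"]) auto
 next
  assume "\<exists>b\<in>A0. b ~= \<zero> \<and> 0 \<le> v b div 2 \<and> w b div 2 = - int m"
  then obtain b where b: "b \<in> A0" "b ~= \<zero>" "0 \<le> v b div 2" "w b div 2 = - int m" by blast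
  have "even (w b)" using double_cover.invariant_even_A[OF swap_cover A0_A[OF b(1)] b(2) A0_\<sigma>[OF b(1)]] .
  hence "w b = - int (2 * m)" using b(4) by (auto elim!: evenE)
  thus "\<exists>b\<in>A. b ~= \<zero> \<and> 0 \<le> v b \<and> w b = - int (2 * m)" using b A0_A by (intro bexI[of _ b]) (auto simp: pos_imp_zdiv_nonneg_iff)
 qed
 thus ?thesis unfolding gaps_def Y.gaps_def mem_Collect_eq by (simp only:)
qed

text \<open>Functions of odd order at \<open>W\<close> may be taken anti-invariant, \<open>l\<close> times an invariant \<open>h\<close>. As \<open>l\<close> has a
 triple zero at \<open>V\<close> and a triple pole at \<open>W\<close>, regularity at \<open>V\<close> allows \<open>h\<close> a simple pole on the quotient
 curve, and the pole order \<open>2 k + 1\<close> becomes \<open>k - 1\<close> there.\<close>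
lemma odd_gap: "2 * k + 1 \<in> gaps \<longleftrightarrow>
 \<not> (\<exists>b\<in>A0. b ~= \<zero> \<and> - 1 \<le> v b div 2 \<and> w b div 2 = 1 - int k)"
proof -
 have "(\<exists>b\<in>A. b ~= \<zero> \<and> 0 \<le> v b \<and> w b = - int (2 * k + 1)) \<longleftrightarrow>
  (\<exists>b\<in>A0. b ~= \<zero> \<and> - 1 \<le> v b div 2 \<and> w b div 2 = 1 - int k)"
 proof
  assume "\<exists>b\<in>A. b ~= \<zero> \<and> 0 \<le> v b \<and> w b = - int (2 * k + 1)"
  then obtain b where b: "b \<in> A" "b ~= \<zero>" "0 \<le> v b" "w b = - int (2 * k + 1)" by blast
  have od: "odd (w b)" using b(4) by simp
  have e: "odd_part b ~= \<zero>" "w (odd_part b) = w b" using double_cover.parity_odd[OF swap_cover b(1,2) od]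
   unfolding double_cover.odd_part_def[OF swap_cover] odd_part_def by auto
  have bF: "b \<in> V.F 0" using V.F_v[of b 0] b by simp
  have oc: "odd_part b \<in> carrier K" "\<sigma> (odd_part b) = \<ominus> odd_part b" using parts[OF B_carr[OF b(1)]] by auto
  have vo: "0 \<le> v (odd_part b)" using V.F_D[OF odd_part_F[OF bF] e(1)] .
  define h where "h = inv l \<otimes> odd_part b"
  have \<sigma>il: "\<sigma> (inv l) = \<ominus> (inv l)" using double_cover.\<sigma>_l[OF swap_cover] .
  have hA: "h \<in> A0" unfolding h_def using oc parts_A(2)[OF b(1)] by (intro A0_I) (simp_all add: \<sigma>_mult \<sigma>il l_minus r_minus)
  have h0: "h ~= \<zero>" unfolding h_def using oc e(1) by simp
  have "v h = v (odd_part b) - 3" "w h = w b + 3" unfolding h_def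
   using V.v_mult[of "inv l" "odd_part b"] W.v_mult[of "inv l" "odd_part b"] V.v_inv[of l] W.v_inv[of l]
    w_l v_l oc e by simp_all
  moreover have "odd (v (odd_part b))" using antiinvariant_odd[OF oc(1) e(1) oc(2)] .
  ultimately have "- 2 \<le> v h" "w h = 2 * (1 - int k)" using vo b(4) by (presburger, simp)
  thus "\<exists>b\<in>A0. b ~= \<zero> \<and> - 1 \<le> v b div 2 \<and> w b div 2 = 1 - int k" using hA h0 by (intro bexI[of _ h]) auto
 next
  assume "\<exists>b\<in>A0. b ~= \<zero> \<and> - 1 \<le> v b div 2 \<and> w b div 2 = 1 - int k"
  then obtain b where b: "b \<in> A0" "b ~= \<zero>" "- 1 \<le> v b div 2" "w b div 2 = 1 - int k" by blast
  have bA: "b \<in> A" using A0_A[OF b(1)] .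
  have "even (w b)" using double_cover.invariant_even_A[OF swap_cover bA b(2) A0_\<sigma>[OF b(1)]] .
  hence wb: "w b = 2 * (1 - int k)" using b(4) by (auto elim!: evenE)
  have "v (l \<otimes> b) = 3 + v b" "w (l \<otimes> b) = - 3 + w b" using V.v_mult[of l b] W.v_mult[of l b] bA b(2) v_l w_l by simp_all
  moreover have "- 2 \<le> v b" using b(3) by presburger
  ultimately show "\<exists>b\<in>A. b ~= \<zero> \<and> 0 \<le> v b \<and> w b = - int (2 * k + 1)" using wb bA b(2) by (intro bexI[of _ "l \<otimes> b"]) auto
 qed
 thus ?thesis unfolding gaps_def mem_Collect_eq by (simp only:)
qed

lemma card_gaps_double: "card gaps = 2 * card Y.gaps"
proof -
 define D where "D = {k::nat. \<not> (\<exists>b\<in>A0. b ~= \<zero> \<and> - 1 \<le> v b div 2 \<and> w b div 2 = 1 - int k)}"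
 have gaps_eq: "gaps = (%m. 2 * m) ` Y.gaps \<union> (%k. 2 * k + 1) ` D"
 proof (rule Set.set_eqI)
  fix n :: nat
  show "n \<in> gaps \<longleftrightarrow> n \<in> (%m. 2 * m) ` Y.gaps \<union> (%k. 2 * k + 1) ` D"
  proof (cases "even n")
   case True
   then obtain m where m: "n = 2 * m" by (rule evenE)
   have "n \<notin> (%k. 2 * k + 1) ` D" using True by auto
   thus ?thesis unfolding m even_gap by auto
  next
   case False
   then obtain k where k: "n = 2 * k + 1" by (rule oddE)
   have "n \<notin> (%m. 2 * m) ` Y.gaps" using False by auto
   moreover have "k \<in> D \<longleftrightarrow> n \<in> gaps" unfolding D_def k odd_gap by blast
   ultimately show ?thesis unfolding k by auto
  qed
 qed
 have D: "card D = card Y.gaps" unfolding D_def by (rule Y.card_gaps_twisted)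
 have fin: "finite ((%m. 2 * m) ` Y.gaps)" "finite ((%k. 2 * k + 1) ` D)" using gaps_finite unfolding gaps_eq by auto
 have "card gaps = card ((%m. 2 * m) ` Y.gaps) + card ((%k. 2 * k + 1) ` D)"
  unfolding gaps_eq using fin by (intro card_Un_disjoint) (auto, presburger)
 also have "\<dots> = card Y.gaps + card D" by (simp add: card_image inj_on_def)
 finally show ?thesis using D by simp
qed

theorem genus_double:
 "\<exists>p. arithmetic_genus K (range cst) A0 = enat p \<and> arithmetic_genus K (range cst) A = enat (2 * p)"
 using genus_eq_card_gaps Y.genus_eq_card_gaps card_gaps_double by auto

end

section \<open>The field of fractions of a domain\<close>

lemma UN_pairs_const:
 assumes "(a, b) \<in> X" "!!x y. (x, y) \<in> X ==> G x y = S"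
 shows "(\<Union>(x, y)\<in>X. G x y) = S" using assms by fastforce

context domain
begin

abbreviation nonzero :: "'a set" where "nonzero \<equiv> carrier R - {\<zero>}"

lemma fraction_eq_iff:
 assumes "a \<in> carrier R" "b \<in> nonzero" "c \<in> carrier R" "d \<in> nonzero"
 shows "fraction R a b = fraction R c d \<longleftrightarrow> a \<otimes> d = c \<otimes> b"
proof
 have "(c, d) \<in> fraction R c d" unfolding fraction_def using assms by auto
 moreover assume "fraction R a b = fraction R c d"
 ultimately have "(c, d) \<in> fraction R a b" by simp
 thus "a \<otimes> d = c \<otimes> b" unfolding fraction_def by simp
next
 assume eq: "a \<otimes> d = c \<otimes> b"
 have "a \<otimes> y = x \<otimes> b \<longleftrightarrow> c \<otimes> y = x \<otimes> d" if "x \<in> carrier R" "y \<in> carrier R" for x y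
 proof -
  have "(a \<otimes> y) \<otimes> d = (a \<otimes> d) \<otimes> y" using assms that by (simp add: m_ac)
  hence 1: "(a \<otimes> y) \<otimes> d = (c \<otimes> y) \<otimes> b" using assms that unfolding eq by (simp add: m_ac)
  have 2: "(x \<otimes> b) \<otimes> d = (x \<otimes> d) \<otimes> b" using assms that by (simp add: m_ac)
  have "a \<otimes> y = x \<otimes> b \<longleftrightarrow> (a \<otimes> y) \<otimes> d = (x \<otimes> b) \<otimes> d" using m_rcancel[of d "a \<otimes> y" "x \<otimes> b"] assms that by auto
  also have "\<dots> \<longleftrightarrow> (c \<otimes> y) \<otimes> b = (x \<otimes> d) \<otimes> b" unfolding 1 2 ..
  also have "\<dots> \<longleftrightarrow> c \<otimes> y = x \<otimes> d" using m_rcancel[of b "c \<otimes> y" "x \<otimes> d"] assms that by auto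
  finally show ?thesis .
 qed
 thus "fraction R a b = fraction R c d" unfolding fraction_def by auto
qed

lemma fraction_self: "a \<in> carrier R ==> b \<in> nonzero ==> (a, b) \<in> fraction R a b" unfolding fraction_def by auto

lemma fraction_memD:
 "(c, d) \<in> fraction R a b ==> c \<in> carrier R \<and> d \<in> nonzero \<and> a \<otimes> d = c \<otimes> b" unfolding fraction_def by auto

lemma nonzero_mult: "b \<in> nonzero ==> d \<in> nonzero ==> b \<otimes> d \<in> nonzero" using integral by auto

abbreviation Frac where "Frac \<equiv> fraction_field R"

lemma Frac_carrier: "carrier Frac = {fraction R a b | a b. a \<in> carrier R \<and> b \<in> nonzero}" unfolding fraction_field_def by simp

lemma Frac_one: "one Frac = fraction R \<one> \<one>" and Frac_zero: "zero Frac = fraction R \<zero> \<one>" unfolding fraction_field_def by simp_all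

lemma Frac_mult:
 assumes "a \<in> carrier R" "b \<in> nonzero" "c \<in> carrier R" "d \<in> nonzero"
 shows "fraction R a b \<otimes>\<^bsub>Frac\<^esub> fraction R c d = fraction R (a \<otimes> c) (b \<otimes> d)"
proof -
 have "fraction R (x \<otimes> z) (y \<otimes> u) = fraction R (a \<otimes> c) (b \<otimes> d)"
  if "(x, y) \<in> fraction R a b" "(z, u) \<in> fraction R c d" for x y z u
 proof -
  have xy: "x \<in> carrier R" "y \<in> nonzero" "a \<otimes> y = x \<otimes> b" using fraction_memD[OF that(1)] by auto
  have zu: "z \<in> carrier R" "u \<in> nonzero" "c \<otimes> u = z \<otimes> d" using fraction_memD[OF that(2)] by auto
  have "(x \<otimes> z) \<otimes> (b \<otimes> d) = (x \<otimes> b) \<otimes> (z \<otimes> d)" using assms xy(1,2) zu(1,2) by (simp add: m_ac)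
  also have "\<dots> = (a \<otimes> c) \<otimes> (y \<otimes> u)" unfolding xy(3)[symmetric] zu(3)[symmetric] using assms xy(1,2) zu(1,2) by (simp add: m_ac)
  finally show ?thesis using nonzero_mult[OF xy(2) zu(2)] nonzero_mult[OF assms(2,4)] assms xy zu by (subst fraction_eq_iff) auto
 qed
 hence "(\<Union>(x, y)\<in>fraction R a b. \<Union>(z, u)\<in>fraction R c d. fraction R (x \<otimes> z) (y \<otimes> u))
   = fraction R (a \<otimes> c) (b \<otimes> d)"
  by (intro UN_pairs_const[OF fraction_self[OF assms(1,2)]] UN_pairs_const[OF fraction_self[OF assms(3,4)]])
 thus ?thesis unfolding fraction_field_def by simp
qed

lemma Frac_add:
 assumes "a \<in> carrier R" "b \<in> nonzero" "c \<in> carrier R" "d \<in> nonzero"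
 shows "fraction R a b \<oplus>\<^bsub>Frac\<^esub> fraction R c d = fraction R (a \<otimes> d \<oplus> c \<otimes> b) (b \<otimes> d)"
proof -
 have "fraction R (x \<otimes> u \<oplus> z \<otimes> y) (y \<otimes> u) = fraction R (a \<otimes> d \<oplus> c \<otimes> b) (b \<otimes> d)"
  if "(x, y) \<in> fraction R a b" "(z, u) \<in> fraction R c d" for x y z u
 proof -
  have xy: "x \<in> carrier R" "y \<in> nonzero" "a \<otimes> y = x \<otimes> b" using fraction_memD[OF that(1)] by auto
  have zu: "z \<in> carrier R" "u \<in> nonzero" "c \<otimes> u = z \<otimes> d" using fraction_memD[OF that(2)] by auto
  have cc: "a \<in> carrier R" "b \<in> carrier R" "c \<in> carrier R" "d \<in> carrier R" "x \<in> carrier R" "y \<in> carrier R"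
   "z \<in> carrier R" "u \<in> carrier R" using assms xy zu by auto
  have "(x \<otimes> u \<oplus> z \<otimes> y) \<otimes> (b \<otimes> d) = (x \<otimes> b) \<otimes> (u \<otimes> d) \<oplus> (z \<otimes> d) \<otimes> (y \<otimes> b)" using cc by algebra
  also have "\<dots> = (a \<otimes> d \<oplus> c \<otimes> b) \<otimes> (y \<otimes> u)" unfolding xy(3)[symmetric] zu(3)[symmetric] using cc by algebra
  finally show ?thesis using nonzero_mult[OF xy(2) zu(2)] nonzero_mult[OF assms(2,4)] assms xy zu by (subst fraction_eq_iff) auto
 qed
 hence "(\<Union>(x, y)\<in>fraction R a b. \<Union>(z, u)\<in>fraction R c d. fraction R (x \<otimes> u \<oplus> z \<otimes> y) (y \<otimes> u))
   = fraction R (a \<otimes> d \<oplus> c \<otimes> b) (b \<otimes> d)"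
  by (intro UN_pairs_const[OF fraction_self[OF assms(1,2)]] UN_pairs_const[OF fraction_self[OF assms(3,4)]])
 thus ?thesis unfolding fraction_field_def by simp
qed

lemma Frac_E:
 assumes "X \<in> carrier Frac"
 obtains a b where "a \<in> carrier R" "b \<in> nonzero" "X = fraction R a b" using assms unfolding Frac_carrier by blast

lemma Frac_I: "a \<in> carrier R ==> b \<in> nonzero ==> fraction R a b \<in> carrier Frac" unfolding Frac_carrier by blast

lemma one_nz: "\<one> \<in> nonzero" by simp

lemma Frac_eq_zero: "a \<in> carrier R ==> b \<in> nonzero ==> fraction R a b = zero Frac \<longleftrightarrow> a = \<zero>"
 unfolding Frac_zero using fraction_eq_iff[of a b \<zero> \<one>] by auto

lemma Frac_cring: "cring Frac"
proof (rule cringI)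
 show "abelian_group Frac"
 proof (rule abelian_groupI)
  fix x y z assume x: "x \<in> carrier Frac" and y: "y \<in> carrier Frac"
  obtain a b where ab: "a \<in> carrier R" "b \<in> nonzero" "x = fraction R a b" using x by (rule Frac_E)
  obtain c d where cd: "c \<in> carrier R" "d \<in> nonzero" "y = fraction R c d" using y by (rule Frac_E)
  note nz = nonzero_mult[OF ab(2) cd(2)] nonzero_mult[OF cd(2) ab(2)]
  show "x \<oplus>\<^bsub>Frac\<^esub> y \<in> carrier Frac" unfolding ab(3) cd(3) Frac_add[OF ab(1,2) cd(1,2)] using ab cd nz by (intro Frac_I) auto
  show "x \<oplus>\<^bsub>Frac\<^esub> y = y \<oplus>\<^bsub>Frac\<^esub> x" unfolding ab(3) cd(3) Frac_add[OF ab(1,2) cd(1,2)] Frac_add[OF cd(1,2) ab(1,2)]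
   using ab(1,2) cd(1,2) by (simp add: m_comm a_comm)
  assume z: "z \<in> carrier Frac"
  obtain e f where ef: "e \<in> carrier R" "f \<in> nonzero" "z = fraction R e f" using z by (rule Frac_E)
  have cc: "a \<in> carrier R" "b \<in> carrier R" "c \<in> carrier R" "d \<in> carrier R" "e \<in> carrier R" "f \<in> carrier R" using ab cd ef by auto
  have "(a \<otimes> d \<oplus> c \<otimes> b) \<otimes> f \<oplus> e \<otimes> (b \<otimes> d) = a \<otimes> (d \<otimes> f) \<oplus> (c \<otimes> f \<oplus> e \<otimes> d) \<otimes> b" using cc by algebra
  moreover have "b \<otimes> d \<otimes> f = b \<otimes> (d \<otimes> f)" using cc by (simp add: m_assoc)
  ultimately show "x \<oplus>\<^bsub>Frac\<^esub> y \<oplus>\<^bsub>Frac\<^esub> z = x \<oplus>\<^bsub>Frac\<^esub> (y \<oplus>\<^bsub>Frac\<^esub> z)"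
   unfolding ab(3) cd(3) ef(3) using ab(1,2) cd(1,2) ef(1,2) nz nonzero_mult[OF cd(2) ef(2)] cc
   by (simp only: Frac_add m_closed a_closed)
 next
  show "zero Frac \<in> carrier Frac" unfolding Frac_zero by (intro Frac_I) auto
 next
  fix x assume x: "x \<in> carrier Frac"
  obtain a b where ab: "a \<in> carrier R" "b \<in> nonzero" "x = fraction R a b" using x by (rule Frac_E)
  show "zero Frac \<oplus>\<^bsub>Frac\<^esub> x = x" unfolding ab(3) Frac_zero using ab(1,2) Frac_add[OF zero_closed one_nz ab(1,2)] by simp
  have bb: "b \<otimes> b \<in> nonzero" by (rule nonzero_mult[OF ab(2,2)])
  have "fraction R (\<ominus> a) b \<oplus>\<^bsub>Frac\<^esub> x = fraction R (\<ominus> a \<otimes> b \<oplus> a \<otimes> b) (b \<otimes> b)" unfolding ab(3) using ab(1,2) by (intro Frac_add) auto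
  also have "\<ominus> a \<otimes> b \<oplus> a \<otimes> b = \<zero>" using ab(1,2) by (simp add: l_minus l_neg)
  also have "fraction R \<zero> (b \<otimes> b) = zero Frac" using Frac_eq_zero[OF zero_closed bb] by simp
  finally show "\<exists>y\<in>carrier Frac. y \<oplus>\<^bsub>Frac\<^esub> x = zero Frac" using Frac_I[of "\<ominus> a" b] ab(1,2) by auto
 qed
 show "Group.comm_monoid Frac"
 proof (rule comm_monoidI)
  fix x y z assume x: "x \<in> carrier Frac" and y: "y \<in> carrier Frac"
  obtain a b where ab: "a \<in> carrier R" "b \<in> nonzero" "x = fraction R a b" using x by (rule Frac_E)
  obtain c d where cd: "c \<in> carrier R" "d \<in> nonzero" "y = fraction R c d" using y by (rule Frac_E)
  note nz = nonzero_mult[OF ab(2) cd(2)] nonzero_mult[OF cd(2) ab(2)]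
  show "x \<otimes>\<^bsub>Frac\<^esub> y \<in> carrier Frac" unfolding ab(3) cd(3) Frac_mult[OF ab(1,2) cd(1,2)] using ab cd nz by (intro Frac_I) auto
  show "x \<otimes>\<^bsub>Frac\<^esub> y = y \<otimes>\<^bsub>Frac\<^esub> x" unfolding ab(3) cd(3) Frac_mult[OF ab(1,2) cd(1,2)] Frac_mult[OF cd(1,2) ab(1,2)]
   using ab(1,2) cd(1,2) by (simp add: m_comm)
  assume z: "z \<in> carrier Frac"
  obtain e f where ef: "e \<in> carrier R" "f \<in> nonzero" "z = fraction R e f" using z by (rule Frac_E)
  have cc: "a \<in> carrier R" "b \<in> carrier R" "c \<in> carrier R" "d \<in> carrier R" "e \<in> carrier R" "f \<in> carrier R" using ab cd ef by auto
  show "x \<otimes>\<^bsub>Frac\<^esub> y \<otimes>\<^bsub>Frac\<^esub> z = x \<otimes>\<^bsub>Frac\<^esub> (y \<otimes>\<^bsub>Frac\<^esub> z)"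
   unfolding ab(3) cd(3) ef(3) using ab(1,2) cd(1,2) ef(1,2) nz nonzero_mult[OF cd(2) ef(2)] cc
   by (simp only: Frac_mult m_closed m_assoc)
 next
  show "one Frac \<in> carrier Frac" unfolding Frac_one by (intro Frac_I) auto
  fix x assume x: "x \<in> carrier Frac"
  obtain a b where ab: "a \<in> carrier R" "b \<in> nonzero" "x = fraction R a b" using x by (rule Frac_E)
  show "one Frac \<otimes>\<^bsub>Frac\<^esub> x = x" unfolding ab(3) Frac_one using ab(1,2) Frac_mult[OF one_closed one_nz ab(1,2)] by simp
 qed
 fix x y z assume x: "x \<in> carrier Frac" and y: "y \<in> carrier Frac" and z: "z \<in> carrier Frac"
 obtain a b where ab: "a \<in> carrier R" "b \<in> nonzero" "x = fraction R a b" using x by (rule Frac_E)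
 obtain c d where cd: "c \<in> carrier R" "d \<in> nonzero" "y = fraction R c d" using y by (rule Frac_E)
 obtain e f where ef: "e \<in> carrier R" "f \<in> nonzero" "z = fraction R e f" using z by (rule Frac_E)
 have cc: "a \<in> carrier R" "b \<in> carrier R" "c \<in> carrier R" "d \<in> carrier R" "e \<in> carrier R" "f \<in> carrier R" using ab cd ef by auto
 note nz = nonzero_mult[OF ab(2) cd(2)] nonzero_mult[OF ab(2) ef(2)] nonzero_mult[OF cd(2) ef(2)]
 have l: "(x \<oplus>\<^bsub>Frac\<^esub> y) \<otimes>\<^bsub>Frac\<^esub> z = fraction R ((a \<otimes> d \<oplus> c \<otimes> b) \<otimes> e) (b \<otimes> d \<otimes> f)"
  unfolding ab(3) cd(3) ef(3) using ab(1,2) cd(1,2) ef(1,2) nz cc by (simp only: Frac_add Frac_mult m_closed a_closed)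
 have r: "x \<otimes>\<^bsub>Frac\<^esub> z \<oplus>\<^bsub>Frac\<^esub> y \<otimes>\<^bsub>Frac\<^esub> z
   = fraction R ((a \<otimes> e) \<otimes> (d \<otimes> f) \<oplus> (c \<otimes> e) \<otimes> (b \<otimes> f)) (b \<otimes> f \<otimes> (d \<otimes> f))"
  unfolding ab(3) cd(3) ef(3) using ab(1,2) cd(1,2) ef(1,2) nz cc by (simp only: Frac_add Frac_mult m_closed a_closed)
 have "((a \<otimes> d \<oplus> c \<otimes> b) \<otimes> e) \<otimes> (b \<otimes> f \<otimes> (d \<otimes> f))
   = ((a \<otimes> e) \<otimes> (d \<otimes> f) \<oplus> (c \<otimes> e) \<otimes> (b \<otimes> f)) \<otimes> (b \<otimes> d \<otimes> f)" using cc by algebra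
 thus "(x \<oplus>\<^bsub>Frac\<^esub> y) \<otimes>\<^bsub>Frac\<^esub> z = x \<otimes>\<^bsub>Frac\<^esub> z \<oplus>\<^bsub>Frac\<^esub> y \<otimes>\<^bsub>Frac\<^esub> z"
  unfolding l r using cc nonzero_mult[OF nz(1) ef(2)] nonzero_mult[OF nz(2,3)] by (subst fraction_eq_iff) auto
qed

lemma Frac_inverse:
 assumes "a \<in> nonzero" "b \<in> nonzero"
 shows "fraction R a b \<otimes>\<^bsub>Frac\<^esub> fraction R b a = one Frac"
proof -
 have "fraction R (a \<otimes> b) (b \<otimes> a) = fraction R \<one> \<one>" using assms nonzero_mult[OF assms(2,1)] by (subst fraction_eq_iff) (auto simp: m_comm)
 thus ?thesis using assms Frac_mult[of a b b a] unfolding Frac_one by auto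
qed

lemma Frac_field: "field Frac"
proof (rule cring.cring_fieldI2[OF Frac_cring])
 show "zero Frac ~= one Frac" unfolding Frac_one using Frac_eq_zero[OF one_closed one_nz] by auto
 fix x assume x: "x \<in> carrier Frac" "x ~= zero Frac"
 obtain a b where ab: "a \<in> carrier R" "b \<in> nonzero" "x = fraction R a b" using x(1) by (rule Frac_E)
 hence "a \<in> nonzero" using x(2) Frac_eq_zero by auto
 thus "\<exists>y\<in>carrier Frac. x \<otimes>\<^bsub>Frac\<^esub> y = one Frac" using Frac_inverse[of a b] Frac_I[of b a] ab by auto
qed

lemma to_fraction_closed: "a \<in> carrier R ==> to_fraction R a \<in> carrier Frac" unfolding to_fraction_def by (intro Frac_I) auto

lemma to_fraction_inj: "a \<in> carrier R ==> b \<in> carrier R ==> to_fraction R a = to_fraction R b \<longleftrightarrow> a = b"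
 unfolding to_fraction_def using fraction_eq_iff[of a \<one> b \<one>] by auto

lemma to_fraction_zero: "to_fraction R \<zero> = zero Frac" unfolding to_fraction_def Frac_zero ..
lemma to_fraction_one: "to_fraction R \<one> = one Frac" unfolding to_fraction_def Frac_one ..

lemma to_fraction_eq_zero: "a \<in> carrier R ==> to_fraction R a = zero Frac \<longleftrightarrow> a = \<zero>"
 unfolding to_fraction_def using Frac_eq_zero[of a \<one>] by auto

lemma to_fraction_mult: "a \<in> carrier R ==> b \<in> carrier R ==>
  to_fraction R (a \<otimes> b) = to_fraction R a \<otimes>\<^bsub>Frac\<^esub> to_fraction R b" unfolding to_fraction_def using Frac_mult[of a \<one> b \<one>] by auto

lemma to_fraction_add: "a \<in> carrier R ==> b \<in> carrier R ==>
  to_fraction R (a \<oplus> b) = to_fraction R a \<oplus>\<^bsub>Frac\<^esub> to_fraction R b" unfolding to_fraction_def using Frac_add[of a \<one> b \<one>] by auto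

lemma to_fraction_uminus: assumes "a \<in> carrier R" shows "to_fraction R (\<ominus> a) = \<ominus>\<^bsub>Frac\<^esub> to_fraction R a"
proof -
 have "to_fraction R (\<ominus> a) \<oplus>\<^bsub>Frac\<^esub> to_fraction R a = zero Frac"
  using to_fraction_add[of "\<ominus> a" a] assms by (simp add: l_neg to_fraction_zero)
 thus ?thesis using abelian_group.minus_equality[OF ring.is_abelian_group[OF cring.axioms(1)[OF Frac_cring]]]
   to_fraction_closed assms by (metis a_inv_closed)
qed

lemma to_fraction_minus: "a \<in> carrier R ==> b \<in> carrier R ==>
  to_fraction R (a \<ominus> b) = to_fraction R a \<ominus>\<^bsub>Frac\<^esub> to_fraction R b" by (simp add: a_minus_def to_fraction_add to_fraction_uminus)

lemma fraction_to_fraction: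
 assumes "a \<in> carrier R" "b \<in> nonzero"
 shows "fraction R a b = to_fraction R a \<otimes>\<^bsub>Frac\<^esub> inv\<^bsub>Frac\<^esub> (to_fraction R b)"
proof -
 have "inv\<^bsub>Frac\<^esub> (to_fraction R b) = fraction R \<one> b"
  using comm_monoid.comm_inv_char[OF cring.axioms(2)[OF Frac_cring], of "to_fraction R b" "fraction R \<one> b"]
   Frac_inverse[OF assms(2) one_nz] Frac_I[OF one_closed assms(2)] to_fraction_closed[of b] assms(2) unfolding to_fraction_def by auto
 thus ?thesis unfolding to_fraction_def using Frac_mult[of a \<one> \<one> b] assms by auto
qed

definition frac_val :: "('a => int) => ('a \<times> 'a) set => int" where
 "frac_val \<nu> X = (let (a, b) = SOME p. p \<in> X in \<nu> a - \<nu> b)"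

definition valuation :: "(complex => 'a) => ('a => int) => bool" where
 "valuation c \<nu> \<longleftrightarrow> (\<forall>a\<in>nonzero. \<forall>b\<in>nonzero. \<nu> (a \<otimes> b) = \<nu> a + \<nu> b \<and>
   (a \<oplus> b ~= \<zero> \<longrightarrow> min (\<nu> a) (\<nu> b) \<le> \<nu> (a \<oplus> b)) \<and>
   (\<nu> a = \<nu> b \<longrightarrow> (\<exists>z. a \<ominus> c z \<otimes> b = \<zero> \<or> \<nu> a < \<nu> (a \<ominus> c z \<otimes> b)))) \<and>
  (\<forall>z. z ~= 0 \<longrightarrow> \<nu> (c z) = 0)"

lemma frac_val_fraction:
 assumes \<nu>: "valuation c \<nu>" and ab: "a \<in> nonzero" "b \<in> nonzero"
 shows "frac_val \<nu> (fraction R a b) = \<nu> a - \<nu> b"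
proof -
 obtain x y where xy: "(SOME p. p \<in> fraction R a b) = (x, y)" by (cases "SOME p. p \<in> fraction R a b")
 have "(a, b) \<in> fraction R a b" using ab by (intro fraction_self) auto
 hence "(x, y) \<in> fraction R a b" using someI[of "%p. p \<in> fraction R a b"] xy by metis
 hence *: "x \<in> carrier R" "y \<in> nonzero" "a \<otimes> y = x \<otimes> b" using fraction_memD by auto
 hence "x ~= \<zero>" using ab integral[of a y] by auto
 hence "\<nu> (a \<otimes> y) = \<nu> a + \<nu> y" "\<nu> (x \<otimes> b) = \<nu> x + \<nu> b" using \<nu> * ab unfolding valuation_def by blast+
 thus ?thesis unfolding frac_val_def xy using * by simp
qed

lemma frac_val_to_fraction:
 assumes \<nu>: "valuation c \<nu>" and a: "a \<in> nonzero" and "c 1 = \<one>"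
 shows "frac_val \<nu> (to_fraction R a) = \<nu> a"
proof -
 have "\<nu> \<one> = 0" using \<nu> assms(3) unfolding valuation_def by (metis one_neq_zero)
 thus ?thesis unfolding to_fraction_def using frac_val_fraction[OF \<nu> a one_nz] by simp
qed

definition constants_hom :: "(complex => 'a) => bool" where
 "constants_hom c \<longleftrightarrow> c ` UNIV \<subseteq> carrier R \<and> c 1 = \<one> \<and> (\<forall>x y. c (x + y) = c x \<oplus> c y \<and> c (x * y) = c x \<otimes> c y)"

lemma constants_hom_D:
 assumes "constants_hom c"
 shows "c x \<in> carrier R" "c 1 = \<one>" "c (x + y) = c x \<oplus> c y" "c (x * y) = c x \<otimes> c y" using assms unfolding constants_hom_def by auto

lemma to_fraction_hom: "ring_hom_ring R Frac (to_fraction R)"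
 by (intro ring_hom_ringI2 ring_axioms cring.axioms(1)[OF Frac_cring] ring_hom_memI)
  (simp_all add: to_fraction_closed to_fraction_mult to_fraction_add to_fraction_one)

lemma Frac_affine_ring:
 assumes c: "constants_hom c" and H: "subring H R" "!!z. c z \<in> H"
 shows "affine_ring Frac (%z. to_fraction R (c z)) (to_fraction R ` H)"
proof (intro affine_ring.intro field_over_complex.intro affine_ring_axioms.intro field_over_complex_axioms.intro)
 show "field Frac" by (rule Frac_field)
 note cD = constants_hom_D[OF c]
 show "to_fraction R (c z) \<in> carrier Frac" for z using cD(1) by (rule to_fraction_closed)
 show "to_fraction R (c (x + y)) = to_fraction R (c x) \<oplus>\<^bsub>Frac\<^esub> to_fraction R (c y)" for x y using cD by (simp add: to_fraction_add)
 show "to_fraction R (c (x * y)) = to_fraction R (c x) \<otimes>\<^bsub>Frac\<^esub> to_fraction R (c y)" for x y using cD by (simp add: to_fraction_mult)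
 show "to_fraction R (c 1) = one Frac" using cD by (simp add: to_fraction_one)
 show "to_fraction R (c z) \<in> to_fraction R ` H" for z using H(2) by blast
 show "subring (to_fraction R ` H) Frac" by (rule ring_hom_ring.img_is_subring[OF to_fraction_hom H(1)])
qed

lemma quotients_Frac: "quotients Frac (to_fraction R ` carrier R) = carrier Frac"
proof (intro equalityI subsetI)
 fix x assume "x \<in> carrier Frac"
 then obtain a b where ab: "a \<in> carrier R" "b \<in> nonzero" "x = fraction R a b" by (rule Frac_E)
 hence "to_fraction R b \<in> to_fraction R ` carrier R - {zero Frac}" using to_fraction_eq_zero by auto
 thus "x \<in> quotients Frac (to_fraction R ` carrier R)" unfolding quotients_def ab(3) fraction_to_fraction[OF ab(1,2)] using ab(1) by blast
next
 fix x assume "x \<in> quotients Frac (to_fraction R ` carrier R)"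
 then obtain a b where ab: "a \<in> carrier R" "b \<in> carrier R" "to_fraction R b ~= zero Frac"
  "x = to_fraction R a \<otimes>\<^bsub>Frac\<^esub> inv\<^bsub>Frac\<^esub> (to_fraction R b)" unfolding quotients_def by blast
 hence "b \<in> nonzero" using to_fraction_eq_zero by auto
 hence "x = fraction R a b" using ab fraction_to_fraction by simp
 thus "x \<in> carrier Frac" using Frac_I ab \<open>b \<in> nonzero\<close> by blast
qed

lemma Frac_place:
 assumes c: "constants_hom c" and \<nu>: "valuation c \<nu>" and surj: "!!n. \<exists>a\<in>nonzero. \<nu> a = n"
 shows "place Frac (%z. to_fraction R (c z)) (to_fraction R ` carrier R) (frac_val \<nu>)"
proof (intro place.intro place_axioms.intro)
 note cD = constants_hom_D[OF c]
 note tv = frac_val_to_fraction[OF \<nu> _ cD(2)]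
 show "affine_ring Frac (%z. to_fraction R (c z)) (to_fraction R ` carrier R)" by (rule Frac_affine_ring[OF c carrier_is_subring cD(1)])
 show "frac_val \<nu> (x \<otimes>\<^bsub>Frac\<^esub> y) = frac_val \<nu> x + frac_val \<nu> y"
  if xy: "x \<in> quotients Frac (to_fraction R ` carrier R)" "y \<in> quotients Frac (to_fraction R ` carrier R)"
   "x ~= zero Frac" "y ~= zero Frac" for x y
 proof -
  obtain a b where ab: "a \<in> carrier R" "b \<in> nonzero" "x = fraction R a b" using xy(1) unfolding quotients_Frac by (rule Frac_E)
  obtain d e where de: "d \<in> carrier R" "e \<in> nonzero" "y = fraction R d e" using xy(2) unfolding quotients_Frac by (rule Frac_E)
  have nz: "a \<in> nonzero" "d \<in> nonzero" using ab de xy(3,4) Frac_eq_zero by auto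
  have "frac_val \<nu> (x \<otimes>\<^bsub>Frac\<^esub> y) = \<nu> (a \<otimes> d) - \<nu> (b \<otimes> e)" unfolding ab(3) de(3) Frac_mult[OF ab(1,2) de(1,2)]
   by (rule frac_val_fraction[OF \<nu> nonzero_mult[OF nz] nonzero_mult[OF ab(2) de(2)]])
  also have "\<nu> (a \<otimes> d) = \<nu> a + \<nu> d" using \<nu> nz unfolding valuation_def by blast
  also have "\<nu> (b \<otimes> e) = \<nu> b + \<nu> e" using \<nu> ab(2) de(2) unfolding valuation_def by blast
  finally show ?thesis unfolding ab(3) de(3) using frac_val_fraction[OF \<nu> nz(1) ab(2)] frac_val_fraction[OF \<nu> nz(2) de(2)] by simp
 qed
 show "min (frac_val \<nu> x) (frac_val \<nu> y) \<le> frac_val \<nu> (x \<oplus>\<^bsub>Frac\<^esub> y)"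
  if xy: "x \<in> to_fraction R ` carrier R" "y \<in> to_fraction R ` carrier R"
   "x ~= zero Frac" "y ~= zero Frac" "x \<oplus>\<^bsub>Frac\<^esub> y ~= zero Frac" for x y
 proof -
  obtain a b where ab: "a \<in> carrier R" "x = to_fraction R a" "b \<in> carrier R" "y = to_fraction R b" using xy(1,2) by blast
  have "to_fraction R (a \<oplus> b) ~= zero Frac" unfolding to_fraction_add[OF ab(1,3)] using xy(5) ab by simp
  hence nz: "a \<in> nonzero" "b \<in> nonzero" "a \<oplus> b \<in> nonzero" using xy(3,4) ab(1,3) to_fraction_zero unfolding ab(2,4) by (simp; metis)+
  hence "min (\<nu> a) (\<nu> b) \<le> \<nu> (a \<oplus> b)" using \<nu> unfolding valuation_def by blast
  thus ?thesis unfolding ab(2,4) to_fraction_add[OF ab(1,3), symmetric] tv[OF nz(1)] tv[OF nz(2)] tv[OF nz(3)] .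
 qed
 show "\<exists>z. x \<ominus>\<^bsub>Frac\<^esub> to_fraction R (c z) \<otimes>\<^bsub>Frac\<^esub> y = zero Frac \<or>
    frac_val \<nu> x < frac_val \<nu> (x \<ominus>\<^bsub>Frac\<^esub> to_fraction R (c z) \<otimes>\<^bsub>Frac\<^esub> y)"
  if xy: "x \<in> to_fraction R ` carrier R" "y \<in> to_fraction R ` carrier R"
   "x ~= zero Frac" "y ~= zero Frac" "frac_val \<nu> x = frac_val \<nu> y" for x y
 proof -
  obtain a b where ab: "a \<in> carrier R" "x = to_fraction R a" "b \<in> carrier R" "y = to_fraction R b" using xy(1,2) by blast
  hence nz: "a \<in> nonzero" "b \<in> nonzero" using xy to_fraction_eq_zero by auto
  hence "\<nu> a = \<nu> b" using xy(5) ab tv by simp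
  then obtain z where z: "a \<ominus> c z \<otimes> b = \<zero> \<or> \<nu> a < \<nu> (a \<ominus> c z \<otimes> b)" using \<nu> nz unfolding valuation_def by blast
  have eq: "x \<ominus>\<^bsub>Frac\<^esub> to_fraction R (c z) \<otimes>\<^bsub>Frac\<^esub> y = to_fraction R (a \<ominus> c z \<otimes> b)"
   unfolding ab using ab cD(1) by (simp add: to_fraction_minus to_fraction_mult)
  have "a \<ominus> c z \<otimes> b \<in> carrier R" using ab cD(1) by simp
  thus ?thesis unfolding eq[symmetric] using z tv[of "a \<ominus> c z \<otimes> b"] tv[OF nz(1)] to_fraction_zero ab(2) eq
   by (cases "a \<ominus> c z \<otimes> b = \<zero>") (intro exI[of _ z]; simp)+
 qed
 show "frac_val \<nu> (to_fraction R (c z)) = 0" if "z ~= 0" for z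
 proof -
  have "c z \<otimes> c (inverse z) = \<one>" using cD(2) cD(4)[of z "inverse z"] that by simp
  hence "c z ~= \<zero>" using cD(1)[of "inverse z"] by auto
  hence "frac_val \<nu> (to_fraction R (c z)) = \<nu> (c z)" using tv cD(1) by simp
  thus ?thesis using \<nu> that unfolding valuation_def by simp
 qed
 show "\<exists>b\<in>to_fraction R ` carrier R - {zero Frac}. frac_val \<nu> b = n" for n
 proof -
  obtain a where "a \<in> nonzero" "\<nu> a = n" using surj by blast
  thus ?thesis using tv[of a] to_fraction_eq_zero[of a] by (intro bexI[of _ "to_fraction R a"]) auto
 qed
qed

lemma fraction_map_fraction:
 assumes h: "!!a. a \<in> carrier R ==> h a \<in> carrier R" "!!a. a \<in> nonzero ==> h a ~= \<zero>"
  "!!a b. a \<in> carrier R ==> b \<in> carrier R ==> h (a \<otimes> b) = h a \<otimes> h b"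
  and ab: "a \<in> carrier R" "b \<in> nonzero"
 shows "fraction_map R h (fraction R a b) = fraction R (h a) (h b)"
proof -
 have "fraction R (h x) (h y) = fraction R (h a) (h b)" if "(x, y) \<in> fraction R a b" for x y
 proof -
  have xy: "x \<in> carrier R" "y \<in> nonzero" "a \<otimes> y = x \<otimes> b" using fraction_memD[OF that] by auto
  hence "h a \<otimes> h y = h x \<otimes> h b" using h(3)[of a y] h(3)[of x b] ab by auto
  thus ?thesis using h(1,2) xy ab fraction_eq_iff[of "h x" "h y" "h a" "h b"] by auto
 qed
 thus ?thesis unfolding fraction_map_def by (intro UN_pairs_const[OF fraction_self[OF ab]])
qed

end

context place
begin

lemma finsum_3:
 assumes "!!i. i < 3 ==> f i \<in> carrier K"
 shows "(\<Oplus>i\<in>{..<3::nat}. f i) = f 0 \<oplus> (f 1 \<oplus> f 2)"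
proof -
 have "{..<3::nat} = insert 0 (insert 1 (insert 2 {}))" by auto
 moreover have "f 0 \<in> carrier K" "f 1 \<in> carrier K" "f 2 \<in> carrier K" using assms by auto
 ultimately show ?thesis by (simp add: finsum_insert)
qed

text \<open>Let \<open>y\<close> be the image of the place. As \<open>l\<close> vanishes only there, the stalk over \<open>y\<close> is the valuation ring
 \<open>F 0\<close>, free of rank three over \<open>y\<close>. If \<open>l\<close> were a parameter, then \<open>F 0\<close> modulo \<open>l\<close> would be \<open>\<complex>\<close>, while
 three free generators remain independent modulo \<open>l\<close>.\<close>
lemma unit_not_uniformizer:
 fixes l B'
 assumes B': "affine_ring K cst B'" "l \<in> B'" "inv l \<in> B'"
  and l: "l \<in> L" "l ~= \<zero>" and cover: "dual_to_cover K (range cst) 3 B B'"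
  and zeros: "{x \<in> smooth_completion K (range cst) B. l \<in> max_ideal K x} = {P}"
 shows "v l ~= 1"
proof
 assume vl: "v l = 1"
 interpret B': affine_ring K cst B' by (rule B')
 let ?X = "smooth_completion K (range cst) B" and ?Y = "smooth_completion K (range cst) B'"
 have FX: "F 0 \<in> ?X" unfolding smooth_completion_def using F0_at_infinity by blast
 have lF: "l \<in> F 1" "inv l \<notin> F 0" using F_v[OF l, of 1] F_v[of "inv l" 0] L_inv[OF l] v_inv[OF l] vl l by auto
 have P: "P = F 0" using zeros FX lF(1) max_ideal_F0 by blast
 have uniq: "\<exists>!y. y \<in> ?Y \<and> dominates K x y" if "x \<in> ?X" for x using cover that unfolding dual_to_cover_def by blast
 have dual: "dual_map K (range cst) B' x \<in> ?Y \<and> dominates K x (dual_map K (range cst) B' x)" if "x \<in> ?X" for x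
  unfolding dual_map_def using theI'[OF uniq[OF that]] .
 define y where "y = dual_map K (range cst) B' (F 0)"
 have yY: "y \<in> ?Y" and yd: "y \<subseteq> F 0" "max_ideal K y = F 1 \<inter> y" using dual[OF FX] max_ideal_F0 unfolding y_def dominates_def by auto
 have "y \<notin> Spec K B'"
 proof
  assume "y \<in> Spec K B'"
  then obtain M where "B'.max_id M" "y = B'.loc M" unfolding B'.Spec_eq by blast
  hence "inv l \<in> y" using B'.B_loc B'(3) by blast
  thus False using yd(1) lF(2) by blast
 qed
 hence dvr: "discrete_valuation_ring K (range cst) B'.L y" using yY unfolding smooth_completion_def points_at_infinity_def by blast
 obtain G u where G: "!!x m. x \<in> G m \<longleftrightarrow> x \<in> B'.L \<and> (x = \<zero> \<or> (m::int) \<le> u x)" and y0: "y = G 0"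
  and Gs: "!!m. subspace (G m)" and Gm: "!!x y m n. x \<in> G m ==> y \<in> G n ==> x \<otimes> y \<in> G (m + n)"
  and um: "!!x y. x \<in> B'.L ==> y \<in> B'.L ==> x ~= \<zero> ==> y ~= \<zero> ==> u (x \<otimes> y) = u x + u y"
  and uk: "!!c. c ~= 0 ==> u (cst c) = 0" by (rule B'.dvr_valuation[OF dvr], rule that)
 have ly: "l \<in> y"
 proof -
  have "u l + u (inv l) = 0" using um[of l "inv l"] uk[of 1] B'(2,3) l by simp
  moreover have "\<not> 0 \<le> u (inv l)" using G[of "inv l" 0] B'(3) yd(1) lF(2) unfolding y0 by auto
  ultimately show ?thesis using G[of l 0] B'(2) unfolding y0 by simp
 qed
 have csty: "cst c \<in> y" for c using dvr unfolding discrete_valuation_ring_def by blast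
 have stalk: "direct_image_stalk K (range cst) B B' y = F 0"
 proof
  show "direct_image_stalk K (range cst) B B' y \<subseteq> F 0" unfolding direct_image_stalk_def y_def using FX by blast
  have "x = F 0" if "x \<in> ?X" "dual_map K (range cst) B' x = y" for x
  proof -
   have "max_ideal K y = max_ideal K x \<inter> y" using dual[OF that(1)] that(2) unfolding dominates_def by simp
   hence "l \<in> max_ideal K x" using ly lF(1) yd(2) by blast
   thus ?thesis using zeros that(1) P by blast
  qed
  thus "F 0 \<subseteq> direct_image_stalk K (range cst) B B' y" unfolding direct_image_stalk_def by auto
 qed
 have "free_of_rank K 3 y (F 0)" using cover yY unfolding dual_to_cover_def stalk[symmetric] by blast
 then obtain e :: "nat => 'a" where e': "\<forall>i<3. e i \<in> F 0"
  and bij: "bij_betw (%c. \<Oplus>i\<in>{..<3}. c i \<otimes> e i) ({..<3} \<rightarrow>\<^sub>E y) (F 0)" unfolding free_of_rank_def by (elim exE conjE)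
 hence e: "e i \<in> F 0" if "i < 3" for i using that by simp
 let ?f = "%c. \<Oplus>i\<in>{..<3::nat}. c i \<otimes> e i"
 have yc: "a \<in> y ==> a \<in> carrier K" for a using yd(1) F_carr by blast
 have ec: "e i \<in> carrier K" if "i < 3" for i using e[OF that] F_carr by blast
 have f: "?f c = c 0 \<otimes> e 0 \<oplus> (c 1 \<otimes> e 1 \<oplus> c 2 \<otimes> e 2)" if "!!i. i < 3 ==> c i \<in> y" for c using that ec yc by (intro finsum_3) auto
 have res: "\<exists>r. a \<ominus> cst r \<in> F 1" if "a \<in> F 0" for a using F_residue[OF that, of \<one>] F_cst[of 1] F_v[of \<one> 1] by auto
 obtain r0 r1 where r: "e 0 \<ominus> cst r0 \<in> F 1" "e 1 \<ominus> cst r1 \<in> F 1" using res e by (metis numeral_3_eq_3 lessI less_Suc_eq zero_less_Suc One_nat_def)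
 \<comment> \<open>The residues of two generators are dependent over the complex numbers.\<close>
 obtain s0 s1 where s: "s0 * r0 + s1 * r1 = 0" "s0 ~= 0 \<or> s1 ~= 0"
  by (cases "r0 = 0") (metis mult_zero_left mult_zero_right add_0 one_neq_zero, metis add.commute mult.commute neg_eq_iff_add_eq_0 mult_minus_left)
 define s where "s i = (if i = 0 then s0 else if i = 1 then s1 else 0)" for i :: nat
 have e01: "e 0 \<in> F 0" "e 1 \<in> F 0" "e 2 \<in> F 0" using e by auto
 define x where "x = cst s0 \<otimes> e 0 \<oplus> cst s1 \<otimes> e 1"
 have "cst s0 \<otimes> (e 0 \<ominus> cst r0) \<oplus> cst s1 \<otimes> (e 1 \<ominus> cst r1) \<in> F 1" using F_add[OF F_cst_mult[OF r(1)] F_cst_mult[OF r(2)]] .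
 moreover have "cst s0 \<otimes> (e 0 \<ominus> cst r0) \<oplus> cst s1 \<otimes> (e 1 \<ominus> cst r1)
   = x \<ominus> (cst s0 \<otimes> cst r0 \<oplus> cst s1 \<otimes> cst r1)" unfolding x_def using F_carr[OF e01(1)] F_carr[OF e01(2)] cst_closed by algebra
 moreover have "cst s0 \<otimes> cst r0 \<oplus> cst s1 \<otimes> cst r1 = \<zero>" using s(1) by (simp flip: cst_mult cst_add)
 moreover have xc: "x \<in> carrier K" unfolding x_def using F_carr[OF e01(1)] F_carr[OF e01(2)] by auto
 ultimately have xF: "x \<in> F 1" by (simp add: a_minus_def)
 have il: "inv l \<in> F (- 1)" using F_v[of "inv l" "-1"] L_inv[OF l] v_inv[OF l] vl l by auto
 have "inv l \<otimes> x \<in> F 0" using F_mult[OF il xF] by simp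
 then obtain c where c: "c \<in> {..<3} \<rightarrow>\<^sub>E y" "inv l \<otimes> x = ?f c" using bij_betw_imp_surj_on[OF bij] by blast
 have cy: "c i \<in> y" if "i < 3" for i using c(1) that by (auto simp: PiE_iff)
 define d where "d = (\<lambda>i\<in>{..<3}. l \<otimes> c i)"
 define t where "t = (\<lambda>i\<in>{..<3}. cst (s i))"
 have ym: "a \<otimes> b \<in> y" if "a \<in> y" "b \<in> y" for a b using Gm[of a 0 b 0] that unfolding y0 by simp
 have d: "d \<in> {..<3} \<rightarrow>\<^sub>E y" unfolding d_def using ym[OF ly] cy by auto
 have t: "t \<in> {..<3} \<rightarrow>\<^sub>E y" unfolding t_def using csty by auto
 have "?f d = (l \<otimes> c 0) \<otimes> e 0 \<oplus> ((l \<otimes> c 1) \<otimes> e 1 \<oplus> (l \<otimes> c 2) \<otimes> e 2)" using f[of d] d unfolding d_def by (simp add: PiE_iff)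
 also have "\<dots> = l \<otimes> (c 0 \<otimes> e 0 \<oplus> (c 1 \<otimes> e 1 \<oplus> c 2 \<otimes> e 2))"
  using yc[OF cy[of 0]] yc[OF cy[of 1]] yc[OF cy[of 2]] ec[of 0] ec[of 1] ec[of 2] L_carr[OF l(1)] by (simp add: m_assoc r_distr)
 also have "\<dots> = l \<otimes> (inv l \<otimes> x)" using f[of c] cy c(2) by simp
 also have "\<dots> = x" using l xc by (simp flip: m_assoc)
 also have "x = ?f t" using f[of t] t F_carr[OF e01(1)] F_carr[OF e01(2)] F_carr[OF e01(3)]
  unfolding t_def s_def x_def by (simp add: PiE_iff)
 finally have "d = t" by (rule inj_onD[OF bij_betw_imp_inj_on[OF bij] _ d t])
 hence "d i = t i" for i by simp
 from this[of 0] this[of 1] have eq: "l \<otimes> c 0 = cst s0" "l \<otimes> c 1 = cst s1" unfolding d_def t_def s_def by simp_all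
 have "l \<otimes> c i \<in> F 1" if "i < 3" for i using F_mult[OF lF(1), of "c i" 0] cy[OF that] yd(1) by auto
 from this[of 0] this[of 1] have "cst s0 \<in> F 1" "cst s1 \<in> F 1" unfolding eq by simp_all
 thus False using s(2) F_v[OF B_L[OF cst_B], of s0 1] F_v[OF B_L[OF cst_B], of s1 1] v_cst by auto
qed

end

section \<open>The moving frame of a minimal Lagrangian surface\<close>

lemma cont_diff_differentiable: "cont_diff (Suc k) f ==> f differentiable (at p)" by (auto simp: differentiable_on_def)

lemma dir_deriv_has_derivative:
 assumes "f differentiable (at p)" shows "(f has_derivative (%v. dir_deriv v f p)) (at p)"
 using assms unfolding dir_deriv_def frechet_derivative_works .

lemma dir_deriv_eq: assumes "(f has_derivative f') (at p)" shows "dir_deriv v f p = f' v"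
 unfolding dir_deriv_def using frechet_derivative_at[OF assms] by simp

lemma dir_deriv_expand:
 assumes "f differentiable (at p)"
 shows "dir_deriv v f p = Re v *\<^sub>R d_x f p + Im v *\<^sub>R d_y f p"
proof -
 have lin: "linear (%v. dir_deriv v f p)" using dir_deriv_has_derivative[OF assms] has_derivative_linear by blast
 have "v = Re v *\<^sub>R 1 + Im v *\<^sub>R \<i>" by (simp add: complex_eq_iff)
 hence "dir_deriv v f p = dir_deriv (Re v *\<^sub>R 1 + Im v *\<^sub>R \<i>) f p" by simp
 also have "\<dots> = Re v *\<^sub>R d_x f p + Im v *\<^sub>R d_y f p" using linear_add[OF lin] linear_scale[OF lin] by simp
 finally show ?thesis .
qed

lemma dir_deriv_linear:
 fixes f :: "complex => 'b::real_normed_vector"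
 assumes "bounded_linear h" "f differentiable (at p)"
 shows "dir_deriv v (%p. h (f p)) p = h (dir_deriv v f p)"
 by (rule dir_deriv_eq) (rule bounded_linear.has_derivative[OF assms(1) dir_deriv_has_derivative[OF assms(2)]])

lemma differentiable_linear:
 fixes f :: "complex => 'b::real_normed_vector"
 assumes "bounded_linear h" "f differentiable (at p)" shows "(%p. h (f p)) differentiable (at p)"
 using bounded_linear.has_derivative[OF assms(1) dir_deriv_has_derivative[OF assms(2)]] differentiableI by blast

lemma cont_diff_linear:
 fixes f :: "complex => 'b::real_normed_vector"
 shows "bounded_linear h ==> cont_diff k f ==> cont_diff k (%p. h (f p))"
proof (induct k arbitrary: f)
 case 0
 thus ?case using bounded_linear.continuous_on by auto
next
 case (Suc k)
 have d: "f differentiable (at p)" for p using cont_diff_differentiable[OF Suc(3)] .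
 have "dir_deriv v (%p. h (f p)) = (%p. h (dir_deriv v f p))" for v using dir_deriv_linear[OF Suc(2) d] by blast
 thus ?case using Suc d differentiable_linear[OF Suc(2) d] by (auto simp: differentiable_on_def)
qed

lemma cont_diff_add: "cont_diff k f ==> cont_diff k g ==> cont_diff k (%p. f p + g p)"
proof (induct k arbitrary: f g)
 case 0 thus ?case by (auto intro: continuous_on_add)
next
 case (Suc k)
 have d: "f differentiable (at p)" "g differentiable (at p)" for p
  using cont_diff_differentiable[OF Suc(2)] cont_diff_differentiable[OF Suc(3)] by auto
 have "dir_deriv v (%p. f p + g p) = (%p. dir_deriv v f p + dir_deriv v g p)" for v
  by (rule ext, rule dir_deriv_eq) (intro has_derivative_add dir_deriv_has_derivative d)
 thus ?case using Suc d by (auto simp: differentiable_on_def)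
qed

lemma smooth_linear: "bounded_linear h ==> smooth_map f ==> smooth_map (%p. h (f p))"
 unfolding smooth_map_def using cont_diff_linear by blast

lemma smooth_add: "smooth_map f ==> smooth_map g ==> smooth_map (%p. f p + g p)" unfolding smooth_map_def using cont_diff_add by blast

lemma smooth_differentiable: "smooth_map f ==> f differentiable (at p)" unfolding smooth_map_def using cont_diff_differentiable by blast

lemma smooth_partial: "smooth_map f ==> smooth_map (d_x f)" "smooth_map f ==> smooth_map (d_y f)"
 unfolding smooth_map_def by (metis cont_diff.simps(2))+

text \<open>Schwarz's theorem: both mixed derivatives are limits of the same second difference quotient, by the mean
 value theorem applied twice.\<close>
lemma real_partials_commute:
 fixes g :: "complex => real"
 assumes g: "smooth_map g"
 shows "d_x (d_y g) p = d_y (d_x g) p"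
proof -
 note gx = smooth_partial(1)[OF g] and gy = smooth_partial(2)[OF g]
 have hd: "((%t. h (q + of_real t * e)) has_real_derivative dir_deriv e h (q + of_real t * e)) (at t within S)"
  if "smooth_map h" for h :: "complex => real" and q e t S
 proof -
  have "((%t. q + of_real t * e) has_derivative (%s. of_real s * e)) (at t within S)" by (auto intro!: derivative_eq_intros)
  moreover have "(h has_derivative (%v. dir_deriv v h (q + of_real t * e))) (at (q + of_real t * e))"
   using dir_deriv_has_derivative[OF smooth_differentiable[OF that]] .
  ultimately have *: "((%t. h (q + of_real t * e)) has_derivative (%s. dir_deriv (of_real s * e) h (q + of_real t * e))) (at t within S)"
   by (rule has_derivative_compose)
  have lin: "linear (%v. dir_deriv v h (q + of_real t * e))"
   using dir_deriv_has_derivative[OF smooth_differentiable[OF that]] has_derivative_linear by blast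
  have "dir_deriv (of_real s * e) h (q + of_real t * e) = dir_deriv e h (q + of_real t * e) * s" for s
   using linear_scale[OF lin, of s e] by (simp add: scaleR_conv_of_real mult.commute)
  thus ?thesis using * unfolding has_field_derivative_def by simp
 qed
 have mixed: "\<exists>s t. 0 < s \<and> s < h \<and> 0 < t \<and> t < h \<and>
   (g (p + of_real h * e + of_real h * e') - g (p + of_real h * e)) - (g (p + of_real h * e') - g p)
   = h * (h * dir_deriv e' (dir_deriv e g) (p + of_real s * e + of_real t * e'))"
  if h: "0 < h" and se: "smooth_map (dir_deriv e g)" for h e e'
 proof -
  let ?\<phi> = "%t. g ((p + of_real h * e') + of_real t * e) - g (p + of_real t * e)"
  obtain s where s: "0 < s" "s < h" "?\<phi> h - ?\<phi> 0 = (h - 0) *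
    (dir_deriv e g ((p + of_real h * e') + of_real s * e) - dir_deriv e g (p + of_real s * e))"
   using MVT2[OF h, of ?\<phi> "%t. dir_deriv e g ((p + of_real h * e') + of_real t * e) - dir_deriv e g (p + of_real t * e)"]
   using DERIV_diff[OF hd[OF g] hd[OF g]] by blast
  let ?\<psi> = "%t. dir_deriv e g ((p + of_real s * e) + of_real t * e')"
  obtain t where t: "0 < t" "t < h" "?\<psi> h - ?\<psi> 0 = (h - 0) *
    dir_deriv e' (dir_deriv e g) ((p + of_real s * e) + of_real t * e')"
   using MVT2[OF h, of ?\<psi> "%t. dir_deriv e' (dir_deriv e g) ((p + of_real s * e) + of_real t * e')"] hd[OF se] by blast
  have "?\<psi> h - ?\<psi> 0 = dir_deriv e g ((p + of_real h * e') + of_real s * e) - dir_deriv e g (p + of_real s * e)"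
   by (simp add: algebra_simps)
  thus ?thesis using s t by (intro exI[of _ s] exI[of _ t]) (simp add: algebra_simps)
 qed
 have cont: "isCont (d_y (d_x g)) p" "isCont (d_x (d_y g)) p" using smooth_partial(2)[OF gx] smooth_partial(1)[OF gy]
  by (auto simp: differentiable_imp_continuous_within smooth_differentiable)
 show ?thesis
 proof (rule ccontr)
  assume ne: "d_x (d_y g) p ~= d_y (d_x g) p"
  define \<epsilon> where "\<epsilon> = \<bar>d_x (d_y g) p - d_y (d_x g) p\<bar> / 2"
  have \<epsilon>: "0 < \<epsilon>" unfolding \<epsilon>_def using ne by simp
  obtain r1 where r1: "0 < r1" "!!q. dist q p < r1 ==> dist (d_y (d_x g) q) (d_y (d_x g) p) < \<epsilon>"
   using cont(1) \<epsilon> unfolding continuous_at_eps_delta by (metis dist_norm)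
  obtain r2 where r2: "0 < r2" "!!q. dist q p < r2 ==> dist (d_x (d_y g) q) (d_x (d_y g) p) < \<epsilon>"
   using cont(2) \<epsilon> unfolding continuous_at_eps_delta by (metis dist_norm)
  define h where "h = min r1 r2 / 2"
  have h: "0 < h" unfolding h_def using r1 r2 by simp
  obtain s t where st: "0 < s" "s < h" "0 < t" "t < h"
   "(g (p + of_real h * 1 + of_real h * \<i>) - g (p + of_real h * 1)) - (g (p + of_real h * \<i>) - g p)
    = h * (h * d_y (d_x g) (p + of_real s * 1 + of_real t * \<i>))" using mixed[OF h gx] by blast
  obtain s' t' where st': "0 < s'" "s' < h" "0 < t'" "t' < h"
   "(g (p + of_real h * \<i> + of_real h * 1) - g (p + of_real h * \<i>)) - (g (p + of_real h * 1) - g p)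
    = h * (h * d_x (d_y g) (p + of_real s' * \<i> + of_real t' * 1))" using mixed[OF h gy] by blast
  have "h * (h * d_y (d_x g) (p + of_real s * 1 + of_real t * \<i>))
    = h * (h * d_x (d_y g) (p + of_real s' * \<i> + of_real t' * 1))"
   unfolding st(5)[symmetric] st'(5)[symmetric] by (simp add: algebra_simps)
  hence eq: "d_y (d_x g) (p + of_real s * 1 + of_real t * \<i>) = d_x (d_y g) (p + of_real s' * \<i> + of_real t' * 1)" using h by simp
  have small: "norm (of_real a * e + of_real b * e') < min r1 r2"
   if "0 < a" "a < h" "0 < b" "b < h" "norm e = 1" "norm e' = 1" for a b :: real and e e' :: complex
  proof -
   have "norm (of_real a * e + of_real b * e') \<le> a + b"
    using norm_triangle_ineq[of "of_real a * e" "of_real b * e'"] that by (simp add: norm_mult)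
   thus ?thesis using that unfolding h_def by linarith
  qed
  have "dist (p + of_real s * 1 + of_real t * \<i>) p < r1" using small[OF st(1-4), of 1 \<i>] by (simp add: dist_norm algebra_simps)
  hence a: "dist (d_y (d_x g) (p + of_real s * 1 + of_real t * \<i>)) (d_y (d_x g) p) < \<epsilon>" by (rule r1(2))
  have "dist (p + of_real s' * \<i> + of_real t' * 1) p < r2" using small[OF st'(1-4), of \<i> 1] by (simp add: dist_norm algebra_simps)
  hence b: "dist (d_x (d_y g) (p + of_real s' * \<i> + of_real t' * 1)) (d_x (d_y g) p) < \<epsilon>" by (rule r2(2))
  show False using a b eq unfolding \<epsilon>_def dist_real_def by (simp add: abs_if split: if_splits)
 qed
qed

lemma partials_commute:
 fixes f :: "complex => 'b::euclidean_space"
 assumes f: "smooth_map f"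
 shows "d_x (d_y f) p = d_y (d_x f) p"
proof (rule vector_eq_ldot[THEN iffD1], intro allI)
 fix b :: 'b
 have bl: "bounded_linear (%x. b \<bullet> x)" by (rule bounded_linear_inner_right)
 have D: "dir_deriv v (%p. b \<bullet> h p) = (%p. b \<bullet> dir_deriv v h p)" if "smooth_map h" for h :: "complex => 'b" and v
  using dir_deriv_linear[OF bl smooth_differentiable[OF that]] by blast
 have "d_x (d_y (%p. b \<bullet> f p)) p = d_y (d_x (%p. b \<bullet> f p)) p" by (rule real_partials_commute[OF smooth_linear[OF bl f]])
 thus "b \<bullet> d_x (d_y f) p = b \<bullet> d_y (d_x f) p" unfolding D[OF f] D[OF smooth_partial(1)[OF f]] D[OF smooth_partial(2)[OF f]] .
qed

lemma herm_sum3: "herm u v = u $ 1 * cnj (v $ 1) + u $ 2 * cnj (v $ 2) + u $ 3 * cnj (v $ 3)" unfolding herm_def sum_3 ..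

lemma herm_add_left: "herm (u + u') v = herm u v + herm u' v"
 and herm_add_right: "herm u (v + v') = herm u v + herm u v'"
 and herm_diff_left: "herm (u - u') v = herm u v - herm u' v"
 and herm_diff_right: "herm u (v - v') = herm u v - herm u v'"
 and herm_minus_left: "herm (- u) v = - herm u v"
 and herm_minus_right: "herm u (- v) = - herm u v"
 and herm_smult_left: "herm (c *s u) v = c * herm u v"
 and herm_smult_right: "herm u (c *s v) = cnj c * herm u v"
 and herm_scaleR_left: "herm (r *\<^sub>R u) v = of_real r * herm u v"
 and herm_scaleR_right: "herm u (r *\<^sub>R v) = of_real r * herm u v"
 and herm_zero_left: "herm 0 v = 0" and herm_zero_right: "herm u 0 = 0"
 unfolding herm_sum3 by (simp_all add: algebra_simps scaleR_conv_of_real[where 'a = complex])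

lemmas herm_simps = herm_add_left herm_add_right herm_diff_left herm_diff_right herm_minus_left
 herm_minus_right herm_smult_left herm_smult_right herm_scaleR_left herm_scaleR_right
 herm_zero_left herm_zero_right

lemma herm_cnj: "cnj (herm u v) = herm v u" unfolding herm_sum3 by (simp add: algebra_simps)

lemma herm_self: "herm u u = of_real ((norm u)\<^sup>2)"
proof -
 have "(norm u)\<^sup>2 = (norm (u $ 1))\<^sup>2 + (norm (u $ 2))\<^sup>2 + (norm (u $ 3))\<^sup>2"
  unfolding norm_vec_def L2_set_def sum_3 by (simp add: add_nonneg_nonneg)
 thus ?thesis unfolding herm_sum3 by (simp add: complex_norm_square del: of_real_power)
qed

lemma bounded_bilinear_herm: "bounded_bilinear herm"
proof -
 have "bilinear herm" unfolding bilinear_def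
  by (intro conjI allI linearI) (simp_all add: herm_simps scaleR_conv_of_real[where 'a = complex])
 thus ?thesis by (simp add: bilinear_conv_bounded_bilinear)
qed

lemma herm_const_derivative:
 assumes "g differentiable (at p)" "h differentiable (at p)" "!!q. herm (g q) (h q) = c"
 shows "herm (dir_deriv v g p) (h p) + herm (g p) (dir_deriv v h p) = 0"
proof -
 have "((%q. herm (g q) (h q)) has_derivative (%v. herm (g p) (dir_deriv v h p) + herm (dir_deriv v g p) (h p))) (at p)"
  by (rule bounded_bilinear.FDERIV[OF bounded_bilinear_herm
     dir_deriv_has_derivative[OF assms(1)] dir_deriv_has_derivative[OF assms(2)]])
 moreover have "((%q. herm (g q) (h q)) has_derivative (%v. 0)) (at p)" unfolding assms(3) by simp
 ultimately have "(%v. herm (g p) (dir_deriv v h p) + herm (dir_deriv v g p) (h p)) = (%v. 0)" by (rule has_derivative_unique)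
 thus ?thesis by (metis add.commute)
qed

lemma herm_Im_derivative:
 assumes "g differentiable (at p)" "h differentiable (at p)" "!!q. Im (herm (g q) (h q)) = 0"
 shows "Im (herm (dir_deriv v g p) (h p)) + Im (herm (g p) (dir_deriv v h p)) = 0"
proof -
 have "((%q. herm (g q) (h q)) has_derivative (%v. herm (g p) (dir_deriv v h p) + herm (dir_deriv v g p) (h p))) (at p)"
  by (rule bounded_bilinear.FDERIV[OF bounded_bilinear_herm
     dir_deriv_has_derivative[OF assms(1)] dir_deriv_has_derivative[OF assms(2)]])
 hence "((%q. Im (herm (g q) (h q))) has_derivative (%v. Im (herm (g p) (dir_deriv v h p) + herm (dir_deriv v g p) (h p)))) (at p)"
  by (rule bounded_linear.has_derivative[OF bounded_linear_Im])
 moreover have "((%q. Im (herm (g q) (h q))) has_derivative (%v. 0)) (at p)" unfolding assms(3) by simp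
 ultimately have "(%v. Im (herm (g p) (dir_deriv v h p) + herm (dir_deriv v g p) (h p))) = (%v. 0)" by (rule has_derivative_unique)
 hence "Im (herm (g p) (dir_deriv v h p) + herm (dir_deriv v g p) (h p)) = 0" by metis
 thus ?thesis by simp
qed

lemma dir_deriv_complex:
 assumes "g differentiable (at p)"
 shows "dir_deriv v g p = v *s d_z g p + cnj v *s d_zbar g p" by (subst dir_deriv_expand[OF assms])
  (auto simp: d_z_def d_zbar_def vec_eq_iff complex_eq_iff field_simps)

lemma herm_d_z:
 assumes "g differentiable (at p)" "h differentiable (at p)" "!!q. herm (g q) (h q) = c"
 shows "herm (d_z g p) (h p) + herm (g p) (d_zbar h p) = 0"
proof -
 have "herm (d_z g p) (h p) + herm (g p) (d_zbar h p) = (1/2) * ((herm (d_x g p) (h p) + herm (g p) (d_x h p))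
   - \<i> * (herm (d_y g p) (h p) + herm (g p) (d_y h p)))" unfolding d_z_def d_zbar_def by (simp add: herm_simps algebra_simps)
 thus ?thesis using herm_const_derivative[OF assms] by simp
qed

lemma bounded_linear_smult: "bounded_linear (%u :: complex^3. c *s u)"
proof -
 have "linear (%u :: complex^3. c *s u)" by (intro linearI) (auto simp: vec_eq_iff algebra_simps)
 thus ?thesis by (simp add: linear_conv_bounded_linear)
qed

lemma smooth_d_z: assumes "smooth_map f" shows "smooth_map (d_z f)" "smooth_map (d_zbar f)"
proof -
 have *: "smooth_map (%p. (1/2) *s d_x f p + c *s d_y f p)" for c
  by (intro smooth_add smooth_linear[OF bounded_linear_smult] smooth_partial assms)
 have "d_z f = (%p. (1/2) *s d_x f p + (- \<i> / 2) *s d_y f p)"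
  "d_zbar f = (%p. (1/2) *s d_x f p + (\<i> / 2) *s d_y f p)"
  unfolding d_z_def d_zbar_def fun_eq_iff vec_eq_iff by (auto simp: algebra_simps)
 thus "smooth_map (d_z f)" "smooth_map (d_zbar f)" using *[of "- \<i> / 2"] *[of "\<i> / 2"] by simp_all
qed

definition cyclic_lower :: "real => mat3" where
 "cyclic_lower r = vector [vector [0, 0, of_real r], vector [of_real r, 0, 0], vector [0, of_real (1 / r\<^sup>2), 0]]"

definition cyclic_upper :: "real => mat3" where
 "cyclic_upper r = vector [vector [0, - of_real r, 0], vector [0, 0, - of_real (1 / r\<^sup>2)], vector [- of_real r, 0, 0]]"

definition diagonal_pair :: "complex => mat3" where
 "diagonal_pair d = vector [vector [0, 0, 0], vector [0, d, 0], vector [0, 0, - d]]"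

lemma matrix_inv_eq:
 fixes A B :: mat3
 assumes "A ** B = mat 1" shows "matrix_inv A = B"
proof -
 have "B ** A = mat 1" using assms matrix_left_right_inverse by blast
 hence "invertible A" using assms unfolding invertible_def by blast
 hence "matrix_inv A ** A = mat 1" unfolding matrix_inv_def invertible_def by (metis (mono_tags, lifting) someI_ex)
 hence "matrix_inv A ** (A ** B) = B" by (simp add: matrix_mul_assoc)
 thus ?thesis using assms by simp
qed

locale conformal_minimal_lagrangian =
 fixes f :: "complex => complex^3"
 assumes smooth: "smooth_map f" and unit: "!!p. norm (f p) = 1"
  and horizontal: "!!p v. herm (dir_deriv v f p) (f p) = 0"
  and immersive: "immersive f" and lagr: "lagrangian f" and min: "minimal f"
  and conf: "conformal f" and cubic: "!!p. herm (d_z (d_z (d_z f)) p) (f p) = 1"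
  and SU3: "!!p. in_SU3 (frame f p)"
begin

abbreviation "fx \<equiv> d_x f"
abbreviation "fy \<equiv> d_y f"

lemmas smx = smooth_partial(1)[OF smooth] and smy = smooth_partial(2)[OF smooth]
lemmas smz = smooth_d_z(1)[OF smooth] and smzb = smooth_d_z(2)[OF smooth]
lemmas diff = smooth_differentiable[OF smooth] smooth_differentiable[OF smx] smooth_differentiable[OF smy]
 smooth_differentiable[OF smz] smooth_differentiable[OF smzb]

lemma herm_xy: "herm (fx p) (fy p) = 0" "herm (fy p) (fx p) = 0"
proof -
 show 1: "herm (fx p) (fy p) = 0" using conf lagr unfolding conformal_def lagrangian_def by (simp add: complex_eq_iff)
 show "herm (fy p) (fx p) = 0" using herm_cnj[of "fx p" "fy p"] 1 by simp
qed

lemma herm_xx_yy: "herm (fx p) (fx p) = herm (fy p) (fy p)" using conf unfolding conformal_def herm_self by simp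

lemma fx_nonzero: "fx p ~= 0" using immersive unfolding immersive_def by simp

lemma herm_z_zb: "herm (d_z f p) (d_zbar f p) = 0"
 unfolding d_z_def d_zbar_def using herm_xy[of p] herm_xx_yy[of p] by (simp add: herm_simps algebra_simps)

lemma herm_z_z: "herm (d_z f p) (d_z f p) = herm (fx p) (fx p) / 2"
 "herm (d_zbar f p) (d_zbar f p) = herm (fx p) (fx p) / 2"
 unfolding d_z_def d_zbar_def using herm_xy[of p] herm_xx_yy[of p] by (simp_all add: herm_simps algebra_simps)

definition r :: "complex => real" where "r p = norm (d_z f p)"

lemma norm_zb: "norm (d_zbar f p) = r p"
proof -
 have "herm (d_zbar f p) (d_zbar f p) = herm (d_z f p) (d_z f p)" unfolding herm_z_z ..
 hence "(norm (d_zbar f p))\<^sup>2 = (r p)\<^sup>2" unfolding herm_self r_def by (metis of_real_eq_iff)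
 thus ?thesis unfolding r_def by simp
qed

lemma r_pos: "0 < r p"
proof -
 have "herm (fx p) (fx p) ~= 0" using fx_nonzero unfolding herm_self by simp
 hence "herm (d_z f p) (d_z f p) ~= 0" unfolding herm_z_z by simp
 thus ?thesis unfolding herm_self r_def by simp
qed

lemma herm_r: "herm (d_z f p) (d_z f p) = of_real ((r p)\<^sup>2)" "herm (d_zbar f p) (d_zbar f p) = of_real ((r p)\<^sup>2)"
 unfolding herm_self norm_zb r_def by simp_all

lemma herm_f_f: "herm (f p) (f p) = 1" unfolding herm_self unit by simp

lemma herm_partial_f: "herm (fx p) (f p) = 0" "herm (fy p) (f p) = 0" "herm (f p) (fx p) = 0" "herm (f p) (fy p) = 0"
 using horizontal herm_cnj by (metis complex_cnj_zero)+

lemma herm_z_f: "herm (d_z f p) (f p) = 0" "herm (d_zbar f p) (f p) = 0"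
 "herm (f p) (d_z f p) = 0" "herm (f p) (d_zbar f p) = 0" unfolding d_z_def d_zbar_def using herm_partial_f by (simp_all add: herm_simps)

abbreviation "laplace p \<equiv> d_x fx p + d_y fy p"

lemma laplace_tangential: "Re (herm (laplace p) (fx p)) = 0" "Re (herm (laplace p) (fy p)) = 0"
proof -
 have comm: "d_x fy p = d_y fx p" by (rule partials_commute[OF smooth])
 have sym: "Re (herm a b) = Re (herm b a)" for a b by (metis herm_cnj cnj.sel(1))
 have n: "Re (herm (dir_deriv v fx p) (fx p)) = Re (herm (dir_deriv v fy p) (fy p))" for v
 proof -
  have "((%q. herm (fx q) (fx q)) has_derivative (%v. herm (fx p) (dir_deriv v fx p) + herm (dir_deriv v fx p) (fx p))) (at p)"
   by (rule bounded_bilinear.FDERIV[OF bounded_bilinear_herm dir_deriv_has_derivative[OF diff(2)] dir_deriv_has_derivative[OF diff(2)]])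
  moreover have "((%q. herm (fx q) (fx q)) has_derivative (%v. herm (fy p) (dir_deriv v fy p) + herm (dir_deriv v fy p) (fy p))) (at p)"
   unfolding herm_xx_yy
   by (rule bounded_bilinear.FDERIV[OF bounded_bilinear_herm dir_deriv_has_derivative[OF diff(3)] dir_deriv_has_derivative[OF diff(3)]])
  ultimately have "herm (fx p) (dir_deriv v fx p) + herm (dir_deriv v fx p) (fx p)
    = herm (fy p) (dir_deriv v fy p) + herm (dir_deriv v fy p) (fy p)" using fun_cong[OF has_derivative_unique] by blast
  hence "Re (herm (fx p) (dir_deriv v fx p)) + Re (herm (dir_deriv v fx p) (fx p))
    = Re (herm (fy p) (dir_deriv v fy p)) + Re (herm (dir_deriv v fy p) (fy p))" by (metis plus_complex.sel(1))
  thus ?thesis using sym[of "fx p" "dir_deriv v fx p"] sym[of "fy p" "dir_deriv v fy p"] by simp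
 qed
 have o: "Re (herm (dir_deriv v fx p) (fy p)) + Re (herm (fx p) (dir_deriv v fy p)) = 0" for v
  using herm_const_derivative[OF diff(2,3) herm_xy(1), of v p] by (metis plus_complex.sel(1) zero_complex.sel(1))
 have "Re (herm (d_x fx p) (fx p)) = Re (herm (d_y fx p) (fy p))" using n[of 1] comm by simp
 also have "\<dots> = - Re (herm (fx p) (d_y fy p))" using o[of \<i>] by simp
 finally show "Re (herm (laplace p) (fx p)) = 0" using sym[of "fx p" "d_y fy p"] by (simp add: herm_simps)
 have "Re (herm (d_y fy p) (fy p)) = Re (herm (d_y fx p) (fx p))" using n[of \<i>] by simp
 also have "\<dots> = Re (herm (fx p) (d_x fy p))" using sym comm by simp
 also have "\<dots> = - Re (herm (d_x fx p) (fy p))" using o[of 1] by simp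
 finally show "Re (herm (laplace p) (fy p)) = 0" by (simp add: herm_simps)
qed

text \<open>By minimality the horizontal part of the Laplacian is tangent to the surface; as it is also orthogonal
 to the tangent plane, it vanishes.\<close>
lemma laplace_radial: "\<exists>c. laplace p = c *s f p"
proof -
 define E where "E = Re (herm (fx p) (fx p))"
 have E: "herm (fx p) (fx p) = of_real E" "herm (fy p) (fy p) = of_real E"
  unfolding E_def using herm_self[of "fx p"] herm_xx_yy[of p] by simp_all
 have E0: "E ~= 0" unfolding E_def herm_self using fx_nonzero[of p] by simp
 have "horizontal_part (f p) (E *\<^sub>R d_x fx p - (2 * Re (herm (fx p) (fy p))) *\<^sub>R d_x fy p + E *\<^sub>R d_y fy p) \<in> span {fx p, fy p}"
  using min unfolding minimal_def Let_def by (metis E Re_complex_of_real)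
 hence "horizontal_part (f p) (E *\<^sub>R laplace p) \<in> span {fx p, fy p}" using herm_xy(1)[of p] by (simp add: algebra_simps)
 then obtain a b where ab: "horizontal_part (f p) (E *\<^sub>R laplace p) = a *\<^sub>R fx p + b *\<^sub>R fy p"
  unfolding span_insert by (auto simp: span_singleton algebra_simps)
 define k where "k = herm (E *\<^sub>R laplace p) (f p)"
 have H: "E *\<^sub>R laplace p = k *s f p + a *\<^sub>R fx p + b *\<^sub>R fy p" using ab unfolding horizontal_part_def k_def by (simp add: algebra_simps)
 have "herm (E *\<^sub>R laplace p) (fx p) = of_real a * of_real E"
  unfolding H using herm_partial_f[of p] herm_xy[of p] E by (simp add: herm_simps)
 hence "Re (of_real E * herm (laplace p) (fx p)) = a * E" by (metis herm_scaleR_left Re_complex_of_real of_real_mult)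
 hence "a * E = 0" using laplace_tangential(1)[of p] by simp
 hence a: "a = 0" using E0 by simp
 have "herm (E *\<^sub>R laplace p) (fy p) = of_real b * of_real E"
  unfolding H using herm_partial_f[of p] herm_xy[of p] E by (simp add: herm_simps)
 hence "Re (of_real E * herm (laplace p) (fy p)) = b * E" by (metis herm_scaleR_left Re_complex_of_real of_real_mult)
 hence "b * E = 0" using laplace_tangential(2)[of p] by simp
 hence b: "b = 0" using E0 by simp
 have "E *\<^sub>R laplace p = k *s f p" using H a b by simp
 hence "(1 / E) *\<^sub>R (E *\<^sub>R laplace p) = (1 / E) *\<^sub>R (k *s f p)" by simp
 hence "laplace p = (1 / E) *\<^sub>R (k *s f p)" using E0 by simp
 also have "\<dots> = (of_real (1 / E) * k) *s f p" by (simp add: vec_eq_iff scaleR_conv_of_real[where 'a = complex])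
 finally show ?thesis by blast
qed

lemma d_zbar_d_z: "\<exists>c. d_zbar (d_z f) p = c *s f p"
proof -
 obtain c where c: "laplace p = c *s f p" using laplace_radial by blast
 have d: "dir_deriv v (d_z f) p = (1/2) *s (dir_deriv v fx p - \<i> *s dir_deriv v fy p)" for v
 proof -
  have e: "d_z f = (%p. (1/2) *s fx p + (- \<i> / 2) *s fy p)" unfolding d_z_def fun_eq_iff vec_eq_iff by (auto simp: algebra_simps)
  have "dir_deriv v (d_z f) p = (1/2) *s dir_deriv v fx p + (- \<i> / 2) *s dir_deriv v fy p" unfolding e by (rule dir_deriv_eq)
    (intro has_derivative_add bounded_linear.has_derivative[OF bounded_linear_smult] dir_deriv_has_derivative diff)
  thus ?thesis by (simp add: vec_eq_iff algebra_simps)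
 qed
 have "d_zbar (d_z f) p = (1/4) *s laplace p" unfolding d_zbar_def[of "d_z f"] d using partials_commute[OF smooth, of p]
  by (simp add: vec_eq_iff algebra_simps)
 hence "d_zbar (d_z f) p = ((1/4) * c) *s f p" unfolding c by simp
 thus ?thesis by blast
qed

text \<open>The part along \<open>dz\<close> is the normalised cubic form, by differentiating \<open>\<langle>f\<^sub>z\<^sub>z, f\<rangle> = 0\<close>; the other part
 vanishes because the mixed derivative of \<open>f\<close> is proportional to \<open>f\<close>.\<close>
lemma herm_dz_zb: "herm (dir_deriv v (d_z f) p) (d_zbar f p) = - v"
proof -
 have 1: "herm (d_z (d_z f) q) (f q) = 0" for q using herm_d_z[OF diff(4) diff(1) herm_z_f(1), of q] herm_z_zb[of q] by simp
 have dzz: "d_z (d_z f) differentiable (at p)" for p by (rule smooth_differentiable[OF smooth_d_z(1)[OF smz]])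
 have "herm (d_z (d_z (d_z f)) p) (f p) + herm (d_z (d_z f) p) (d_zbar f p) = 0" by (rule herm_d_z[OF dzz diff(1) 1])
 hence 2: "herm (d_z (d_z f) p) (d_zbar f p) = - 1" using cubic[of p] by (simp add: add_eq_0_iff)
 obtain c where c: "d_zbar (d_z f) p = c *s f p" using d_zbar_d_z by blast
 have "dir_deriv v (d_z f) p = v *s d_z (d_z f) p + cnj v *s d_zbar (d_z f) p" by (rule dir_deriv_complex[OF diff(4)])
 thus ?thesis using 2 herm_z_f(4)[of p] by (simp add: herm_simps c)
qed

text \<open>By the Lagrangian condition and minimality the trace of the connection form is real; as the form is also
 skew-hermitian, the trace vanishes.\<close>
lemma Im_trace: "Im (herm (dir_deriv v (d_z f) p) (d_z f p) + herm (dir_deriv v (d_zbar f) p) (d_zbar f p)) = 0"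
proof -
 have d: "dir_deriv v (d_z f) p = (1/2) *s (dir_deriv v fx p - \<i> *s dir_deriv v fy p)"
  "dir_deriv v (d_zbar f) p = (1/2) *s (dir_deriv v fx p + \<i> *s dir_deriv v fy p)" for v
 proof -
  have e: "d_z f = (%p. (1/2) *s fx p + (- \<i> / 2) *s fy p)" "d_zbar f = (%p. (1/2) *s fx p + (\<i> / 2) *s fy p)"
   unfolding d_z_def d_zbar_def fun_eq_iff vec_eq_iff by (auto simp: algebra_simps)
  have lin: "dir_deriv v (%p. (1/2) *s fx p + k *s fy p) p = (1/2) *s dir_deriv v fx p + k *s dir_deriv v fy p" for k
   by (rule dir_deriv_eq)
    (intro has_derivative_add bounded_linear.has_derivative[OF bounded_linear_smult] dir_deriv_has_derivative diff)
  show "dir_deriv v (d_z f) p = (1/2) *s (dir_deriv v fx p - \<i> *s dir_deriv v fy p)"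
   "dir_deriv v (d_zbar f) p = (1/2) *s (dir_deriv v fx p + \<i> *s dir_deriv v fy p)"
   unfolding e lin by (simp_all add: vec_eq_iff algebra_simps)
 qed
 have sum: "herm (dir_deriv v (d_z f) p) (d_z f p) + herm (dir_deriv v (d_zbar f) p) (d_zbar f p)
   = (1/2) * (herm (dir_deriv v fx p) (fx p) + herm (dir_deriv v fy p) (fy p))"
  unfolding d d_z_def[of f p] d_zbar_def[of f p] by (simp add: herm_simps algebra_simps)
 have Dv: "dir_deriv v f = (%q. Re v *\<^sub>R fx q + Im v *\<^sub>R fy q)" using dir_deriv_expand[OF diff(1)] by blast
 have Dvd: "dir_deriv v f differentiable (at p)" for p unfolding Dv by (intro derivative_intros diff)
 have Dw: "dir_deriv u (dir_deriv v f) p = Re v *\<^sub>R dir_deriv u fx p + Im v *\<^sub>R dir_deriv u fy p" for u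
  unfolding Dv by (rule dir_deriv_eq) (intro has_derivative_add has_derivative_scaleR_right dir_deriv_has_derivative diff)
 have comm: "d_x fy p = d_y fx p" by (rule partials_commute[OF smooth])
 have cx: "dir_deriv v fx p = d_x (dir_deriv v f) p" "dir_deriv v fy p = d_y (dir_deriv v f) p"
  unfolding Dw dir_deriv_expand[OF diff(2), of v] dir_deriv_expand[OF diff(3), of v] comm by simp_all
 have L: "Im (herm (dir_deriv v f q) (fx q)) = 0" "Im (herm (dir_deriv v f q) (fy q)) = 0" for q
  using lagr unfolding lagrangian_def by blast+
 have "Im (herm (d_x (dir_deriv v f) p) (fx p)) + Im (herm (dir_deriv v f p) (d_x fx p)) = 0"
  by (rule herm_Im_derivative[OF Dvd diff(2) L(1)])
 moreover have "Im (herm (d_y (dir_deriv v f) p) (fy p)) + Im (herm (dir_deriv v f p) (d_y fy p)) = 0"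
  by (rule herm_Im_derivative[OF Dvd diff(3) L(2)])
 moreover obtain c where "laplace p = c *s f p" using laplace_radial by blast
 hence "herm (dir_deriv v f p) (laplace p) = 0" using horizontal[of v p] by (simp add: herm_simps)
 hence "Im (herm (dir_deriv v f p) (d_x fx p)) + Im (herm (dir_deriv v f p) (d_y fy p)) = 0"
  by (simp add: herm_simps) (metis plus_complex.sel(2) zero_complex.sel(2))
 ultimately have "Im (herm (dir_deriv v fx p) (fx p)) + Im (herm (dir_deriv v fy p) (fy p)) = 0" unfolding cx by linarith
 thus ?thesis unfolding sum by simp
qed

definition col2 :: "complex => complex^3" where "col2 p = (1 / r p) *\<^sub>R d_z f p"
definition col3 :: "complex => complex^3" where "col3 p = - ((1 / r p) *\<^sub>R d_zbar f p)"

lemma frame_eq: "frame f p = transpose (vector [f p, col2 p, col3 p])" unfolding frame_def col2_def col3_def norm_zb r_def ..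

lemma differentiable_inverse_r: "(%p. 1 / r p) differentiable (at p)"
proof -
 have "norm differentiable (at (d_z f p))" using r_pos[of p] differentiable_norm_at[of "d_z f p"] unfolding r_def by auto
 hence "(%p. norm (d_z f p)) differentiable (at p)" using differentiable_chain_at[OF diff(4), of norm p] by (simp add: o_def)
 thus ?thesis using r_pos[of p] unfolding r_def by (intro derivative_intros) auto
qed

lemma col_differentiable: "col2 differentiable (at p)" "col3 differentiable (at p)"
 unfolding col2_def col3_def by (intro derivative_intros differentiable_inverse_r diff)+

lemma dir_deriv_cols: "\<exists>k. dir_deriv v col2 p = k *\<^sub>R d_z f p + (1 / r p) *\<^sub>R dir_deriv v (d_z f) p
  \<and> dir_deriv v col3 p = - (k *\<^sub>R d_zbar f p + (1 / r p) *\<^sub>R dir_deriv v (d_zbar f) p)"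
proof -
 note hr = dir_deriv_has_derivative[OF differentiable_inverse_r, of p]
 have "dir_deriv v col2 p = (1 / r p) *\<^sub>R dir_deriv v (d_z f) p + dir_deriv v (%p. 1 / r p) p *\<^sub>R d_z f p"
  unfolding col2_def by (rule dir_deriv_eq) (rule has_derivative_scaleR[OF hr dir_deriv_has_derivative[OF diff(4)]])
 moreover have "dir_deriv v col3 p = - ((1 / r p) *\<^sub>R dir_deriv v (d_zbar f) p + dir_deriv v (%p. 1 / r p) p *\<^sub>R d_zbar f p)"
  unfolding col3_def by (rule dir_deriv_eq)
   (rule has_derivative_minus[OF has_derivative_scaleR[OF hr dir_deriv_has_derivative[OF diff(5)]]])
 ultimately show ?thesis by (intro exI[of _ "dir_deriv v (%p. 1 / r p) p"]) (simp add: add.commute)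
qed

lemma matrix_of_columns:
 "transpose (vector [a, b, c] :: mat3) = (\<chi> i j. if j = 1 then a $ i else if j = 2 then b $ i else c $ i)"
 unfolding transpose_def vec_eq_iff forall_3 by simp

lemma dir_deriv_frame: "dir_deriv v (frame f) p
  = transpose (vector [dir_deriv v f p, dir_deriv v col2 p, dir_deriv v col3 p])"
proof (rule dir_deriv_eq)
 let ?M = "%(a, b, c). transpose (vector [a, b, c] :: mat3)"
 have "linear ?M" unfolding matrix_of_columns by (intro linearI) (auto simp: vec_eq_iff)
 hence bl: "bounded_linear ?M" by (simp add: linear_conv_bounded_linear)
 have "((%p. (f p, col2 p, col3 p)) has_derivative (%v. (dir_deriv v f p, dir_deriv v col2 p, dir_deriv v col3 p))) (at p)"
  by (intro has_derivative_Pair dir_deriv_has_derivative diff col_differentiable)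
 from bounded_linear.has_derivative[OF bl this]
 show "(frame f has_derivative (%v. transpose (vector [dir_deriv v f p, dir_deriv v col2 p, dir_deriv v col3 p]))) (at p)"
  unfolding frame_eq[abs_def] by simp
qed

lemma inverse_frame: "matrix_inv (frame f p) = map_matrix cnj (transpose (frame f p))"
proof -
 have "frame f p ** map_matrix cnj (transpose (frame f p)) = mat 1" using SU3 unfolding in_SU3_def by blast
 thus ?thesis by (rule matrix_inv_eq)
qed

lemma conn_entries:
 "conn f p v $ i $ j = herm (column j (dir_deriv v (frame f) p)) (column i (frame f p))"
 unfolding conn_def inverse_frame matrix_matrix_mult_def map_matrix_def transpose_def herm_def by (simp add: column_def mult.commute)

lemma conn_form: "\<exists>d. conn f p v = smat v (cyclic_lower (r p)) + diagonal_pair d + smat (cnj v) (cyclic_upper (r p))"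
proof -
 let ?R = "of_real (r p) :: complex"
 have R0: "?R ~= 0" using r_pos[of p] by simp
 have colF: "column 1 (frame f p) = f p" "column 2 (frame f p) = col2 p" "column 3 (frame f p) = col3 p"
  unfolding frame_eq matrix_of_columns column_def vec_eq_iff by simp_all
 have colD: "column 1 (dir_deriv v (frame f) p) = dir_deriv v f p"
  "column 2 (dir_deriv v (frame f) p) = dir_deriv v col2 p"
  "column 3 (dir_deriv v (frame f) p) = dir_deriv v col3 p" unfolding dir_deriv_frame matrix_of_columns column_def vec_eq_iff by simp_all
 have orth: "herm (f q) (col2 q) = 0" "herm (f q) (col3 q) = 0" "herm (col2 q) (col3 q) = 0"
  "herm (f q) (f q) = 1" "herm (col2 q) (col2 q) = 1" "herm (col3 q) (col3 q) = 1" for q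
  unfolding col2_def col3_def using herm_z_f[of q] herm_z_zb[of q] herm_f_f[of q] herm_r[of q] r_pos[of q]
  by (simp_all add: herm_simps power2_eq_square)
 have Df: "dir_deriv v f p = v *s d_z f p + cnj v *s d_zbar f p" by (rule dir_deriv_complex[OF diff(1)])
 have zbz: "herm (d_zbar f p) (d_z f p) = 0" using herm_cnj[of "d_z f p" "d_zbar f p"] herm_z_zb[of p] by simp
 let ?M = "conn f p v"
 have M: "?M $ 1 $ 1 = herm (dir_deriv v f p) (f p)" "?M $ 2 $ 1 = herm (dir_deriv v f p) (col2 p)"
  "?M $ 3 $ 1 = herm (dir_deriv v f p) (col3 p)" "?M $ 1 $ 2 = herm (dir_deriv v col2 p) (f p)"
  "?M $ 2 $ 2 = herm (dir_deriv v col2 p) (col2 p)" "?M $ 3 $ 2 = herm (dir_deriv v col2 p) (col3 p)"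
  "?M $ 1 $ 3 = herm (dir_deriv v col3 p) (f p)" "?M $ 2 $ 3 = herm (dir_deriv v col3 p) (col2 p)"
  "?M $ 3 $ 3 = herm (dir_deriv v col3 p) (col3 p)" unfolding conn_entries colF colD by simp_all
 have m11: "?M $ 1 $ 1 = 0" unfolding M using horizontal by simp
 have m21: "?M $ 2 $ 1 = v * ?R" unfolding M Df col2_def using herm_r(1)[of p] zbz R0 by (simp add: herm_simps power2_eq_square)
 have m31: "?M $ 3 $ 1 = - cnj v * ?R"
  unfolding M Df col3_def using herm_r(2)[of p] herm_z_zb[of p] R0 by (simp add: herm_simps power2_eq_square)
 have sk: "herm (dir_deriv v b p) (a p) = - cnj (herm (dir_deriv v a p) (b p))"
  if "a differentiable (at p)" "b differentiable (at p)" "!!q. herm (a q) (b q) = c" for a b c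
 proof -
  have "herm (dir_deriv v a p) (b p) + herm (a p) (dir_deriv v b p) = 0" by (rule herm_const_derivative[OF that])
  hence "herm (a p) (dir_deriv v b p) = - herm (dir_deriv v a p) (b p)" by (simp add: add_eq_0_iff)
  thus ?thesis using herm_cnj[of "a p" "dir_deriv v b p"] by simp
 qed
 have m12: "?M $ 1 $ 2 = - cnj v * ?R" using sk[OF diff(1) col_differentiable(1) orth(1)] m21 unfolding M by simp
 have m13: "?M $ 1 $ 3 = v * ?R" using sk[OF diff(1) col_differentiable(2) orth(2)] m31 unfolding M by simp
 obtain k where k: "dir_deriv v col2 p = k *\<^sub>R d_z f p + (1 / r p) *\<^sub>R dir_deriv v (d_z f) p"
  "dir_deriv v col3 p = - (k *\<^sub>R d_zbar f p + (1 / r p) *\<^sub>R dir_deriv v (d_zbar f) p)" using dir_deriv_cols by blast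
 have m32: "?M $ 3 $ 2 = v * of_real (1 / (r p)\<^sup>2)"
  unfolding M k col3_def using herm_z_zb[of p] herm_dz_zb[of v p] by (simp add: herm_simps power2_eq_square)
 have m23: "?M $ 2 $ 3 = - cnj v * of_real (1 / (r p)\<^sup>2)" using sk[OF col_differentiable orth(3)] m32 unfolding M by simp
 have "?M $ 2 $ 2 + ?M $ 3 $ 3 = 0"
 proof -
  have re: "Re (?M $ 2 $ 2) = 0" "Re (?M $ 3 $ 3) = 0"
   using sk[OF col_differentiable(1,1) orth(5)] sk[OF col_differentiable(2,2) orth(6)] unfolding M
   by (metis add.inverse_inverse cnj.sel(1) eq_neg_iff_add_eq_0 uminus_complex.sel(1) add_eq_0_iff field_sum_of_halves neg_equal_zero)+
  have "?M $ 2 $ 2 + ?M $ 3 $ 3 = of_real (2 * k * r p)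
    + of_real (1 / (r p)\<^sup>2) * (herm (dir_deriv v (d_z f) p) (d_z f p) + herm (dir_deriv v (d_zbar f) p) (d_zbar f p))"
   unfolding M k col2_def col3_def using herm_r[of p] R0 by (simp add: herm_simps power2_eq_square field_simps)
  hence "Im (?M $ 2 $ 2 + ?M $ 3 $ 3) = 0" using Im_trace[of v p] by simp
  thus ?thesis using re by (simp add: complex_eq_iff)
 qed
 hence m33: "?M $ 3 $ 3 = - ?M $ 2 $ 2" by (simp add: add_eq_0_iff)
 show ?thesis by (intro exI[of _ "?M $ 2 $ 2"])
   (simp add: vec_eq_iff forall_3 smat_def map_matrix_def cyclic_lower_def cyclic_upper_def diagonal_pair_def
    m11 m12 m13 m21 m23 m31 m32 m33)
qed

lemma conn_loop_form: "\<exists>d. \<forall>\<zeta>. conn_loop f \<zeta> p v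
  = smat (\<zeta> * v) (cyclic_lower (r p)) + diagonal_pair d + smat (inverse \<zeta> * cnj v) (cyclic_upper (r p))"
proof -
 have "\<forall>v. \<exists>d. conn f p v = smat v (cyclic_lower (r p)) + diagonal_pair d + smat (cnj v) (cyclic_upper (r p))" using conn_form by blast
 then obtain d where d: "!!v. conn f p v = smat v (cyclic_lower (r p)) + diagonal_pair (d v) + smat (cnj v) (cyclic_upper (r p))" by metis
 have "conn_loop f \<zeta> p v
  = smat (\<zeta> * v) (cyclic_lower (r p)) + diagonal_pair (d v) + smat (inverse \<zeta> * cnj v) (cyclic_upper (r p))" for \<zeta>
  unfolding conn_loop_def type10_def type01_def d
  by (simp add: vec_eq_iff forall_3 smat_def map_matrix_def cyclic_lower_def cyclic_upper_def diagonal_pair_def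
    offdiag_part_def diag_part_def algebra_simps)
 thus ?thesis by blast
qed

end

section \<open>Polynomial Killing fields\<close>

lemma smat_simps:
 "smat c (A + B) = smat c A + smat c B" "smat (c + d) A = smat c A + smat d A"
 "smat c (smat d A) = smat (c * d) A" "smat 1 A = A" "smat 0 A = 0" "smat c 0 = 0"
 "smat c (A - B) = smat c A - smat c B" "smat c (- A) = - smat c A" "smat (- c) A = - smat c A"
 "smat c A ** B = smat c (A ** B)" "A ** smat c B = smat c (A ** B)" unfolding smat_def map_matrix_def matrix_matrix_mult_def
 by (simp_all add: vec_eq_iff algebra_simps sum_distrib_left)

lemma smat_sum: "smat c (\<Sum>i\<in>I. A i) = (\<Sum>i\<in>I. smat c (A i))"
 unfolding smat_def map_matrix_def by (simp add: vec_eq_iff sum_component sum_distrib_left)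

lemma mat_smat: "mat c = smat c (mat 1)" unfolding smat_def map_matrix_def mat_def by (simp add: vec_eq_iff)

lemma matrix_distrib:
 fixes A B C :: mat3
 shows "(A + B) ** C = A ** C + B ** C" "A ** (B + C) = A ** B + A ** C"
  "(A - B) ** C = A ** C - B ** C" "A ** (B - C) = A ** B - A ** C"
  "(- A) ** C = - (A ** C)" "A ** (- C) = - (A ** C)" "0 ** A = 0" "A ** 0 = 0"
 unfolding matrix_matrix_mult_def by (simp_all add: vec_eq_iff algebra_simps sum.distrib sum_subtractf sum_negf)

lemma matrix_mult_sum:
 fixes A :: "'i => mat3"
 shows "(\<Sum>i\<in>I. A i) ** B = (\<Sum>i\<in>I. A i ** B)" "B ** (\<Sum>i\<in>I. A i) = (\<Sum>i\<in>I. B ** A i)"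
 by (induct I rule: infinite_finite_induct) (simp_all add: matrix_distrib)

lemma bounded_bilinear_matrix: "bounded_bilinear ((**) :: mat3 => mat3 => mat3)"
proof -
 have "(c *\<^sub>R A) ** B = c *\<^sub>R (A ** B)" "A ** (c *\<^sub>R B) = c *\<^sub>R (A ** B)" for c and A B :: mat3
  by (simp_all add: vec_eq_iff matrix_matrix_mult_def scaleR_sum_right)
 hence "bilinear ((**) :: mat3 => mat3 => mat3)" unfolding bilinear_def by (intro conjI allI linearI) (simp_all add: matrix_distrib)
 thus ?thesis by (simp add: bilinear_conv_bounded_bilinear)
qed

lemma bounded_linear_smat: "bounded_linear (smat c)"
proof -
 have "linear (smat c)" by (intro linearI) (simp_all add: smat_simps, simp add: smat_def map_matrix_def vec_eq_iff)
 thus ?thesis by (simp add: linear_conv_bounded_linear)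
qed

lemma transpose_simps:
 "transpose (A + B) = transpose A + transpose B" "transpose (A - B) = transpose A - transpose (B::mat3)"
 "transpose (smat c A) = smat c (transpose A)" "transpose (- A) = - transpose (A::mat3)"
 unfolding transpose_def smat_def map_matrix_def by (simp_all add: vec_eq_iff)

definition laurent :: "int => (complex => mat3) => bool" where
 "laurent N g \<longleftrightarrow> (\<exists>c. \<forall>\<zeta>. \<zeta> ~= 0 \<longrightarrow> g \<zeta> = (\<Sum>k = -N..N. smat (\<zeta> powi k) (c k)))"

lemma laurent_zero: "laurent N (%_. 0)" unfolding laurent_def by (intro exI[of _ "%_. 0"]) (simp add: smat_simps)

lemma laurent_add: "laurent N g ==> laurent N h ==> laurent N (%\<zeta>. g \<zeta> + h \<zeta>)"
proof -
 assume "laurent N g" "laurent N h"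
 then obtain c d where "!!\<zeta>. \<zeta> ~= 0 ==> g \<zeta> = (\<Sum>k = -N..N. smat (\<zeta> powi k) (c k))"
  "!!\<zeta>. \<zeta> ~= 0 ==> h \<zeta> = (\<Sum>k = -N..N. smat (\<zeta> powi k) (d k))" unfolding laurent_def by blast
 thus ?thesis unfolding laurent_def by (intro exI[of _ "%k. c k + d k"]) (simp add: smat_simps sum.distrib)
qed

lemma laurent_sum: "finite I ==> (!!i. i \<in> I ==> laurent N (g i)) ==> laurent N (%\<zeta>. \<Sum>i\<in>I. g i \<zeta>)"
 by (induct I rule: finite_induct) (auto simp: laurent_zero laurent_add)

lemma laurent_monomial: assumes "\<bar>k\<bar> \<le> N" shows "laurent N (%\<zeta>. smat (\<zeta> powi k) A)" unfolding laurent_def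
proof (intro exI[of _ "%j. if j = k then A else 0"] allI impI)
 fix \<zeta> :: complex assume "\<zeta> ~= 0"
 have "(\<Sum>j = -N..N. smat (\<zeta> powi j) (if j = k then A else 0)) = (\<Sum>j = -N..N. if j = k then smat (\<zeta> powi k) A else 0)"
  by (intro sum.cong) (auto simp: smat_simps)
 also have "\<dots> = smat (\<zeta> powi k) A"
 proof -
  have "- N \<le> k" "k \<le> N" using assms by auto
  thus ?thesis by (simp add: sum.delta)
 qed
 finally show "smat (\<zeta> powi k) A = (\<Sum>j = -N..N. smat (\<zeta> powi j) (if j = k then A else 0))" by simp
qed

lemma laurent_cong: "laurent N g ==> (!!\<zeta>. \<zeta> ~= 0 ==> g \<zeta> = h \<zeta>) ==> laurent N h" unfolding laurent_def by simp

lemma laurent_mono: assumes "laurent N g" "N \<le> M" shows "laurent M g"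
proof -
 obtain c where c: "!!\<zeta>. \<zeta> ~= 0 ==> g \<zeta> = (\<Sum>k = -N..N. smat (\<zeta> powi k) (c k))" using assms(1) unfolding laurent_def by blast
 have "laurent M (%\<zeta>. \<Sum>k = -N..N. smat (\<zeta> powi k) (c k))" using assms(2) by (intro laurent_sum laurent_monomial) auto
 thus ?thesis by (rule laurent_cong) (simp add: c)
qed

lemma laurent_mult: assumes "laurent N g" "laurent M h" shows "laurent (N + M) (%\<zeta>. g \<zeta> ** h \<zeta>)"
proof -
 obtain c where c: "!!\<zeta>. \<zeta> ~= 0 ==> g \<zeta> = (\<Sum>k = -N..N. smat (\<zeta> powi k) (c k))" using assms(1) unfolding laurent_def by blast
 obtain d where d: "!!\<zeta>. \<zeta> ~= 0 ==> h \<zeta> = (\<Sum>k = -M..M. smat (\<zeta> powi k) (d k))" using assms(2) unfolding laurent_def by blast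
 have "laurent (N + M) (%\<zeta>. \<Sum>k = -N..N. \<Sum>l = -M..M. smat (\<zeta> powi (k + l)) (c k ** d l))" by (intro laurent_sum laurent_monomial) auto
 thus ?thesis
 proof (rule laurent_cong)
  fix \<zeta> :: complex assume z: "\<zeta> ~= 0"
  show "(\<Sum>k = -N..N. \<Sum>l = -M..M. smat (\<zeta> powi (k + l)) (c k ** d l)) = g \<zeta> ** h \<zeta>" unfolding c[OF z] d[OF z] matrix_mult_sum using z
   by (subst sum.swap) (simp add: smat_simps power_int_add mult.commute)
 qed
qed

lemma laurent_transform:
 assumes "laurent N g" "!!A B. h (A + B) = h A + h B" "!!z A. h (smat z A) = smat z (h A)" "a ~= 0"
 shows "laurent N (%\<zeta>. h (g (a * \<zeta>)))"
proof -
 obtain c where c: "!!\<zeta>. \<zeta> ~= 0 ==> g \<zeta> = (\<Sum>k = -N..N. smat (\<zeta> powi k) (c k))" using assms(1) unfolding laurent_def by blast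
 have h0: "h 0 = 0" using assms(3)[of 0 0] by (simp add: smat_simps)
 have hs: "h (\<Sum>i\<in>I. A i) = (\<Sum>i\<in>I. h (A i))" if "finite I" for I :: "int set" and A
  using that by (induct I rule: finite_induct) (simp_all add: h0 assms(2))
 have "laurent N (%\<zeta>. \<Sum>k = -N..N. smat (\<zeta> powi k) (smat (a powi k) (h (c k))))" by (intro laurent_sum laurent_monomial) auto
 thus ?thesis by (rule laurent_cong) (use assms(4) in \<open>simp add: c hs assms(3) smat_simps power_int_mult_distrib mult.commute\<close>)
qed

lemma laurent_field_iff:
 "laurent_field \<xi> \<longleftrightarrow> \<xi> 0 = (%p. 0) \<and> (\<exists>N. \<forall>p. laurent N (%\<zeta>. \<xi> \<zeta> p))"
proof
 assume "laurent_field \<xi>"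
 then obtain N c where z: "\<xi> 0 = (%p. 0)" and c: "!!\<zeta> p. \<zeta> ~= 0 ==> \<xi> \<zeta> p = (\<Sum>k = -N..N. smat (\<zeta> powi k) (c k p))"
  unfolding laurent_field_def by blast
 thus "\<xi> 0 = (%p. 0) \<and> (\<exists>N. \<forall>p. laurent N (%\<zeta>. \<xi> \<zeta> p))" unfolding laurent_def
  by (intro conjI exI[of _ N] allI) (auto intro!: exI[of _ "%k. c k _"])
next
 assume "\<xi> 0 = (%p. 0) \<and> (\<exists>N. \<forall>p. laurent N (%\<zeta>. \<xi> \<zeta> p))"
 then obtain N where z: "\<xi> 0 = (%p. 0)" and "\<forall>p. \<exists>c. \<forall>\<zeta>. \<zeta> ~= 0 \<longrightarrow> \<xi> \<zeta> p = (\<Sum>k = -N..N. smat (\<zeta> powi k) (c k))"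
  unfolding laurent_def by blast
 from choice[OF this(2)] obtain c where c: "!!p \<zeta>. \<zeta> ~= 0 ==> \<xi> \<zeta> p = (\<Sum>k = -N..N. smat (\<zeta> powi k) (c p k))" by blast
 show "laurent_field \<xi>" unfolding laurent_field_def using z c by (intro conjI exI[of _ N] exI[of _ "%k p. c p k"]) auto
qed

lemma eps_props: "eps ^ 3 = 1" "eps ~= 0" "eps ~= 1" "eps\<^sup>2 ~= 1"
proof -
 show e3: "eps ^ 3 = 1" unfolding eps_def using Complex.DeMoivre[of "2 * pi / 3" 3] by simp
 show "eps ~= 0" unfolding eps_def by simp
 have i: "Im eps ~= 0" unfolding eps_def by (simp add: sin_120)
 thus e1: "eps ~= 1" by auto
 show "eps\<^sup>2 ~= 1"
 proof
  assume "eps\<^sup>2 = 1"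
  hence "eps ^ 3 = eps" by (simp add: power3_eq_cube power2_eq_square)
  thus False using e3 e1 by simp
 qed
qed

lemma S_inv: "matrix_inv S_mat = vector [vector [1, 0, 0], vector [0, eps\<^sup>2, 0], vector [0, 0, eps]]"
proof (rule matrix_inv_eq)
 have "eps * eps\<^sup>2 = 1" using eps_props(1) by (simp add: power3_eq_cube power2_eq_square mult.assoc)
 thus "S_mat ** vector [vector [1, 0, 0], vector [0, eps\<^sup>2, 0], vector [0, 0, eps]] = mat 1"
  unfolding S_mat_def matrix_matrix_mult_def mat_def vec_eq_iff forall_3 by (simp add: sum_3 mult.commute)
qed

lemma S_inv_mult: "matrix_inv S_mat ** S_mat = mat 1" "S_mat ** matrix_inv S_mat = mat 1"
proof -
 have "eps * eps\<^sup>2 = 1" using eps_props(1) by (simp add: power3_eq_cube power2_eq_square mult.assoc)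
 thus "S_mat ** matrix_inv S_mat = mat 1" unfolding S_inv
  unfolding S_mat_def matrix_matrix_mult_def mat_def vec_eq_iff forall_3 by (simp add: sum_3 mult.commute)
 thus "matrix_inv S_mat ** S_mat = mat 1" using matrix_left_right_inverse by blast
qed

lemma T_T: "T_mat ** T_mat = mat 1" unfolding T_mat_def matrix_matrix_mult_def mat_def vec_eq_iff forall_3 by (simp add: sum_3)

definition T_flip :: "mat3 => mat3" where "T_flip A = T_mat ** transpose A ** T_mat"

lemma T_flip_simps:
 "T_flip (A + B) = T_flip A + T_flip B" "T_flip (A - B) = T_flip A - T_flip B"
 "T_flip (smat c A) = smat c (T_flip A)" "T_flip (A ** B) = T_flip B ** T_flip A" "T_flip (T_flip A) = A"
 "T_flip (mat 1) = mat 1" "T_flip (- A) = - T_flip A"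
proof -
 show "T_flip (A + B) = T_flip A + T_flip B" "T_flip (A - B) = T_flip A - T_flip B"
  "T_flip (smat c A) = smat c (T_flip A)" "T_flip (- A) = - T_flip A"
  unfolding T_flip_def by (simp_all add: transpose_simps matrix_distrib smat_simps)
 have "T_flip B ** T_flip A = T_mat ** transpose B ** (T_mat ** T_mat) ** transpose A ** T_mat"
  unfolding T_flip_def by (simp add: matrix_mul_assoc)
 thus "T_flip (A ** B) = T_flip B ** T_flip A" unfolding T_T by (simp add: T_flip_def matrix_transpose_mul matrix_mul_assoc)
 show "T_flip (mat 1) = mat 1" unfolding T_flip_def by (simp add: T_T)
 have Tt: "transpose T_mat = T_mat" unfolding T_mat_def transpose_def vec_eq_iff forall_3 by simp
 have "T_flip (T_flip A) = (T_mat ** T_mat) ** A ** (T_mat ** T_mat)"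
  unfolding T_flip_def by (simp add: matrix_transpose_mul Tt matrix_mul_assoc)
 thus "T_flip (T_flip A) = A" unfolding T_T by simp
qed

lemma T_flip_S: "T_flip (S_mat ** A ** matrix_inv S_mat) = S_mat ** T_flip A ** matrix_inv S_mat"
 unfolding T_flip_def S_inv unfolding S_mat_def T_mat_def transpose_def matrix_matrix_mult_def vec_eq_iff forall_3
 by (simp add: sum_3 algebra_simps)

lemma bounded_linear_T_flip: "bounded_linear T_flip"
proof -
 have "linear T_flip" unfolding T_flip_def T_mat_def transpose_def matrix_matrix_mult_def
  by (intro linearI) (simp_all add: vec_eq_iff forall_3 sum_3 algebra_simps)
 thus ?thesis by (simp add: linear_conv_bounded_linear)
qed

lemma mu_star_eq: "mu_star \<xi> = (%\<zeta> p. T_flip (\<xi> (- \<zeta>) p))" unfolding mu_star_def T_flip_def ..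

lemma commutator_mult: "commutator A C ** B + A ** commutator B C = commutator (A ** B) C"
 unfolding commutator_def by (simp add: matrix_distrib matrix_mul_assoc)

abbreviation killing_mult :: "loop_field => loop_field => loop_field" where
 "killing_mult \<xi> \<eta> \<equiv> (%\<zeta> p. \<xi> \<zeta> p ** \<eta> \<zeta> p)"
abbreviation killing_add :: "loop_field => loop_field => loop_field" where
 "killing_add \<xi> \<eta> \<equiv> (%\<zeta> p. \<xi> \<zeta> p + \<eta> \<zeta> p)"

lemma A_simps:
 "carrier (killing_algebra f) = killing_fields f"
 "\<xi> \<otimes>\<^bsub>killing_algebra f\<^esub> \<eta> = killing_mult \<xi> \<eta>"
 "\<xi> \<oplus>\<^bsub>killing_algebra f\<^esub> \<eta> = killing_add \<xi> \<eta>"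
 "\<one>\<^bsub>killing_algebra f\<^esub> = scalar_field (%_. 1)"
 "\<zero>\<^bsub>killing_algebra f\<^esub> = (%\<zeta> p. 0)" unfolding killing_algebra_def by simp_all

context
 fixes f :: "complex => complex^3"
begin

lemma killing_fields_I:
 assumes "\<xi> 0 = (%p. 0)" "!!p. laurent N (%\<zeta>. \<xi> \<zeta> p)"
  "!!\<zeta> p. \<zeta> ~= 0 ==> S_mat ** \<xi> \<zeta> p ** matrix_inv S_mat = \<xi> (eps * \<zeta>) p"
  "!!\<zeta> p. \<zeta> ~= 0 ==> (\<xi> \<zeta> has_derivative (%v. commutator (\<xi> \<zeta> p) (conn_loop f \<zeta> p v))) (at p)"
 shows "\<xi> \<in> killing_fields f"
proof -
 have "S_mat ** \<xi> \<zeta> p ** matrix_inv S_mat = \<xi> (eps * \<zeta>) p" for \<zeta> p by (cases "\<zeta> = 0") (simp_all add: assms(1,3) matrix_distrib)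
 thus ?thesis unfolding killing_fields_def laurent_field_iff using assms by blast
qed

lemma killing_fields_D:
 assumes "\<xi> \<in> killing_fields f"
 shows "\<xi> 0 = (%p. 0)" "\<exists>N. \<forall>p. laurent N (%\<zeta>. \<xi> \<zeta> p)"
  "S_mat ** \<xi> \<zeta> p ** matrix_inv S_mat = \<xi> (eps * \<zeta>) p"
  "\<zeta> ~= 0 ==> (\<xi> \<zeta> has_derivative (%v. commutator (\<xi> \<zeta> p) (conn_loop f \<zeta> p v))) (at p)"
 using assms unfolding killing_fields_def laurent_field_iff by blast+

lemma killing_mult_closed:
 assumes "\<xi> \<in> killing_fields f" "\<eta> \<in> killing_fields f" shows "killing_mult \<xi> \<eta> \<in> killing_fields f"
proof -
 obtain N M where N: "!!p. laurent N (%\<zeta>. \<xi> \<zeta> p)" "!!p. laurent M (%\<zeta>. \<eta> \<zeta> p)" using killing_fields_D(2) assms by metis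
 show ?thesis
 proof (rule killing_fields_I[where N = "N + M"])
  show "(%p. \<xi> 0 p ** \<eta> 0 p) = (%p. 0)" using killing_fields_D(1)[OF assms(1)] by (simp add: matrix_distrib)
  show "laurent (N + M) (%\<zeta>. \<xi> \<zeta> p ** \<eta> \<zeta> p)" for p by (intro laurent_mult N)
  fix \<zeta> :: complex and p assume z: "\<zeta> ~= 0"
  have "\<xi> (eps * \<zeta>) p ** \<eta> (eps * \<zeta>) p
    = S_mat ** \<xi> \<zeta> p ** (matrix_inv S_mat ** S_mat) ** \<eta> \<zeta> p ** matrix_inv S_mat"
   unfolding killing_fields_D(3)[OF assms(1), symmetric] killing_fields_D(3)[OF assms(2), symmetric] by (simp add: matrix_mul_assoc)
  thus "S_mat ** (\<xi> \<zeta> p ** \<eta> \<zeta> p) ** matrix_inv S_mat = \<xi> (eps * \<zeta>) p ** \<eta> (eps * \<zeta>) p"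
   unfolding S_inv_mult by (simp add: matrix_mul_assoc)
  have "((%p. \<xi> \<zeta> p ** \<eta> \<zeta> p) has_derivative (%v. \<xi> \<zeta> p ** commutator (\<eta> \<zeta> p) (conn_loop f \<zeta> p v)
    + commutator (\<xi> \<zeta> p) (conn_loop f \<zeta> p v) ** \<eta> \<zeta> p)) (at p)"
   by (rule bounded_bilinear.FDERIV[OF bounded_bilinear_matrix killing_fields_D(4)[OF assms(1) z] killing_fields_D(4)[OF assms(2) z]])
  moreover have "\<xi> \<zeta> p ** commutator (\<eta> \<zeta> p) C + commutator (\<xi> \<zeta> p) C ** \<eta> \<zeta> p
    = commutator (\<xi> \<zeta> p ** \<eta> \<zeta> p) C" for C using commutator_mult[of "\<xi> \<zeta> p" C "\<eta> \<zeta> p"] by (simp add: add.commute)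
  ultimately show "((%p. \<xi> \<zeta> p ** \<eta> \<zeta> p) has_derivative
    (%v. commutator (\<xi> \<zeta> p ** \<eta> \<zeta> p) (conn_loop f \<zeta> p v))) (at p)" by simp
 qed
qed

lemma killing_add_closed:
 assumes "\<xi> \<in> killing_fields f" "\<eta> \<in> killing_fields f" shows "killing_add \<xi> \<eta> \<in> killing_fields f"
proof -
 obtain N M where N: "!!p. laurent N (%\<zeta>. \<xi> \<zeta> p)" "!!p. laurent M (%\<zeta>. \<eta> \<zeta> p)" using killing_fields_D(2) assms by metis
 show ?thesis
 proof (rule killing_fields_I[where N = "max N M"])
  show "(%p. \<xi> 0 p + \<eta> 0 p) = (%p. 0)" using killing_fields_D(1)[OF assms(1)] killing_fields_D(1)[OF assms(2)] by simp
  show "laurent (max N M) (%\<zeta>. \<xi> \<zeta> p + \<eta> \<zeta> p)" for p by (intro laurent_add laurent_mono[OF N(1)] laurent_mono[OF N(2)]) auto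
  fix \<zeta> :: complex and p assume z: "\<zeta> ~= 0"
  show "S_mat ** (\<xi> \<zeta> p + \<eta> \<zeta> p) ** matrix_inv S_mat = \<xi> (eps * \<zeta>) p + \<eta> (eps * \<zeta>) p"
   unfolding killing_fields_D(3)[OF assms(1), symmetric] killing_fields_D(3)[OF assms(2), symmetric] by (simp add: matrix_distrib)
  have "((%p. \<xi> \<zeta> p + \<eta> \<zeta> p) has_derivative (%v. commutator (\<xi> \<zeta> p) (conn_loop f \<zeta> p v)
    + commutator (\<eta> \<zeta> p) (conn_loop f \<zeta> p v))) (at p)" by (intro has_derivative_add killing_fields_D(4) assms z)
  moreover have "commutator (\<xi> \<zeta> p) C + commutator (\<eta> \<zeta> p) C = commutator (\<xi> \<zeta> p + \<eta> \<zeta> p) C" for C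
   unfolding commutator_def by (simp add: matrix_distrib)
  ultimately show "((%p. \<xi> \<zeta> p + \<eta> \<zeta> p) has_derivative
    (%v. commutator (\<xi> \<zeta> p + \<eta> \<zeta> p) (conn_loop f \<zeta> p v))) (at p)" by simp
 qed
qed

lemma scalar_field_closed:
 assumes "\<bar>k\<bar> \<le> N" "3 dvd k" shows "scalar_field (%\<zeta>. c * \<zeta> powi k) \<in> killing_fields f"
proof (rule killing_fields_I[where N = N])
 show "scalar_field (%\<zeta>. c * \<zeta> powi k) 0 = (%p. 0)" unfolding scalar_field_def by simp
 have "laurent N (%\<zeta>. smat (\<zeta> powi k) (smat c (mat 1)))" by (rule laurent_monomial[OF assms(1)])
 thus "laurent N (%\<zeta>. scalar_field (%\<zeta>. c * \<zeta> powi k) \<zeta> p)" for p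
  by (rule laurent_cong) (simp add: scalar_field_def smat_simps mat_smat[of "c * _"] mult.commute)
 fix \<zeta> :: complex and p assume z: "\<zeta> ~= 0"
 obtain j where k: "k = 3 * j" using assms(2) by blast
 have "eps powi k = (eps ^ 3) powi j" unfolding k by (simp add: power_int_mult)
 hence e: "(eps * \<zeta>) powi k = \<zeta> powi k" unfolding eps_props(1) by (simp add: power_int_mult_distrib)
 have "S_mat ** smat x (mat 1) ** matrix_inv S_mat = smat x (mat 1)" for x by (simp add: smat_simps S_inv_mult)
 thus "S_mat ** scalar_field (%\<zeta>. c * \<zeta> powi k) \<zeta> p ** matrix_inv S_mat = scalar_field (%\<zeta>. c * \<zeta> powi k) (eps * \<zeta>) p"
  unfolding scalar_field_def using z eps_props(2) e by (simp add: mat_smat[of "c * _"])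
 have "commutator (smat x (mat 1)) C = 0" for x C unfolding commutator_def by (simp add: smat_simps)
 hence "commutator (scalar_field (%\<zeta>. c * \<zeta> powi k) \<zeta> p) C = 0" for C
  unfolding scalar_field_def using z by (simp add: mat_smat[of "c * _"])
 moreover have "scalar_field (%\<zeta>. c * \<zeta> powi k) \<zeta> = (%p. mat (c * \<zeta> powi k))" unfolding scalar_field_def using z by simp
 ultimately show "(scalar_field (%\<zeta>. c * \<zeta> powi k) \<zeta> has_derivative
   (%v. commutator (scalar_field (%\<zeta>. c * \<zeta> powi k) \<zeta> p) (conn_loop f \<zeta> p v))) (at p)" by simp
qed

lemma constant_closed: "scalar_field (%_. c) \<in> killing_fields f" using scalar_field_closed[of 0 0 c] by simp

lemma zeta_pow_closed: "3 dvd k ==> zeta_pow k \<in> killing_fields f" using scalar_field_closed[of k "\<bar>k\<bar>" 1] unfolding zeta_pow_def by simp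

lemma zero_closed: "(%\<zeta> p. 0) \<in> killing_fields f"
 using constant_closed[of 0] unfolding scalar_field_def by (simp add: mat_smat[of 0] smat_simps cong: if_cong)

lemma scalar_mult_closed:
 "\<xi> \<in> killing_fields f ==> (%\<zeta> p. smat c (\<xi> \<zeta> p)) \<in> killing_fields f"
 and scalar_mult_eq: "\<xi> \<in> killing_fields f ==> killing_mult (scalar_field (%_. c)) \<xi> = (%\<zeta> p. smat c (\<xi> \<zeta> p))"
proof -
 assume \<xi>: "\<xi> \<in> killing_fields f"
 show eq: "killing_mult (scalar_field (%_. c)) \<xi> = (%\<zeta> p. smat c (\<xi> \<zeta> p))"
  using killing_fields_D(1)[OF \<xi>] unfolding scalar_field_def fun_eq_iff by (auto simp: mat_smat[of c] smat_simps matrix_distrib)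
 thus "(%\<zeta> p. smat c (\<xi> \<zeta> p)) \<in> killing_fields f" using killing_mult_closed[OF constant_closed[of c] \<xi>] by simp
qed

lemma killing_ring: "ring (killing_algebra f)"
proof (rule ringI)
 show "abelian_group (killing_algebra f)"
 proof (rule abelian_groupI; unfold A_simps)
  fix \<xi> assume \<xi>: "\<xi> \<in> killing_fields f"
  show "\<exists>\<eta>\<in>killing_fields f. killing_add \<eta> \<xi> = (%\<zeta> p. 0)" by (rule bexI[OF _ scalar_mult_closed[OF \<xi>, of "-1"]]) (simp add: smat_simps)
 qed (simp_all add: killing_add_closed zero_closed ac_simps)
 show "Group.monoid (killing_algebra f)"
 proof (rule monoidI; unfold A_simps)
  show "scalar_field (%_. 1) \<in> killing_fields f" by (rule constant_closed)
  fix \<xi> assume \<xi>: "\<xi> \<in> killing_fields f"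
  show "killing_mult (scalar_field (%_. 1)) \<xi> = \<xi>" using scalar_mult_eq[OF \<xi>, of 1] by (simp add: smat_simps)
  show "killing_mult \<xi> (scalar_field (%_. 1)) = \<xi>"
   using killing_fields_D(1)[OF \<xi>] unfolding scalar_field_def fun_eq_iff by (auto simp: matrix_distrib)
 qed (simp_all add: killing_mult_closed matrix_mul_assoc)
qed (simp_all add: A_simps matrix_distrib)

lemma killing_uminus: "\<xi> \<in> killing_fields f ==> \<ominus>\<^bsub>killing_algebra f\<^esub> \<xi> = (%\<zeta> p. - \<xi> \<zeta> p)"
proof -
 assume \<xi>: "\<xi> \<in> killing_fields f"
 have c: "(%\<zeta> p. - \<xi> \<zeta> p) \<in> killing_fields f" using scalar_mult_closed[OF \<xi>, of "-1"] by (simp add: smat_simps)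
 show ?thesis by (rule abelian_group.minus_equality[OF ring.is_abelian_group[OF killing_ring]])
   (simp_all add: A_simps \<xi> c)
qed

lemma killing_minus: "\<xi> \<in> killing_fields f ==> \<eta> \<in> killing_fields f ==>
  \<xi> \<ominus>\<^bsub>killing_algebra f\<^esub> \<eta> = (%\<zeta> p. \<xi> \<zeta> p - \<eta> \<zeta> p)" unfolding a_minus_def by (simp add: killing_uminus A_simps)

end

context conformal_minimal_lagrangian
begin

lemma conn_loop_flip: assumes "\<zeta> ~= 0" shows "T_flip (conn_loop f (- \<zeta>) p v) = - conn_loop f \<zeta> p v"
proof -
 obtain d where d: "!!\<zeta>. conn_loop f \<zeta> p v
  = smat (\<zeta> * v) (cyclic_lower (r p)) + diagonal_pair d + smat (inverse \<zeta> * cnj v) (cyclic_upper (r p))" using conn_loop_form by blast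
 have "T_flip (cyclic_lower (r p)) = cyclic_lower (r p)" "T_flip (cyclic_upper (r p)) = cyclic_upper (r p)"
  "T_flip (diagonal_pair d) = - diagonal_pair d"
  unfolding T_flip_def T_mat_def cyclic_lower_def cyclic_upper_def diagonal_pair_def transpose_def matrix_matrix_mult_def
  by (simp_all add: vec_eq_iff forall_3 sum_3)
 thus ?thesis unfolding d T_flip_simps by (simp add: smat_simps)
qed

text \<open>By \<open>conn_loop_flip\<close> the anti-automorphism \<open>T (\<cdot>)\<^sup>t T\<close> sends \<open>\<alpha>\<^bsub>-\<zeta>\<^esub>\<close> to \<open>- \<alpha>\<^sub>\<zeta>\<close>, and reversing the order
 of a commutator compensates the sign.\<close>
lemma mu_star_closed: assumes \<xi>: "\<xi> \<in> killing_fields f" shows "mu_star \<xi> \<in> killing_fields f"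
proof -
 obtain N where N: "!!p. laurent N (%\<zeta>. \<xi> \<zeta> p)" using killing_fields_D(2)[OF \<xi>] by blast
 show ?thesis unfolding mu_star_eq
 proof (rule killing_fields_I[where N = N])
  have T0: "T_flip 0 = 0" unfolding T_flip_def by (simp add: transpose_def matrix_distrib flip: zero_vec_def)
  show "(%p. T_flip (\<xi> (- 0) p)) = (%p. 0)" using killing_fields_D(1)[OF \<xi>] T0 by simp
  have "laurent N (%\<zeta>. T_flip (\<xi> ((-1) * \<zeta>) p))" for p by (rule laurent_transform[OF N]) (simp_all add: T_flip_simps)
  thus "laurent N (%\<zeta>. T_flip (\<xi> (- \<zeta>) p))" for p by simp
  fix \<zeta> :: complex and p assume z: "\<zeta> ~= 0"
  show "S_mat ** T_flip (\<xi> (- \<zeta>) p) ** matrix_inv S_mat = T_flip (\<xi> (- (eps * \<zeta>)) p)"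
   using killing_fields_D(3)[OF \<xi>, of "- \<zeta>" p] T_flip_S[of "\<xi> (- \<zeta>) p"] by simp
  have "((%p. T_flip (\<xi> (- \<zeta>) p)) has_derivative (%v. T_flip (commutator (\<xi> (- \<zeta>) p) (conn_loop f (- \<zeta>) p v)))) (at p)"
   by (rule bounded_linear.has_derivative[OF bounded_linear_T_flip killing_fields_D(4)[OF \<xi>]]) (use z in simp)
  moreover have "T_flip (commutator (\<xi> (- \<zeta>) p) (conn_loop f (- \<zeta>) p v))
    = commutator (T_flip (\<xi> (- \<zeta>) p)) (conn_loop f \<zeta> p v)" for v
   unfolding commutator_def T_flip_simps conn_loop_flip[OF z] by (simp add: matrix_distrib)
  ultimately show "((%p. T_flip (\<xi> (- \<zeta>) p)) has_derivative
    (%v. commutator (T_flip (\<xi> (- \<zeta>) p)) (conn_loop f \<zeta> p v))) (at p)" by simp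
 qed
qed

end

lemma mu_star_mu_star: "mu_star (mu_star \<xi>) = \<xi>" unfolding mu_star_eq by (simp add: T_flip_simps)

lemma mu_star_mult: "mu_star (killing_mult \<xi> \<eta>) = killing_mult (mu_star \<eta>) (mu_star \<xi>)" unfolding mu_star_eq by (simp add: T_flip_simps)

lemma mu_star_add: "mu_star (killing_add \<xi> \<eta>) = killing_add (mu_star \<xi>) (mu_star \<eta>)" unfolding mu_star_eq by (simp add: T_flip_simps)

lemma mu_star_scalar: "mu_star (scalar_field c) = scalar_field (%\<zeta>. c (- \<zeta>))"
proof -
 have "T_flip 0 = 0" unfolding T_flip_def by (simp add: transpose_def matrix_distrib flip: zero_vec_def)
 thus ?thesis unfolding mu_star_eq scalar_field_def fun_eq_iff by (auto simp: mat_smat[of "c _"] T_flip_simps)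
qed

section \<open>Leading coefficients\<close>

text \<open>Coefficients of a Laurent polynomial are linear combinations of its values. Subtracting a multiple of
 the value at \<open>\<zeta>\<close> from that at \<open>2 \<zeta>\<close> kills the highest power and scales the others by nonzero factors.\<close>
lemma laurent_coefficients_extract:
 fixes Q :: "('x => mat3) => bool" and c :: "int => 'x => mat3"
 assumes Q: "!!g h. Q g ==> Q h ==> Q (%p. g p + h p)" "!!g z. Q g ==> Q (%p. smat z (g p))"
  and sum: "!!\<zeta>. \<zeta> ~= 0 ==> Q (%p. \<Sum>k = a..<a + int n. smat (\<zeta> powi k) (c k p))"
  and k: "k \<in> {a..<a + int n}"
 shows "Q (c k)" using sum k
proof (induct n arbitrary: c k)
 case 0 thus ?case by simp
next
 case (Suc n)
 let ?b = "a + int n"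
 have split: "{a..<a + int (Suc n)} = insert ?b {a..<?b}" by auto
 have S: "(\<Sum>k = a..<a + int (Suc n). g k) = g ?b + (\<Sum>k = a..<?b. g k)" for g :: "int => mat3" unfolding split by simp
 have two: "(2::complex) powi k - 2 powi ?b ~= 0" if "k \<in> {a..<?b}" for k
 proof -
  have "(2::real) powi k ~= 2 powi ?b" using that power_int_strict_increasing[of k ?b "2::real"] by auto
  hence "complex_of_real (2 powi k) ~= complex_of_real (2 powi ?b)" by (simp only: of_real_eq_iff not_False_eq_True)
  hence "(2::complex) powi k ~= 2 powi ?b" unfolding of_real_power_int of_real_numeral .
  thus ?thesis by (simp only: right_minus_eq not_False_eq_True)
 qed
 have "Q (%p. \<Sum>k = a..<?b. smat (\<zeta> powi k) (smat (2 powi k - 2 powi ?b) (c k p)))" if z: "\<zeta> ~= 0" for \<zeta> :: complex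
 proof -
  let ?F = "%\<zeta> p. \<Sum>k = a..<a + int (Suc n). smat (\<zeta> powi k) (c k p)"
  have "Q (%p. ?F (2 * \<zeta>) p + smat (- (2 powi ?b)) (?F \<zeta> p))" using Q(1)[OF Suc(2)[of "2 * \<zeta>"] Q(2)[OF Suc(2)[OF z]]] z by simp
  moreover have "?F (2 * \<zeta>) p + smat (- (2 powi ?b)) (?F \<zeta> p)
    = (\<Sum>k = a..<?b. smat (\<zeta> powi k) (smat (2 powi k - 2 powi ?b) (c k p)))" for p
  proof -
   have "?F (2 * \<zeta>) p + smat (- (2 powi ?b)) (?F \<zeta> p)
     = (\<Sum>k = a..<a + int (Suc n). smat (\<zeta> powi k) (smat (2 powi k - 2 powi ?b) (c k p)))" unfolding smat_sum sum.distrib[symmetric]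
    by (intro sum.cong refl) (simp add: smat_simps power_int_mult_distrib algebra_simps flip: smat_simps(2))
   also have "\<dots> = (\<Sum>k = a..<?b. smat (\<zeta> powi k) (smat (2 powi k - 2 powi ?b) (c k p)))" unfolding S by (simp add: smat_simps)
   finally show ?thesis .
  qed
  ultimately show ?thesis by simp
 qed
 hence low: "Q (%p. smat (2 powi k - 2 powi ?b) (c k p))" if "k \<in> {a..<?b}" for k
  using Suc(1)[of "%k p. smat (2 powi k - 2 powi ?b) (c k p)" k] that by blast
 have lowc: "Q (c k)" if "k \<in> {a..<?b}" for k
  using Q(2)[OF low[OF that], of "inverse (2 powi k - 2 powi ?b)"] two[OF that] by (simp add: smat_simps)
 have top: "Q (c ?b)"
 proof -
  have minus: "Q (%p. - g p)" if "Q g" for g using Q(2)[OF that, of "-1"] by (simp add: smat_simps)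
  have "Q (%p. \<Sum>k\<in>J. c k p)" if "finite J" "J ~= {}" "J \<subseteq> {a..<?b}" for J using that
  proof (induct J rule: finite_ne_induct)
   case (singleton x) thus ?case using lowc by simp
  next
   case (insert x J) thus ?case using Q(1)[OF lowc[of x]] by simp
  qed
  hence rest: "Q (%p. \<Sum>k = a..<?b. c k p)" if "{a..<?b} ~= {}" using that by blast
  have all: "Q (%p. c ?b p + (\<Sum>k = a..<?b. c k p))" using Suc(2)[of 1] unfolding S by (simp add: smat_simps)
  show ?thesis
  proof (cases "{a..<?b} = {}")
   case True thus ?thesis using all by simp
  next
   case False
   thus ?thesis using Q(1)[OF all minus[OF rest[OF False]]] by simp
  qed
 qed
 show ?case
 proof (cases "k = ?b")
  case False
  hence "k \<in> {a..<?b}" using Suc(3) by auto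
  thus ?thesis by (rule lowc)
 qed (use top in simp)
qed

text \<open>The sign \<open>s\<close> selects the end: \<open>1\<close> stands for \<open>\<zeta> \<rightarrow> \<infinity>\<close> and \<open>-1\<close> for \<open>\<zeta> \<rightarrow> 0\<close>, so that \<open>\<zeta>\<^bsup>- s\<^esup>\<close> tends to
 \<open>0\<close>.\<close>
definition end_filter :: "int => complex filter" where
 "end_filter s = (if s = 1 then at_infinity else at 0)"

lemma end_filter_props:
 assumes s: "s = 1 \<or> s = - 1"
 shows "end_filter s ~= bot" "\<forall>\<^sub>F \<zeta> in end_filter s. \<zeta> ~= 0" "((%\<zeta>. \<zeta> powi (- s)) \<longlongrightarrow> 0) (end_filter s)"
  "a ~= 0 ==> filterlim (%\<zeta>. a * \<zeta>) (end_filter s) (end_filter s)"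
proof -
 show "end_filter s ~= bot" unfolding end_filter_def using trivial_limit_at_infinity[where 'a = complex] by simp
 show "\<forall>\<^sub>F \<zeta> in end_filter s. \<zeta> ~= 0" unfolding end_filter_def
  by (auto simp: eventually_at_infinity eventually_at_filter intro!: exI[of _ 1])
 show "((%\<zeta>. \<zeta> powi (- s)) \<longlongrightarrow> 0) (end_filter s)"
  using s tendsto_inverse_0[where 'a = complex] unfolding end_filter_def by (auto simp: power_int_minus)
 show "filterlim (%\<zeta>. a * \<zeta>) (end_filter s) (end_filter s)" if "a ~= 0"
 proof (cases "s = 1")
  case True
  have "filterlim (%\<zeta>. a * \<zeta>) at_infinity at_infinity" by (rule tendsto_mult_filterlim_at_infinity[OF tendsto_const that filterlim_ident])
  thus ?thesis unfolding end_filter_def using True by simp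
 next
  case False
  have "((%\<zeta>. a * \<zeta>) \<longlongrightarrow> a * 0) (at 0)" by (intro tendsto_intros)
  hence "filterlim (%\<zeta>. a * \<zeta>) (at 0) (at 0)" unfolding filterlim_at using that by (auto simp: eventually_at_filter)
  thus ?thesis unfolding end_filter_def using False by simp
 qed
qed

lemma tendsto_powi_zero: assumes s: "s = 1 \<or> s = - 1" and "0 < m"
 shows "((%\<zeta>. \<zeta> powi (- (s * m))) \<longlongrightarrow> 0) (end_filter s)"
proof -
 have "((%\<zeta>. (\<zeta> powi (- s)) ^ nat m) \<longlongrightarrow> 0 ^ nat m) (end_filter s)" by (intro tendsto_power end_filter_props s)
 moreover have "(\<zeta> powi (- s)) ^ nat m = \<zeta> powi (- (s * m))" for \<zeta> :: complex
 proof -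
  have "(\<zeta> powi (- s)) ^ nat m = \<zeta> powi (- s * int (nat m))" by (simp only: power_int_mult power_int_of_nat)
  thus ?thesis using assms(2) by simp
 qed
 ultimately show ?thesis using assms(2) by (simp add: zero_power)
qed

lemma tendsto_smat: assumes "(c \<longlongrightarrow> c0) F" "(A \<longlongrightarrow> A0) F" shows "((%x. smat (c x) (A x)) \<longlongrightarrow> smat c0 A0) F"
 unfolding smat_def map_matrix_def using assms by (intro tendsto_vec_lambda tendsto_mult tendsto_vec_nth) auto

lemma tendsto_matrix_mult:
 fixes A B :: "'x => mat3"
 assumes "(A \<longlongrightarrow> A0) F" "(B \<longlongrightarrow> B0) F" shows "((%x. A x ** B x) \<longlongrightarrow> A0 ** B0) F"
 by (rule bounded_bilinear.tendsto[OF bounded_bilinear_matrix assms])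

text \<open>The coefficient of \<open>\<zeta>\<^bsup>- s n\<^esup>\<close> is \<open>C\<close>, and no higher power (for \<open>s = 1\<close>) or lower power (for \<open>s = - 1\<close>)
 occurs. The number \<open>n\<close> is an order of vanishing, and \<open>C = 0\<close> is permitted. Limits, unlike coefficients,
 are immediately compatible with sums and products.\<close>
definition lead :: "int => loop_field => int => (complex => mat3) => bool" where
 "lead s \<xi> n C \<longleftrightarrow> (\<forall>p. ((%\<zeta>. smat (\<zeta> powi (s * n)) (\<xi> \<zeta> p)) \<longlongrightarrow> C p) (end_filter s))"

context
 fixes s :: int
 assumes s: "s = 1 \<or> s = - 1"
begin

lemma lead_unique: "lead s \<xi> n C ==> lead s \<xi> n D ==> C = D" unfolding lead_def using tendsto_unique[OF end_filter_props(1)[OF s]] by blast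

lemma lead_add: "lead s \<xi> n C ==> lead s \<eta> n D ==> lead s (killing_add \<xi> \<eta>) n (%p. C p + D p)"
 unfolding lead_def smat_simps by (auto intro: tendsto_add)

lemma lead_smat: "lead s \<xi> n C ==> lead s (%\<zeta> p. smat c (\<xi> \<zeta> p)) n (%p. smat c (C p))" unfolding lead_def
proof (intro allI)
 fix p assume "\<forall>p. ((%\<zeta>. smat (\<zeta> powi (s * n)) (\<xi> \<zeta> p)) \<longlongrightarrow> C p) (end_filter s)"
 hence "((%\<zeta>. smat c (smat (\<zeta> powi (s * n)) (\<xi> \<zeta> p))) \<longlongrightarrow> smat c (C p)) (end_filter s)" by (intro tendsto_smat) auto
 thus "((%\<zeta>. smat (\<zeta> powi (s * n)) (smat c (\<xi> \<zeta> p))) \<longlongrightarrow> smat c (C p)) (end_filter s)" by (simp add: smat_simps mult.commute)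
qed

lemma lead_diff: assumes "lead s \<xi> n C" "lead s \<eta> n D"
 shows "lead s (%\<zeta> p. \<xi> \<zeta> p - \<eta> \<zeta> p) n (%p. C p - D p)"
 using lead_add[OF assms(1) lead_smat[OF assms(2), of "-1"]] by (simp add: smat_simps)

lemma lead_mult: assumes "lead s \<xi> n C" "lead s \<eta> m D"
 shows "lead s (killing_mult \<xi> \<eta>) (n + m) (%p. C p ** D p)" unfolding lead_def
proof (intro allI)
 fix p
 have "((%\<zeta>. smat (\<zeta> powi (s * n)) (\<xi> \<zeta> p) ** smat (\<zeta> powi (s * m)) (\<eta> \<zeta> p)) \<longlongrightarrow> C p ** D p) (end_filter s)"
  using assms unfolding lead_def by (intro tendsto_matrix_mult) auto
 moreover have "\<forall>\<^sub>F \<zeta> in end_filter s. smat (\<zeta> powi (s * n)) (\<xi> \<zeta> p) ** smat (\<zeta> powi (s * m)) (\<eta> \<zeta> p)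
   = smat (\<zeta> powi (s * (n + m))) (\<xi> \<zeta> p ** \<eta> \<zeta> p)" using end_filter_props(2)[OF s]
  by eventually_elim (simp add: smat_simps power_int_add distrib_left mult.commute)
 ultimately show "((%\<zeta>. smat (\<zeta> powi (s * (n + m))) (\<xi> \<zeta> p ** \<eta> \<zeta> p)) \<longlongrightarrow> C p ** D p) (end_filter s)" by (rule Lim_transform_eventually)
qed

lemma lead_shift: assumes "lead s \<xi> n C" "m < n" shows "lead s \<xi> m (%p. 0)" unfolding lead_def
proof (intro allI)
 fix p
 have "((%\<zeta>. smat (\<zeta> powi (- (s * (n - m)))) (smat (\<zeta> powi (s * n)) (\<xi> \<zeta> p))) \<longlongrightarrow> smat 0 (C p)) (end_filter s)"
  using assms tendsto_powi_zero[OF s, of "n - m"] unfolding lead_def by (intro tendsto_smat) auto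
 moreover have "\<forall>\<^sub>F \<zeta> in end_filter s. smat (\<zeta> powi (- (s * (n - m)))) (smat (\<zeta> powi (s * n)) (\<xi> \<zeta> p))
   = smat (\<zeta> powi (s * m)) (\<xi> \<zeta> p)" using end_filter_props(2)[OF s]
  by eventually_elim (simp add: smat_simps algebra_simps flip: power_int_add)
 ultimately have "((%\<zeta>. smat (\<zeta> powi (s * m)) (\<xi> \<zeta> p)) \<longlongrightarrow> smat 0 (C p)) (end_filter s)" by (rule Lim_transform_eventually)
 thus "((%\<zeta>. smat (\<zeta> powi (s * m)) (\<xi> \<zeta> p)) \<longlongrightarrow> 0) (end_filter s)" by (simp add: smat_simps)
qed

lemma lead_mu_star: assumes "lead s \<xi> n C"
 shows "lead s (mu_star \<xi>) n (%p. smat ((-1) powi n) (T_flip (C p)))" unfolding lead_def mu_star_eq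
proof (intro allI)
 fix p
 have "((%\<zeta>. smat ((-1 * \<zeta>) powi (s * n)) (\<xi> (-1 * \<zeta>) p)) \<longlongrightarrow> C p) (end_filter s)"
  using filterlim_compose[OF assms[unfolded lead_def, rule_format, of p] end_filter_props(4)[OF s, of "-1"]] by simp
 hence lim: "((%\<zeta>. smat ((-1) powi n) (T_flip (smat ((-1 * \<zeta>) powi (s * n)) (\<xi> (-1 * \<zeta>) p))))
   \<longlongrightarrow> smat ((-1) powi n) (T_flip (C p))) (end_filter s)"
  by (intro tendsto_smat tendsto_const bounded_linear.tendsto[OF bounded_linear_T_flip])
 have sq: "(-1) powi n * (-1::complex) powi (s * n) = 1" using s by (auto simp flip: power_int_add power_int_mult_distrib simp: power_int_minus)
 have "smat ((-1) powi n) (T_flip (smat ((-1 * \<zeta>) powi (s * n)) (\<xi> (-1 * \<zeta>) p))) = smat (\<zeta> powi (s * n)) (T_flip (\<xi> (- \<zeta>) p))" for \<zeta>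
  unfolding power_int_mult_distrib using sq by (simp add: T_flip_simps smat_simps flip: mult.assoc)
 thus "((%\<zeta>. smat (\<zeta> powi (s * n)) (T_flip (\<xi> (- \<zeta>) p))) \<longlongrightarrow> smat ((-1) powi n) (T_flip (C p))) (end_filter s)" using lim by simp
qed

lemma lead_S:
 assumes "lead s \<xi> n C" "!!\<zeta>. S_mat ** \<xi> \<zeta> p ** matrix_inv S_mat = \<xi> (eps * \<zeta>) p"
 shows "smat (eps powi (s * n)) (S_mat ** C p ** matrix_inv S_mat) = C p"
proof (rule tendsto_unique[OF end_filter_props(1)[OF s]])
 have "((%\<zeta>. smat ((eps * \<zeta>) powi (s * n)) (\<xi> (eps * \<zeta>) p)) \<longlongrightarrow> C p) (end_filter s)"
  using filterlim_compose[OF assms(1)[unfolded lead_def, rule_format, of p] end_filter_props(4)[OF s eps_props(2)]] .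
 moreover have "smat ((eps * \<zeta>) powi (s * n)) (\<xi> (eps * \<zeta>) p)
   = smat (eps powi (s * n)) (S_mat ** smat (\<zeta> powi (s * n)) (\<xi> \<zeta> p) ** matrix_inv S_mat)" for \<zeta>
  unfolding assms(2)[symmetric] power_int_mult_distrib by (simp add: smat_simps)
 ultimately show "((%\<zeta>. smat (eps powi (s * n)) (S_mat ** smat (\<zeta> powi (s * n)) (\<xi> \<zeta> p) ** matrix_inv S_mat)) \<longlongrightarrow> C p) (end_filter s)"
  by simp
 show "((%\<zeta>. smat (eps powi (s * n)) (S_mat ** smat (\<zeta> powi (s * n)) (\<xi> \<zeta> p) ** matrix_inv S_mat))
   \<longlongrightarrow> smat (eps powi (s * n)) (S_mat ** C p ** matrix_inv S_mat)) (end_filter s)"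
  using assms(1) unfolding lead_def by (intro tendsto_smat tendsto_matrix_mult tendsto_const) auto
qed

end

lemma end_cases: "1 = (1::int) \<or> 1 = - (1::int)" "- 1 = (1::int) \<or> - 1 = - (1::int)" by simp_all

definition cyc :: "int => real => mat3" where
 "cyc s r = (if s = 1 then cyclic_lower r else transpose (cyclic_lower r))"

lemma cyc_upper: "cyclic_upper r = - cyc (-1) r"
 unfolding cyc_def cyclic_upper_def cyclic_lower_def transpose_def by (simp add: vec_eq_iff forall_3)

lemma cyc_props:
 assumes "0 < r"
 shows "cyc s r ** cyc s r ** cyc s r = mat 1" "T_flip (cyc s r) = cyc s r"
proof -
 have r: "of_real r ~= (0::complex)" using assms by simp
 show "cyc s r ** cyc s r ** cyc s r = mat 1" unfolding cyc_def cyclic_lower_def transpose_def matrix_matrix_mult_def mat_def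
  using r by (auto simp: vec_eq_iff forall_3 sum_3 power2_eq_square)
 show "T_flip (cyc s r) = cyc s r" unfolding T_flip_def T_mat_def cyc_def cyclic_lower_def transpose_def matrix_matrix_mult_def
  by (auto simp: vec_eq_iff forall_3 sum_3)
qed

text \<open>The power of the cyclic matrix \<open>cyc s r\<close> that has the grading of a leading coefficient of order \<open>n\<close>. The
 exponents \<open>1\<close> and \<open>2\<close> belong to \<open>n \<equiv> 2\<close> and \<open>n \<equiv> 1\<close> modulo \<open>3\<close>, since order counts powers of \<open>\<zeta>\<^bsup>- s\<^esup>\<close>.\<close>
definition cyc_pow :: "int => real => int => mat3" where
 "cyc_pow s r n = (if n mod 3 = 0 then mat 1 else if n mod 3 = 2 then cyc s r else cyc s r ** cyc s r)"

lemma cyc_pow_props: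
 assumes "0 < r"
 shows "cyc_pow s r n ** cyc_pow s r n ** cyc_pow s r n = mat 1" "T_flip (cyc_pow s r n) = cyc_pow s r n"
proof -
 let ?B = "cyc s r"
 have "(?B ** ?B) ** (?B ** ?B) ** (?B ** ?B) = (?B ** ?B ** ?B) ** (?B ** ?B ** ?B)" by (simp add: matrix_mul_assoc)
 thus "cyc_pow s r n ** cyc_pow s r n ** cyc_pow s r n = mat 1" unfolding cyc_pow_def using cyc_props(1)[OF assms, of s] by simp
 show "T_flip (cyc_pow s r n) = cyc_pow s r n" unfolding cyc_pow_def using cyc_props(2)[OF assms, of s] by (simp add: T_flip_simps)
qed

lemma graded_centralizer_lower:
 assumes r: "0 < r" and comm: "C ** cyclic_lower r = cyclic_lower r ** C"
  and grade: "smat (eps powi n) (S_mat ** C ** matrix_inv S_mat) = C"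
 shows "\<exists>x. C = smat x (cyc_pow 1 r n)"
proof -
 have rc: "of_real r ~= (0::complex)" using r by simp
 have e3: "eps powi n = eps powi (n mod 3)"
 proof -
  have "n = 3 * (n div 3) + n mod 3" by simp
  hence "eps powi n = (eps ^ 3) powi (n div 3) * eps powi (n mod 3)"
   using eps_props(2) by (metis power_int_add power_int_mult power_int_numeral)
  thus ?thesis unfolding eps_props(1) by simp
 qed
 have e0: "eps * (eps * eps) = 1" using eps_props(1) by (simp add: power3_eq_cube mult.assoc)
 have e1: "eps * (eps * (eps * x)) = x" for x
 proof -
  have "eps * (eps * (eps * x)) = (eps * (eps * eps)) * x" by (simp only: mult.assoc)
  thus ?thesis unfolding e0 by simp
 qed
 have sq: "eps * eps\<^sup>2 = 1" "eps\<^sup>2 * eps = 1" "eps\<^sup>2 * eps\<^sup>2 = eps" using e0 e1[of eps] by (simp_all add: power2_eq_square mult.assoc)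
 have E: "(S_mat ** C ** matrix_inv S_mat) $ 1 $ 1 = C $ 1 $ 1" "(S_mat ** C ** matrix_inv S_mat) $ 1 $ 2 = eps\<^sup>2 * C $ 1 $ 2"
  "(S_mat ** C ** matrix_inv S_mat) $ 1 $ 3 = eps * C $ 1 $ 3" "(S_mat ** C ** matrix_inv S_mat) $ 2 $ 1 = eps * C $ 2 $ 1"
  "(S_mat ** C ** matrix_inv S_mat) $ 2 $ 2 = C $ 2 $ 2" "(S_mat ** C ** matrix_inv S_mat) $ 2 $ 3 = eps\<^sup>2 * C $ 2 $ 3"
  "(S_mat ** C ** matrix_inv S_mat) $ 3 $ 1 = eps\<^sup>2 * C $ 3 $ 1" "(S_mat ** C ** matrix_inv S_mat) $ 3 $ 2 = eps * C $ 3 $ 2"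
  "(S_mat ** C ** matrix_inv S_mat) $ 3 $ 3 = C $ 3 $ 3" unfolding S_inv unfolding S_mat_def matrix_matrix_mult_def
  by (simp_all add: sum_3 power2_eq_square ac_simps e0 e1)
 have G: "eps powi (n mod 3) * (S_mat ** C ** matrix_inv S_mat) $ i $ j = C $ i $ j" for i j
  using grade unfolding e3 smat_def map_matrix_def by (metis (no_types, lifting) vec_lambda_beta)
 have M: "(C ** cyclic_lower r) $ i $ j = (cyclic_lower r ** C) $ i $ j" for i j using comm by simp
 note M' = M[of 1 1] M[of 1 2] M[of 1 3] M[of 2 1] M[of 2 2] M[of 2 3] M[of 3 1] M[of 3 2] M[of 3 3]
 note Mx = M'[unfolded cyclic_lower_def matrix_matrix_mult_def, simplified sum_3, simplified]
 consider "n mod 3 = 0" | "n mod 3 = 1" | "n mod 3 = 2" by linarith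
 thus ?thesis
 proof cases
  case 1
  have z: "C $ 1 $ 2 = 0" "C $ 1 $ 3 = 0" "C $ 2 $ 1 = 0" "C $ 2 $ 3 = 0" "C $ 3 $ 1 = 0" "C $ 3 $ 2 = 0"
   using G[of 1 2] G[of 1 3] G[of 2 1] G[of 2 3] G[of 3 1] G[of 3 2] eps_props(3,4) unfolding E 1 by auto
  have "C $ 2 $ 2 = C $ 1 $ 1" "C $ 3 $ 3 = C $ 1 $ 1" using Mx rc z by auto
  thus ?thesis unfolding cyc_pow_def using 1 z
   by (intro exI[of _ "C $ 1 $ 1"]) (simp add: vec_eq_iff forall_3 smat_def map_matrix_def mat_def)
 next
  case 2
  have z: "C $ 1 $ 1 = 0" "C $ 2 $ 2 = 0" "C $ 3 $ 3 = 0" "C $ 1 $ 3 = 0" "C $ 2 $ 1 = 0" "C $ 3 $ 2 = 0"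
   using G[of 1 1] G[of 2 2] G[of 3 3] G[of 1 3] G[of 2 1] G[of 3 2] eps_props(3,4) unfolding E 2
   by (auto simp: power2_eq_square simp flip: mult.assoc)
  have "C $ 3 $ 1 = C $ 1 $ 2" "C $ 2 $ 3 = of_real (r * r\<^sup>2) * C $ 1 $ 2" using Mx rc z by (auto simp: field_simps)
  thus ?thesis unfolding cyc_pow_def cyc_def cyclic_lower_def using 2 z rc by (intro exI[of _ "C $ 1 $ 2 * of_real r"])
    (simp add: vec_eq_iff forall_3 smat_def map_matrix_def matrix_matrix_mult_def sum_3 power2_eq_square field_simps)
 next
  case 3
  have z: "C $ 1 $ 1 = 0" "C $ 2 $ 2 = 0" "C $ 3 $ 3 = 0" "C $ 1 $ 2 = 0" "C $ 2 $ 3 = 0" "C $ 3 $ 1 = 0"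
   using G[of 1 1] G[of 2 2] G[of 3 3] G[of 1 2] G[of 2 3] G[of 3 1] eps_props(3,4) sq unfolding E 3 by (auto simp flip: mult.assoc)
  have "C $ 2 $ 1 = C $ 1 $ 3" "C $ 3 $ 2 * of_real (r * r\<^sup>2) = C $ 1 $ 3" using Mx rc z by (auto simp: field_simps)
  thus ?thesis unfolding cyc_pow_def cyc_def cyclic_lower_def using 3 z rc by (intro exI[of _ "C $ 1 $ 3 / of_real r"])
    (simp add: vec_eq_iff forall_3 smat_def map_matrix_def power2_eq_square field_simps)
 qed
qed

lemma S_transpose: "transpose (S_mat ** C ** matrix_inv S_mat) = matrix_inv S_mat ** transpose C ** S_mat"
proof -
 have "transpose S_mat = S_mat" "transpose (matrix_inv S_mat) = matrix_inv S_mat"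
  unfolding S_inv unfolding S_mat_def transpose_def by (simp_all add: vec_eq_iff forall_3)
 thus ?thesis by (simp add: matrix_transpose_mul matrix_mul_assoc)
qed

text \<open>The cyclic matrix has distinct eigenvalues, so its centralizer consists of the polynomials in it; the
 grading by \<open>S\<close> selects one power.\<close>
lemma graded_centralizer:
 assumes s: "s = 1 \<or> s = - 1" and r: "0 < r" and comm: "C ** cyc s r = cyc s r ** C"
  and grade: "smat (eps powi (s * n)) (S_mat ** C ** matrix_inv S_mat) = C"
 shows "\<exists>x. C = smat x (cyc_pow s r n)"
proof (cases "s = 1")
 case True
 thus ?thesis using graded_centralizer_lower[OF r, of C n] comm grade unfolding cyc_def by simp
next
 case False
 hence s1: "s = - 1" using s by simp
 let ?D = "transpose C"
 have "transpose (C ** cyc s r) = transpose (cyc s r ** C)" using comm by simp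
 hence 1: "?D ** cyclic_lower r = cyclic_lower r ** ?D" unfolding cyc_def s1 by (simp add: matrix_transpose_mul)
 have "transpose (smat (eps powi (s * n)) (S_mat ** C ** matrix_inv S_mat)) = ?D" using grade by simp
 hence t: "smat (eps powi (- n)) (matrix_inv S_mat ** ?D ** S_mat) = ?D" unfolding transpose_simps S_transpose s1 by simp
 have "S_mat ** ?D ** matrix_inv S_mat = S_mat ** smat (eps powi (- n)) (matrix_inv S_mat ** ?D ** S_mat) ** matrix_inv S_mat"
  using t by simp
 also have "\<dots> = smat (eps powi (- n)) ((S_mat ** matrix_inv S_mat) ** ?D ** (S_mat ** matrix_inv S_mat))"
  by (simp add: smat_simps matrix_mul_assoc)
 finally have "smat (eps powi n) (S_mat ** ?D ** matrix_inv S_mat) = ?D"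
  unfolding S_inv_mult using eps_props(2) by (simp add: smat_simps flip: power_int_add)
 then obtain x where "?D = smat x (cyc_pow 1 r n)" using graded_centralizer_lower[OF r 1] by blast
 hence "C = smat x (transpose (cyc_pow 1 r n))" by (metis transpose_simps(3) transpose_transpose)
 moreover have "transpose (cyc_pow 1 r n) = cyc_pow s r n" unfolding cyc_pow_def cyc_def s1 by (simp add: matrix_transpose_mul)
 ultimately show ?thesis by auto
qed

lemma laurent_tendsto_leading:
 assumes s: "s = 1 \<or> s = - 1" and "finite I"
  and "!!k. k \<in> I ==> c k = 0 \<or> s * (k - k0) < 0 \<or> k = k0"
 shows "((%\<zeta>. \<Sum>k\<in>I. smat (\<zeta> powi (k - k0)) (c k)) \<longlongrightarrow> (if k0 \<in> I then c k0 else 0)) (end_filter s)"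
proof -
 have "((%\<zeta>. smat (\<zeta> powi (k - k0)) (c k)) \<longlongrightarrow> (if k = k0 then c k0 else 0)) (end_filter s)" if k: "k \<in> I" for k
 proof -
  consider "k = k0" | "k ~= k0" "c k = 0" | "k ~= k0" "s * (k - k0) < 0" using assms(3)[OF k] by blast
  thus ?thesis
  proof cases
   case 3
   have e: "s * (s * (k - k0)) = k - k0" using s by auto
   have "((%\<zeta>. \<zeta> powi (k - k0)) \<longlongrightarrow> 0) (end_filter s)" using tendsto_powi_zero[OF s, of "- (s * (k - k0))"] 3 by (simp add: e)
   hence "((%\<zeta>. smat (\<zeta> powi (k - k0)) (c k)) \<longlongrightarrow> smat 0 (c k)) (end_filter s)" by (intro tendsto_smat tendsto_const)
   thus ?thesis using 3 by (simp add: smat_simps)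
  qed (simp_all add: smat_simps)
 qed
 hence "((%\<zeta>. \<Sum>k\<in>I. smat (\<zeta> powi (k - k0)) (c k)) \<longlongrightarrow> (\<Sum>k\<in>I. if k = k0 then c k0 else 0)) (end_filter s)" by (intro tendsto_sum)
 thus ?thesis using assms(2) by simp
qed

lemma killing_coefficients:
 assumes "\<xi> \<in> killing_fields f"
 obtains N c where "!!\<zeta> p. \<zeta> ~= 0 ==> \<xi> \<zeta> p = (\<Sum>k = - int N..int N. smat (\<zeta> powi k) (c k p))"
  "!!k p. k \<in> {- int N..int N} ==> c k differentiable (at p)"
proof -
 obtain N0 c where c: "!!\<zeta> p. \<zeta> ~= 0 ==> \<xi> \<zeta> p = (\<Sum>k = -N0..N0. smat (\<zeta> powi k) (c k p))"
  using assms unfolding killing_fields_def laurent_field_def by blast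
 define c' where "c' k p = (if k \<in> {-N0..N0} then c k p else 0)" for k p
 define N where "N = nat \<bar>N0\<bar>"
 have eq: "\<xi> \<zeta> p = (\<Sum>k = - int N..int N. smat (\<zeta> powi k) (c' k p))" if "\<zeta> ~= 0" for \<zeta> p
 proof -
  have "(\<Sum>k = - int N..int N. smat (\<zeta> powi k) (c' k p)) = (\<Sum>k = -N0..N0. smat (\<zeta> powi k) (c' k p))"
   by (rule sum.mono_neutral_right) (auto simp: N_def c'_def smat_simps)
  also have "\<dots> = \<xi> \<zeta> p" unfolding c[OF that] c'_def by (intro sum.cong) auto
  finally show ?thesis by simp
 qed
 have int: "{- int N..int N} = {- int N..<- int N + int (2 * N + 1)}" by auto
 show ?thesis
 proof (rule that[OF eq])
  fix k p assume k: "k \<in> {- int N..int N}"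
  show "c' k differentiable (at p)"
  proof (rule laurent_coefficients_extract[where Q = "%g. g differentiable (at p)" and a = "- int N" and n = "2 * N + 1"])
   show "(%p. smat z (g p)) differentiable (at p)" if "g differentiable (at p)" for g z
    by (rule differentiable_linear[OF bounded_linear_smat that])
   fix \<zeta> :: complex assume z: "\<zeta> ~= 0"
   have "\<xi> \<zeta> differentiable (at p)" using killing_fields_D(4)[OF assms z] differentiableI by blast
   moreover have "\<xi> \<zeta> = (%p. \<Sum>k = - int N..int N. smat (\<zeta> powi k) (c' k p))" using eq[OF z] by blast
   ultimately show "(%p. \<Sum>k = - int N..<- int N + int (2 * N + 1). smat (\<zeta> powi k) (c' k p)) differentiable (at p)" unfolding int by simp
  qed (use k int in auto)
 qed
qed

context conformal_minimal_lagrangian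
begin

context
 fixes s :: int
 assumes s: "s = 1 \<or> s = - 1"
begin

lemma coefficients_vanish_beyond_lead:
 assumes c: "!!\<zeta> p. \<zeta> ~= 0 ==> \<xi> \<zeta> p = (\<Sum>k\<in>I. smat (\<zeta> powi k) (c k p))" and "finite I"
  and l: "lead s \<xi> n C" and k: "k \<in> I" "0 < n + s * k"
 shows "c k q = 0"
proof (rule ccontr)
 assume "c k q ~= 0"
 define K where "K = {k \<in> I. 0 < n + s * k \<and> c k q ~= 0}"
 have K: "finite K" "k \<in> K" unfolding K_def using assms \<open>c k q ~= 0\<close> by auto
 define m where "m = Max ((%k. s * k) ` K)"
 have "m \<in> (%k. s * k) ` K" unfolding m_def using K by (intro Max_in) auto
 then obtain k0 where k0: "k0 \<in> K" "s * k0 = m" by blast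
 have max: "s * j \<le> s * k0" if "j \<in> K" for j unfolding k0(2) m_def using that K(1) by (intro Max_ge) auto
 have kI: "k0 \<in> I" "c k0 q ~= 0" "0 < n + s * k0" using k0(1) unfolding K_def by auto
 have "((%\<zeta>. \<Sum>k\<in>I. smat (\<zeta> powi (k - k0)) (c k q)) \<longlongrightarrow> (if k0 \<in> I then c k0 q else 0)) (end_filter s)"
 proof (rule laurent_tendsto_leading[OF s \<open>finite I\<close>])
  fix j assume j: "j \<in> I"
  show "c j q = 0 \<or> s * (j - k0) < 0 \<or> j = k0"
  proof (rule ccontr)
   assume no: "\<not> ?thesis"
   hence "s * k0 \<le> s * j" "j ~= k0" by (auto simp: algebra_simps)
   moreover have "j \<in> K" unfolding K_def using j no kI(3) \<open>s * k0 \<le> s * j\<close> by auto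
   ultimately have "s * j = s * k0" using max[of j] by simp
   thus False using s no by auto
  qed
 qed
 moreover have "\<forall>\<^sub>F \<zeta> in end_filter s. (\<Sum>k\<in>I. smat (\<zeta> powi (k - k0)) (c k q)) = smat (\<zeta> powi (s * (- (s * k0)))) (\<xi> \<zeta> q)"
  using end_filter_props(2)[OF s]
 proof eventually_elim
  case (elim \<zeta>)
  have e: "s * (- (s * k0)) = - k0" using s by auto
  show ?case unfolding c[OF elim] smat_sum e
   using elim by (intro sum.cong) (simp_all add: smat_simps power_int_diff power_int_minus field_simps)
 qed
 ultimately have "((%\<zeta>. smat (\<zeta> powi (s * (- (s * k0)))) (\<xi> \<zeta> q)) \<longlongrightarrow> c k0 q) (end_filter s)" using kI(1) Lim_transform_eventually by force
 moreover have "lead s \<xi> (- (s * k0)) (%p. 0)" using lead_shift[OF s l] kI(3) by simp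
 ultimately have "c k0 q = 0" unfolding lead_def using tendsto_unique[OF end_filter_props(1)[OF s]] by blast
 thus False using kI(2) by simp
qed

text \<open>In \<open>d\<xi> = [\<xi>, \<alpha>\<^sub>\<zeta>]\<close> the left side has order at least \<open>n\<close>, the right side \<open>n - 1\<close> unless the leading terms
 commute.\<close>
lemma lead_commutes:
 assumes \<xi>: "\<xi> \<in> killing_fields f" and l: "lead s \<xi> n C"
 shows "C p ** cyc s (r p) = cyc s (r p) ** C p"
proof -
 obtain N c where c: "!!\<zeta> p. \<zeta> ~= 0 ==> \<xi> \<zeta> p = (\<Sum>k = - int N..int N. smat (\<zeta> powi k) (c k p))"
  and cd: "!!k p. k \<in> {- int N..int N} ==> c k differentiable (at p)" by (rule killing_coefficients[OF \<xi>], rule that)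
 define D where "D k = dir_deriv 1 (c k) p" for k
 have D0: "D k = 0" if "k \<in> {- int N..int N}" "0 < n + s * k" for k
 proof -
  have "c k = (%q. 0)" using coefficients_vanish_beyond_lead[OF c _ l that(1,2)] by blast
  thus ?thesis unfolding D_def by (simp add: dir_deriv_eq[OF has_derivative_const])
 qed
 have dc: "commutator (\<xi> \<zeta> p) (conn_loop f \<zeta> p 1) = (\<Sum>k = - int N..int N. smat (\<zeta> powi k) (D k))" if z: "\<zeta> ~= 0" for \<zeta>
 proof -
  have "\<xi> \<zeta> = (%p. \<Sum>k = - int N..int N. smat (\<zeta> powi k) (c k p))" using c[OF z] by blast
  moreover have "((%p. \<Sum>k = - int N..int N. smat (\<zeta> powi k) (c k p)) has_derivative
    (%v. \<Sum>k = - int N..int N. smat (\<zeta> powi k) (dir_deriv v (c k) p))) (at p)"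
   by (intro has_derivative_sum bounded_linear.has_derivative[OF bounded_linear_smat] dir_deriv_has_derivative cd)
  ultimately have "(\<xi> \<zeta> has_derivative (%v. \<Sum>k = - int N..int N. smat (\<zeta> powi k) (dir_deriv v (c k) p))) (at p)" by simp
  from has_derivative_unique[OF killing_fields_D(4)[OF \<xi> z] this] show ?thesis unfolding D_def by metis
 qed
 obtain d where d: "!!\<zeta>. conn_loop f \<zeta> p 1
  = smat (\<zeta> * 1) (cyclic_lower (r p)) + diagonal_pair d + smat (inverse \<zeta> * cnj 1) (cyclic_upper (r p))" using conn_loop_form by blast
 define P where "P = (if s = 1 then cyclic_lower (r p) else cyclic_upper (r p))"
 have conn_lim: "((%\<zeta>. smat (\<zeta> powi (- s)) (conn_loop f \<zeta> p 1)) \<longlongrightarrow> P) (end_filter s)"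
 proof -
  have z: "((%\<zeta>. \<zeta> powi (- s)) \<longlongrightarrow> 0) (end_filter s)" by (rule end_filter_props(3)[OF s])
  let ?Q = "if s = 1 then cyclic_upper (r p) else cyclic_lower (r p)"
  have "((%\<zeta>. P + smat (\<zeta> powi (- s)) (diagonal_pair d) + smat (\<zeta> powi (- s) * \<zeta> powi (- s)) ?Q)
    \<longlongrightarrow> P + smat 0 (diagonal_pair d) + smat (0 * 0) ?Q) (end_filter s)" by (intro tendsto_add tendsto_smat tendsto_const tendsto_mult z)
  moreover have "\<forall>\<^sub>F \<zeta> in end_filter s. P + smat (\<zeta> powi (- s)) (diagonal_pair d) + smat (\<zeta> powi (- s) * \<zeta> powi (- s)) ?Q
    = smat (\<zeta> powi (- s)) (conn_loop f \<zeta> p 1)" using end_filter_props(2)[OF s]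
   by eventually_elim (use s in \<open>auto simp: d P_def smat_simps power_int_minus\<close>)
  ultimately show ?thesis using Lim_transform_eventually by (force simp: smat_simps)
 qed
 have "((%\<zeta>. commutator (smat (\<zeta> powi (s * n)) (\<xi> \<zeta> p)) (smat (\<zeta> powi (- s)) (conn_loop f \<zeta> p 1))) \<longlongrightarrow> commutator (C p) P) (end_filter s)"
  unfolding commutator_def using l conn_lim unfolding lead_def by (intro tendsto_diff tendsto_matrix_mult) auto
 moreover have "\<forall>\<^sub>F \<zeta> in end_filter s. commutator (smat (\<zeta> powi (s * n)) (\<xi> \<zeta> p)) (smat (\<zeta> powi (- s)) (conn_loop f \<zeta> p 1))
   = (\<Sum>k = - int N..int N. smat (\<zeta> powi (k - (s - s * n))) (D k))" using end_filter_props(2)[OF s]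
 proof eventually_elim
  case (elim \<zeta>)
  have "commutator (smat (\<zeta> powi (s * n)) (\<xi> \<zeta> p)) (smat (\<zeta> powi (- s)) (conn_loop f \<zeta> p 1))
    = smat (\<zeta> powi (s * n) * \<zeta> powi (- s)) (commutator (\<xi> \<zeta> p) (conn_loop f \<zeta> p 1))"
   unfolding commutator_def by (simp add: smat_simps mult.commute)
  also have "\<dots> = (\<Sum>k = - int N..int N. smat (\<zeta> powi (k - (s - s * n))) (D k))" unfolding dc[OF elim] smat_sum using elim
   by (intro sum.cong refl) (simp add: smat_simps power_int_diff power_int_add power_int_minus field_simps)
  finally show ?case .
 qed
 ultimately have 1: "((%\<zeta>. \<Sum>k = - int N..int N. smat (\<zeta> powi (k - (s - s * n))) (D k)) \<longlongrightarrow> commutator (C p) P) (end_filter s)"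
  by (rule Lim_transform_eventually)
 have low: "D k = 0 \<or> s * (k - (s - s * n)) < 0 \<or> k = s - s * n" if "k \<in> {- int N..int N}" for k
 proof (cases "0 < n + s * k")
  case True thus ?thesis using D0[OF that] by blast
 next
  case False
  have "s * (k - (s - s * n)) = s * k - 1 + n" using s by auto
  thus ?thesis using False by simp
 qed
 have 2: "((%\<zeta>. \<Sum>k = - int N..int N. smat (\<zeta> powi (k - (s - s * n))) (D k)) \<longlongrightarrow>
   (if s - s * n \<in> {- int N..int N} then D (s - s * n) else 0)) (end_filter s)" by (rule laurent_tendsto_leading[OF s _ low]) simp_all
 have "n + s * (s - s * n) = 1" using s by auto
 hence "(if s - s * n \<in> {- int N..int N} then D (s - s * n) else 0) = 0" using D0 by simp
 hence "commutator (C p) P = 0" using tendsto_unique[OF end_filter_props(1)[OF s] 1 2] by simp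
 hence "C p ** P = P ** C p" unfolding commutator_def by simp
 thus ?thesis using s cyc_upper[of "r p"] unfolding P_def cyc_def by (auto simp: matrix_distrib)
qed

lemma lead_structure:
 assumes \<xi>: "\<xi> \<in> killing_fields f" and l: "lead s \<xi> n C"
 shows "\<exists>x. \<forall>p. C p = smat (x p) (cyc_pow s (r p) n)"
proof -
 have "\<exists>x. C p = smat x (cyc_pow s (r p) n)" for p
 proof (rule graded_centralizer[OF s r_pos])
  show "C p ** cyc s (r p) = cyc s (r p) ** C p" by (rule lead_commutes[OF \<xi> l])
  show "smat (eps powi (s * n)) (S_mat ** C p ** matrix_inv S_mat) = C p" by (rule lead_S[OF s l]) (rule killing_fields_D(3)[OF \<xi>])
 qed
 thus ?thesis by (rule choice[OF allI])
qed

lemma killing_trace_constant: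
 assumes \<xi>: "\<xi> \<in> killing_fields f" and z: "\<zeta> ~= 0" shows "trace (\<xi> \<zeta> p) = trace (\<xi> \<zeta> q)"
proof -
 have "linear (trace :: mat3 => complex)" by (intro linearI) (simp_all add: trace_def sum.distrib scaleR_sum_right)
 hence bl: "bounded_linear (trace :: mat3 => complex)" by (simp add: linear_conv_bounded_linear)
 have "trace (commutator A B) = 0" for A B :: mat3 unfolding commutator_def trace_sub using trace_mul_sym[of A B] by simp
 hence "((%p. trace (\<xi> \<zeta> p)) has_derivative (%v. 0)) (at p)" for p
  using bounded_linear.has_derivative[OF bl killing_fields_D(4)[OF \<xi> z]] by simp
 hence "\<exists>c. \<forall>p\<in>UNIV. trace (\<xi> \<zeta> p) = c" by (intro has_derivative_zero_constant) (auto simp: has_derivative_at_withinI)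
 thus ?thesis by auto
qed

lemma cyc_pow_scaled_zero: "smat x (cyc_pow s (r p) n) = 0 \<longleftrightarrow> x = 0"
proof
 assume 0: "smat x (cyc_pow s (r p) n) = 0"
 have "smat x (mat 1 :: mat3) = smat x (cyc_pow s (r p) n) ** cyc_pow s (r p) n ** cyc_pow s (r p) n"
  using cyc_pow_props(1)[OF r_pos, of s p n] by (simp add: smat_simps)
 hence "smat x (mat 1 :: mat3) = 0" unfolding 0 by (simp add: matrix_distrib)
 hence "smat x (mat 1 :: mat3) $ 1 $ 1 = 0" by simp
 thus "x = 0" unfolding smat_def map_matrix_def mat_def by simp
qed (simp add: smat_simps)

text \<open>The cube of \<open>\<xi>\<close> has leading coefficient \<open>x\<^sup>3\<close> times the identity, whose trace is constant. So \<open>x\<close>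
 vanishes everywhere or nowhere.\<close>
lemma lead_zero_somewhere:
 assumes \<xi>: "\<xi> \<in> killing_fields f" and l: "lead s \<xi> n C" and p: "C p = 0" shows "C q = 0"
proof -
 obtain x where x: "!!p. C p = smat (x p) (cyc_pow s (r p) n)" using lead_structure[OF \<xi> l] by blast
 let ?\<eta> = "killing_mult (killing_mult \<xi> \<xi>) \<xi>"
 have \<eta>: "?\<eta> \<in> killing_fields f" using killing_mult_closed[OF killing_mult_closed[OF \<xi> \<xi>] \<xi>] .
 have l3: "lead s ?\<eta> (n + n + n) (%p. C p ** C p ** C p)" by (rule lead_mult[OF s lead_mult[OF s l l] l])
 have C3: "C p ** C p ** C p = smat (x p ^ 3) (mat 1)" for p
  unfolding x cyc_pow_props(1)[OF r_pos, of s p n, symmetric] by (simp add: smat_simps power3_eq_cube mult.assoc)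
 have tr: "((%\<zeta>. \<zeta> powi (s * (n + n + n)) * trace (?\<eta> \<zeta> p)) \<longlongrightarrow> 3 * x p ^ 3) (end_filter s)" for p
 proof -
  have "((%\<zeta>. trace (smat (\<zeta> powi (s * (n + n + n))) (?\<eta> \<zeta> p))) \<longlongrightarrow> trace (smat (x p ^ 3) (mat 1))) (end_filter s)"
   unfolding trace_def using l3 unfolding lead_def C3 by (intro tendsto_sum tendsto_vec_nth) auto
  moreover have "trace (smat a A) = a * trace A" for a A unfolding trace_def smat_def map_matrix_def by (simp add: sum_distrib_left)
  moreover have "trace (mat 1 :: mat3) = 3" unfolding trace_def mat_def sum_3 by simp
  ultimately show ?thesis by (simp add: mult.commute)
 qed
 have "\<forall>\<^sub>F \<zeta> in end_filter s. \<zeta> powi (s * (n + n + n)) * trace (?\<eta> \<zeta> p) = \<zeta> powi (s * (n + n + n)) * trace (?\<eta> \<zeta> q)"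
  using end_filter_props(2)[OF s]
 proof eventually_elim
  case (elim \<zeta>)
  show ?case unfolding killing_trace_constant[OF \<eta> elim, of p q] ..
 qed
 hence "3 * x p ^ 3 = 3 * x q ^ 3"
  using tendsto_unique[OF end_filter_props(1)[OF s] Lim_transform_eventually[OF tr[of p]] tr[of q]] by blast
 moreover have "x p = 0" using p cyc_pow_scaled_zero unfolding x by blast
 ultimately have "x q = 0" by simp
 thus ?thesis unfolding x by (simp add: smat_simps)
qed

text \<open>Subtracting the multiple that cancels the leading coefficient at the point \<open>p\<close> cancels it at all points.\<close>
lemma lead_proportional:
 assumes \<xi>: "\<xi> \<in> killing_fields f" "lead s \<xi> n C" and \<eta>: "\<eta> \<in> killing_fields f" "lead s \<eta> n D" and "D p ~= 0"
 shows "\<exists>c. lead s (%\<zeta> p. \<xi> \<zeta> p - smat c (\<eta> \<zeta> p)) n (%p. 0)"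
proof -
 obtain x where x: "!!p. C p = smat (x p) (cyc_pow s (r p) n)" using lead_structure[OF \<xi>] by blast
 obtain y where y: "!!p. D p = smat (y p) (cyc_pow s (r p) n)" using lead_structure[OF \<eta>] by blast
 have y0: "y p ~= 0" using assms(5) unfolding y by (auto simp: smat_simps)
 define c where "c = x p / y p"
 let ?z = "%\<zeta> p. \<xi> \<zeta> p - smat c (\<eta> \<zeta> p)"
 have l: "lead s ?z n (%p. C p - smat c (D p))" by (rule lead_diff[OF s \<xi>(2) lead_smat[OF s \<eta>(2)]])
 have "?z \<in> killing_fields f" using killing_add_closed[OF \<xi>(1) scalar_mult_closed[OF \<eta>(1), of "- c"]] by (simp add: smat_simps)
 moreover have "C p - smat c (D p) = 0" unfolding x y c_def using y0 by (simp add: smat_simps)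
 ultimately have "(%p. C p - smat c (D p)) = (%p. 0)" using lead_zero_somewhere[OF _ l] by blast
 thus ?thesis using l by auto
qed

end

lemma lead_exists:
 assumes \<xi>: "\<xi> \<in> killing_fields f" "\<xi> ~= (%\<zeta> p. 0)"
 shows "\<exists>lo hi C D. lo \<le> hi \<and> lead (-1) \<xi> lo C \<and> lead 1 \<xi> (- hi) D \<and> C ~= (%p. 0) \<and> D ~= (%p. 0)"
proof -
 obtain N c where c: "!!\<zeta> p. \<zeta> ~= 0 ==> \<xi> \<zeta> p = (\<Sum>k = - int N..int N. smat (\<zeta> powi k) (c k p))"
  by (rule killing_coefficients[OF \<xi>(1)], rule that)
 define K where "K = {k \<in> {- int N..int N}. c k ~= (%p. 0)}"
 have "K ~= {}"
 proof
  assume "K = {}"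
  hence "c k = (%p. 0)" if "k \<in> {- int N..int N}" for k using that unfolding K_def by blast
  hence "\<xi> \<zeta> p = 0" for \<zeta> p using killing_fields_D(1)[OF \<xi>(1)] by (cases "\<zeta> = 0") (simp_all add: c smat_simps)
  thus False using \<xi>(2) unfolding fun_eq_iff by blast
 qed
 moreover have fK: "finite K" by (rule finite_subset[of _ "{- int N..int N}"]) (auto simp: K_def)
 ultimately have m: "Min K \<in> K" "Max K \<in> K" "Min K \<le> Max K" by auto
 have lead: "lead s \<xi> (- s * k0) (c k0)" if s: "s = 1 \<or> s = - 1" and k0: "k0 \<in> K" and ext: "!!k. k \<in> K ==> s * k \<le> s * k0" for s k0
  unfolding lead_def
 proof (intro allI)
  fix p
  have k0I: "k0 \<in> {- int N..int N}" using k0 unfolding K_def by auto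
  have "((%\<zeta>. \<Sum>k\<in>{- int N..int N}. smat (\<zeta> powi (k - k0)) (c k p)) \<longlongrightarrow> (if k0 \<in> {- int N..int N} then c k0 p else 0)) (end_filter s)"
  proof (rule laurent_tendsto_leading[OF s])
   fix k assume k: "k \<in> {- int N..int N}"
   show "c k p = 0 \<or> s * (k - k0) < 0 \<or> k = k0"
   proof (cases "k \<in> K")
    case True
    thus ?thesis using ext[OF True] s by auto
   next
    case False
    hence "c k = (%p. 0)" using k unfolding K_def by blast
    thus ?thesis by simp
   qed
  qed simp
  moreover have "\<forall>\<^sub>F \<zeta> in end_filter s. (\<Sum>k\<in>{- int N..int N}. smat (\<zeta> powi (k - k0)) (c k p)) = smat (\<zeta> powi (s * (- s * k0))) (\<xi> \<zeta> p)"
   using end_filter_props(2)[OF s]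
  proof eventually_elim
   case (elim \<zeta>)
   have e: "s * (- s * k0) = - k0" using s by auto
   show ?case unfolding c[OF elim] smat_sum e
    using elim by (intro sum.cong) (simp_all add: smat_simps power_int_diff power_int_minus field_simps)
  qed
  ultimately show "((%\<zeta>. smat (\<zeta> powi (s * (- s * k0))) (\<xi> \<zeta> p)) \<longlongrightarrow> c k0 p) (end_filter s)" using k0I Lim_transform_eventually by force
 qed
 have "lead (-1) \<xi> (Min K) (c (Min K))" using lead[of "-1" "Min K"] m fK by simp
 moreover have "lead 1 \<xi> (- Max K) (c (Max K))" using lead[of 1 "Max K"] m fK by simp
 ultimately show ?thesis using m unfolding K_def by blast
qed

text \<open>The order of vanishing at \<open>\<zeta> = 0\<close> for \<open>s = - 1\<close> and at \<open>\<zeta> = \<infinity>\<close> for \<open>s = 1\<close>.\<close>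
definition ord :: "int => loop_field => int" where
 "ord s \<xi> = (THE n. \<exists>C. lead s \<xi> n C \<and> C ~= (%p. 0))"

context
 fixes s :: int
 assumes s: "s = 1 \<or> s = - 1"
begin

lemma ord_eqI: assumes "lead s \<xi> n C" "C ~= (%p. 0)" shows "ord s \<xi> = n" unfolding ord_def
proof (rule the_equality)
 show "\<exists>C. lead s \<xi> n C \<and> C ~= (%p. 0)" using assms by blast
 fix m assume "\<exists>C. lead s \<xi> m C \<and> C ~= (%p. 0)"
 then obtain D where D: "lead s \<xi> m D" "D ~= (%p. 0)" by blast
 have "\<not> n < m" using lead_shift[OF s D(1)] lead_unique[OF s assms(1)] assms(2) by blast
 moreover have "\<not> m < n" using lead_shift[OF s assms(1)] lead_unique[OF s D(1)] D(2) by blast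
 ultimately show "m = n" by simp
qed

lemma ord_lead:
 assumes "\<xi> \<in> killing_fields f" "\<xi> ~= (%\<zeta> p. 0)"
 shows "\<exists>C. lead s \<xi> (ord s \<xi>) C \<and> (\<forall>p. C p ~= 0)"
proof -
 obtain n C where C: "lead s \<xi> n C" "C ~= (%p. 0)" using lead_exists[OF assms] s by metis
 have "C p ~= 0" for p using C(2) lead_zero_somewhere[OF s assms(1) C(1), of p] by blast
 thus ?thesis using C ord_eqI[OF C] by blast
qed

lemma ord_greater:
 assumes "\<xi> \<in> killing_fields f" "\<xi> ~= (%\<zeta> p. 0)" "lead s \<xi> n (%p. 0)"
 shows "n < ord s \<xi>"
proof (rule ccontr)
 assume "\<not> n < ord s \<xi>"
 obtain C where C: "lead s \<xi> (ord s \<xi>) C" "!!p. C p ~= 0" using ord_lead[OF assms(1,2)] by blast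
 have "lead s \<xi> (ord s \<xi>) (%p. 0)" using \<open>\<not> n < ord s \<xi>\<close> lead_shift[OF s assms(3)] assms(3) by (cases "n = ord s \<xi>") auto
 thus False using lead_unique[OF s C(1)] C(2) by metis
qed

lemma lead_below: assumes "\<xi> \<in> killing_fields f" "\<xi> ~= (%\<zeta> p. 0)" "n \<le> ord s \<xi>"
 shows "\<exists>C. lead s \<xi> n C" using ord_lead[OF assms(1,2)] lead_shift[OF s, of \<xi> "ord s \<xi>" _ n] assms(3) by (cases "n = ord s \<xi>") auto

lemma ord_at_least:
 assumes "\<xi> \<in> killing_fields f" "\<xi> ~= (%\<zeta> p. 0)" "lead s \<xi> n C" shows "n \<le> ord s \<xi>"
 using ord_greater[OF assms(1,2), of n] ord_eqI[OF assms(3)] assms(3) by (cases "C = (%p. 0)") auto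

lemma killing_mult_nonzero:
 assumes \<xi>: "\<xi> \<in> killing_fields f" "\<xi> ~= (%\<zeta> p. 0)" and \<eta>: "\<eta> \<in> killing_fields f" "\<eta> ~= (%\<zeta> p. 0)"
 shows "killing_mult \<xi> \<eta> ~= (%\<zeta> p. 0)" "ord s (killing_mult \<xi> \<eta>) = ord s \<xi> + ord s \<eta>"
proof -
 obtain C where C: "lead s \<xi> (ord s \<xi>) C" "!!p. C p ~= 0" using ord_lead[OF \<xi>] by blast
 obtain D where D: "lead s \<eta> (ord s \<eta>) D" "!!p. D p ~= 0" using ord_lead[OF \<eta>] by blast
 have l: "lead s (killing_mult \<xi> \<eta>) (ord s \<xi> + ord s \<eta>) (%p. C p ** D p)" by (rule lead_mult[OF s C(1) D(1)])
 obtain x where x: "!!p. C p = smat (x p) (cyc_pow s (r p) (ord s \<xi>))" using lead_structure[OF s \<xi>(1) C(1)] by blast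
 let ?B = "cyc_pow s (r 0) (ord s \<xi>)"
 have x0: "x 0 ~= 0" using C(2)[of 0] unfolding x by (auto simp: smat_simps)
 have "C 0 ** D 0 ~= 0"
 proof
  assume "C 0 ** D 0 = 0"
  hence "smat (inverse (x 0)) (?B ** ?B ** (C 0 ** D 0)) = 0" by (simp add: matrix_distrib smat_simps)
  moreover have "smat (inverse (x 0)) (?B ** ?B ** (C 0 ** D 0)) = (?B ** ?B ** ?B) ** D 0"
   unfolding x using x0 by (simp add: smat_simps matrix_mul_assoc)
  ultimately show False unfolding cyc_pow_props(1)[OF r_pos] using D(2) by simp
 qed
 hence nz: "(%p. C p ** D p) ~= (%p. 0)" by metis
 show "ord s (killing_mult \<xi> \<eta>) = ord s \<xi> + ord s \<eta>" by (rule ord_eqI[OF l nz])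
 show "killing_mult \<xi> \<eta> ~= (%\<zeta> p. 0)"
 proof
  assume "killing_mult \<xi> \<eta> = (%\<zeta> p. 0)"
  hence "lead s (%\<zeta> p. 0) (ord s \<xi> + ord s \<eta>) (%p. C p ** D p)" using l by simp
  moreover have "lead s (%\<zeta> p. 0) (ord s \<xi> + ord s \<eta>) (%p. 0)" unfolding lead_def by (simp add: smat_simps)
  ultimately show False using lead_unique[OF s] nz by blast
 qed
qed

lemma scalar_lead: "lead s (scalar_field (%\<zeta>. c * \<zeta> powi k)) (- (s * k)) (%p. mat c)" unfolding lead_def
proof (intro allI)
 fix p
 have "s * (- (s * k)) = - k" using s by auto
 hence "\<forall>\<^sub>F \<zeta> in end_filter s. mat c = smat (\<zeta> powi (s * (- (s * k)))) (scalar_field (%\<zeta>. c * \<zeta> powi k) \<zeta> p)"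
  using end_filter_props(2)[OF s]
  by (auto elim!: eventually_mono simp: scalar_field_def mat_smat[of "c * _"] mat_smat[of c] smat_simps power_int_minus field_simps)
 thus "((%\<zeta>. smat (\<zeta> powi (s * (- (s * k)))) (scalar_field (%\<zeta>. c * \<zeta> powi k) \<zeta> p)) \<longlongrightarrow> mat c) (end_filter s)"
  by (rule Lim_transform_eventually[OF tendsto_const])
qed

lemma scalar_ord: assumes "c ~= 0" shows "ord s (scalar_field (%\<zeta>. c * \<zeta> powi k)) = - (s * k)"
proof (rule ord_eqI[OF scalar_lead])
 have "(mat c :: mat3) $ 1 $ 1 ~= 0" using assms unfolding mat_def by simp
 thus "(%p. mat c :: mat3) ~= (%p. 0)" by (metis zero_index)
qed

lemma mu_star_parity:
 assumes \<xi>: "\<xi> \<in> killing_fields f" "\<xi> ~= (%\<zeta> p. 0)"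
 shows "lead s (%\<zeta> p. mu_star \<xi> \<zeta> p - smat ((-1) powi ord s \<xi>) (\<xi> \<zeta> p)) (ord s \<xi>) (%p. 0)"
proof -
 obtain C where C: "lead s \<xi> (ord s \<xi>) C" using ord_lead[OF \<xi>] by blast
 obtain x where x: "!!p. C p = smat (x p) (cyc_pow s (r p) (ord s \<xi>))" using lead_structure[OF s \<xi>(1) C] by blast
 have T: "T_flip (C p) = C p" for p unfolding x T_flip_simps cyc_pow_props(2)[OF r_pos] ..
 have "lead s (%\<zeta> p. mu_star \<xi> \<zeta> p - smat ((-1) powi ord s \<xi>) (\<xi> \<zeta> p)) (ord s \<xi>)
   (%p. smat ((-1) powi ord s \<xi>) (T_flip (C p)) - smat ((-1) powi ord s \<xi>) (C p))"
  by (rule lead_diff[OF s lead_mu_star[OF s C] lead_smat[OF s C]])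
 thus ?thesis unfolding T by simp
qed

end

lemma ord_sum: assumes "\<xi> \<in> killing_fields f" "\<xi> ~= (%\<zeta> p. 0)" shows "ord (-1) \<xi> + ord 1 \<xi> \<le> 0"
proof -
 obtain lo hi C D where *: "lo \<le> hi" "lead (-1) \<xi> lo C" "lead 1 \<xi> (- hi) D" "C ~= (%p. 0)" "D ~= (%p. 0)"
  using lead_exists[OF assms] by blast
 thus ?thesis using ord_eqI[OF end_cases(2) *(2,4)] ord_eqI[OF end_cases(1) *(3,5)] by simp
qed

end

section \<open>Adjoining a square root\<close>

text \<open>Evaluation at \<open>t\<close> is onto by \<open>span\<close>. Division by the monic polynomial \<open>X\<^sup>2 - t\<^sup>2\<close> leaves a remainder \<open>b
 + c X\<close>, which is determined by its value, so that the kernel is the ideal of this polynomial.\<close>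
lemma (in cring) adjoin_square_root:
 assumes sub: "subring B R" and t: "t \<in> carrier R" "t \<otimes> t \<in> B" and nontrivial: "\<one> ~= \<zero>"
  and span: "!!a. a \<in> carrier R ==> \<exists>b\<in>B. \<exists>c\<in>B. a = b \<oplus> c \<otimes> t"
  and indep: "!!b c. b \<in> B ==> c \<in> B ==> b \<oplus> c \<otimes> t = \<zero> ==> b = \<zero> \<and> c = \<zero>"
 defines "P \<equiv> UP (R\<lparr>carrier := B\<rparr>)"
 defines "I \<equiv> Idl\<^bsub>P\<^esub> {up_ring.monom P \<one> 2 \<ominus>\<^bsub>P\<^esub> up_ring.monom P (t \<otimes> t) 0}"
 shows "\<exists>h \<in> ring_iso (P Quot I) R. (\<forall>b\<in>B. h (I +>\<^bsub>P\<^esub> up_ring.monom P b 0) = b) \<and> h (I +>\<^bsub>P\<^esub> up_ring.monom P \<one> 1) = t"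
proof -
 let ?B = "R\<lparr>carrier := B\<rparr>"
 have BR: "B \<subseteq> carrier R" by (rule subringE(1)[OF sub])
 have cB: "cring ?B" using subcring_iff[OF BR] subcringI'[OF sub] by simp
 interpret U: UP_pre_univ_prop ?B R "%x. x" P
  unfolding P_def using BR by (intro UP_pre_univ_propI cB cring_axioms) (auto simp: ring_hom_def)
 let ?e = "eval ?B R (%x. x) t"
 have simps: "carrier ?B = B" "\<one>\<^bsub>?B\<^esub> = \<one>" "\<zero>\<^bsub>?B\<^esub> = \<zero>" by simp_all
 have e1: "one R \<in> B" and e0: "zero R \<in> B" using subringE[OF sub] by auto
 interpret E: ring_hom_ring P R ?e by (intro ring_hom_ringI2 U.P.ring_axioms ring_axioms U.eval_ring_hom t(1))
 have em: "?e (up_ring.monom P b n) = b \<otimes> t [^] n" if "b \<in> B" for b n using U.eval_monom[of b t n] that t(1) by simp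
 define g where "g = up_ring.monom P \<one> 2 \<ominus>\<^bsub>P\<^esub> up_ring.monom P (t \<otimes> t) 0"
 have mc: "up_ring.monom P b n \<in> carrier P" if "b \<in> B" for b n using U.monom_closed[of b n] that by simp
 have cm: "up_ring.coeff P (up_ring.monom P b n) k = (if n = k then b else \<zero>)" if "b \<in> B" for b n k
  using U.coeff_monom[of b n k] that by simp
 have gc: "g \<in> carrier P" unfolding g_def using mc e1 t(2) by (intro U.P.minus_closed) auto
 have zm: "a \<ominus>\<^bsub>?B\<^esub> \<zero> = a" if "a \<in> B" for a using ring.ring_simprules(15)[OF cring.axioms(1)[OF cB]] cring.axioms(1)[OF cB] that
  by (metis U.R.minus_zero U.R.r_zero a_minus_def simps(1,3))
 have gk: "up_ring.coeff P g k = (if k = 2 then \<one> else if k = 0 then \<ominus>\<^bsub>?B\<^esub> (t \<otimes> t) else \<zero>)" for k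
 proof -
  have "up_ring.coeff P g k = (if 2 = k then \<one> else \<zero>) \<ominus>\<^bsub>?B\<^esub> (if 0 = k then t \<otimes> t else \<zero>)"
   unfolding g_def using U.coeff_minus[OF mc[OF e1, of 2] mc[OF t(2), of 0], of k] unfolding cm[OF e1] cm[OF t(2)] .
  thus ?thesis using zm[OF e1] zm[OF e0] U.R.l_zero[of "\<ominus>\<^bsub>?B\<^esub> (t \<otimes> t)"] U.R.a_inv_closed[of "t \<otimes> t"] t(2)
   by (auto simp: a_minus_def split: if_splits)
 qed
 have dg: "deg ?B g = 2"
 proof (rule antisym)
  show "deg ?B g \<le> 2" by (rule U.deg_aboveI[OF _ gc]) (simp add: gk)
  show "2 \<le> deg ?B g" by (rule U.deg_belowI[OF _ gc]) (use nontrivial in \<open>simp add: gk\<close>)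
 qed
 have eg: "?e g = \<zero>"
 proof -
  have "?e g = ?e (up_ring.monom P \<one> 2) \<ominus> ?e (up_ring.monom P (t \<otimes> t) 0)"
   unfolding g_def a_minus_def using mc[OF e1, of 2] mc[OF t(2), of 0] by simp
  also have "\<dots> = t \<otimes> t \<ominus> t \<otimes> t" unfolding em[OF e1] em[OF t(2)] using t(1) by (simp add: numeral_2_eq_2)
  also have "\<dots> = \<zero>" using t(1) by (simp add: a_minus_def r_neg)
  finally show ?thesis .
 qed
 have "a_kernel P R ?e = I"
 proof (intro equalityI)
  have "g \<in> a_kernel P R ?e" unfolding a_kernel_def' using gc eg by blast
  thus "I \<subseteq> a_kernel P R ?e" unfolding I_def g_def[symmetric] by (intro U.P.genideal_minimal[OF E.kernel_is_ideal]) blast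
  show "a_kernel P R ?e \<subseteq> I"
  proof
   fix p assume "p \<in> a_kernel P R ?e"
   hence p: "p \<in> carrier P" "?e p = \<zero>" unfolding a_kernel_def' by blast+
   have "g ~= \<zero>\<^bsub>P\<^esub>" using gk[of 2] nontrivial by auto
   from U.long_div_theorem[OF gc p(1) this] obtain q r and k :: nat
    where qr: "q \<in> carrier P" "r \<in> carrier P"
     "up_ring.coeff P g (deg ?B g) [^]\<^bsub>?B\<^esub> k \<odot>\<^bsub>P\<^esub> p = g \<otimes>\<^bsub>P\<^esub> q \<oplus>\<^bsub>P\<^esub> r"
     "r = \<zero>\<^bsub>P\<^esub> \<or> deg ?B r < deg ?B g" by blast
   have lc: "up_ring.coeff P g (deg ?B g) [^]\<^bsub>?B\<^esub> k = \<one>\<^bsub>?B\<^esub>" unfolding dg gk using U.R.nat_pow_one[of k] by simp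
   have pqr: "p = g \<otimes>\<^bsub>P\<^esub> q \<oplus>\<^bsub>P\<^esub> r" using qr(3) U.UP_smult_one[OF p(1)] unfolding lc by simp
   define b where "b = up_ring.coeff P r 0"
   define c where "c = up_ring.coeff P r 1"
   have bc: "b \<in> B" "c \<in> B" unfolding b_def c_def using U.coeff_closed[OF qr(2)] by auto
   have high: "up_ring.coeff P r n = \<zero>" if "2 \<le> n" for n using qr(4) dg that U.deg_aboveD[OF _ qr(2), of n] by auto
   have r: "r = up_ring.monom P b 0 \<oplus>\<^bsub>P\<^esub> up_ring.monom P c 1"
   proof (rule U.up_eqI)
    fix n
    have "up_ring.coeff P (up_ring.monom P b 0 \<oplus>\<^bsub>P\<^esub> up_ring.monom P c 1) n = (if 0 = n then b else \<zero>) \<oplus> (if 1 = n then c else \<zero>)"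
     using U.coeff_add[OF mc[OF bc(1), of 0] mc[OF bc(2), of 1], of n] unfolding cm[OF bc(1)] cm[OF bc(2)] by simp
    moreover have "n = 0 \<or> n = 1 \<or> 2 \<le> n" by arith
    ultimately show "up_ring.coeff P r n = up_ring.coeff P (up_ring.monom P b 0 \<oplus>\<^bsub>P\<^esub> up_ring.monom P c 1) n"
     using bc BR high b_def c_def by auto
   qed (use mc bc qr(2) in auto)
   have "?e p = ?e r" unfolding pqr using gc qr eg by simp
   also have "\<dots> = b \<oplus> c \<otimes> t" unfolding r using em[OF bc(1), of 0] em[OF bc(2), of 1] mc[OF bc(1)] mc[OF bc(2)] bc BR t(1)
    by (simp add: subsetD)
   finally have "b \<oplus> c \<otimes> t = \<zero>" unfolding p(2) by (rule sym)
   hence "b = \<zero> \<and> c = \<zero>" by (rule indep[OF bc])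
   hence "r = \<zero>\<^bsub>P\<^esub>" unfolding r using U.monom_zero[of 0] U.monom_zero[of 1] by simp
   hence "p = g \<otimes>\<^bsub>P\<^esub> q" unfolding pqr using gc qr(1) by simp
   moreover have "g \<in> I" unfolding I_def g_def[symmetric] by (rule U.P.genideal_self'[OF gc])
   moreover have "ideal I P" unfolding I_def g_def[symmetric] using gc by (intro U.P.genideal_ideal) simp
   ultimately show "p \<in> I" using ideal.I_r_closed qr(1) by metis
  qed
 qed
 note ker = this
 have surj: "?e ` carrier P = carrier R"
 proof
  show "?e ` carrier P \<subseteq> carrier R" using E.hom_closed by blast
  show "carrier R \<subseteq> ?e ` carrier P"
  proof
   fix a assume "a \<in> carrier R"
   then obtain b c where bc: "b \<in> B" "c \<in> B" "a = b \<oplus> c \<otimes> t" using span by blast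
   have "?e (up_ring.monom P b 0 \<oplus>\<^bsub>P\<^esub> up_ring.monom P c 1) = a"
    unfolding bc(3) using em[OF bc(1), of 0] em[OF bc(2), of 1] mc[OF bc(1)] mc[OF bc(2)] bc BR t(1) by (simp add: subsetD)
   moreover have "up_ring.monom P b 0 \<oplus>\<^bsub>P\<^esub> up_ring.monom P c 1 \<in> carrier P" using mc bc by blast
   ultimately show "a \<in> ?e ` carrier P" by blast
  qed
 qed
 show ?thesis
 proof (intro bexI[of _ "%X. the_elem (?e ` X)"] conjI ballI)
  show "(%X. the_elem (?e ` X)) \<in> ring_iso (P Quot I) R" using E.FactRing_iso_set[OF surj] unfolding ker .
  show "the_elem (?e ` (I +>\<^bsub>P\<^esub> up_ring.monom P b 0)) = b" if "b \<in> B" for b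
   using E.the_elem_simp[OF mc[OF that, of 0]] em[OF that, of 0] that BR unfolding ker by auto
  show "the_elem (?e ` (I +>\<^bsub>P\<^esub> up_ring.monom P \<one> 1)) = t"
   using E.the_elem_simp[OF mc[OF e1, of 1]] em[OF e1, of 1] t(1) unfolding ker by auto
 qed
qed

section \<open>The spectral curve\<close>

locale spectral_curve = conformal_minimal_lagrangian f for f +
 fixes P0 Pinf :: "frac set"
 assumes commutative: "!!\<xi> \<eta>. \<xi> \<in> killing_fields f ==> \<eta> \<in> killing_fields f ==> killing_mult \<xi> \<eta> = killing_mult \<eta> \<xi>"
  and lambda: "lambda_cover f P0 Pinf"
begin

abbreviation A :: "loop_field ring" where "A \<equiv> killing_algebra f"
abbreviation K :: "frac ring" where "K \<equiv> frac_ring f"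
abbreviation const :: "complex => loop_field" where "const c \<equiv> scalar_field (%_. c)"

lemma A_domain: "domain A"
proof (rule domainI)
 have "comm_monoid A" by (rule monoid.monoid_comm_monoidI[OF ring.is_monoid[OF killing_ring]])
   (use commutative in \<open>simp add: A_simps\<close>)
 thus "cring A" using killing_ring by (intro cring.intro)
 show "\<one>\<^bsub>A\<^esub> ~= \<zero>\<^bsub>A\<^esub>"
 proof
  assume "\<one>\<^bsub>A\<^esub> = \<zero>\<^bsub>A\<^esub>"
  hence "const 1 1 0 = 0" unfolding A_simps fun_eq_iff by blast
  hence "(mat 1 :: mat3) $ 1 $ 1 = 0" unfolding scalar_field_def by simp
  thus False unfolding mat_def by simp
 qed
 fix \<xi> \<eta> assume "\<xi> \<otimes>\<^bsub>A\<^esub> \<eta> = \<zero>\<^bsub>A\<^esub>" "\<xi> \<in> carrier A" "\<eta> \<in> carrier A"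
 thus "\<xi> = \<zero>\<^bsub>A\<^esub> \<or> \<eta> = \<zero>\<^bsub>A\<^esub>" using killing_mult_nonzero(1)[OF end_cases(1)] unfolding A_simps by blast
qed

sublocale A: "domain" A by (rule A_domain)

lemma A_cases: "\<xi> \<in> A.nonzero \<longleftrightarrow> \<xi> \<in> killing_fields f \<and> \<xi> ~= (%\<zeta> p. 0)" unfolding A_simps by blast

lemma const_hom: "A.constants_hom const"
proof -
 have "const (x + y) = killing_add (const x) (const y)" "const (x * y) = killing_mult (const x) (const y)" for x y
  unfolding scalar_field_def fun_eq_iff
  by (auto simp: mat_smat[of "_ + _"] mat_smat[of "_ * _"] mat_smat[of x] mat_smat[of y] smat_simps mult.commute)
 thus ?thesis unfolding A.constants_hom_def A_simps using constant_closed by auto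
qed

lemma ord_valuation: assumes s: "s = 1 \<or> s = - 1" shows "A.valuation const (ord s)" unfolding A.valuation_def
proof (intro conjI ballI impI allI)
 fix \<xi> \<eta> assume "\<xi> \<in> A.nonzero" "\<eta> \<in> A.nonzero"
 hence \<xi>: "\<xi> \<in> killing_fields f" "\<xi> ~= (%\<zeta> p. 0)" and \<eta>: "\<eta> \<in> killing_fields f" "\<eta> ~= (%\<zeta> p. 0)" unfolding A_cases by auto
 show "ord s (\<xi> \<otimes>\<^bsub>A\<^esub> \<eta>) = ord s \<xi> + ord s \<eta>" unfolding A_simps by (rule killing_mult_nonzero(2)[OF s \<xi> \<eta>])
 show "min (ord s \<xi>) (ord s \<eta>) \<le> ord s (\<xi> \<oplus>\<^bsub>A\<^esub> \<eta>)" if "\<xi> \<oplus>\<^bsub>A\<^esub> \<eta> ~= \<zero>\<^bsub>A\<^esub>"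
 proof -
  obtain C D where CD: "lead s \<xi> (min (ord s \<xi>) (ord s \<eta>)) C" "lead s \<eta> (min (ord s \<xi>) (ord s \<eta>)) D"
   using lead_below[OF s \<xi>, of "min (ord s \<xi>) (ord s \<eta>)"] lead_below[OF s \<eta>, of "min (ord s \<xi>) (ord s \<eta>)"] by auto
  show ?thesis unfolding A_simps by (rule ord_at_least[OF s killing_add_closed[OF \<xi>(1) \<eta>(1)] _ lead_add[OF s CD]])
    (use that in \<open>simp add: A_simps\<close>)
 qed
 assume eq: "ord s \<xi> = ord s \<eta>"
 obtain C where C: "lead s \<xi> (ord s \<xi>) C" using ord_lead[OF s \<xi>] by blast
 obtain D where D: "lead s \<eta> (ord s \<xi>) D" "D 0 ~= 0" using ord_lead[OF s \<eta>] unfolding eq by blast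
 obtain c where c: "lead s (%\<zeta> p. \<xi> \<zeta> p - smat c (\<eta> \<zeta> p)) (ord s \<xi>) (%p. 0)" using lead_proportional[OF s \<xi>(1) C \<eta>(1) D] by blast
 have *: "\<xi> \<ominus>\<^bsub>A\<^esub> const c \<otimes>\<^bsub>A\<^esub> \<eta> = (%\<zeta> p. \<xi> \<zeta> p - smat c (\<eta> \<zeta> p))"
  unfolding A_simps scalar_mult_eq[OF \<eta>(1)] by (rule killing_minus[OF \<xi>(1) scalar_mult_closed[OF \<eta>(1)]])
 have "\<xi> \<ominus>\<^bsub>A\<^esub> const c \<otimes>\<^bsub>A\<^esub> \<eta> \<in> killing_fields f" using A.minus_closed A.m_closed \<xi>(1) \<eta>(1) constant_closed unfolding A_simps(1) by metis
 thus "\<exists>z. \<xi> \<ominus>\<^bsub>A\<^esub> const z \<otimes>\<^bsub>A\<^esub> \<eta> = \<zero>\<^bsub>A\<^esub> \<or> ord s \<xi> < ord s (\<xi> \<ominus>\<^bsub>A\<^esub> const z \<otimes>\<^bsub>A\<^esub> \<eta>)"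
  using ord_greater[OF s _ _ c] unfolding * by (intro exI[of _ c], unfold * A_simps(5)) blast
next
 fix z :: complex assume "z ~= 0"
 thus "ord s (const z) = 0" using scalar_ord[OF s, of z 0] by simp
qed

lemma zeta_pow_ord: "s = 1 \<or> s = - 1 ==> ord s (zeta_pow k) = - (s * k)" using scalar_ord[of s 1 k] unfolding zeta_pow_def by simp

lemma zeta_pow_nonzero: "zeta_pow k ~= (%\<zeta> p. 0)"
proof
 assume "zeta_pow k = (%\<zeta> p. 0)"
 hence "zeta_pow k 1 0 = 0" by simp
 hence "(mat 1 :: mat3) $ 1 $ 1 = 0" unfolding zeta_pow_def scalar_field_def by simp
 thus False unfolding mat_def by simp
qed

lemma zeta_pow_A: "3 dvd k ==> zeta_pow k \<in> A.nonzero" unfolding A_cases using zeta_pow_closed zeta_pow_nonzero by blast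

lemma zeta_pow_mult: "killing_mult (zeta_pow j) (zeta_pow k) = zeta_pow (j + k)" unfolding zeta_pow_def scalar_field_def fun_eq_iff
 by (auto simp: mat_smat[of "_ powi _"] mat_smat[of "_ * _"] smat_simps power_int_add mult.commute)

lemma zeta_pow_0: "zeta_pow 0 = \<one>\<^bsub>A\<^esub>" unfolding zeta_pow_def A_simps by simp

abbreviation embed :: "loop_field => frac" where "embed \<equiv> to_fraction A"
abbreviation cst :: "complex => frac" where "cst z \<equiv> embed (const z)"

lemma range_cst: "range cst = in_frac f constants" unfolding in_frac_def constants_def by auto

lemma in_frac_killing: "in_frac f (killing_fields f) = embed ` carrier A" unfolding in_frac_def A_simps ..

lemma embed_inverse: assumes "3 dvd k" shows "inv\<^bsub>K\<^esub> (embed (zeta_pow k)) = embed (zeta_pow (- k))"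
proof -
 have c: "zeta_pow k \<in> carrier A" "zeta_pow (- k) \<in> carrier A" using zeta_pow_A assms by auto
 have "embed (zeta_pow k) \<otimes>\<^bsub>K\<^esub> embed (zeta_pow (- k)) = embed (zeta_pow k \<otimes>\<^bsub>A\<^esub> zeta_pow (- k))"
  by (rule A.to_fraction_mult[OF c, symmetric])
 also have "zeta_pow k \<otimes>\<^bsub>A\<^esub> zeta_pow (- k) = \<one>\<^bsub>A\<^esub>" using zeta_pow_mult[of k "- k"] zeta_pow_0 by (simp add: A_simps(2))
 also have "embed \<one>\<^bsub>A\<^esub> = \<one>\<^bsub>K\<^esub>" by (rule A.to_fraction_one)
 finally show ?thesis using comm_monoid.comm_inv_char[OF cring.axioms(2)[OF A.Frac_cring]] A.to_fraction_closed c by metis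
qed

lemma laurent_affine_ring:
 "affine_ring K cst (in_frac f (subalgebra_generated f {zeta_pow 3, zeta_pow (- 3)}))"
proof -
 have H: "constants \<union> {zeta_pow 3, zeta_pow (- 3)} \<subseteq> carrier A"
  unfolding constants_def A_simps using constant_closed zeta_pow_closed by auto
 show ?thesis unfolding in_frac_def subalgebra_generated_def
  by (rule A.Frac_affine_ring[OF const_hom A.generate_ring_is_subring[OF H] generate_ring.incl])
   (auto simp: constants_def)
qed

text \<open>Otherwise a third of the order is a valuation onto the integers. The corresponding power \<open>\<lambda>\<^bsup>\<plusminus>1\<^esup>\<close> is a
 parameter, which contradicts that it has a single zero on a cover of degree three.\<close>
lemma ord_not_all_divisible:
 assumes s: "s = 1 \<or> s = - 1" shows "\<exists>\<xi>\<in>A.nonzero. \<not> 3 dvd ord s \<xi>"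
proof (rule ccontr)
 assume "\<not> ?thesis"
 hence dvd: "3 dvd ord s \<xi>" if "\<xi> \<in> A.nonzero" for \<xi> using that by blast
 define \<nu> where "\<nu> \<xi> = ord s \<xi> div 3" for \<xi>
 have \<nu>3: "ord s \<xi> = 3 * \<nu> \<xi>" if "\<xi> \<in> A.nonzero" for \<xi> unfolding \<nu>_def using dvd[OF that] by simp
 have \<nu>: "A.valuation const \<nu>" unfolding A.valuation_def
 proof (intro conjI ballI impI allI)
  fix \<xi> \<eta> assume \<xi>: "\<xi> \<in> A.nonzero" and \<eta>: "\<eta> \<in> A.nonzero"
  have "ord s (\<xi> \<otimes>\<^bsub>A\<^esub> \<eta>) = ord s \<xi> + ord s \<eta>" using ord_valuation[OF s] \<xi> \<eta> unfolding A.valuation_def by blast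
  thus "\<nu> (\<xi> \<otimes>\<^bsub>A\<^esub> \<eta>) = \<nu> \<xi> + \<nu> \<eta>" using \<nu>3[OF \<xi>] \<nu>3[OF \<eta>] \<nu>3[OF A.nonzero_mult[OF \<xi> \<eta>]] by simp
  show "min (\<nu> \<xi>) (\<nu> \<eta>) \<le> \<nu> (\<xi> \<oplus>\<^bsub>A\<^esub> \<eta>)" if nz: "\<xi> \<oplus>\<^bsub>A\<^esub> \<eta> ~= \<zero>\<^bsub>A\<^esub>"
  proof -
   have "min (ord s \<xi>) (ord s \<eta>) \<le> ord s (\<xi> \<oplus>\<^bsub>A\<^esub> \<eta>)" using ord_valuation[OF s] \<xi> \<eta> nz unfolding A.valuation_def by blast
   moreover have "\<xi> \<oplus>\<^bsub>A\<^esub> \<eta> \<in> A.nonzero" using nz \<xi> \<eta> by simp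
   ultimately show ?thesis using \<nu>3[OF \<xi>] \<nu>3[OF \<eta>] \<nu>3[of "\<xi> \<oplus>\<^bsub>A\<^esub> \<eta>"] by linarith
  qed
  assume "\<nu> \<xi> = \<nu> \<eta>"
  hence "ord s \<xi> = ord s \<eta>" using \<nu>3[OF \<xi>] \<nu>3[OF \<eta>] by simp
  then obtain z where z: "\<xi> \<ominus>\<^bsub>A\<^esub> const z \<otimes>\<^bsub>A\<^esub> \<eta> = \<zero>\<^bsub>A\<^esub> \<or> ord s \<xi> < ord s (\<xi> \<ominus>\<^bsub>A\<^esub> const z \<otimes>\<^bsub>A\<^esub> \<eta>)"
   using ord_valuation[OF s] \<xi> \<eta> unfolding A.valuation_def by blast
  have "\<xi> \<ominus>\<^bsub>A\<^esub> const z \<otimes>\<^bsub>A\<^esub> \<eta> \<in> carrier A" using \<xi> \<eta> A.constants_hom_D(1)[OF const_hom] by simp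
  hence "\<xi> \<ominus>\<^bsub>A\<^esub> const z \<otimes>\<^bsub>A\<^esub> \<eta> = \<zero>\<^bsub>A\<^esub> \<or> \<nu> \<xi> < \<nu> (\<xi> \<ominus>\<^bsub>A\<^esub> const z \<otimes>\<^bsub>A\<^esub> \<eta>)" using z \<nu>3[OF \<xi>] \<nu>3[of "\<xi> \<ominus>\<^bsub>A\<^esub> const z \<otimes>\<^bsub>A\<^esub> \<eta>"]
   by (cases "\<xi> \<ominus>\<^bsub>A\<^esub> const z \<otimes>\<^bsub>A\<^esub> \<eta> = \<zero>\<^bsub>A\<^esub>") simp_all
  thus "\<exists>z. \<xi> \<ominus>\<^bsub>A\<^esub> const z \<otimes>\<^bsub>A\<^esub> \<eta> = \<zero>\<^bsub>A\<^esub> \<or> \<nu> \<xi> < \<nu> (\<xi> \<ominus>\<^bsub>A\<^esub> const z \<otimes>\<^bsub>A\<^esub> \<eta>)" by blast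
 next
  fix z :: complex assume "z ~= 0"
  thus "\<nu> (const z) = 0" unfolding \<nu>_def using scalar_ord[OF s, of z 0] by simp
 qed
 have "\<exists>a\<in>A.nonzero. \<nu> a = n" for n
 proof (rule bexI[OF _ zeta_pow_A[of "- (3 * s * n)"]])
  show "\<nu> (zeta_pow (- (3 * s * n))) = n" unfolding \<nu>_def zeta_pow_ord[OF s] using s by auto
 qed simp
 then interpret P: place K cst "embed ` carrier A" "A.frac_val \<nu>" by (rule A.Frac_place[OF const_hom \<nu>])
 let ?B = "in_frac f (subalgebra_generated f {zeta_pow 3, zeta_pow (- 3)})"
 let ?l = "embed (zeta_pow (- (3 * s)))"
 have l: "zeta_pow (- (3 * s)) \<in> A.nonzero" by (rule zeta_pow_A) simp
 have gen: "embed (zeta_pow k) \<in> ?B" if "k = 3 \<or> k = - 3" for k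
  unfolding in_frac_def subalgebra_generated_def using that by (intro imageI generate_ring.incl) auto
 have "A.frac_val \<nu> ?l ~= 1"
 proof (rule P.unit_not_uniformizer[OF laurent_affine_ring])
  show "?l \<in> ?B" by (rule gen) (use s in auto)
  show "inv\<^bsub>K\<^esub> ?l \<in> ?B" using gen[of "3 * s"] s embed_inverse[of "- (3 * s)"] by auto
  show "?l \<in> quotients K (embed ` carrier A)" using l A.to_fraction_closed unfolding A.quotients_Frac by blast
  show "?l ~= \<zero>\<^bsub>K\<^esub>" using l A.to_fraction_eq_zero by blast
  show "dual_to_cover K (range cst) 3 (embed ` carrier A) ?B"
   using lambda unfolding lambda_cover_def inclusion_dual_to_cover_def in_frac_killing range_cst by blast
  show "{x \<in> smooth_completion K (range cst) (embed ` carrier A). ?l \<in> max_ideal K x} = {if s = 1 then Pinf else P0}"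
   using lambda s unfolding lambda_cover_def zeros_def curve_of_def in_frac_killing range_cst by auto
 qed
 moreover have "A.frac_val \<nu> ?l = 1"
  using A.frac_val_to_fraction[OF \<nu> l A.constants_hom_D(2)[OF const_hom]] \<nu>3[OF l] zeta_pow_ord[OF s, of "- (3 * s)"] s by auto
 ultimately show False by blast
qed

text \<open>An order prime to \<open>3\<close>, its double and \<open>0\<close> represent all classes modulo \<open>3\<close>, and powers of \<open>\<zeta>\<^sup>3\<close> shift
 orders by multiples of \<open>3\<close>.\<close>
lemma ord_surj:
 assumes s: "s = 1 \<or> s = - 1" shows "\<exists>\<xi>\<in>A.nonzero. ord s \<xi> = n"
proof -
 obtain \<xi> where \<xi>: "\<xi> \<in> A.nonzero" "\<not> 3 dvd ord s \<xi>" using ord_not_all_divisible[OF s] by blast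
 have mult: "ord s (\<xi> \<otimes>\<^bsub>A\<^esub> \<eta>) = ord s \<xi> + ord s \<eta>"
  if "\<xi> \<in> A.nonzero" "\<eta> \<in> A.nonzero" for \<xi> \<eta> using ord_valuation[OF s] that unfolding A.valuation_def by blast
 have "\<exists>\<eta>\<in>A.nonzero. 3 dvd n - ord s \<eta>"
 proof -
  have "3 dvd n \<or> 3 dvd n - ord s \<xi> \<or> 3 dvd n - (ord s \<xi> + ord s \<xi>)" using \<xi>(2) by presburger
  then consider "3 dvd n" | "3 dvd n - ord s \<xi>" | "3 dvd n - (ord s \<xi> + ord s \<xi>)" by blast
  thus ?thesis
  proof cases
   case 1
   thus ?thesis using zeta_pow_ord[OF s, of 0] zeta_pow_A[of 0] by (intro bexI[of _ "zeta_pow 0"]) auto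
  next
   case 2 thus ?thesis using \<xi>(1) by blast
  next
   case 3 thus ?thesis using mult[OF \<xi>(1) \<xi>(1)] A.nonzero_mult[OF \<xi>(1) \<xi>(1)] by metis
  qed
 qed
 then obtain \<eta> k where \<eta>: "\<eta> \<in> A.nonzero" "n - ord s \<eta> = 3 * k" by blast
 have z: "zeta_pow (- (s * (3 * k))) \<in> A.nonzero" by (rule zeta_pow_A) simp
 have "ord s (\<eta> \<otimes>\<^bsub>A\<^esub> zeta_pow (- (s * (3 * k)))) = n" unfolding mult[OF \<eta>(1) z] zeta_pow_ord[OF s] using \<eta>(2) s by auto
 thus ?thesis using A.nonzero_mult[OF \<eta>(1) z] by blast
qed

lemma mu_A: "\<xi> \<in> carrier A ==> mu_star \<xi> \<in> carrier A"
 and mu_nonzero: "\<xi> \<in> A.nonzero ==> mu_star \<xi> ~= \<zero>\<^bsub>A\<^esub>"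
 and mu_mult: "\<xi> \<in> carrier A ==> \<eta> \<in> carrier A ==> mu_star (\<xi> \<otimes>\<^bsub>A\<^esub> \<eta>) = mu_star \<xi> \<otimes>\<^bsub>A\<^esub> mu_star \<eta>"
 and mu_add: "mu_star (\<xi> \<oplus>\<^bsub>A\<^esub> \<eta>) = mu_star \<xi> \<oplus>\<^bsub>A\<^esub> mu_star \<eta>"
proof -
 show c: "\<xi> \<in> carrier A ==> mu_star \<xi> \<in> carrier A" for \<xi> unfolding A_simps by (rule mu_star_closed)
 have z: "mu_star \<zero>\<^bsub>A\<^esub> = \<zero>\<^bsub>A\<^esub>" using mu_star_add[of "%\<zeta> p. 0" "%\<zeta> p. 0"] unfolding A_simps fun_eq_iff by simp
 show "\<xi> \<in> A.nonzero ==> mu_star \<xi> ~= \<zero>\<^bsub>A\<^esub>" using z mu_star_mu_star[of \<xi>] by auto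
 show "\<xi> \<in> carrier A ==> \<eta> \<in> carrier A ==> mu_star (\<xi> \<otimes>\<^bsub>A\<^esub> \<eta>) = mu_star \<xi> \<otimes>\<^bsub>A\<^esub> mu_star \<eta>"
  using c commutative[of "mu_star \<xi>" "mu_star \<eta>"] unfolding A_simps mu_star_mult by simp
 show "mu_star (\<xi> \<oplus>\<^bsub>A\<^esub> \<eta>) = mu_star \<xi> \<oplus>\<^bsub>A\<^esub> mu_star \<eta>" unfolding A_simps by (rule mu_star_add)
qed

lemma mu_zeta_pow: "mu_star (zeta_pow 3) = \<ominus>\<^bsub>A\<^esub> zeta_pow 3"
proof -
 have "mu_star (zeta_pow 3) = (%\<zeta> p. - zeta_pow 3 \<zeta> p)" unfolding zeta_pow_def mu_star_scalar unfolding scalar_field_def fun_eq_iff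
  by (auto simp: mat_smat[of "_ ^ _"] mat_smat[of "- _"] smat_simps)
 thus ?thesis using killing_uminus[OF zeta_pow_closed[of 3]] by simp
qed

lemma mu_const: "mu_star (const c) = const c" unfolding mu_star_scalar ..

abbreviation v :: "frac => int" where "v \<equiv> A.frac_val (ord (- 1))"
abbreviation w :: "frac => int" where "w \<equiv> A.frac_val (ord 1)"
abbreviation \<sigma> :: "frac => frac" where "\<sigma> \<equiv> fraction_map A mu_star"

lemma \<sigma>_fraction:
 "a \<in> carrier A ==> b \<in> A.nonzero ==> \<sigma> (fraction A a b) = fraction A (mu_star a) (mu_star b)"
 using mu_A mu_nonzero mu_mult by (intro A.fraction_map_fraction) auto

lemma \<sigma>_embed: "a \<in> carrier A ==> \<sigma> (embed a) = embed (mu_star a)"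
proof -
 assume a: "a \<in> carrier A"
 have "mu_star \<one>\<^bsub>A\<^esub> = \<one>\<^bsub>A\<^esub>" using mu_const[of 1] unfolding A_simps .
 thus ?thesis using \<sigma>_fraction[OF a A.one_nz] unfolding to_fraction_def by simp
qed

text \<open>The leading coefficient is a multiple of a power of the cyclic matrix, which \<open>T (\<cdot>)\<^sup>t T\<close> fixes; the
 substitution \<open>\<zeta> \<mapsto> - \<zeta>\<close> contributes the sign.\<close>
lemma parity_embed:
 assumes s: "s = 1 \<or> s = - 1" and P: "place K cst (embed ` carrier A) (A.frac_val (ord s))"
  and a: "a \<in> embed ` carrier A" "a ~= \<zero>\<^bsub>K\<^esub>"
 shows "(if even (A.frac_val (ord s) a) then \<sigma> a \<ominus>\<^bsub>K\<^esub> a else \<sigma> a \<oplus>\<^bsub>K\<^esub> a)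
  \<in> place.F K (embed ` carrier A) (A.frac_val (ord s)) (A.frac_val (ord s) a + 1)"
proof -
 interpret P: place K cst "embed ` carrier A" "A.frac_val (ord s)" by (rule P)
 obtain \<xi> where \<xi>: "\<xi> \<in> carrier A" "a = embed \<xi>" using a(1) by blast
 have nz: "\<xi> \<in> A.nonzero" using \<xi> a(2) A.to_fraction_zero by auto
 have val: "A.frac_val (ord s) (embed \<eta>) = ord s \<eta>" if "\<eta> \<in> A.nonzero" for \<eta>
  by (rule A.frac_val_to_fraction[OF ord_valuation[OF s] that A.constants_hom_D(2)[OF const_hom]])
 have k: "\<xi> \<in> killing_fields f" "\<xi> ~= (%\<zeta> p. 0)" "mu_star \<xi> \<in> killing_fields f" using nz mu_star_closed unfolding A_cases by auto
 define \<eta> where "\<eta> = (if even (ord s \<xi>) then mu_star \<xi> \<ominus>\<^bsub>A\<^esub> \<xi> else mu_star \<xi> \<oplus>\<^bsub>A\<^esub> \<xi>)"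
 have \<eta>: "\<eta> \<in> carrier A" unfolding \<eta>_def using mu_A \<xi>(1) by simp
 have "\<eta> = (%\<zeta> p. mu_star \<xi> \<zeta> p - smat ((- 1) powi ord s \<xi>) (\<xi> \<zeta> p))"
  unfolding \<eta>_def A_simps killing_minus[OF k(3,1)] by (simp add: smat_simps)
 hence "lead s \<eta> (ord s \<xi>) (%p. 0)" using mu_star_parity[OF s k(1,2)] by simp
 hence "\<eta> = \<zero>\<^bsub>A\<^esub> \<or> ord s \<xi> < ord s \<eta>" using ord_greater[OF s] \<eta> unfolding A_simps by blast
 hence "embed \<eta> \<in> P.F (ord s \<xi> + 1)"
 proof
  assume lt: "ord s \<xi> < ord s \<eta>"
  show ?thesis
  proof (cases "\<eta> = \<zero>\<^bsub>A\<^esub>")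
   case False
   thus ?thesis using lt \<eta> val[of \<eta>] A.to_fraction_closed[OF \<eta>] by (intro P.F_I) (auto simp: A.quotients_Frac)
  qed (simp add: A.to_fraction_zero)
 qed (simp add: A.to_fraction_zero)
 moreover have "embed \<eta> = (if even (ord s \<xi>) then \<sigma> a \<ominus>\<^bsub>K\<^esub> a else \<sigma> a \<oplus>\<^bsub>K\<^esub> a)"
  unfolding \<eta>_def \<xi>(2) \<sigma>_embed[OF \<xi>(1)] using \<xi>(1) mu_A by (simp add: A.to_fraction_minus A.to_fraction_add)
 ultimately show ?thesis using val[OF nz] \<xi>(2) by simp
qed

lemma places: "place K cst (embed ` carrier A) v" "place K cst (embed ` carrier A) w"
 by (intro A.Frac_place const_hom ord_valuation ord_surj end_cases)+

lemma spectral_two_places: "two_places K cst (embed ` carrier A) v w (embed (zeta_pow 3))"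
proof (intro two_places.intro two_places_axioms.intro places A.Frac_affine_ring A.carrier_is_subring A.constants_hom_D(1) const_hom)
 have val: "A.frac_val (ord s) (embed \<eta>) = ord s \<eta>" if "s = 1 \<or> s = - 1" "\<eta> \<in> A.nonzero" for s \<eta>
  by (rule A.frac_val_to_fraction[OF ord_valuation[OF that(1)] that(2) A.constants_hom_D(2)[OF const_hom]])
 show "v b + w b \<le> 0" if b: "b \<in> embed ` carrier A" "b ~= \<zero>\<^bsub>K\<^esub>" for b
 proof -
  obtain \<xi> where \<xi>: "\<xi> \<in> carrier A" "b = embed \<xi>" using b(1) by blast
  have nz: "\<xi> \<in> A.nonzero" using \<xi> b(2) A.to_fraction_zero by auto
  show ?thesis using ord_sum nz unfolding \<xi>(2) val[OF end_cases(1) nz] val[OF end_cases(2) nz] A_cases by blast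
 qed
 have t: "zeta_pow 3 \<in> A.nonzero" "zeta_pow (- 3) \<in> A.nonzero" by (rule zeta_pow_A, simp)+
 show "embed (zeta_pow 3) \<in> embed ` carrier A" "embed (zeta_pow 3) ~= \<zero>\<^bsub>K\<^esub>" using t(1) A.to_fraction_eq_zero by auto
 show "inv\<^bsub>K\<^esub> (embed (zeta_pow 3)) \<in> embed ` carrier A" using embed_inverse[of 3] t(2) by auto
 show "0 < v (embed (zeta_pow 3))" unfolding val[OF end_cases(2) t(1)] zeta_pow_ord[OF end_cases(2)] by simp
qed

lemma spectral_double_cover: "double_cover K cst (embed ` carrier A) v w (embed (zeta_pow 3)) \<sigma>"
proof (intro double_cover.intro double_cover_axioms.intro spectral_two_places A.quotients_Frac)
 note t = zeta_pow_A[of 3, simplified]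
 have nz: "mu_star a \<in> A.nonzero" if "a \<in> A.nonzero" for a using that mu_A mu_nonzero by blast
 show "\<sigma> x \<in> carrier K" if "x \<in> carrier K" for x using that
 proof (rule A.Frac_E)
  fix a b assume "a \<in> carrier A" "b \<in> A.nonzero" "x = fraction A a b"
  thus ?thesis using \<sigma>_fraction A.Frac_I mu_A nz by metis
 qed
 show "\<sigma> (\<sigma> x) = x" if "x \<in> carrier K" for x using that
 proof (rule A.Frac_E)
  fix a b assume "a \<in> carrier A" "b \<in> A.nonzero" "x = fraction A a b"
  thus ?thesis using \<sigma>_fraction mu_A nz mu_star_mu_star by metis
 qed
 show "\<sigma> (x \<oplus>\<^bsub>K\<^esub> y) = \<sigma> x \<oplus>\<^bsub>K\<^esub> \<sigma> y" "\<sigma> (x \<otimes>\<^bsub>K\<^esub> y) = \<sigma> x \<otimes>\<^bsub>K\<^esub> \<sigma> y" if xy: "x \<in> carrier K" "y \<in> carrier K" for x y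
 proof -
  obtain a b where ab: "a \<in> carrier A" "b \<in> A.nonzero" "x = fraction A a b" using xy(1) by (rule A.Frac_E)
  obtain c d where cd: "c \<in> carrier A" "d \<in> A.nonzero" "y = fraction A c d" using xy(2) by (rule A.Frac_E)
  have bd: "b \<otimes>\<^bsub>A\<^esub> d \<in> A.nonzero" by (rule A.nonzero_mult[OF ab(2) cd(2)])
  have cc: "b \<in> carrier A" "d \<in> carrier A" using ab cd by auto
  show "\<sigma> (x \<oplus>\<^bsub>K\<^esub> y) = \<sigma> x \<oplus>\<^bsub>K\<^esub> \<sigma> y" unfolding ab(3) cd(3) A.Frac_add[OF ab(1,2) cd(1,2)] \<sigma>_fraction[OF ab(1,2)] \<sigma>_fraction[OF cd(1,2)]
    A.Frac_add[OF mu_A[OF ab(1)] nz[OF ab(2)] mu_A[OF cd(1)] nz[OF cd(2)]]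
   using ab(1) cd(1) cc by (subst \<sigma>_fraction[OF _ bd]) (simp_all add: mu_mult mu_add)
  show "\<sigma> (x \<otimes>\<^bsub>K\<^esub> y) = \<sigma> x \<otimes>\<^bsub>K\<^esub> \<sigma> y" unfolding ab(3) cd(3) A.Frac_mult[OF ab(1,2) cd(1,2)] \<sigma>_fraction[OF ab(1,2)] \<sigma>_fraction[OF cd(1,2)]
    A.Frac_mult[OF mu_A[OF ab(1)] nz[OF ab(2)] mu_A[OF cd(1)] nz[OF cd(2)]]
   using ab(1) cd(1) cc by (subst \<sigma>_fraction[OF _ bd]) (simp_all add: mu_mult)
 qed
 show "\<sigma> (cst c) = cst c" for c using \<sigma>_embed[OF A.constants_hom_D(1)[OF const_hom]] mu_const by simp
 show "\<sigma> a \<in> embed ` carrier A" if "a \<in> embed ` carrier A" for a using that \<sigma>_embed mu_A by auto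
 show "\<sigma> (embed (zeta_pow 3)) = \<ominus>\<^bsub>K\<^esub> embed (zeta_pow 3)"
  using t \<sigma>_embed[of "zeta_pow 3"] mu_zeta_pow A.to_fraction_uminus[of "zeta_pow 3"] by simp
 show "v (embed (zeta_pow 3)) = 3"
  using A.frac_val_to_fraction[OF ord_valuation[OF end_cases(2)] _ A.constants_hom_D(2)[OF const_hom], of "zeta_pow 3"]
   zeta_pow_ord[OF end_cases(2), of 3] t by simp
qed (intro parity_embed places end_cases; assumption)+

end

context spectral_curve
begin

sublocale C: double_cover K cst "embed ` carrier A" v w "embed (zeta_pow 3)" \<sigma> by (rule spectral_double_cover)

lemma invariants_eq: "C.A0 = in_frac f (mu_invariants f)"
proof -
 have "\<sigma> (embed \<xi>) = embed \<xi> \<longleftrightarrow> mu_star \<xi> = \<xi>" if "\<xi> \<in> carrier A" for \<xi>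
  unfolding \<sigma>_embed[OF that] using A.to_fraction_inj[OF mu_A[OF that] that] .
 thus ?thesis unfolding C.A0_def in_frac_def mu_invariants_def A_simps(1)[symmetric] by auto
qed

lemma curve_eq: "curve_of f (killing_fields f) = C.X" unfolding curve_of_def in_frac_killing range_cst ..

lemma P_eq: "P0 = C.V.F 0" "Pinf = C.W.F 0"
proof -
 have l: "embed (zeta_pow 3) \<in> C.V.F 3" "inv\<^bsub>K\<^esub> (embed (zeta_pow 3)) \<in> C.W.F 3"
  using C.V.F_I[OF C.B_L[OF C.l_B], of 3] C.W.F_I[OF C.B_L[OF C.inv_l_B], of 3] C.v_l C.w_l C.W.v_inv[OF C.B_L[OF C.l_B]] by auto
 have "C.V.F 0 \<in> zeros f (zeta_pow 3)" "C.W.F 0 \<in> zeros f (zeta_pow (- 3))"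
  unfolding zeros_def curve_eq using C.V.F_mono[OF l(1), of 1] C.W.F_mono[OF l(2), of 1]
  by (auto simp: C.X_eq C.V.max_ideal_F0 C.W.max_ideal_F0 embed_inverse)
 thus "P0 = C.V.F 0" "Pinf = C.W.F 0" using lambda unfolding lambda_cover_def by auto
qed

lemma invariant_ring: "subring (mu_invariants f) A"
proof (rule A.subringI)
 show "mu_invariants f \<subseteq> carrier A" unfolding mu_invariants_def A_simps by blast
 show "\<one>\<^bsub>A\<^esub> \<in> mu_invariants f" unfolding mu_invariants_def A_simps using constant_closed mu_const by blast
 fix a assume "a \<in> mu_invariants f"
 hence a: "a \<in> carrier A" "mu_star a = a" unfolding mu_invariants_def A_simps by auto
 have "mu_star (%\<zeta> p. - a \<zeta> p) = (%\<zeta> p. - mu_star a \<zeta> p)" unfolding mu_star_eq T_flip_simps ..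
 hence "mu_star (\<ominus>\<^bsub>A\<^esub> a) = \<ominus>\<^bsub>A\<^esub> a" using killing_uminus a unfolding A_simps by metis
 moreover have "\<ominus>\<^bsub>A\<^esub> a \<in> killing_fields f" using A.a_inv_closed[OF a(1)] unfolding A_simps .
 ultimately show "\<ominus>\<^bsub>A\<^esub> a \<in> mu_invariants f" unfolding mu_invariants_def by blast
 fix b assume "b \<in> mu_invariants f"
 hence b: "b \<in> carrier A" "mu_star b = b" unfolding mu_invariants_def A_simps by auto
 show "a \<otimes>\<^bsub>A\<^esub> b \<in> mu_invariants f" "a \<oplus>\<^bsub>A\<^esub> b \<in> mu_invariants f"
  using mu_mult[OF a(1) b(1)] mu_add[of a b] a b A.m_closed[OF a(1) b(1)] A.a_closed[OF a(1) b(1)]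
  unfolding mu_invariants_def A_simps(1) by auto
qed

lemma zeta_odd: "a \<in> carrier A ==> mu_star (a \<otimes>\<^bsub>A\<^esub> zeta_pow k) = (%\<zeta> p. smat ((-1) powi k) (killing_mult (mu_star a) (zeta_pow k) \<zeta> p))" if "3 dvd k"
proof -
 assume a: "a \<in> carrier A"
 have z: "mu_star (zeta_pow k) = (%\<zeta> p. smat ((-1) powi k) (zeta_pow k \<zeta> p))"
  unfolding zeta_pow_def mu_star_scalar unfolding scalar_field_def fun_eq_iff
 proof (intro allI)
  fix \<zeta> p :: complex
  have "(- \<zeta>) powi k = (- 1) powi k * \<zeta> powi k" by (metis mult_minus1 power_int_mult_distrib)
  thus "(if \<zeta> = 0 then 0 else mat ((- \<zeta>) powi k)) = smat ((- 1) powi k) (if \<zeta> = 0 then 0 else mat (\<zeta> powi k))"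
   by (simp add: mat_smat[of "_ * _"] mat_smat[of "_ powi k"] smat_simps)
 qed
 have "zeta_pow k \<in> carrier A" using zeta_pow_A[OF that] by blast
 thus ?thesis unfolding mu_mult[OF a \<open>zeta_pow k \<in> carrier A\<close>] z by (simp add: A_simps smat_simps)
qed

lemma invariant_decomposition:
 assumes \<xi>: "\<xi> \<in> carrier A"
 shows "\<exists>b\<in>mu_invariants f. \<exists>c\<in>mu_invariants f. \<xi> = b \<oplus>\<^bsub>A\<^esub> c \<otimes>\<^bsub>A\<^esub> zeta_pow 3"
proof -
 define b :: loop_field where "b = (%\<zeta> p. smat (1/2) (\<xi> \<zeta> p + mu_star \<xi> \<zeta> p))"
 define d :: loop_field where "d = (%\<zeta> p. smat (1/2) (\<xi> \<zeta> p - mu_star \<xi> \<zeta> p))"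
 define c where "c = d \<otimes>\<^bsub>A\<^esub> zeta_pow (- 3)"
 have \<xi>k: "\<xi> \<in> killing_fields f" "mu_star \<xi> \<in> killing_fields f" using \<xi> mu_star_closed unfolding A_simps by auto
 have bk: "b \<in> killing_fields f" unfolding b_def by (rule scalar_mult_closed[OF killing_add_closed[OF \<xi>k]])
 have dA: "d \<in> carrier A" unfolding d_def A_simps
  using scalar_mult_closed[OF killing_add_closed[OF \<xi>k(1) scalar_mult_closed[OF \<xi>k(2), of "-1"]], of "1/2"] by (simp add: smat_simps)
 have t: "zeta_pow 3 \<in> carrier A" "zeta_pow (- 3) \<in> carrier A" using zeta_pow_A[of 3] zeta_pow_A[of "- 3"] by auto
 have mu: "mu_star b = b" "mu_star d = (%\<zeta> p. - d \<zeta> p)"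
  unfolding b_def d_def using mu_star_mu_star[of \<xi>] unfolding mu_star_eq T_flip_simps fun_eq_iff
  by (simp_all add: add.commute smat_simps T_flip_simps)
 have "mu_star c = c" unfolding c_def zeta_odd[OF _ dA, of "- 3", simplified] mu(2) by (simp add: A_simps matrix_distrib smat_simps)
 moreover have "c \<in> killing_fields f" unfolding c_def using A.m_closed[OF dA t(2)] unfolding A_simps .
 moreover have "c \<otimes>\<^bsub>A\<^esub> zeta_pow 3 = d"
 proof -
  have "c \<otimes>\<^bsub>A\<^esub> zeta_pow 3 = d \<otimes>\<^bsub>A\<^esub> (zeta_pow (- 3) \<otimes>\<^bsub>A\<^esub> zeta_pow 3)" unfolding c_def by (rule A.m_assoc[OF dA t(2,1)])
  also have "zeta_pow (- 3) \<otimes>\<^bsub>A\<^esub> zeta_pow 3 = \<one>\<^bsub>A\<^esub>" using zeta_pow_mult[of "- 3" 3] zeta_pow_0 by (simp add: A_simps(2))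
  finally show ?thesis using dA by simp
 qed
 moreover have "\<xi> = b \<oplus>\<^bsub>A\<^esub> d" unfolding b_def d_def A_simps smat_simps(1)[symmetric]
 proof -
  have "smat (1/2) (M + N + (M - N)) = M" for M N
  proof -
   have "M + N + (M - N) = M + M" by simp
   moreover have "smat (1/2) (M + M) = smat (1/2 + 1/2) M" unfolding smat_simps(1,2) ..
   ultimately show ?thesis by (simp add: smat_simps(4))
  qed
  thus "\<xi> = (%\<zeta> p. smat (1/2) (\<xi> \<zeta> p + mu_star \<xi> \<zeta> p + (\<xi> \<zeta> p - mu_star \<xi> \<zeta> p)))" by simp
 qed
 ultimately show ?thesis using bk mu(1) unfolding mu_invariants_def by blast
qed

lemma invariant_decomposition_unique:
 assumes b: "b \<in> mu_invariants f" and c: "c \<in> mu_invariants f" and 0: "b \<oplus>\<^bsub>A\<^esub> c \<otimes>\<^bsub>A\<^esub> zeta_pow 3 = \<zero>\<^bsub>A\<^esub>"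
 shows "b = \<zero>\<^bsub>A\<^esub> \<and> c = \<zero>\<^bsub>A\<^esub>"
proof -
 have t: "zeta_pow 3 \<in> A.nonzero" by (rule zeta_pow_A) simp
 have bc: "b \<in> carrier A" "c \<in> carrier A" "mu_star b = b" "mu_star c = c" using b c unfolding mu_invariants_def A_simps by auto
 let ?d = "c \<otimes>\<^bsub>A\<^esub> zeta_pow 3"
 have "mu_star ?d = (%\<zeta> p. - ?d \<zeta> p)" using zeta_odd[OF _ bc(2), of 3] unfolding bc(4) by (simp add: A_simps smat_simps)
 hence "mu_star (b \<oplus>\<^bsub>A\<^esub> ?d) = (%\<zeta> p. b \<zeta> p - ?d \<zeta> p)" unfolding mu_add bc(3) by (simp add: A_simps)
 moreover have "mu_star \<zero>\<^bsub>A\<^esub> = \<zero>\<^bsub>A\<^esub>" using mu_const[of 0] A.constants_hom_D(1)[OF const_hom]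
  using mu_add[of "\<zero>\<^bsub>A\<^esub>" "\<zero>\<^bsub>A\<^esub>"] mu_A[OF A.zero_closed] A.add.r_cancel_one by auto
 ultimately have "(%\<zeta> p. b \<zeta> p - ?d \<zeta> p) = (%\<zeta> p. 0)" unfolding 0 A_simps(5) by simp
 hence "b \<zeta> p - ?d \<zeta> p = 0" for \<zeta> p unfolding fun_eq_iff by blast
 moreover have "b \<zeta> p + ?d \<zeta> p = 0" for \<zeta> p using 0 unfolding A_simps(3,5) fun_eq_iff by blast
 ultimately have "b \<zeta> p + b \<zeta> p = 0" for \<zeta> p by (simp add: eq_iff_diff_eq_0[symmetric])
 hence "2 *\<^sub>R b \<zeta> p = 0" for \<zeta> p by (simp add: scaleR_2)
 hence "b \<zeta> p = 0" for \<zeta> p by simp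
 hence "b = \<zero>\<^bsub>A\<^esub>" unfolding A_simps fun_eq_iff by blast
 moreover have "?d = \<zero>\<^bsub>A\<^esub>" using 0 bc t unfolding calculation by simp
 hence "c = \<zero>\<^bsub>A\<^esub>" using A.integral[of c "zeta_pow 3"] bc t by auto
 ultimately show ?thesis by simp
qed

lemma generated_by_invariants: "killing_fields f = subalgebra_generated f (mu_invariants f \<union> {zeta_pow 3})"
proof
 let ?H = "constants \<union> (mu_invariants f \<union> {zeta_pow 3})"
 have H: "?H \<subseteq> carrier A" unfolding constants_def mu_invariants_def A_simps using constant_closed zeta_pow_closed[of 3] by auto
 show "subalgebra_generated f (mu_invariants f \<union> {zeta_pow 3}) \<subseteq> killing_fields f"
  unfolding subalgebra_generated_def using A.generate_ring_incl[OF H] unfolding A_simps(1) .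
 show "killing_fields f \<subseteq> subalgebra_generated f (mu_invariants f \<union> {zeta_pow 3})"
 proof
  fix \<xi> assume "\<xi> \<in> killing_fields f"
  then obtain b c where "b \<in> mu_invariants f" "c \<in> mu_invariants f" "\<xi> = b \<oplus>\<^bsub>A\<^esub> c \<otimes>\<^bsub>A\<^esub> zeta_pow 3"
   using invariant_decomposition unfolding A_simps(1) by blast
  thus "\<xi> \<in> subalgebra_generated f (mu_invariants f \<union> {zeta_pow 3})" unfolding subalgebra_generated_def
   by (simp only:) (intro generate_ring.eng_add generate_ring.eng_mult generate_ring.incl; simp)
 qed
qed

lemma quadratic_extension:
 "\<exists>h \<in> ring_iso (mu_poly f Quot quadratic_ideal f) A.
   (\<forall>\<xi> \<in> mu_invariants f. h (quadratic_class f \<xi> 0) = \<xi>) \<and> h (quadratic_class f \<one>\<^bsub>A\<^esub> 1) = zeta_pow 3"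
proof -
 have sq: "zeta_pow 3 \<otimes>\<^bsub>A\<^esub> zeta_pow 3 = zeta_pow 6" using zeta_pow_mult[of 3 3] by (simp add: A_simps(2))
 have "mu_star (zeta_pow 6) = zeta_pow 6" unfolding zeta_pow_def mu_star_scalar by simp
 hence "zeta_pow 6 \<in> mu_invariants f" unfolding mu_invariants_def using zeta_pow_closed[of 6] by simp
 moreover have "zeta_pow 3 \<in> carrier A" using zeta_pow_A[of 3] by simp
 moreover have one: "\<one>\<^bsub>A\<lparr>carrier := mu_invariants f\<rparr>\<^esub> = \<one>\<^bsub>A\<^esub>" by simp
 ultimately show ?thesis unfolding quadratic_class_def quadratic_ideal_def mu_algebra_def one
  using A.adjoin_square_root[OF invariant_ring _ _ A.one_not_zero invariant_decomposition invariant_decomposition_unique, unfolded sq]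
  by blast
qed

end

theorem lemma1:
  fixes \<omega>1 \<omega>2 :: complex
    and \<phi> :: "complex \<Rightarrow> (complex^3) set"
    and f :: "complex \<Rightarrow> complex^3"
    and P0 Pinf :: "frac set"
  assumes torus: "minimal_lagrangian_torus \<omega>1 \<omega>2 \<phi> f"
    and conformal: "conformal f"
    and cubic: "\<forall>p. herm (d_z (d_z (d_z f)) p) (f p) = 1"
    and frame: "\<forall>p. in_SU3 (frame f p)"
    and commutative: "\<forall>\<xi> \<in> killing_fields f. \<forall>\<eta> \<in> killing_fields f.
          \<xi> \<otimes>\<^bsub>killing_algebra f\<^esub> \<eta> = \<eta> \<otimes>\<^bsub>killing_algebra f\<^esub> \<xi>"
    and lambda: "lambda_cover f P0 Pinf"
  shows "killing_fields f = subalgebra_generated f (mu_invariants f \<union> {zeta_pow 3})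
    \<and> (\<exists>h \<in> ring_iso (mu_poly f Quot quadratic_ideal f) (killing_algebra f).
          (\<forall>\<xi> \<in> mu_invariants f. h (quadratic_class f \<xi> 0) = \<xi>) \<and>
          h (quadratic_class f \<one>\<^bsub>killing_algebra f\<^esub> 1) = zeta_pow 3)
    \<and> inclusion_dual_to_cover f 2 (mu_invariants f) (killing_fields f)
    \<and> {x \<in> curve_of f (killing_fields f). delta_ramified_at f x} = {P0, Pinf}
    \<and> (\<forall>x \<in> curve_of f (killing_fields f).
          mu_map f x \<in> curve_of f (killing_fields f) \<and>
          mu_map f (mu_map f x) = x \<and>
          {x' \<in> curve_of f (killing_fields f). delta_map f x' = delta_map f x} = {x, mu_map f x} \<and>
          (mu_map f x = x \<longleftrightarrow> x \<in> {P0, Pinf}))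
    \<and> (\<exists>p::nat. genus_of f (mu_invariants f) = enat p \<and>
                 genus_of f (killing_fields f) = enat (2 * p))"
proof -
 interpret spectral_curve f P0 Pinf using assms unfolding minimal_lagrangian_torus_def horizontal_lift_def A_simps(2)
  by unfold_locales blast+
 have mu: "mu_map f x = C.\<mu> x" for x unfolding mu_map_def C.\<mu>_def ..
 have fibres: "{x' \<in> C.X. delta_map f x' = delta_map f x} = {x, C.\<mu> x}" if "x \<in> C.X" for x
 proof -
  have "delta_map f x = x \<inter> C.L0" if "x \<in> C.X" for x
   unfolding delta_map_def invariants_eq[symmetric] range_cst[symmetric] by (rule C.dual_map_eq[OF that])
  hence "{x' \<in> C.X. delta_map f x' = delta_map f x} = {x' \<in> C.X. x' \<inter> C.L0 = x \<inter> C.L0}" using that by auto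
  thus ?thesis using C.fibre[OF that] by simp
 qed
 have cover: "inclusion_dual_to_cover f 2 (mu_invariants f) (killing_fields f)"
  unfolding inclusion_dual_to_cover_def range_cst[symmetric] in_frac_killing invariants_eq[symmetric]
  using C.dual_to_double_cover by (auto simp: mu_invariants_def)
 have ramified: "{x \<in> C.X. delta_ramified_at f x} = {P0, Pinf}"
  using C.ramification unfolding delta_ramified_at_def range_cst[symmetric] invariants_eq[symmetric] P_eq .
 have genus: "\<exists>p. genus_of f (mu_invariants f) = enat p \<and> genus_of f (killing_fields f) = enat (2 * p)"
  unfolding genus_of_def range_cst[symmetric] in_frac_killing invariants_eq[symmetric] by (rule C.genus_double)
 show ?thesis using generated_by_invariants quadratic_extension cover ramified genus
   C.\<mu>_point C.\<mu>_\<mu> fibres C.\<mu>_fixed unfolding curve_eq mu P_eq by (intro conjI ballI) simp_all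
qed

end
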